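(* Let $d=3$ and $p\in(1,\infty)$. Then $$\mathbf Z^{\mathrm c,p}_0(D)=\ker(\gamma_{\times\mathbf n}),\qquad\mathbf Z^{\mathrm d,p}_0(D)=\ker(\gamma_{\cdot\mathbf n}).$$
   Context: $D\subset\mathbb R^d$ ($d=3$) is an open, bounded, connected, strongly Lipschitz set; boldface spaces are spaces of $\mathbb R^d$-valued fields; $p'$ is the conjugate exponent of $p$. $\mathbf Z^{\mathrm c,p}(D)=\{\mathbf v\in\mathbf L^p(D):\nabla\times\mathbf v\in\mathbf L^p(D)\}$ and $\mathbf Z^{\mathrm d,p}(D)=\{\mathbf v\in\mathbf L^p(D):\nabla\cdot\mathbf v\in L^p(D)\}$ (weak derivatives), with their graph norms. $\mathbf Z^{\mathrm c,p}_0(D)$ and $\mathbf Z^{\mathrm d,p}_0(D)$ are the closures of $\mathbf C_0^\infty(D)$ (smooth fields with compact support in $D$) in $\mathbf Z^{\mathrm c,p}(D)$ and $\mathbf Z^{\mathrm d,p}(D)$, respectively. Let $\gamma_0:W^{1,p'}(D)\to W^{\frac1p,p'}(\partial D)$ be the (surjective) trace operator, acting componentwise on vector fields, and let $W^{-\frac1p,p}(\partial D)$ be the dual space of $W^{\frac1p,p'}(\partial D)$, with duality pairing $\langle\cdot,\cdot\rangle_{\partial D}$ (similarly for vector fields). The bounded linear map $\gamma_{\times\mathbf n}:\mathbf Z^{\mathrm c,p}(D)\to\mathbf W^{-\frac1p,p}(\partial D)$ is defined by $$\langle\gamma_{\times\mathbf n}(\mathbf v),\mathbf l\rangle_{\partial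 D}=\int_D\mathbf v\cdot\nabla\times\mathbf w(\mathbf l)\,dx-\int_D\mathbf w(\mathbf l)\cdot\nabla\times\mathbf v\,dx,\qquad\mathbf l\in\mathbf W^{\frac1p,p'}(\partial D),$$ where $\mathbf w(\mathbf l)\in\mathbf W^{1,p'}(D)$ is any field with $\gamma_0(\mathbf w(\mathbf l))=\mathbf l$. The bounded linear map $\gamma_{\cdot\mathbf n}:\mathbf Z^{\mathrm d,p}(D)\to W^{-\frac1p,p}(\partial D)$ is defined by $$\langle\gamma_{\cdot\mathbf n}(\mathbf v),l\rangle_{\partial D}=\int_D\mathbf v\cdot\nabla q(l)\,dx+\int_Dq(l)\,\nabla\cdot\mathbf v\,dx,\qquad l\in W^{\frac1p,p'}(\partial D),$$ where $q(l)\in W^{1,p'}(D)$ is any function with $\gamma_0(q(l))=l$. Both definitions are independent of the choice of the lifting. *)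

theory Defs
  imports "HOL-Analysis.Analysis"
begin

type_synonym point = "real ^ 3"
type_synonym scalar_field = "point \<Rightarrow> real"
type_synonym vector_field = "point \<Rightarrow> point"

section \<open>Strongly Lipschitz sets\<close>

text \<open>Near each boundary point, in a suitable orthonormal coordinate system (\<open>T\<close>), the set is
  exactly the part below the graph of a Lipschitz function of two variables.  No translation is
  needed in \<open>T\<close>, since it can be absorbed into \<open>\<psi>\<close>.\<close>

definition strongly_lipschitz :: "point set \<Rightarrow> bool" where
  "strongly_lipschitz D \<longleftrightarrow>
     (\<forall>x \<in> frontier D. \<exists>U (T :: point \<Rightarrow> point) (\<psi> :: real \<times> real \<Rightarrow> real) L.
        open U \<and> x \<in> U \<and> orthogonal_transformation T \<and> L-lipschitz_on UNIV \<psi> \<and>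
        D \<inter> U = {y \<in> U. T y $ 3 < \<psi> (T y $ 1, T y $ 2)})"

section \<open>Smooth functions and classical differential operators\<close>

definition partial :: "3 \<Rightarrow> scalar_field \<Rightarrow> scalar_field" where
  "partial i f x = frechet_derivative f (at x) (axis i 1)"

primrec Ck :: "nat \<Rightarrow> scalar_field \<Rightarrow> bool" where
  "Ck 0 f \<longleftrightarrow> continuous_on UNIV f"
| "Ck (Suc k) f \<longleftrightarrow> (\<forall>x. f differentiable at x) \<and> (\<forall>i. Ck k (partial i f))"

definition smooth :: "scalar_field \<Rightarrow> bool" where
  "smooth f \<longleftrightarrow> (\<forall>k. Ck k f)"

definition curl :: "vector_field \<Rightarrow> vector_field" where
  "curl f x = vector
     [partial 2 (\<lambda>y. f y $ 3) x - partial 3 (\<lambda>y. f y $ 2) x,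
      partial 3 (\<lambda>y. f y $ 1) x - partial 1 (\<lambda>y. f y $ 3) x,
      partial 1 (\<lambda>y. f y $ 2) x - partial 2 (\<lambda>y. f y $ 1) x]"

definition grad :: "scalar_field \<Rightarrow> vector_field" where
  "grad f x = (\<chi> i. partial i f x)"

definition test_functions :: "point set \<Rightarrow> scalar_field set" where
  "test_functions D =
     {f. smooth f \<and> (\<exists>K. compact K \<and> K \<subseteq> D \<and> (\<forall>x. x \<notin> K \<longrightarrow> f x = 0))}"

definition test_fields :: "point set \<Rightarrow> vector_field set" where
  "test_fields D = {f. \<forall>i. (\<lambda>x. f x $ i) \<in> test_functions D}"

section \<open>Lebesgue spaces\<close>

text \<open>Elements of function spaces are represented by functions, not by equivalence classes; all
  spaces below are closed under modification on null sets (and outside the domain).  Accordingly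
  all norms are seminorms on representatives.\<close>

definition Lp :: "real \<Rightarrow> 'a measure \<Rightarrow> ('a \<Rightarrow> 'b::euclidean_space) set" where
  "Lp p M = {f \<in> borel_measurable M. integrable M (\<lambda>x. norm (f x) powr p)}"

definition Lp_norm :: "real \<Rightarrow> 'a measure \<Rightarrow> ('a \<Rightarrow> 'b::euclidean_space) \<Rightarrow> real" where
  "Lp_norm p M f = (LINT x|M. norm (f x) powr p) powr (1 / p)"

definition locally_integrable :: "point set \<Rightarrow> (point \<Rightarrow> 'b::euclidean_space) \<Rightarrow> bool" where
  "locally_integrable D f \<longleftrightarrow> (\<forall>K. compact K \<and> K \<subseteq> D \<longrightarrow> integrable (lebesgue_on K) f)"

section \<open>Weak derivatives\<close>

definition has_weak_grad :: "point set \<Rightarrow> scalar_field \<Rightarrow> vector_field \<Rightarrow> bool" where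
  "has_weak_grad D u g \<longleftrightarrow> locally_integrable D u \<and> locally_integrable D g \<and>
     (\<forall>i. \<forall>f \<in> test_functions D.
        (LINT x|lebesgue_on D. u x * partial i f x) = - (LINT x|lebesgue_on D. g x $ i * f x))"

definition has_weak_curl :: "point set \<Rightarrow> vector_field \<Rightarrow> vector_field \<Rightarrow> bool" where
  "has_weak_curl D v g \<longleftrightarrow> locally_integrable D v \<and> locally_integrable D g \<and>
     (\<forall>f \<in> test_fields D.
        (LINT x|lebesgue_on D. v x \<bullet> curl f x) = (LINT x|lebesgue_on D. g x \<bullet> f x))"

definition has_weak_div :: "point set \<Rightarrow> vector_field \<Rightarrow> scalar_field \<Rightarrow> bool" where
  "has_weak_div D v g \<longleftrightarrow> locally_integrable D v \<and> locally_integrable D g \<and>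
     (\<forall>f \<in> test_functions D.
        (LINT x|lebesgue_on D. v x \<bullet> grad f x) = - (LINT x|lebesgue_on D. g x * f x))"

text \<open>Weak derivatives are unique up to null sets; the following pick a representative, and are
  meaningful only where the weak derivative exists.\<close>

definition weak_grad :: "point set \<Rightarrow> scalar_field \<Rightarrow> vector_field" where
  "weak_grad D u = (SOME g. has_weak_grad D u g)"

definition weak_curl :: "point set \<Rightarrow> vector_field \<Rightarrow> vector_field" where
  "weak_curl D v = (SOME g. has_weak_curl D v g)"

definition weak_div :: "point set \<Rightarrow> vector_field \<Rightarrow> scalar_field" where
  "weak_div D v = (SOME g. has_weak_div D v g)"

section \<open>Sobolev spaces and graph spaces\<close>

definition W1 :: "real \<Rightarrow> point set \<Rightarrow> scalar_field set" where
  "W1 p D = {u \<in> Lp p (lebesgue_on D). \<exists>g \<in> Lp p (lebesgue_on D). has_weak_grad D u g}"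

definition W1_norm :: "real \<Rightarrow> point set \<Rightarrow> scalar_field \<Rightarrow> real" where
  "W1_norm p D u = Lp_norm p (lebesgue_on D) u + Lp_norm p (lebesgue_on D) (weak_grad D u)"

definition W1_fields :: "real \<Rightarrow> point set \<Rightarrow> vector_field set" where
  "W1_fields p D = {w. \<forall>i. (\<lambda>x. w x $ i) \<in> W1 p D}"

definition Zc :: "real \<Rightarrow> point set \<Rightarrow> vector_field set" where
  "Zc p D = {v \<in> Lp p (lebesgue_on D). \<exists>g \<in> Lp p (lebesgue_on D). has_weak_curl D v g}"

definition Zc_norm :: "real \<Rightarrow> point set \<Rightarrow> vector_field \<Rightarrow> real" where
  "Zc_norm p D v = Lp_norm p (lebesgue_on D) v + Lp_norm p (lebesgue_on D) (weak_curl D v)"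

definition Zd :: "real \<Rightarrow> point set \<Rightarrow> vector_field set" where
  "Zd p D = {v \<in> Lp p (lebesgue_on D). \<exists>g \<in> Lp p (lebesgue_on D). has_weak_div D v g}"

definition Zd_norm :: "real \<Rightarrow> point set \<Rightarrow> vector_field \<Rightarrow> real" where
  "Zd_norm p D v = Lp_norm p (lebesgue_on D) v + Lp_norm p (lebesgue_on D) (weak_div D v)"

text \<open>Closures of the test fields in the graph norms.\<close>

definition Zc0 :: "real \<Rightarrow> point set \<Rightarrow> vector_field set" where
  "Zc0 p D = {v \<in> Zc p D. \<forall>e>0. \<exists>f \<in> test_fields D. Zc_norm p D (\<lambda>x. v x - f x) < e}"

definition Zd0 :: "real \<Rightarrow> point set \<Rightarrow> vector_field set" where
  "Zd0 p D = {v \<in> Zd p D. \<forall>e>0. \<exists>f \<in> test_fields D. Zd_norm p D (\<lambda>x. v x - f x) < e}"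

section \<open>Surface measure\<close>

text \<open>The surface measure on the boundary is the two-dimensional Hausdorff measure, normalised so
  that a flat disc of diameter \<open>\<delta>\<close> has measure \<open>pi * (\<delta> / 2)\<^sup>2\<close>.  The outer measure is a metric
  outer measure, hence countably additive on the Borel sets, as \<open>measure_of\<close> requires.\<close>

definition hausdorff2_content :: "real \<Rightarrow> point set \<Rightarrow> ennreal" where
  "hausdorff2_content \<delta> A =
     (INF C \<in> {C :: nat \<Rightarrow> point set. A \<subseteq> (\<Union>n. C n) \<and> (\<forall>n. bounded (C n) \<and> diameter (C n) \<le> \<delta>)}.
        (\<Sum>n. ennreal (pi * (diameter (C n) / 2)\<^sup>2)))"

definition hausdorff2_outer :: "point set \<Rightarrow> ennreal" where
  "hausdorff2_outer A = (SUP \<delta> \<in> {0<..}. hausdorff2_content \<delta> A)"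

definition hausdorff2 :: "point measure" where
  "hausdorff2 = measure_of UNIV (sets borel) hausdorff2_outer"

definition surface_measure :: "point set \<Rightarrow> point measure" where
  "surface_measure D = restrict_space hausdorff2 (frontier D)"

section \<open>The trace operator\<close>

text \<open>The trace operator is the continuous extension of the restriction map
  \<open>f \<mapsto> f|\<partial>D\<close> from functions smooth up to the boundary to the whole Sobolev space.  It is
  written as a relation because boundary functions, too, are determined only almost everywhere:
  \<open>has_trace q D w l\<close> says that the trace of \<open>w\<close> is the class of \<open>l\<close>.\<close>

definition has_trace :: "real \<Rightarrow> point set \<Rightarrow> scalar_field \<Rightarrow> scalar_field \<Rightarrow> bool" where
  "has_trace q D w l \<longleftrightarrow> w \<in> W1 q D \<and> l \<in> Lp q (surface_measure D) \<and>
     (\<exists>f :: nat \<Rightarrow> scalar_field. (\<forall>n. smooth (f n)) \<and>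
        (\<lambda>n. W1_norm q D (\<lambda>x. f n x - w x)) \<longlonglongrightarrow> 0 \<and>
        (\<lambda>n. Lp_norm q (surface_measure D) (\<lambda>x. f n x - l x)) \<longlonglongrightarrow> 0)"

definition has_trace_field :: "real \<Rightarrow> point set \<Rightarrow> vector_field \<Rightarrow> vector_field \<Rightarrow> bool" where
  "has_trace_field q D w l \<longleftrightarrow> (\<forall>i. has_trace q D (\<lambda>x. w x $ i) (\<lambda>x. l x $ i))"

text \<open>The trace operator maps onto the fractional space \<open>W\<^sup>1\<^sup>-\<^sup>1\<^sup>/\<^sup>q\<^sup>,\<^sup>q(\<partial>D)\<close>, which is
  therefore introduced as its range.\<close>

definition trace_space :: "real \<Rightarrow> point set \<Rightarrow> scalar_field set" where
  "trace_space q D = {l. \<exists>w \<in> W1 q D. has_trace q D w l}"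

definition trace_space_fields :: "real \<Rightarrow> point set \<Rightarrow> vector_field set" where
  "trace_space_fields q D = {l. \<forall>i. (\<lambda>x. l x $ i) \<in> trace_space q D}"

section \<open>Tangential and normal traces\<close>

definition conj_exponent :: "real \<Rightarrow> real" where
  "conj_exponent p = p / (p - 1)"

text \<open>\<open>gamma_cross_n p D v l\<close> and \<open>gamma_dot_n p D v l\<close> are the duality pairings of the
  tangential and the normal trace of \<open>v\<close> with \<open>l\<close>; they do not depend on the chosen lifting.\<close>

definition gamma_cross_n :: "real \<Rightarrow> point set \<Rightarrow> vector_field \<Rightarrow> vector_field \<Rightarrow> real" where
  "gamma_cross_n p D v l =
     (let q = conj_exponent p;
          w = (SOME w. w \<in> W1_fields q D \<and> has_trace_field q D w l)
      in (LINT x|lebesgue_on D. v x \<bullet> weak_curl D w x)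
         - (LINT x|lebesgue_on D. w x \<bullet> weak_curl D v x))"

definition gamma_dot_n :: "real \<Rightarrow> point set \<Rightarrow> vector_field \<Rightarrow> scalar_field \<Rightarrow> real" where
  "gamma_dot_n p D v l =
     (let q = conj_exponent p;
          u = (SOME u. u \<in> W1 q D \<and> has_trace q D u l)
      in (LINT x|lebesgue_on D. v x \<bullet> weak_grad D u x)
         + (LINT x|lebesgue_on D. u x * weak_div D v x))"

text \<open>A functional is the zero element of the dual of the trace space iff it vanishes on that
  space.\<close>

definition ker_gamma_cross_n :: "real \<Rightarrow> point set \<Rightarrow> vector_field set" where
  "ker_gamma_cross_n p D =
     {v \<in> Zc p D. \<forall>l \<in> trace_space_fields (conj_exponent p) D. gamma_cross_n p D v l = 0}"

definition ker_gamma_dot_n :: "real \<Rightarrow> point set \<Rightarrow> vector_field set" where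
  "ker_gamma_dot_n p D =
     {v \<in> Zd p D. \<forall>l \<in> trace_space (conj_exponent p) D. gamma_dot_n p D v l = 0}"

end

theory Submission
  imports Defs
begin

text \<open>If \<open>v\<close> is a limit of test fields, then the pairing of its trace with the trace of any \<open>w\<close> is a
  limit of zeros, by the definition of the weak derivatives of \<open>w\<close>.  Conversely, if the trace of
  \<open>v\<close> vanishes, then the extension of \<open>v\<close> by zero has on the whole space the extension by zero of its
  curl (or divergence) as weak curl (or divergence).  Localising by a partition of unity and
  convolving with mollifiers supported in small balls around vectors that point into \<open>D\<close> yields test
  fields that converge to \<open>v\<close> in the graph norm.

  The lifting is an arbitrary one, so the second step needs that a \<open>W\<^sup>1\<^sup>,\<^sup>q\<close> function with zero trace
  extends by zero, which follows from the bound of the integral of \<open>\<partial>\<^sub>i h\<close> over \<open>D\<close> by 16 times that of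
  \<open>\<bar>h\<bar>\<close> over the boundary, for smooth \<open>h\<close>.  This bound holds for every bounded open \<open>D\<close> whose boundary
  has finite Hausdorff measure: the integral over \<open>D\<close> is the limit of the integrals of
  \<open>(1\<^sub>D(y - t e\<^sub>i) - 1\<^sub>D(y)) h(y) / t\<close>, and the two indicators differ only where a segment of
  length \<open>t\<close> meets the boundary, a layer whose volume is controlled by covering the boundary with sets
  of diameter at most \<open>t\<close>.  The same argument applied to the extended function then approximates it by
  test functions.  The curl is treated as three divergences, one for each component.\<close>

section \<open>Smooth functions\<close>

text \<open>The Lipschitz charts supply two facts: the boundary has finite two-dimensional Hausdorff
  measure, and near every point of the closure some direction points into \<open>D\<close>. The
  boundary is handled by an inequality rather than by Gauss's formula because only boundary terms
  that tend to 0 must be controlled: a lifting of a smooth function differs from that function by a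
  limit of smooth functions whose boundary values tend to 0 in L^q, hence in L^1. To turn a covering
  estimate into an integral over the boundary, the boundary is cut into level sets of \<bar>h\<bar>,
  so the Hausdorff measure must be additive; hence Caratheodory's criterion. The factor 16 compares
  a box of volume \<open>12 * d^2 * t\<close> with a disc of area \<open>pi * d^2 / 4\<close>.
  Smooth boundary values suffice as tests, since vanishing pairings with all smooth functions say
  exactly that the extension by zero has a weak divergence. One linear operator approximates
  functions and divergences at once; a partial derivative of \<open>w\<close> is reached as the
  divergence of \<open>w\<close> times a unit vector.\<close>

lemma Ck_differentiable: "Ck (Suc k) f \<Longrightarrow> f differentiable at x"
  by simp

lemma Ck_continuous: "Ck k f \<Longrightarrow> continuous_on UNIV f"
  by (cases k) (auto intro: differentiable_imp_continuous_within simp: continuous_on_eq_continuous_within)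

lemma Ck_SucD: "Ck (Suc k) f \<Longrightarrow> Ck k f"
proof (induction k arbitrary: f)
  case 0
  then show ?case using Ck_continuous[of "Suc 0" f] by simp
next
  case (Suc k)
  then show ?case by auto
qed

lemma partialI: "(f has_derivative f') (at x) \<Longrightarrow> partial i f x = f' (axis i 1)"
  unfolding partial_def using frechet_derivative_at by metis

lemma partial_const [simp]: "partial i (\<lambda>_. c) = (\<lambda>_. 0)"
  using partialI[OF has_derivative_const] by (intro ext) blast

lemma differentiable_has_derivative:
  fixes f :: scalar_field
  shows "f differentiable at x \<Longrightarrow> (f has_derivative frechet_derivative f (at x)) (at x)"
  using frechet_derivative_works by blast

lemma partial_mult:
  assumes "f differentiable at x" "g differentiable at x"
  shows "partial i (\<lambda>y. f y * g y) x = f x * partial i g x + partial i f x * g x"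
  using partialI[OF has_derivative_mult[OF assms[THEN differentiable_has_derivative]]]
  by (simp add: partial_def)

lemma partial_add:
  assumes "f differentiable at x" "g differentiable at x"
  shows "partial i (\<lambda>y. f y + g y) x = partial i f x + partial i g x"
  using partialI[OF has_derivative_add[OF assms[THEN differentiable_has_derivative]]]
  by (simp add: partial_def)

lemma partial_affine:
  assumes "f differentiable at (a + s *\<^sub>R x)"
  shows "partial i (\<lambda>y. f (a + s *\<^sub>R y)) x = s * partial i f (a + s *\<^sub>R x)"
    and "(\<lambda>y. f (a + s *\<^sub>R y)) differentiable at x"
proof -
  let ?f' = "frechet_derivative f (at (a + s *\<^sub>R x))"
  have f: "(f has_derivative ?f') (at (a + s *\<^sub>R x))"
    using assms by (rule differentiable_has_derivative)
  have d: "((\<lambda>y. f (a + s *\<^sub>R y)) has_derivative (\<lambda>h. ?f' (s *\<^sub>R h))) (at x)"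
    by (rule has_derivative_compose[where g = f and f = "\<lambda>y. a + s *\<^sub>R y", OF _ f]) (auto intro!: derivative_eq_intros)
  then show "(\<lambda>y. f (a + s *\<^sub>R y)) differentiable at x"
    unfolding differentiable_def by blast
  interpret linear ?f' using f by (rule has_derivative_linear)
  show "partial i (\<lambda>y. f (a + s *\<^sub>R y)) x = s * partial i f (a + s *\<^sub>R x)"
    using partialI[OF d] scale[of s "axis i 1"] by (simp add: partial_def)
qed

lemma Ck_const [simp]: "Ck k (\<lambda>_. c)"
  by (induction k arbitrary: c) simp_all

lemma Ck_add: "Ck k f \<Longrightarrow> Ck k g \<Longrightarrow> Ck k (\<lambda>x. f x + g x)"
proof (induction k arbitrary: f g)
  case (Suc k)
  have "partial i (\<lambda>y. f y + g y) = (\<lambda>x. partial i f x + partial i g x)" for i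
    using Suc.prems by (intro ext partial_add) auto
  with Suc show ?case by (auto intro: derivative_intros)
qed (auto intro: continuous_intros)

lemma Ck_mult: "Ck k f \<Longrightarrow> Ck k g \<Longrightarrow> Ck k (\<lambda>x. f x * g x)"
proof (induction k arbitrary: f g)
  case (Suc k)
  have "partial i (\<lambda>y. f y * g y) = (\<lambda>x. f x * partial i g x + partial i f x * g x)" for i
    using Suc.prems by (intro ext partial_mult) auto
  moreover have "Ck k f" "Ck k g" using Suc.prems Ck_SucD by blast+
  ultimately show ?case using Suc by (auto intro!: derivative_intros Ck_add)
qed (auto intro: continuous_intros)

lemma Ck_affine: "Ck k f \<Longrightarrow> Ck k (\<lambda>x. f (a + s *\<^sub>R x))"
proof (induction k arbitrary: f)
  case 0
  then have f: "continuous_on UNIV f" by simp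
  show ?case
    by (auto intro!: continuous_on_compose2[OF f] continuous_intros)
next
  case (Suc k)
  have "partial i (\<lambda>y. f (a + s *\<^sub>R y)) = (\<lambda>x. s * partial i f (a + s *\<^sub>R x))" for i
    using Suc.prems by (intro ext partial_affine) auto
  with Suc show ?case by (auto intro!: partial_affine(2) Ck_mult)
qed

lemma smooth_differentiable: "smooth f \<Longrightarrow> f differentiable at x"
  unfolding smooth_def using Ck_differentiable by blast

lemma smooth_continuous: "smooth f \<Longrightarrow> continuous_on A f"
  unfolding smooth_def using Ck_continuous continuous_on_subset by blast

lemma smooth_borel [measurable_dest]: "smooth f \<Longrightarrow> f \<in> borel_measurable borel"
  by (intro borel_measurable_continuous_onI smooth_continuous)

lemma smooth_partial: "smooth f \<Longrightarrow> smooth (partial i f)"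
  unfolding smooth_def by (metis Ck.simps(2))

lemma smooth_const [simp]: "smooth (\<lambda>_. c)"
  by (simp add: smooth_def)

lemma smooth_add: "smooth f \<Longrightarrow> smooth g \<Longrightarrow> smooth (\<lambda>x. f x + g x)"
  by (simp add: smooth_def Ck_add)

lemma smooth_mult: "smooth f \<Longrightarrow> smooth g \<Longrightarrow> smooth (\<lambda>x. f x * g x)"
  by (simp add: smooth_def Ck_mult)

lemma smooth_minus: "smooth f \<Longrightarrow> smooth (\<lambda>x. - f x)"
  using smooth_mult[OF smooth_const[of "-1"]] by simp

lemma smooth_diff: "smooth f \<Longrightarrow> smooth g \<Longrightarrow> smooth (\<lambda>x. f x - g x)"
  using smooth_add[OF _ smooth_minus, of f g] by simp

lemma smooth_sum: "(\<And>i. i \<in> I \<Longrightarrow> smooth (f i)) \<Longrightarrow> smooth (\<lambda>x. \<Sum>i\<in>I. f i x)"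
  by (induction I rule: infinite_finite_induct) (auto intro: smooth_add)

lemma smooth_prod: "(\<And>i. i \<in> I \<Longrightarrow> smooth (f i)) \<Longrightarrow> smooth (\<lambda>x. \<Prod>i\<in>I. f i x)"
  by (induction I rule: infinite_finite_induct) (auto intro: smooth_mult)

lemma smooth_reflect: "smooth f \<Longrightarrow> smooth (\<lambda>y. f (x - y))"
  using Ck_affine[of _ f x "-1"] by (simp add: smooth_def)

lemma smooth_translate: "smooth f \<Longrightarrow> smooth (\<lambda>y. f (x + y))"
  using Ck_affine[of _ f x "1"] by (simp add: smooth_def)

lemma partial_reflect: "smooth f \<Longrightarrow> partial i (\<lambda>y. f (x - y)) y = - partial i f (x - y)"
  using partial_affine(1)[of f x "-1" y] smooth_differentiable by simp

lemma partial_minus: "smooth f \<Longrightarrow> partial i (\<lambda>y. - f y) x = - partial i f x"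
  using partial_mult[of "\<lambda>_. -1" x f] by (simp add: smooth_differentiable)

lemma partial_diff: "smooth f \<Longrightarrow> smooth g \<Longrightarrow> partial i (\<lambda>y. f y - g y) x = partial i f x - partial i g x"
  using partial_add[of f x "\<lambda>y. - g y"] smooth_differentiable smooth_minus partial_minus[of g] by simp

lemma partial_sum:
  "(\<And>j. j \<in> J \<Longrightarrow> smooth (f j)) \<Longrightarrow> partial i (\<lambda>x. \<Sum>j\<in>J. f j x) x = (\<Sum>j\<in>J. partial i (f j) x)"
  by (induction J rule: infinite_finite_induct)
    (auto simp: partial_add smooth_differentiable smooth_sum)

lemma frechet_derivative_eq_sum_partial:
  fixes h :: point
  assumes "f differentiable at x"
  shows "frechet_derivative f (at x) h = (\<Sum>i\<in>UNIV. h $ i * partial i f x)"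
proof -
  interpret linear "frechet_derivative f (at x)"
    using differentiable_has_derivative[OF assms] by (rule has_derivative_linear)
  have "h = (\<Sum>i\<in>UNIV. h $ i *\<^sub>R axis i 1)"
    using basis_expansion[of h] by (simp add: scalar_mult_eq_scaleR)
  then have "frechet_derivative f (at x) h = frechet_derivative f (at x) (\<Sum>i\<in>UNIV. h $ i *\<^sub>R axis i 1)"
    by simp
  then show ?thesis by (simp add: sum scale partial_def)
qed

lemma smooth_directional_derivative:
  assumes "smooth f"
  shows "((\<lambda>t. f (x + t *\<^sub>R axis i 1)) has_real_derivative partial i f (x + t *\<^sub>R axis i 1)) (at t)"
proof -
  let ?z = "x + t *\<^sub>R axis i 1" and ?f' = "frechet_derivative f (at (x + t *\<^sub>R axis i 1))"
  have f: "(f has_derivative ?f') (at ?z)"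
    using assms by (intro differentiable_has_derivative smooth_differentiable)
  have "((\<lambda>t. f (x + t *\<^sub>R axis i 1)) has_derivative (\<lambda>h. ?f' (h *\<^sub>R axis i 1))) (at t)"
    by (rule has_derivative_compose[where g = f and f = "\<lambda>t. x + t *\<^sub>R axis i 1", OF _ f]) (auto intro!: derivative_eq_intros)
  moreover interpret linear ?f' using f by (rule has_derivative_linear)
  have "(\<lambda>h. ?f' (h *\<^sub>R axis i 1)) = (*) (partial i f ?z)"
    by (auto simp: scale partial_def mult.commute)
  ultimately show ?thesis by (simp add: has_field_derivative_def)
qed

subsection \<open>Bump functions\<close>

text \<open>The family exp (-1/t) / t^m, extended by 0 to t \<le> 0. Differentiation stays inside
  its linear span, so smoothness of all members follows by one induction with m arbitrary.\<close>

definition flat :: "nat \<Rightarrow> real \<Rightarrow> real" where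
  "flat m t = (if t \<le> 0 then 0 else exp (- inverse t) * inverse t ^ m)"

text \<open>With s = 1/t and n = m + 2, exp s dominates (1 + s/n)^n and hence (s/n)^n. The two
  surplus powers leave a factor \<open>t\<^sup>2\<close>, which gives continuity and derivative 0 at
  the origin.\<close>

lemma flat_bound: "\<bar>flat m t\<bar> \<le> real (m + 2) ^ (m + 2) * t\<^sup>2"
proof (cases "t \<le> 0")
  case False
  then have t: "t > 0" by simp
  define n where "n = m + 2"
  have "(inverse t / real n) ^ n \<le> (1 + inverse t / real n) ^ n"
    using t by (intro power_mono) auto
  also have "\<dots> \<le> exp (inverse t)"
    using t by (intro exp_ge_one_plus_x_over_n_power_n) (auto simp: n_def intro: order_trans[of _ 0])
  finally have "inverse t ^ n \<le> real n ^ n * exp (inverse t)"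
    by (simp add: power_divide n_def pos_divide_le_eq mult.commute)
  then have "exp (- inverse t) * inverse t ^ n \<le> exp (- inverse t) * (real n ^ n * exp (inverse t))"
    by (intro mult_left_mono) simp_all
  also have "\<dots> = real n ^ n" by (simp add: exp_minus)
  finally have le: "exp (- inverse t) * inverse t ^ n * t\<^sup>2 \<le> real n ^ n * t\<^sup>2"
    by (intro mult_right_mono) simp_all
  have "inverse t ^ n * t\<^sup>2 = inverse t ^ m"
    using t by (simp add: n_def power_add power2_eq_square field_simps)
  then have "flat m t = exp (- inverse t) * inverse t ^ n * t\<^sup>2"
    using t by (simp only: flat_def mult.assoc) simp
  then show ?thesis
    using le t unfolding n_def by (simp only: abs_of_nonneg) (auto simp: flat_def)
qed (simp add: flat_def)

lemma flat_DERIV: "(flat m has_real_derivative flat (m + 2) t - real m * flat (m + 1) t) (at t)"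
proof (cases t "0::real" rule: linorder_cases)
  case equal
  let ?C = "real (m + 2) ^ (m + 2)"
  have "(\<lambda>h. flat m h / h) \<midarrow>0\<rightarrow> 0"
  proof (rule Lim_null_comparison)
    have "\<bar>flat m h / h\<bar> \<le> ?C * \<bar>h\<bar>" for h
      using flat_bound[of m h] by (cases "h = 0") (auto simp: field_simps power2_eq_square abs_mult[symmetric])
    then show "\<forall>\<^sub>F h in at 0. norm (flat m h / h) \<le> ?C * \<bar>h\<bar>" by simp
    show "(\<lambda>h. ?C * \<bar>h\<bar>) \<midarrow>0\<rightarrow> 0" by (auto intro!: tendsto_eq_intros)
  qed
  then show ?thesis using equal by (simp add: DERIV_def flat_def)
next
  case less
  have "((\<lambda>_. 0) has_real_derivative 0) (at t)" by simp
  then have "(flat m has_real_derivative 0) (at t)"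
    by (rule has_field_derivative_transform_within_open[where S = "{..<0}"]) (use less in \<open>auto simp: flat_def\<close>)
  then show ?thesis using less by (simp add: flat_def)
next
  case greater
  have "((\<lambda>t. exp (- inverse t) * inverse t ^ m) has_real_derivative
     flat (m + 2) t - real m * flat (m + 1) t) (at t)"
  proof -
    have "real m * inverse t ^ (m - Suc 0) * inverse t ^ 2 = real m * inverse t ^ (m + 1)"
      by (cases m) (simp_all add: power2_eq_square)
    then show ?thesis
      using greater
      by (auto intro!: derivative_eq_intros simp: flat_def power2_eq_square algebra_simps)
  qed
  then show ?thesis
    by (rule has_field_derivative_transform_within_open[where S = "{0<..}"]) (use greater in \<open>auto simp: flat_def\<close>)
qed

lemma smooth_flat: "smooth (\<lambda>x. flat m (c + s * x $ i))"
proof -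
  have d: "((\<lambda>x. flat m (c + s * x $ i)) has_derivative
      (\<lambda>h. s * h $ i * (flat (m + 2) (c + s * x $ i) - real m * flat (m + 1) (c + s * x $ i)))) (at x)"
    for m and x :: point
    by (rule has_derivative_eq_rhs[OF has_derivative_compose[OF _ flat_DERIV[unfolded has_field_derivative_def]]])
      (auto intro!: derivative_eq_intros bounded_linear.has_derivative[OF bounded_linear_vec_nth])
  have "Ck k (\<lambda>x. flat m (c + s * x $ i))" for k
  proof (induction k arbitrary: m)
    case 0
    show ?case
      using d[THEN has_derivative_continuous] by (simp add: continuous_on_eq_continuous_within)
  next
    case (Suc k)
    have "partial j (\<lambda>x. flat m (c + s * x $ i)) = (\<lambda>x. (s * axis j 1 $ i) *
       (flat (m + 2) (c + s * x $ i) + (- real m) * flat (m + 1) (c + s * x $ i)))" for j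
      using partialI[OF d] by (auto simp: fun_eq_iff)
    moreover have "(\<lambda>x. flat m (c + s * x $ i)) differentiable at x" for x
      using d by (auto simp: differentiable_def)
    ultimately show ?case
      using Suc by (simp only: Ck.simps) (intro conjI allI TrueI Ck_mult Ck_add Ck_const)
  qed
  then show ?thesis by (simp add: smooth_def)
qed

text \<open>A product over the coordinates, positive exactly on the open cube of half side r;
  smoothness thus reduces to functions of one variable. The factors 1 and -1 bring the arguments
  into the affine form that \<open>smooth_flat\<close> expects.\<close>

definition bump :: "real \<Rightarrow> scalar_field" where
  "bump r x = (\<Prod>i\<in>UNIV. flat 0 (r + 1 * x $ i) * flat 0 (r + (-1) * x $ i))"

lemma smooth_bump: "smooth (bump r)"
  unfolding bump_def[abs_def] by (intro smooth_prod smooth_mult smooth_flat)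

lemma bump_nonneg: "0 \<le> bump r x"
  by (auto simp: bump_def flat_def intro!: prod_nonneg)

lemma bump_pos: "(\<And>i. \<bar>x $ i\<bar> < r) \<Longrightarrow> 0 < bump r x"
  by (auto simp: bump_def flat_def abs_less_iff not_le less_diff_eq add.commute intro!: prod_pos)
    (smt (verit))+

text \<open>The cube of half side r lies in the ball of radius 2 r, because sqrt 3 < 2.\<close>

lemma bump_eq_0: "2 * r \<le> norm x \<Longrightarrow> bump r x = 0"
proof -
  assume r: "2 * r \<le> norm x"
  have "\<exists>i. r \<le> \<bar>x $ i\<bar>"
  proof (rule ccontr)
    assume "\<not> (\<exists>i. r \<le> \<bar>x $ i\<bar>)"
    then have lt: "\<bar>x $ i\<bar> < r" for i by (simp add: not_le)
    have r0: "r > 0" using lt[of 1] by simp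
    have "(norm x)\<^sup>2 = (\<Sum>i\<in>UNIV. (x $ i)\<^sup>2)"
      by (simp add: norm_vec_def L2_set_def sum_nonneg)
    also have "\<dots> \<le> (\<Sum>i\<in>(UNIV::3 set). r\<^sup>2)"
      using lt by (intro sum_mono) (metis abs_ge_zero less_imp_le power2_abs power_mono)
    also have "\<dots> < (2 * r)\<^sup>2" using r0 by (simp add: power2_eq_square)
    finally show False using r r0 by (smt (verit) power_mono)
  qed
  then obtain i where "r \<le> x $ i \<or> r \<le> - (x $ i)" by (metis abs_le_iff abs_if)
  then have "flat 0 (r + 1 * x $ i) * flat 0 (r + (-1) * x $ i) = 0" by (auto simp: flat_def)
  then show ?thesis unfolding bump_def by (metis UNIV_I finite prod_zero)
qed

section \<open>Lebesgue spaces\<close>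

lemma norm_add_powr_le:
  fixes a b :: "'a::real_normed_vector"
  assumes "0 \<le> p"
  shows "norm (a + b) powr p \<le> 2 powr p * (norm a powr p + norm b powr p)"
proof -
  have "norm (a + b) \<le> 2 * max (norm a) (norm b)"
    using norm_triangle_ineq[of a b] by simp
  then have "norm (a + b) powr p \<le> (2 * max (norm a) (norm b)) powr p"
    by (intro powr_mono2) (use assms in auto)
  also have "\<dots> = 2 powr p * max (norm a) (norm b) powr p"
    by (simp add: powr_mult)
  also have "\<dots> \<le> 2 powr p * (norm a powr p + norm b powr p)"
    by (intro mult_left_mono) (auto simp: max_def)
  finally show ?thesis .
qed

text \<open>Young's inequality for c a and b / c, with the factors 1/p and 1/q estimated by 1. The
  free weight c allows the first term to be made small before the second one is sent to 0.\<close>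

lemma weighted_young:
  fixes a b c :: real
  assumes "1 < p" "0 < c"
  shows "\<bar>a * b\<bar> \<le> c powr p * \<bar>a\<bar> powr p + (1 / c) powr conj_exponent p * \<bar>b\<bar> powr conj_exponent p"
proof -
  let ?q = "conj_exponent p"
  have q: "?q > 1" "1 / p + 1 / ?q = 1"
    using assms by (auto simp: conj_exponent_def field_simps)
  have "\<bar>a * b\<bar> = (c * \<bar>a\<bar>) * (1 / c * \<bar>b\<bar>)"
    using assms by (simp add: abs_mult)
  also have "\<dots> \<le> (c * \<bar>a\<bar>) powr p / p + (1 / c * \<bar>b\<bar>) powr ?q / ?q"
    using assms q by (intro Youngs_inequality) auto
  also have "\<dots> \<le> (c * \<bar>a\<bar>) powr p + (1 / c * \<bar>b\<bar>) powr ?q"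
  proof (intro add_mono)
    have "x / r \<le> x" if "0 \<le> x" "1 < r" for x r :: real
      using that mult_left_mono[of 1 r x] by (simp add: field_simps)
    then show "(c * \<bar>a\<bar>) powr p / p \<le> (c * \<bar>a\<bar>) powr p"
      "(1 / c * \<bar>b\<bar>) powr ?q / ?q \<le> (1 / c * \<bar>b\<bar>) powr ?q"
      using assms q by auto
  qed
  also have "\<dots> = c powr p * \<bar>a\<bar> powr p + (1 / c) powr ?q * \<bar>b\<bar> powr ?q"
    using assms by (simp add: powr_mult powr_divide)
  finally show ?thesis .
qed

lemma holder_integrable:
  fixes a b :: "'a \<Rightarrow> real"
  assumes "1 < p" and [measurable]: "a \<in> borel_measurable M" "b \<in> borel_measurable M"
    and "integrable M (\<lambda>x. \<bar>a x\<bar> powr p)" "integrable M (\<lambda>x. \<bar>b x\<bar> powr conj_exponent p)"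
  shows "integrable M (\<lambda>x. a x * b x)"
proof (rule Bochner_Integration.integrable_bound)
  show "integrable M (\<lambda>x. \<bar>a x\<bar> powr p + \<bar>b x\<bar> powr conj_exponent p)"
    using assms by auto
  show "AE x in M. norm (a x * b x) \<le> norm (\<bar>a x\<bar> powr p + \<bar>b x\<bar> powr conj_exponent p)"
    using weighted_young[of p 1] assms(1) by auto
qed measurable

text \<open>A substitute for Hoelder's inequality that needs no roots: the weight is chosen first,
  so that the part with \<open>a\<close> costs at most e/2, and then n, so that the part with
  \<open>b n\<close> costs less than e/2.\<close>

lemma holder_tendsto_0:
  fixes a :: "'a \<Rightarrow> real" and b :: "nat \<Rightarrow> 'a \<Rightarrow> real"
  assumes p: "1 < p" and [measurable]: "a \<in> borel_measurable M" "\<And>n. b n \<in> borel_measurable M"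
    and a: "integrable M (\<lambda>x. \<bar>a x\<bar> powr p)"
    and b: "\<And>n. integrable M (\<lambda>x. \<bar>b n x\<bar> powr conj_exponent p)"
    and lim: "(\<lambda>n. LINT x|M. \<bar>b n x\<bar> powr conj_exponent p) \<longlonglongrightarrow> 0"
  shows "(\<lambda>n. LINT x|M. \<bar>a x * b n x\<bar>) \<longlonglongrightarrow> 0"
proof (rule LIMSEQ_I)
  fix e :: real assume e: "0 < e"
  let ?q = "conj_exponent p"
  define A where "A = (LINT x|M. \<bar>a x\<bar> powr p)"
  have A: "0 \<le> A" unfolding A_def by (intro integral_nonneg_AE) simp
  \<comment> \<open>Chosen so that c^p A \<le> e/2; A + 1 avoids a division by 0 when
    \<open>a\<close> vanishes.\<close>
  define c where "c = (e / (2 * (A + 1))) powr (1 / p)"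
  have c: "0 < c" "c powr p = e / (2 * (A + 1))"
    using e A p by (auto simp: c_def powr_powr)
  have "c powr p * A \<le> e / 2"
    using A e by (simp add: c field_simps)
  have le: "(LINT x|M. \<bar>a x * b n x\<bar>) \<le> c powr p * A + (1 / c) powr ?q * (LINT x|M. \<bar>b n x\<bar> powr ?q)" for n
  proof -
    have "(LINT x|M. \<bar>a x * b n x\<bar>) \<le> (LINT x|M. c powr p * \<bar>a x\<bar> powr p + (1 / c) powr ?q * \<bar>b n x\<bar> powr ?q)"
      using a b weighted_young[OF p c(1)] holder_integrable[OF p _ _ a b]
      by (intro integral_mono) auto
    also have "\<dots> = c powr p * A + (1 / c) powr ?q * (LINT x|M. \<bar>b n x\<bar> powr ?q)"
      using a b by (simp add: A_def)
    finally show ?thesis .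
  qed
  have "(\<lambda>n. (1 / c) powr ?q * (LINT x|M. \<bar>b n x\<bar> powr ?q)) \<longlonglongrightarrow> 0"
    using tendsto_mult_right_zero[OF lim] by simp
  then obtain N where N: "\<And>n. n \<ge> N \<Longrightarrow> \<bar>(1 / c) powr ?q * (LINT x|M. \<bar>b n x\<bar> powr ?q)\<bar> < e / 2"
    using e LIMSEQ_D[of _ 0 "e / 2"] by (metis diff_zero half_gt_zero real_norm_def)
  show "\<exists>N. \<forall>n\<ge>N. norm ((LINT x|M. \<bar>a x * b n x\<bar>) - 0) < e"
  proof (intro exI[of _ N] allI impI)
    fix n assume "N \<le> n"
    then show "norm ((LINT x|M. \<bar>a x * b n x\<bar>) - 0) < e"
      using le[of n] N[of n] \<open>c powr p * A \<le> e / 2\<close> by (simp add: integral_nonneg_AE)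
  qed
qed

text \<open>The p-th power of the L^p norm. Without the root the triangle inequality holds up to the
  factor 2^p, which is enough for limits, and values in \<open>ennreal\<close> remove integrability
  side conditions.\<close>

definition Np :: "real \<Rightarrow> scalar_field \<Rightarrow> ennreal" where
  "Np p f = (\<integral>\<^sup>+x. ennreal (\<bar>f x\<bar> powr p) \<partial>lborel)"

lemma Np_add:
  assumes "0 \<le> p" and [measurable]: "f \<in> borel_measurable borel" "g \<in> borel_measurable borel"
  shows "Np p (\<lambda>x. f x + g x) \<le> ennreal (2 powr p) * (Np p f + Np p g)"
proof -
  have "Np p (\<lambda>x. f x + g x) \<le> (\<integral>\<^sup>+x. ennreal (2 powr p) * (ennreal (\<bar>f x\<bar> powr p) + ennreal (\<bar>g x\<bar> powr p)) \<partial>lborel)"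
    unfolding Np_def using norm_add_powr_le[OF assms(1), of "f _" "g _"]
    by (intro nn_integral_mono) (simp add: ennreal_mult[symmetric] ennreal_plus[symmetric] del: ennreal_plus)
  also have "\<dots> = ennreal (2 powr p) * (Np p f + Np p g)"
    by (simp add: Np_def nn_integral_cmult nn_integral_add)
  finally show ?thesis .
qed

lemma Np_minus: "Np p (\<lambda>x. - f x) = Np p f"
  by (simp add: Np_def)

lemma Np_diff_commute: "Np p (\<lambda>x. f x - g x) = Np p (\<lambda>x. g x - f x)"
  by (simp add: Np_def abs_minus_commute)

lemma Np_diff_triangle:
  assumes "0 \<le> p" and [measurable]: "f \<in> borel_measurable borel" "g \<in> borel_measurable borel" "h \<in> borel_measurable borel"
  shows "Np p (\<lambda>x. f x - h x) \<le> ennreal (2 powr p) * (Np p (\<lambda>x. f x - g x) + Np p (\<lambda>x. g x - h x))"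
  using Np_add[of p "\<lambda>x. f x - g x" "\<lambda>x. g x - h x"] assms by simp

definition clamp1 :: "real \<Rightarrow> real \<Rightarrow> real" where "clamp1 B x = max (- B) (min B x)"

lemma Np_clamp_tendsto:
  assumes p: "0 < p" and [measurable]: "f \<in> borel_measurable borel" and fin: "Np p f < \<infinity>"
  shows "(\<lambda>n. Np p (\<lambda>x. f x - clamp1 (real n) (f x))) \<longlonglongrightarrow> 0"
proof -
  have "(\<lambda>n. Np p (\<lambda>x. f x - clamp1 (real n) (f x))) \<longlonglongrightarrow> (\<integral>\<^sup>+x. 0 \<partial>(lborel :: point measure))"
    unfolding Np_def clamp1_def
  proof (rule nn_integral_dominated_convergence[where w = "\<lambda>x. ennreal (\<bar>f x\<bar> powr p)"])
    show "(\<integral>\<^sup>+ x. ennreal (\<bar>f x\<bar> powr p) \<partial>lborel) < \<infinity>" using fin by (simp add: Np_def)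
    show "AE x in lborel. ennreal (\<bar>f x - max (- real n) (min (real n) (f x))\<bar> powr p) \<le> ennreal (\<bar>f x\<bar> powr p)" for n
      using p by (intro AE_I2 ennreal_leI powr_mono2) auto
    show "AE x in lborel. (\<lambda>n. ennreal (\<bar>f x - max (- real n) (min (real n) (f x))\<bar> powr p)) \<longlonglongrightarrow> 0"
    proof (intro AE_I2 tendsto_eventually)
      fix x
      have "\<forall>\<^sub>F n in sequentially. real n \<ge> \<bar>f x\<bar>"
        using eventually_ge_at_top[of "nat \<lceil>\<bar>f x\<bar>\<rceil>"] by eventually_elim linarith
      then show "\<forall>\<^sub>F n in sequentially. ennreal (\<bar>f x - max (- real n) (min (real n) (f x))\<bar> powr p) = 0"
        by eventually_elim (auto simp: max_def min_def)
    qed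
  qed measurable
  then show ?thesis by simp
qed

lemma emeasure_cball_finite: "emeasure lborel (cball (a::point) r) < \<infinity>"
  by (meson emeasure_bounded_finite bounded_cball less_top infinity_ennreal_def)

text \<open>A measurable function is almost everywhere a pointwise limit of continuous ones.
  Clamping these to [-B, B] and multiplying by a cutoff, equal to 1 on the ball of radius R and to 0
  outside radius R + 1, gives an integrable dominating function.\<close>

lemma Np_dense_bounded:
  assumes p: "0 < p" and f [measurable]: "f \<in> borel_measurable borel"
    and R: "\<And>x. R < norm x \<Longrightarrow> f x = 0" and B: "\<And>x. \<bar>f x\<bar> \<le> B"
  obtains g where "\<And>n::nat. continuous_on UNIV (g n)" "\<And>n x. R + 1 < norm x \<Longrightarrow> g n x = 0"
    "(\<lambda>n. Np p (\<lambda>x. f x - g n x)) \<longlonglongrightarrow> 0"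
proof -
  have B0: "0 \<le> B" using B[of 0] by linarith
  have "f \<in> borel_measurable lebesgue" using f by (simp add: measurable_completion)
  then have "f measurable_on UNIV" by (simp add: measurable_on_iff_borel_measurable)
  then obtain N h where N: "negligible N" and h: "\<And>n. continuous_on UNIV (h n)"
    and lim: "\<And>x. x \<notin> N \<Longrightarrow> (\<lambda>n. h n x) \<longlonglongrightarrow> f x"
    unfolding measurable_on_UNIV by (auto simp: measurable_on_def)
  define c where "c x = max 0 (min 1 (R + 1 - norm x))" for x :: point
  define g where "g n x = clamp1 B (h n x) * c x" for n x
  have cont: "continuous_on UNIV (g n)" for n
    unfolding g_def[abs_def] c_def clamp1_def by (intro continuous_intros h)
  then have [measurable]: "g n \<in> borel_measurable borel" for n
    by (rule borel_measurable_continuous_onI)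
  have gz: "g n x = 0" if "R + 1 < norm x" for n x
    using that by (simp add: g_def c_def)
  have gB: "\<bar>g n x\<bar> \<le> B" for n x
    using B0 mult_mono[of "\<bar>clamp1 B (h n x)\<bar>" B "\<bar>c x\<bar>" 1]
    by (auto simp: g_def abs_mult c_def clamp1_def)
  have AE: "AE x in lborel. x \<notin> N"
    using AE_not_in[of N lebesgue] N by (simp add: negligible_iff_null_sets AE_completion_iff)
  have "(\<lambda>n. Np p (\<lambda>x. f x - g n x)) \<longlonglongrightarrow> (\<integral>\<^sup>+x. 0 \<partial>(lborel :: point measure))"
    unfolding Np_def
  proof (rule nn_integral_dominated_convergence[where w = "\<lambda>x. ennreal ((2 * B) powr p) * indicator (cball 0 (R + 1)) x"])
    show "(\<integral>\<^sup>+x. ennreal ((2 * B) powr p) * indicator (cball 0 (R + 1)) x \<partial>(lborel :: point measure)) < \<infinity>"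
      using emeasure_cball_finite[of 0 "R + 1"]
      by (subst nn_integral_cmult_indicator) (simp_all add: ennreal_mult_less_top)
    show "AE x in lborel. ennreal (\<bar>f x - g n x\<bar> powr p) \<le> ennreal ((2 * B) powr p) * indicator (cball 0 (R + 1)) x" for n
    proof (intro AE_I2)
      fix x :: point
      have "\<bar>f x - g n x\<bar> powr p \<le> (2 * B) powr p"
        using p B[of x] gB[of n x] by (intro powr_mono2) auto
      then show "ennreal (\<bar>f x - g n x\<bar> powr p) \<le> ennreal ((2 * B) powr p) * indicator (cball 0 (R + 1)) x"
        using R[of x] gz[of x n] by (cases "norm x \<le> R + 1") (auto intro: ennreal_leI)
    qed
    show "AE x in lborel. (\<lambda>n. ennreal (\<bar>f x - g n x\<bar> powr p)) \<longlonglongrightarrow> 0"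
      using AE
    proof eventually_elim
      case (elim x)
      have "(\<lambda>n. g n x) \<longlonglongrightarrow> clamp1 B (f x) * c x"
        unfolding g_def clamp1_def by (intro tendsto_intros lim elim)
      moreover have "clamp1 B (f x) * c x = f x"
      proof (cases "norm x \<le> R")
        case True
        then show ?thesis using B[of x] by (auto simp: c_def clamp1_def)
      next
        case False
        then show ?thesis using R[of x] B0 by (auto simp: clamp1_def)
      qed
      ultimately have lim_g: "(\<lambda>n. g n x) \<longlonglongrightarrow> f x" by simp
      have "(\<lambda>n. \<bar>f x - g n x\<bar>) \<longlonglongrightarrow> \<bar>f x - f x\<bar>"
        by (rule tendsto_rabs[OF tendsto_diff[OF tendsto_const lim_g]])
      then have "(\<lambda>n. \<bar>f x - g n x\<bar>) \<longlonglongrightarrow> 0" by simp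
      then have "(\<lambda>n. \<bar>f x - g n x\<bar> powr p) \<longlonglongrightarrow> 0"
        by (rule tendsto_zero_powrI[OF _ tendsto_const[of p]]) (simp_all add: p)
      from tendsto_ennrealI[OF this] show ?case by simp
    qed
  next
    show "(\<lambda>x. ennreal (\<bar>f x - g n x\<bar> powr p)) \<in> borel_measurable lborel" for n by measurable
    show "(\<lambda>x. ennreal ((2 * B) powr p) * indicator (cball 0 (R + 1)) x) \<in> borel_measurable lborel"
      by (intro borel_measurable_times_ennreal borel_measurable_const borel_measurable_indicator) simp
  qed simp
  then show ?thesis using that[of g] cont gz by simp
qed

section \<open>Translations, reflections, and continuity of translation in L^p\<close>

lemma lborel_nn_integral_shift:
  fixes f :: "point \<Rightarrow> ennreal"
  assumes [measurable]: "f \<in> borel_measurable borel"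
  shows "(\<integral>\<^sup>+x. f (x - z) \<partial>lborel) = (\<integral>\<^sup>+x. f x \<partial>lborel)"
  using nn_integral_distr[of "(+) (- z)" lborel borel f] lborel_distr_plus[of "- z"] by simp

lemma lborel_integral_shift:
  fixes f :: scalar_field
  assumes [measurable]: "f \<in> borel_measurable borel"
  shows "(LINT x|lborel. f (x - z)) = (LINT x|lborel. f x)"
  using integral_distr[of "(+) (- z)" lborel borel f] lborel_distr_plus[of "- z"] by simp

lemma lborel_distr_reflect: "distr lborel borel ((-) c) = (lborel :: point measure)"
  by (subst lborel_affine[of "-1" c]) (auto simp: density_1)

lemma lborel_integral_reflect:
  fixes f :: scalar_field
  assumes [measurable]: "f \<in> borel_measurable borel"
  shows "(LINT y|lborel. f (x - y)) = (LINT y|lborel. f y)"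
  using integral_distr[of "(-) x" lborel borel f] lborel_distr_reflect[of x] by simp

lemma Np_shift:
  assumes [measurable]: "f \<in> borel_measurable borel"
  shows "Np p (\<lambda>x. f (x - z)) = Np p f"
  unfolding Np_def by (rule lborel_nn_integral_shift) measurable

definition bdd_supp :: "scalar_field \<Rightarrow> bool" where
  "bdd_supp f \<longleftrightarrow> (\<exists>R. \<forall>x. R < norm x \<longrightarrow> f x = 0)"

text \<open>Bounded support makes these functions integrable for every p \<ge> 1, so that their
  convolutions with smooth kernels are genuine integrals.\<close>

definition Lc :: "real \<Rightarrow> scalar_field set" where
  "Lc p = {f \<in> borel_measurable borel. bdd_supp f \<and> Np p f < \<infinity>}"

lemma uniformly_continuous_bdd_supp:
  assumes g: "continuous_on UNIV g" and "bdd_supp g"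
  shows "uniformly_continuous_on UNIV g"
proof -
  obtain R where R: "\<And>x. R < norm x \<Longrightarrow> g x = 0" using assms by (auto simp: bdd_supp_def)
  have "uniformly_continuous_on (cball 0 (R + 1)) g"
    using g by (intro compact_uniformly_continuous) (auto intro: continuous_on_subset)
  show ?thesis
    unfolding uniformly_continuous_on_def
  proof (intro allI impI)
    fix e :: real assume e: "0 < e"
    then obtain d where d: "d > 0" "\<And>x y. \<lbrakk>(x::point) \<in> cball 0 (R + 1); y \<in> cball 0 (R + 1); dist y x < d\<rbrakk> \<Longrightarrow> dist (g y) (g x) < e"
      using \<open>uniformly_continuous_on (cball 0 (R + 1)) g\<close> unfolding uniformly_continuous_on_def by metis
    show "\<exists>d>0. \<forall>x\<in>UNIV. \<forall>x'\<in>UNIV. dist x' x < d \<longrightarrow> dist (g x') (g x) < e"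
    proof (intro exI[of _ "min d 1"] conjI ballI impI)
      fix x y :: point assume xy: "dist y x < min d 1"
      show "dist (g y) (g x) < e"
      proof (cases "norm x \<le> R + 1 \<and> norm y \<le> R + 1")
        case True then show ?thesis using d(2)[of x y] xy by simp
      next
        case False
        have "\<bar>norm y - norm x\<bar> < 1"
          using norm_triangle_ineq3[of y x] xy by (simp add: dist_norm)
        then have "R < norm x" "R < norm y" using False by auto
        then show ?thesis using R e by simp
      qed
    qed (use d in auto)
  qed
qed

lemma bounded_bdd_supp:
  assumes g: "continuous_on UNIV g" and "bdd_supp g"
  obtains B where "0 \<le> B" "\<And>x. \<bar>g x\<bar> \<le> B"
proof -
  obtain R where R: "\<And>x. R < norm x \<Longrightarrow> g x = 0" using assms by (auto simp: bdd_supp_def)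
  have "bounded (g ` cball 0 R)"
    using g by (intro compact_imp_bounded compact_continuous_image) (auto intro: continuous_on_subset)
  then obtain B where "\<forall>x\<in>cball 0 R. \<bar>g x\<bar> \<le> B"
    by (auto simp: bounded_iff)
  then have "\<bar>g x\<bar> \<le> B" if "norm x \<le> R" for x using that by simp
  then have "\<bar>g x\<bar> \<le> max B 0" for x using R[of x] by (cases "norm x \<le> R") (auto simp: le_max_iff_disj)
  then show ?thesis using that[of "max B 0"] by simp
qed

lemma Np_dense:
  assumes p: "0 < p" and f [measurable]: "f \<in> borel_measurable borel"
    and R: "\<And>x. R < norm x \<Longrightarrow> f x = 0" and fin: "Np p f < \<infinity>" and e: "0 < e"
  obtains g where "continuous_on UNIV g" "\<And>x. R + 1 < norm x \<Longrightarrow> g x = 0"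
    "Np p (\<lambda>x. f x - g x) < ennreal e"
proof -
  define d where "d = e / (2 * 2 powr p)"
  have d: "ennreal d > 0" "2 powr p * d = e / 2" using e by (auto simp: d_def)
  obtain N :: nat where N: "Np p (\<lambda>x. f x - clamp1 (real N) (f x)) < ennreal d"
    using order_tendstoD(2)[OF Np_clamp_tendsto[OF p f fin] d(1)]
    by (meson eventually_happens trivial_limit_sequentially)
  let ?f = "\<lambda>x. clamp1 (real N) (f x)"
  have [measurable]: "?f \<in> borel_measurable borel" by (simp add: clamp1_def)
  obtain g where g: "\<And>n::nat. continuous_on UNIV (g n)" "\<And>n x. R + 1 < norm x \<Longrightarrow> g n x = 0"
    "(\<lambda>n. Np p (\<lambda>x. ?f x - g n x)) \<longlonglongrightarrow> 0"
    by (rule Np_dense_bounded[of p ?f R "real N"]) (use p R in \<open>auto simp: clamp1_def\<close>)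
  obtain n where n: "Np p (\<lambda>x. ?f x - g n x) < ennreal d"
    using order_tendstoD(2)[OF g(3) d(1)] by (meson eventually_happens trivial_limit_sequentially)
  have [measurable]: "g n \<in> borel_measurable borel" using g(1) by (rule borel_measurable_continuous_onI)
  have "Np p (\<lambda>x. f x - g n x) \<le> ennreal (2 powr p) * (Np p (\<lambda>x. f x - ?f x) + Np p (\<lambda>x. ?f x - g n x))"
    using p by (intro Np_diff_triangle) auto
  also have "\<dots> < ennreal (2 powr p) * (ennreal d + ennreal d)"
    by (intro ennreal_mult_strict_left_mono add_strict_mono N n) (auto simp: ennreal_zero_less_top)
  also have "\<dots> = ennreal e"
    using d e by (simp add: ennreal_mult[symmetric] ennreal_plus[symmetric] distrib_left del: ennreal_plus)
  finally show ?thesis using that[of "g n"] g by simp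
qed

text \<open>With g continuous of bounded support and close to f, split f(x - z) - f(x) at g(x - z)
  and g(x). The outer terms are small by density, the middle one by uniform continuity. Two uses of
  the triangle inequality with factor C cost C (a + C (a + a)), and a is chosen to make this
  e.\<close>

lemma Np_translation_small:
  assumes p: "0 < p" and f: "f \<in> Lc p" and e: "0 < e"
  obtains d where "0 < d" "\<And>z. norm z \<le> d \<Longrightarrow> Np p (\<lambda>x. f (x - z) - f x) \<le> ennreal e"
proof -
  have [measurable]: "f \<in> borel_measurable borel" and fin: "Np p f < \<infinity>" using f by (auto simp: Lc_def)
  obtain R where R: "\<And>x. R < norm x \<Longrightarrow> f x = 0" using f by (auto simp: Lc_def bdd_supp_def)
  define C where "C = (2::real) powr p"
  have C: "0 < C" by (simp add: C_def)
  define a where "a = e / (C * (1 + 2 * C))"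
  have "0 < C * (1 + 2 * C)" using C by (intro mult_pos_pos) auto
  then have "0 < a" "a * (C * (1 + 2 * C)) = e" using e unfolding a_def by (auto intro: divide_pos_pos)
  then have a: "0 < a" "C * (a + C * (a + a)) = e" by (simp_all add: algebra_simps)
  obtain g where g: "continuous_on UNIV g" "\<And>x. R + 1 < norm x \<Longrightarrow> g x = 0"
    and fg: "Np p (\<lambda>x. f x - g x) < ennreal a"
    using Np_dense[OF p _ R fin a(1)] by auto
  have [measurable]: "g \<in> borel_measurable borel" using g(1) by (rule borel_measurable_continuous_onI)
  \<comment> \<open>The radius is R + 2 because g vanishes beyond R + 1 and the shifts have length
    at most 1.\<close>
  define V where "V = measure lborel (cball (0::point) (R + 2))"
  have V: "emeasure lborel (cball (0::point) (R + 2)) = ennreal V" "0 \<le> V"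
    using emeasure_cball_finite[of 0 "R + 2"] by (auto simp: V_def emeasure_eq_ennreal_measure)
  define b where "b = (a / (V + 1)) powr (1 / p)"
  have b: "0 < b" "b powr p * V \<le> a"
    using a V p by (auto simp: b_def powr_powr field_simps)
  have "uniformly_continuous_on UNIV g"
    using g by (intro uniformly_continuous_bdd_supp) (auto simp: bdd_supp_def)
  then obtain d where d: "d > 0" "\<And>x y. dist y x < d \<Longrightarrow> dist (g y) (g x) < b"
    using b(1) unfolding uniformly_continuous_on_def by (metis UNIV_I)
  show ?thesis
  proof (rule that[of "min (d / 2) 1"])
    fix z :: point assume z: "norm z \<le> min (d / 2) 1"
    have "Np p (\<lambda>x. g (x - z) - g x) \<le> (\<integral>\<^sup>+x. ennreal (b powr p) * indicator (cball (0::point) (R + 2)) x \<partial>lborel)"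
      unfolding Np_def
    proof (intro nn_integral_mono)
      fix x :: point
      show "ennreal (\<bar>g (x - z) - g x\<bar> powr p) \<le> ennreal (b powr p) * indicator (cball 0 (R + 2)) x"
      proof (cases "norm x \<le> R + 2")
        case True
        have "dist (g (x - z)) (g x) < b" using z d(1) by (intro d(2)) (auto simp: dist_norm)
        then have "\<bar>g (x - z) - g x\<bar> powr p \<le> b powr p" using p by (intro powr_mono2) (auto simp: dist_real_def)
        then show ?thesis using True by (auto intro: ennreal_leI)
      next
        case False
        then have "R + 1 < norm (x - z)" using norm_triangle_ineq2[of x z] z by simp
        then show ?thesis using False g(2) by simp
      qed
    qed
    also have "\<dots> = ennreal (b powr p * V)"
      by (subst nn_integral_cmult_indicator) (simp_all add: V ennreal_mult)
    also have "\<dots> \<le> ennreal a" using b by (intro ennreal_leI)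
    finally have 1: "Np p (\<lambda>x. g (x - z) - g x) \<le> ennreal a" .
    have 2: "Np p (\<lambda>x. f (x - z) - g (x - z)) \<le> ennreal a"
      using Np_shift[of "\<lambda>x. f x - g x" p z] fg by simp
    have 3: "Np p (\<lambda>x. g x - f x) \<le> ennreal a" using fg by (subst Np_diff_commute) simp
    have "Np p (\<lambda>x. f (x - z) - f x) \<le> ennreal C * (Np p (\<lambda>x. f (x - z) - g (x - z)) + Np p (\<lambda>x. g (x - z) - f x))"
      unfolding C_def using p by (intro Np_diff_triangle) auto
    also have "\<dots> \<le> ennreal C * (Np p (\<lambda>x. f (x - z) - g (x - z)) + ennreal C * (Np p (\<lambda>x. g (x - z) - g x) + Np p (\<lambda>x. g x - f x)))"
      unfolding C_def using p by (intro mult_left_mono add_left_mono Np_diff_triangle) auto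
    also have "\<dots> \<le> ennreal C * (ennreal a + ennreal C * (ennreal a + ennreal a))"
      by (intro mult_left_mono add_mono 1 2 3) auto
    also have "\<dots> = ennreal e"
      using a C by (simp add: ennreal_mult[symmetric] ennreal_plus[symmetric] del: ennreal_plus)
    finally show "Np p (\<lambda>x. f (x - z) - f x) \<le> ennreal e" .
  qed (use d in auto)
qed

text \<open>On the bounded support \<bar>f\<bar> is at most 1 + \<bar>f\<bar>^p.\<close>

lemma Lc_integrable:
  assumes p: "1 \<le> p" and f: "f \<in> Lc p"
  shows "integrable lborel f"
proof -
  obtain R where R: "\<And>x. R < norm x \<Longrightarrow> f x = 0" using f by (auto simp: Lc_def bdd_supp_def)
  have [measurable]: "f \<in> borel_measurable borel" and fin: "Np p f < \<infinity>" using f by (auto simp: Lc_def)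
  have "integrable lborel (\<lambda>x. \<bar>f x\<bar> powr p)"
    using fin by (intro integrableI_nonneg) (auto simp: Np_def)
  moreover have "integrable lborel (indicator (cball 0 R) :: point \<Rightarrow> real)"
    using emeasure_cball_finite[of 0 R] by (intro integrable_real_indicator) auto
  ultimately have i: "integrable lborel (\<lambda>x. indicator (cball 0 R) x + \<bar>f x\<bar> powr p)"
    by (intro Bochner_Integration.integrable_add)
  show ?thesis
  proof (rule Bochner_Integration.integrable_bound[OF i])
    show "f \<in> borel_measurable lborel" by simp
    show "AE x in lborel. norm (f x) \<le> norm (indicator (cball 0 R) x + \<bar>f x\<bar> powr p)"
    proof (intro AE_I2)
      fix x
      have "\<bar>f x\<bar> \<le> 1 + \<bar>f x\<bar> powr p"
      proof (cases "\<bar>f x\<bar> \<le> 1")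
        case False
        then have "\<bar>f x\<bar> powr 1 \<le> \<bar>f x\<bar> powr p" using p by (intro powr_mono) auto
        then show ?thesis using False by simp
      qed (simp add: add_increasing2)
      then show "norm (f x) \<le> norm (indicator (cball 0 R) x + \<bar>f x\<bar> powr p)"
        using R[of x] by (cases "norm x \<le> R") auto
    qed
  qed
qed

section \<open>Convolution\<close>

text \<open>The set S need not contain the origin: convolution with a kernel carried by a ball away
  from 0 mollifies and translates in one operation.\<close>

definition mollifier :: "scalar_field \<Rightarrow> point set \<Rightarrow> bool" where
  "mollifier k S \<longleftrightarrow> smooth k \<and> (\<forall>x. 0 \<le> k x) \<and> (\<forall>x. x \<notin> S \<longrightarrow> k x = 0) \<and> (LINT x|lborel. k x) = 1"

definition conv :: "scalar_field \<Rightarrow> scalar_field \<Rightarrow> scalar_field" where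
  "conv k f x = (LINT y|lborel. k (x - y) * f y)"

lemma integrable_bdd_supp:
  assumes g: "continuous_on UNIV g" and "bdd_supp g"
  shows "integrable lborel g"
proof -
  obtain R where R: "\<And>x. R < norm x \<Longrightarrow> g x = 0" using assms by (auto simp: bdd_supp_def)
  have "integrable lborel (\<lambda>x. indicator (cball 0 R) x *\<^sub>R g x)"
    using g by (intro borel_integrable_compact) (auto intro: continuous_on_subset)
  moreover have "indicator (cball 0 R) x *\<^sub>R g x = g x" for x
    using R[of x] by (cases "norm x \<le> R") auto
  ultimately show ?thesis by (simp only:)
qed

lemma mollifier_bdd_supp: "mollifier k S \<Longrightarrow> bounded S \<Longrightarrow> bdd_supp k"
  unfolding mollifier_def bdd_supp_def bounded_iff by (metis not_le)

text \<open>A translated bump, divided by its integral. The integral is not 0 since the bump is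
  positive on a ball, which is not a null set.\<close>

lemma mollifier_exists:
  assumes r: "0 < r"
  obtains k where "mollifier k (cball z r)"
proof -
  let ?b = "\<lambda>x. bump (r / 2) (- z + x)"
  have sm: "smooth ?b" using smooth_translate[OF smooth_bump] .
  have supp: "?b x = 0" if "x \<notin> cball z r" for x :: point
    using that by (intro bump_eq_0) (auto simp: dist_norm norm_minus_commute)
  have "bdd_supp ?b"
    unfolding bdd_supp_def
  proof (intro exI[of _ "norm z + r"] allI impI supp)
    fix x :: point assume "norm z + r < norm x"
    then show "x \<notin> cball z r" using norm_triangle_ineq2[of x z] by (auto simp: dist_norm norm_minus_commute)
  qed
  then have int: "integrable lborel ?b" using sm by (intro integrable_bdd_supp smooth_continuous)
  define I where "I = (LINT x|lborel. ?b x)"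
  have "0 < I"
  proof -
    have "I \<noteq> 0"
    proof
      assume "I = 0"
      then have AE0: "AE x in lborel. ?b x = 0"
        using integral_nonneg_eq_0_iff_AE[OF int] by (simp add: I_def bump_nonneg)
      have pos: "?b x > 0" if "x \<in> ball z (r / 2)" for x
      proof (rule bump_pos)
        fix i
        show "\<bar>(- z + x) $ i\<bar> < r / 2"
          using component_le_norm_cart[of "- z + x" i] that
          by (simp add: dist_norm norm_minus_commute del: vector_add_component)
      qed
      have "AE x in lborel. x \<notin> ball z (r / 2)"
        using AE0
      proof eventually_elim
        case (elim x)
        then show ?case using pos[of x] by auto
      qed
      then have "ball z (r / 2) \<in> null_sets lborel"
        by (subst AE_iff_null_sets) auto
      then have "negligible (ball z (r / 2))"
        by (simp add: negligible_iff_null_sets null_sets_completionI)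
      then show False using open_not_negligible[of "ball z (r / 2)"] r by auto
    qed
    moreover have "0 \<le> I" unfolding I_def by (intro integral_nonneg_AE) (simp add: bump_nonneg)
    ultimately show ?thesis by simp
  qed
  moreover have "smooth (\<lambda>x. inverse I * ?b x)" by (intro smooth_mult smooth_const sm)
  ultimately have "mollifier (\<lambda>x. inverse I * ?b x) (cball z r)"
    using int supp by (auto simp: mollifier_def bump_nonneg I_def)
  then show ?thesis by (rule that)
qed

text \<open>Jensen's inequality for t^p, obtained by integrating the tangent line at the mean m
  against k. Both degenerate cases are harmless: a non-integrable product has integral 0 by
  convention, and otherwise the right-hand side is infinite.\<close>

lemma jensen_powr:
  fixes F k :: "'a \<Rightarrow> real"
  assumes p: "1 \<le> p" and [measurable]: "F \<in> borel_measurable M"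
    and k: "integrable M k" "\<And>x. 0 \<le> k x" "(LINT x|M. k x) = 1"
  shows "ennreal (\<bar>LINT x|M. F x * k x\<bar> powr p) \<le> (\<integral>\<^sup>+x. ennreal (\<bar>F x\<bar> powr p * k x) \<partial>M)"
proof (cases "integrable M (\<lambda>x. F x * k x) \<and> (\<integral>\<^sup>+x. ennreal (\<bar>F x\<bar> powr p * k x) \<partial>M) < \<infinity>")
  case True
  have [measurable]: "k \<in> borel_measurable M" using k(1) by simp
  have i: "integrable M (\<lambda>x. \<bar>F x\<bar> * k x)"
    using True integrable_abs[of M "\<lambda>x. F x * k x"] k(2) by (simp add: abs_mult)
  have ip: "integrable M (\<lambda>x. \<bar>F x\<bar> powr p * k x)"
    using True k(2) by (intro integrableI_nonneg) auto
  define m where "m = (LINT x|M. \<bar>F x\<bar> * k x)"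
  have m0: "0 \<le> m" unfolding m_def using k(2) by (intro integral_nonneg_AE) auto
  have "\<bar>LINT x|M. F x * k x\<bar> \<le> m"
    using integral_abs_bound[of M "\<lambda>x. F x * k x"] k(2) by (simp add: m_def abs_mult)
  then have "\<bar>LINT x|M. F x * k x\<bar> powr p \<le> m powr p" using p by (intro powr_mono2) auto
  also have "m powr p \<le> (LINT x|M. \<bar>F x\<bar> powr p * k x)"
  proof (cases "m = 0")
    case True
    then show ?thesis using k(2) by (auto intro!: integral_nonneg_AE)
  next
    case False
    then have m: "0 < m" using m0 by simp
    have tangent: "m powr p + p * m powr (p - 1) * (t - m) \<le> t powr p" if "0 \<le> t" for t
    proof (cases "t = 0")
      case True
      have "m powr (p - 1) * m = m powr p" using m by (simp add: powr_diff)
      then have "m powr p + p * m powr (p - 1) * (0 - m) = (1 - p) * m powr p"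
        by (simp add: algebra_simps)
      also have "\<dots> \<le> 0" using p by (intro mult_nonpos_nonneg) auto
      finally show ?thesis using True by simp
    next
      case False
      have "((\<lambda>x. x powr p) has_real_derivative p * m powr (p - 1)) (at m within {0<..})"
        using m by (auto intro!: derivative_eq_intros)
      then have "p * m powr (p - 1) * (t - m) \<le> t powr p - m powr p"
        using m False that powr_convex[OF p]
        by (intro convex_on_imp_above_tangent[of "{0<..}"]) (auto simp: interior_open)
      then show ?thesis by simp
    qed
    \<comment> \<open>The second summand integrates to 0, because m is the k-mean of \<bar>F\<bar>
      and k has integral 1.\<close>
    have "m powr p = (LINT x|M. m powr p * k x + p * m powr (p - 1) * (\<bar>F x\<bar> * k x - m * k x))"
      using k i by (simp add: m_def[symmetric])
    also have "\<dots> \<le> (LINT x|M. \<bar>F x\<bar> powr p * k x)"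
    proof (intro integral_mono)
      fix x
      show "m powr p * k x + p * m powr (p - 1) * (\<bar>F x\<bar> * k x - m * k x) \<le> \<bar>F x\<bar> powr p * k x"
        using mult_right_mono[OF tangent[of "\<bar>F x\<bar>"] k(2)[of x]] by (simp add: algebra_simps)
    qed (use k i ip in auto)
    finally show ?thesis .
  qed
  finally have "\<bar>LINT x|M. F x * k x\<bar> powr p \<le> (LINT x|M. \<bar>F x\<bar> powr p * k x)" .
  then have "ennreal (\<bar>LINT x|M. F x * k x\<bar> powr p) \<le> ennreal (LINT x|M. \<bar>F x\<bar> powr p * k x)"
    by (rule ennreal_leI)
  also have "\<dots> = (\<integral>\<^sup>+x. ennreal (\<bar>F x\<bar> powr p * k x) \<partial>M)"
    using ip k(2) by (intro nn_integral_eq_integral[symmetric]) auto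
  finally show ?thesis .
next
  case False
  then show ?thesis by (auto simp: not_integrable_integral_eq not_less top_unique)
qed

lemma integrable_mult_bounded:
  fixes f g :: scalar_field
  assumes f: "integrable lborel f" and [measurable]: "g \<in> borel_measurable borel" and B: "\<And>x. \<bar>g x\<bar> \<le> B"
  shows "integrable lborel (\<lambda>x. g x * f x)"
proof (rule Bochner_Integration.integrable_bound)
  show "integrable lborel (\<lambda>x. B * f x)" using f by simp
  have [measurable]: "f \<in> borel_measurable borel" using f by auto
  show "(\<lambda>x. g x * f x) \<in> borel_measurable lborel" by measurable
  show "AE x in lborel. norm (g x * f x) \<le> norm (B * f x)"
    using order_trans[OF B abs_ge_self] by (intro AE_I2) (auto simp: abs_mult intro!: mult_right_mono)
qed

lemma conv_integrable:
  assumes f: "integrable lborel f" and k: "continuous_on UNIV k" "bdd_supp k"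
  shows "integrable lborel (\<lambda>y. k (x - y) * f y)"
proof -
  obtain B where B: "\<And>x. \<bar>k x\<bar> \<le> B" using bounded_bdd_supp[OF k] by blast
  have [measurable]: "k \<in> borel_measurable borel" using k(1) by (rule borel_measurable_continuous_onI)
  show ?thesis using B by (intro integrable_mult_bounded[OF f]) auto
qed

text \<open>After a reflection, the error is the k-mean over z of f(x - z) - f(x). Jensen and Fubini
  bound its p-th power integral by the k-mean of the translation errors. Only the size of the
  support of k enters, not its position, so off-centre kernels are covered.\<close>

lemma Np_conv_approx:
  assumes p: "1 \<le> p" and f: "f \<in> Lc p" and e: "0 < e"
  obtains d where "0 < d" "\<And>k. mollifier k (cball 0 d) \<Longrightarrow> Np p (\<lambda>x. conv k f x - f x) \<le> ennreal e"
proof -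
  obtain d where d: "0 < d" "\<And>z. norm z \<le> d \<Longrightarrow> Np p (\<lambda>x. f (x - z) - f x) \<le> ennreal e"
    using Np_translation_small[OF _ f e] p by auto
  have [measurable]: "f \<in> borel_measurable borel" using f by (auto simp: Lc_def)
  have int: "integrable lborel f" using Lc_integrable[OF p f] .
  show ?thesis
  proof (rule that[OF d(1)])
    fix k assume k: "mollifier k (cball 0 d)"
    have k': "continuous_on UNIV k" "bdd_supp k" "\<And>x. 0 \<le> k x" "(LINT x|lborel. k x) = 1"
      using k mollifier_bdd_supp[OF k] by (auto simp: mollifier_def smooth_continuous)
    then have [measurable]: "k \<in> borel_measurable borel" and ik: "integrable lborel k"
      by (auto intro: borel_measurable_continuous_onI integrable_bdd_supp)
    have eq: "conv k f x - f x = (LINT z|lborel. (f (x - z) - f x) * k z)" for x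
    proof -
      have "conv k f x = (LINT z|lborel. k z * f (x - z))"
        unfolding conv_def using lborel_integral_reflect[of "\<lambda>z. k z * f (x - z)" x] by simp
      moreover have "integrable lborel (\<lambda>z. k z * f (x - z))"
      proof -
        have "integrable (distr lborel borel ((-) x)) (\<lambda>y. k (x - y) * f y)"
          using conv_integrable[OF int k'(1,2), of x] by (simp add: lborel_distr_reflect)
        then show ?thesis by (subst (asm) integrable_distr_eq) auto
      qed
      moreover have "(LINT z|lborel. (f (x - z) - f x) * k z) = (LINT z|lborel. k z * f (x - z) - f x * k z)"
        by (simp add: algebra_simps)
      ultimately show ?thesis
        using ik k'(4) by simp
    qed
    have "Np p (\<lambda>x. conv k f x - f x) \<le> (\<integral>\<^sup>+x. \<integral>\<^sup>+z. ennreal (\<bar>f (x - z) - f x\<bar> powr p * k z) \<partial>lborel \<partial>lborel)"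
      unfolding Np_def eq using ik k' p by (intro nn_integral_mono jensen_powr) auto
    also have "\<dots> = (\<integral>\<^sup>+z. \<integral>\<^sup>+x. ennreal (\<bar>f (x - z) - f x\<bar> powr p * k z) \<partial>lborel \<partial>lborel)"
      by (intro lborel_pair.Fubini') measurable
    also have "\<dots> = (\<integral>\<^sup>+z. ennreal (k z) * Np p (\<lambda>x. f (x - z) - f x) \<partial>lborel)"
      unfolding Np_def using k'(3)
      by (simp add: nn_integral_cmult[symmetric] ennreal_mult[symmetric] mult.commute)
    also have "\<dots> \<le> (\<integral>\<^sup>+z. ennreal (k z) * ennreal e \<partial>lborel)"
    proof (intro nn_integral_mono)
      fix z
      show "ennreal (k z) * Np p (\<lambda>x. f (x - z) - f x) \<le> ennreal (k z) * ennreal e"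
        using d(2)[of z] k by (cases "norm z \<le> d") (auto simp: mollifier_def intro: mult_left_mono)
    qed
    also have "\<dots> = ennreal e"
      using nn_integral_eq_integral[OF ik] k' by (simp add: nn_integral_multc)
    finally show "Np p (\<lambda>x. conv k f x - f x) \<le> ennreal e" .
  qed
qed

section \<open>Derivatives of convolutions\<close>

lemma bdd_supp_partial: "bdd_supp k \<Longrightarrow> bdd_supp (partial i k)"
proof -
  assume "bdd_supp k"
  then obtain R where R: "\<And>x. R < norm x \<Longrightarrow> k x = 0" by (auto simp: bdd_supp_def)
  have "partial i k x = 0" if "R < norm x" for x
  proof -
    have "open {y. R < norm y}" by (intro open_Collect_less continuous_intros)
    then have "(k has_derivative (\<lambda>_. 0)) (at x)"
      using has_derivative_transform_within_open[of "\<lambda>_. 0" "\<lambda>_. 0" x UNIV "{y. R < norm y}" k] that R by auto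
    then show ?thesis using partialI by blast
  qed
  then show ?thesis by (auto simp: bdd_supp_def)
qed

lemma smooth_has_derivative:
  assumes "smooth k"
  shows "(k has_derivative (\<lambda>h. \<Sum>i\<in>UNIV. h $ i * partial i k x)) (at x)"
proof -
  have "frechet_derivative k (at x) = (\<lambda>h. \<Sum>i\<in>UNIV. h $ i * partial i k x)"
    using frechet_derivative_eq_sum_partial smooth_differentiable[OF assms] by blast
  then show ?thesis
    using differentiable_has_derivative[OF smooth_differentiable[OF assms]] by metis
qed

text \<open>The partial derivatives are uniformly continuous. Where each of them varies by at most
  e/3, the mean value estimate applied to k(u + v) minus its linear part gives the error e
  \<bar>h\<bar>, uniformly in u.\<close>

lemma smooth_uniform_linearization:
  assumes k: "smooth k" "bdd_supp k" and e: "0 < e"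
  obtains d where "0 < d"
    "\<And>u h. norm h < d \<Longrightarrow> \<bar>k (u + h) - k u - (\<Sum>i\<in>UNIV. h $ i * partial i k u)\<bar> \<le> e * norm h"
proof -
  have "\<exists>d>0. \<forall>x y. dist y x < d \<longrightarrow> dist (partial i k y) (partial i k x) < e / 3" for i
    using uniformly_continuous_bdd_supp[OF smooth_continuous[OF smooth_partial[OF k(1)]] bdd_supp_partial[OF k(2)], of i]
      e unfolding uniformly_continuous_on_def by (metis UNIV_I divide_pos_pos zero_less_numeral)
  then obtain D where D: "\<And>i. D i > 0" "\<And>i x y. dist y x < D i \<Longrightarrow> dist (partial i k y) (partial i k x) < e / 3"
    by metis
  define d where "d = Min (range D)"
  have d: "0 < d" "\<And>i. d \<le> D i" using D(1) by (auto simp: d_def)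
  show ?thesis
  proof (rule that[OF d(1)])
    fix u h :: point assume h: "norm h < d"
    let ?\<phi> = "\<lambda>v. k (u + v) - (\<Sum>i\<in>UNIV. v $ i * partial i k u)"
    let ?D = "\<lambda>v w. (\<Sum>i\<in>UNIV. w $ i * partial i k (u + v)) - (\<Sum>i\<in>UNIV. w $ i * partial i k u)"
    have "norm (?\<phi> h - ?\<phi> 0) \<le> e * norm (h - 0)"
    proof (rule differentiable_bound[where S = "ball 0 d" and f' = ?D])
      fix v :: point assume v: "v \<in> ball 0 d"
      have "((\<lambda>v. k (u + v)) has_derivative (\<lambda>w. \<Sum>i\<in>UNIV. w $ i * partial i k (u + v))) (at v)"
        by (rule has_derivative_compose[where g = k and f = "\<lambda>v. u + v", OF _ smooth_has_derivative[OF k(1)]])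
          (auto intro!: derivative_eq_intros)
      moreover have "((\<lambda>v. \<Sum>i\<in>UNIV. v $ i * partial i k u) has_derivative
          (\<lambda>w. \<Sum>i\<in>UNIV. w $ i * partial i k u)) (at v)"
        by (intro bounded_linear_imp_has_derivative bounded_linear_sum bounded_linear_mult_const
            bounded_linear_vec_nth)
      ultimately show "(?\<phi> has_derivative ?D v) (at v within ball 0 d)"
        by (rule has_derivative_at_withinI[OF has_derivative_diff])
      show "onorm (?D v) \<le> e"
      proof (rule onorm_le)
        fix w :: point
        have "norm (?D v w) = \<bar>\<Sum>i\<in>UNIV. w $ i * (partial i k (u + v) - partial i k u)\<bar>"
          by (simp add: sum_subtractf right_diff_distrib)
        also have "\<dots> \<le> (\<Sum>i\<in>UNIV. \<bar>w $ i * (partial i k (u + v) - partial i k u)\<bar>)"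
          by (rule sum_abs)
        also have "\<dots> \<le> (\<Sum>i\<in>(UNIV :: 3 set). norm w * (e / 3))"
        proof (rule sum_mono)
          fix i :: 3
          have "\<bar>partial i k (u + v) - partial i k u\<bar> \<le> e / 3"
            using D(2)[of "u + v" u i] v d(2)[of i] by (auto simp: dist_norm)
          then show "\<bar>w $ i * (partial i k (u + v) - partial i k u)\<bar> \<le> norm w * (e / 3)"
            unfolding abs_mult by (intro mult_mono component_le_norm_cart) auto
        qed
        also have "\<dots> = e * norm w" by simp
        finally show "norm (?D v w) \<le> e * norm w" .
      qed
    qed (use h d in auto)
    then show "\<bar>k (u + h) - k u - (\<Sum>i\<in>UNIV. h $ i * partial i k u)\<bar> \<le> e * norm h"
      by (simp add: algebra_simps)
  qed
qed

text \<open>Differentiation under the integral: because the linearisation of k is uniform in the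
  base point, the remainder of the convolution is at most e/(I + 1) \<bar>h\<bar> times the integral
  I of \<bar>f\<bar>.\<close>

lemma conv_has_derivative:
  assumes f: "integrable lborel f" and k: "smooth k" "bdd_supp k"
  shows "(conv k f has_derivative (\<lambda>h. \<Sum>i\<in>UNIV. h $ i * conv (partial i k) f x)) (at x)"
  unfolding has_derivative_at_alt
proof (intro conjI allI impI)
  show "bounded_linear (\<lambda>h. \<Sum>i\<in>UNIV. h $ i * conv (partial i k) f x)"
    by (intro bounded_linear_sum bounded_linear_mult_const bounded_linear_vec_nth)
  fix e :: real assume e: "0 < e"
  define I where "I = (LINT y|lborel. \<bar>f y\<bar>)"
  have I: "0 \<le> I" unfolding I_def by (intro integral_nonneg_AE) simp
  obtain d where d: "0 < d"
    "\<And>u h. norm h < d \<Longrightarrow> \<bar>k (u + h) - k u - (\<Sum>i\<in>UNIV. h $ i * partial i k u)\<bar> \<le> e / (I + 1) * norm h"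
    by (rule smooth_uniform_linearization[OF k, of "e / (I + 1)"]) (use e I in auto)
  have int: "integrable lborel (\<lambda>y. k (z - y) * f y)" "integrable lborel (\<lambda>y. partial i k (z - y) * f y)" for z i
    using k by (auto intro!: conv_integrable f smooth_continuous smooth_partial bdd_supp_partial)
  show "\<exists>d>0. \<forall>y. norm (y - x) < d \<longrightarrow>
      norm (conv k f y - conv k f x - (\<Sum>i\<in>UNIV. (y - x) $ i * conv (partial i k) f x)) \<le> e * norm (y - x)"
  proof (intro exI[of _ d] conjI allI impI d(1))
    fix y assume y: "norm (y - x) < d"
    let ?h = "y - x"
    let ?E = "\<lambda>t. k (y - t) - k (x - t) - (\<Sum>i\<in>UNIV. ?h $ i * partial i k (x - t))"
    have E: "\<bar>?E t\<bar> \<le> e / (I + 1) * norm ?h" for t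
    proof -
      have "x - t + (y - x) = y - t" by simp
      with d(2)[OF y, of "x - t"] show ?thesis by simp
    qed
    have Eq: "?E t * f t = k (y - t) * f t - k (x - t) * f t - (\<Sum>i\<in>UNIV. ?h $ i * (partial i k (x - t) * f t))" for t
      by (simp add: left_diff_distrib sum_distrib_right mult.assoc)
    have i3: "integrable lborel (\<lambda>t. ?h $ i * (partial i k (x - t) * f t))" for i
      using int(2) by (rule integrable_mult_right)
    have i4: "integrable lborel (\<lambda>t. \<Sum>i\<in>UNIV. ?h $ i * (partial i k (x - t) * f t))"
      by (rule Bochner_Integration.integrable_sum) (rule i3)
    note i2 = Bochner_Integration.integrable_diff[OF int(1)[of y] int(1)[of x]]
    have iE: "integrable lborel (\<lambda>t. ?E t * f t)"
      unfolding Eq by (rule Bochner_Integration.integrable_diff[OF i2 i4])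
    have "(LINT t|lborel. ?E t * f t) = conv k f y - conv k f x
        - (\<Sum>i\<in>UNIV. (LINT t|lborel. ?h $ i * (partial i k (x - t) * f t)))"
      unfolding Eq conv_def Bochner_Integration.integral_diff[OF i2 i4]
        Bochner_Integration.integral_diff[OF int(1) int(1)]
      by (simp only: Bochner_Integration.integral_sum[OF i3])
    then have eq: "conv k f y - conv k f x - (\<Sum>i\<in>UNIV. ?h $ i * conv (partial i k) f x) = (LINT t|lborel. ?E t * f t)"
      by (simp only: conv_def integral_mult_right_zero)
    have "norm (LINT t|lborel. ?E t * f t) \<le> (LINT t|lborel. \<bar>?E t * f t\<bar>)"
      using integral_norm_bound[of lborel "\<lambda>t. ?E t * f t"] by (simp only: real_norm_def)
    also have "\<dots> \<le> (LINT t|lborel. e / (I + 1) * norm ?h * \<bar>f t\<bar>)"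
    proof (rule integral_mono)
      show "integrable lborel (\<lambda>t. \<bar>?E t * f t\<bar>)" using iE by (rule integrable_abs)
      show "integrable lborel (\<lambda>t. e / (I + 1) * norm ?h * \<bar>f t\<bar>)" using f by simp
      show "\<bar>?E t * f t\<bar> \<le> e / (I + 1) * norm ?h * \<bar>f t\<bar>" for t
        unfolding abs_mult by (rule mult_right_mono[OF E abs_ge_zero])
    qed
    also have "\<dots> = e * norm ?h * (I / (I + 1))" by (simp add: I_def)
    also have "\<dots> \<le> e * norm ?h * 1" using I e by (intro mult_left_mono) auto
    finally show "norm (conv k f y - conv k f x - (\<Sum>i\<in>UNIV. ?h $ i * conv (partial i k) f x)) \<le> e * norm ?h"
      unfolding eq by simp
  qed
qed

lemma partial_conv:
  assumes "integrable lborel f" "smooth k" "bdd_supp k"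
  shows "partial i (conv k f) = conv (partial i k) f"
proof
  fix x
  have "axis i 1 $ j * c = (if j = i then c else 0)" for j and c :: real
    by (simp add: axis_def)
  then show "partial i (conv k f) x = conv (partial i k) f x"
    using partialI[OF conv_has_derivative[OF assms], of i x] by simp
qed

lemma smooth_conv:
  assumes f: "integrable lborel f" and k: "smooth k" "bdd_supp k"
  shows "smooth (conv k f)"
proof -
  have "Ck n (conv k f)" for n
    using k
  proof (induction n arbitrary: k)
    case 0
    have "isCont (conv k f) x" for x
      by (rule has_derivative_continuous[OF conv_has_derivative[OF f 0]])
    then show ?case by (simp add: continuous_on_eq_continuous_within)
  next
    case (Suc n)
    have "conv k f differentiable at x" for x
      using conv_has_derivative[OF f Suc.prems] unfolding differentiable_def by blast
    moreover have "Ck n (partial i (conv k f))" for i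
      unfolding partial_conv[OF f Suc.prems]
      using Suc.prems by (intro Suc.IH smooth_partial bdd_supp_partial)
    ultimately show ?case by simp
  qed
  then show ?thesis by (simp add: smooth_def)
qed

section \<open>Hausdorff measure\<close>

definition covers2 :: "real \<Rightarrow> point set \<Rightarrow> (nat \<Rightarrow> point set) set" where
  "covers2 d A = {C. A \<subseteq> (\<Union>n. C n) \<and> (\<forall>n. bounded (C n) \<and> diameter (C n) \<le> d)}"

definition disc_area :: "point set \<Rightarrow> ennreal" where
  "disc_area C = ennreal (pi * (diameter C / 2)\<^sup>2)"

lemma hausdorff2_content_alt: "hausdorff2_content d A = (INF C\<in>covers2 d A. \<Sum>n. disc_area (C n))"
  by (simp add: hausdorff2_content_def covers2_def disc_area_def)

lemma disc_area_empty [simp]: "disc_area {} = 0"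
  by (simp add: disc_area_def)

lemma content_le: "C \<in> covers2 d A \<Longrightarrow> hausdorff2_content d A \<le> (\<Sum>n. disc_area (C n))"
  unfolding hausdorff2_content_alt by (rule INF_lower)

lemma content_greatest:
  "(\<And>C. C \<in> covers2 d A \<Longrightarrow> K \<le> (\<Sum>n. disc_area (C n))) \<Longrightarrow> K \<le> hausdorff2_content d A"
  unfolding hausdorff2_content_alt by (rule INF_greatest)

lemma content_mono: "A \<subseteq> B \<Longrightarrow> hausdorff2_content d A \<le> hausdorff2_content d B"
  by (rule content_greatest, rule content_le) (auto simp: covers2_def)

lemma content_antimono: "d \<le> d' \<Longrightarrow> hausdorff2_content d' A \<le> hausdorff2_content d A"
  by (rule content_greatest, rule content_le) (auto simp: covers2_def intro: order_trans)

lemma content_empty: "0 \<le> d \<Longrightarrow> hausdorff2_content d {} = 0"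
  using content_le[of "\<lambda>_. {}" d "{}"] by (simp add: covers2_def)

lemma content_approx:
  assumes "hausdorff2_content d A < K"
  obtains C where "C \<in> covers2 d A" "(\<Sum>n. disc_area (C n)) < K"
  using assms unfolding hausdorff2_content_alt by (auto simp: INF_less_iff)

lemma content_countably_subadditive:
  "hausdorff2_content d (\<Union>n. A n) \<le> (\<Sum>n. hausdorff2_content d (A n))"
proof (cases "(\<Sum>n. hausdorff2_content d (A n)) = \<infinity>")
  case False
  show ?thesis
  proof (rule ennreal_le_epsilon)
    fix e :: real assume e: "0 < e"
    let ?e = "\<lambda>n. e * (1 / 2) ^ Suc n"
    have "\<exists>C. C \<in> covers2 d (A n) \<and> (\<Sum>m. disc_area (C m)) \<le> hausdorff2_content d (A n) + ennreal (?e n)" for n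
    proof -
      have "hausdorff2_content d (A n) \<noteq> \<infinity>"
        using False sum_le_suminf[of "\<lambda>n. hausdorff2_content d (A n)" "{n}"]
        by (auto simp: top_unique)
      then have "hausdorff2_content d (A n) < hausdorff2_content d (A n) + ennreal (?e n)"
        using e by simp
      then show ?thesis by (rule content_approx) (blast intro: less_imp_le)
    qed
    then obtain C where C: "\<And>n. C n \<in> covers2 d (A n)"
      "\<And>n. (\<Sum>m. disc_area (C n m)) \<le> hausdorff2_content d (A n) + ennreal (?e n)"
      by metis
    let ?D = "\<lambda>i. case_prod C (prod_decode i)"
    have "?D \<in> covers2 d (\<Union>n. A n)"
    proof -
      have "x \<in> (\<Union>i. ?D i)" if x: "x \<in> A n" for x n
      proof -
        have "A n \<subseteq> (\<Union>m. C n m)" using C(1)[of n] by (simp add: covers2_def)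
        then obtain m where "x \<in> C n m" using x by blast
        then show ?thesis by (intro UN_I[of "prod_encode (n, m)"]) auto
      qed
      then show ?thesis using C(1) by (auto simp: covers2_def split: prod.split)
    qed
    then have "hausdorff2_content d (\<Union>n. A n) \<le> (\<Sum>i. disc_area (?D i))" by (rule content_le)
    also have "(\<Sum>i. disc_area (?D i)) = (\<Sum>n. \<Sum>m. disc_area (C n m))"
      by (rule suminf_ennreal_2dimen[where f = "\<lambda>p. disc_area (case_prod C p)"]) simp
    also have "\<dots> \<le> (\<Sum>n. hausdorff2_content d (A n) + ennreal (?e n))"
      by (intro suminf_le C(2)) auto
    also have "\<dots> = (\<Sum>n. hausdorff2_content d (A n)) + (\<Sum>n. ennreal (?e n))"
      by (rule suminf_add[symmetric]) auto
    also have "(\<Sum>n. ennreal (?e n)) = ennreal e"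
      using e sums_mult[OF power_half_series, of e] by (intro suminf_ennreal_eq) auto
    finally show "hausdorff2_content d (\<Union>n. A n) \<le> (\<Sum>n. hausdorff2_content d (A n)) + ennreal e" .
  qed
qed simp

section \<open>The outer measure, its metric property and its values on Borel sets\<close>

lemma outer_ge_content: "0 < d \<Longrightarrow> hausdorff2_content d A \<le> hausdorff2_outer A"
  unfolding hausdorff2_outer_def by (rule SUP_upper) simp

lemma outer_least: "(\<And>d. 0 < d \<Longrightarrow> hausdorff2_content d A \<le> K) \<Longrightarrow> hausdorff2_outer A \<le> K"
  unfolding hausdorff2_outer_def by (rule SUP_least) simp

lemma outer_mono: "A \<subseteq> B \<Longrightarrow> hausdorff2_outer A \<le> hausdorff2_outer B"
  by (meson content_mono outer_ge_content outer_least order_trans)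

lemma outer_empty: "hausdorff2_outer {} = 0"
  using outer_least[of "{}" 0] content_empty by simp

lemma outer_countably_subadditive: "hausdorff2_outer (\<Union>n. A n) \<le> (\<Sum>n. hausdorff2_outer (A n))"
proof (rule outer_least)
  fix d :: real assume "0 < d"
  then have "(\<Sum>n. hausdorff2_content d (A n)) \<le> (\<Sum>n. hausdorff2_outer (A n))"
    by (intro suminf_le outer_ge_content) auto
  with content_countably_subadditive show "hausdorff2_content d (\<Union>n. A n) \<le> (\<Sum>n. hausdorff2_outer (A n))"
    by (rule order_trans)
qed

lemma outer_Un: "hausdorff2_outer (A \<union> B) \<le> hausdorff2_outer A + hausdorff2_outer B"
proof -
  have "hausdorff2_outer (\<Union>n. binaryset A B n) \<le> (\<Sum>n. hausdorff2_outer (binaryset A B n))"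
    by (rule outer_countably_subadditive)
  then show ?thesis
    using suminf_binaryset_eq[of hausdorff2_outer A B] by (simp add: UN_binaryset_eq outer_empty)
qed

text \<open>A covering set of diameter less than r meets at most one of A and B, so every fine cover
  of the union splits into a cover of A and a cover of B without repetition.\<close>

lemma outer_metric:
  assumes r: "0 < r" and sep: "\<And>a b. a \<in> A \<Longrightarrow> b \<in> B \<Longrightarrow> r \<le> dist a b"
  shows "hausdorff2_outer A + hausdorff2_outer B \<le> hausdorff2_outer (A \<union> B)"
proof -
  have *: "hausdorff2_content d A + hausdorff2_content d B \<le> hausdorff2_outer (A \<union> B)" if d: "0 < d" "d < r" for d
  proof -
    have "hausdorff2_content d A + hausdorff2_content d B \<le> hausdorff2_content d (A \<union> B)"
    proof (rule content_greatest)
      fix C assume C: "C \<in> covers2 d (A \<union> B)"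
      let ?CA = "\<lambda>n. if C n \<inter> A = {} then {} else C n"
      let ?CB = "\<lambda>n. if C n \<inter> B = {} then {} else C n"
      have "?CA \<in> covers2 d A" "?CB \<in> covers2 d B"
        using C d by (fastforce simp: covers2_def split: if_splits)+
      then have "hausdorff2_content d A + hausdorff2_content d B
          \<le> (\<Sum>n. disc_area (?CA n)) + (\<Sum>n. disc_area (?CB n))"
        by (intro add_mono content_le)
      also have "\<dots> = (\<Sum>n. disc_area (?CA n) + disc_area (?CB n))"
        by (rule suminf_add) auto
      also have "\<dots> \<le> (\<Sum>n. disc_area (C n))"
      proof (intro suminf_le)
        fix n
        have "C n \<inter> A = {} \<or> C n \<inter> B = {}"
        proof (rule ccontr)
          assume "\<not> ?thesis"
          then obtain a b where ab: "a \<in> C n" "a \<in> A" "b \<in> C n" "b \<in> B" by blast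
          have "dist a b \<le> d"
            using C diameter_bounded_bound[of "C n" a b] ab by (auto simp: covers2_def intro: order_trans)
          then show False using sep[of a b] ab d by simp
        qed
        then show "disc_area (?CA n) + disc_area (?CB n) \<le> disc_area (C n)" by auto
      qed auto
      finally show "hausdorff2_content d A + hausdorff2_content d B \<le> (\<Sum>n. disc_area (C n))" .
    qed
    with outer_ge_content[OF d(1)] show ?thesis by (rule order_trans[rotated])
  qed
  \<comment> \<open>The scales d and d' are independent here because the suprema over them are taken
    one after the other; shrinking both to a common scale only increases the contents.\<close>
  have le: "hausdorff2_content d A + hausdorff2_content d' B \<le> hausdorff2_outer (A \<union> B)" if "0 < d" "0 < d'" for d d'
  proof -
    define e where "e = min (min d d') (r / 2)"
    have "hausdorff2_content d A + hausdorff2_content d' B \<le> hausdorff2_content e A + hausdorff2_content e B"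
      by (intro add_mono content_antimono) (auto simp: e_def)
    with *[of e] that r show ?thesis by (auto simp: e_def intro: order_trans)
  qed
  have "hausdorff2_outer A + hausdorff2_content d' B \<le> hausdorff2_outer (A \<union> B)" if "0 < d'" for d'
  proof -
    have "hausdorff2_outer A + hausdorff2_content d' B = (SUP d\<in>{0<..}. hausdorff2_content d A + hausdorff2_content d' B)"
      unfolding hausdorff2_outer_def[of A] by (rule ennreal_SUP_add_left[symmetric]) auto
    also have "\<dots> \<le> hausdorff2_outer (A \<union> B)"
      using le that by (intro SUP_least) auto
    finally show ?thesis .
  qed
  then have "(SUP d'\<in>{0<..}. hausdorff2_outer A + hausdorff2_content d' B) \<le> hausdorff2_outer (A \<union> B)"
    by (intro SUP_least) auto
  then show ?thesis
    unfolding hausdorff2_outer_def[of B] by (subst ennreal_SUP_add_right) auto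
qed

lemma outer_metric_infdist:
  assumes "F \<noteq> {}" "b < a"
    and A: "\<And>x. x \<in> A \<Longrightarrow> a \<le> infdist x F" and B: "\<And>x. x \<in> B \<Longrightarrow> infdist x F \<le> b"
  shows "hausdorff2_outer A + hausdorff2_outer B \<le> hausdorff2_outer (A \<union> B)"
proof (rule outer_metric)
  show "0 < a - b" using assms by simp
  fix x y assume "x \<in> A" "y \<in> B"
  then show "a - b \<le> dist x y"
    using A[of x] B[of y] infdist_triangle[of x F y] by simp
qed

text \<open>The even-indexed rings are pairwise a positive distance apart, and so are the odd-indexed ones.\<close>

lemma outer_rings_summable:
  assumes F: "F \<noteq> {}" and fin: "hausdorff2_outer X < \<infinity>"
    and R: "\<And>n x. x \<in> R n \<Longrightarrow> x \<in> X \<and> 1 / real (n + 2) \<le> infdist x F \<and> infdist x F < 1 / real (n + 1)"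
  shows "(\<Sum>n. hausdorff2_outer (R n)) < \<infinity>"
proof -
  let ?h = hausdorff2_outer
  have part: "(\<Sum>k<n. ?h (R (2 * k + c))) \<le> ?h X" for n c :: nat
  proof -
    have "(\<Sum>k<n. ?h (R (2 * k + c))) \<le> ?h (\<Union>k<n. R (2 * k + c))"
    proof (induction n)
      case (Suc n)
      have "(\<Sum>k<Suc n. ?h (R (2 * k + c))) \<le> ?h (\<Union>k<n. R (2 * k + c)) + ?h (R (2 * n + c))"
        using Suc by (auto intro: add_right_mono)
      also have "\<dots> \<le> ?h ((\<Union>k<n. R (2 * k + c)) \<union> R (2 * n + c))"
      proof (rule outer_metric_infdist[OF F])
        \<comment> \<open>The earlier rings of the same parity stay at distance at least 1/(2n + c)
          from F. The 1/2 leaves a gap to ring 2n + c and avoids a division by 0 when n = c =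
          0.\<close>
        show "1 / (real (2 * n + c) + 1) < 1 / (real (2 * n + c) + 1 / 2)"
          by (intro divide_strict_left_mono) (auto intro!: mult_pos_pos add_nonneg_pos)
        fix x assume "x \<in> (\<Union>k<n. R (2 * k + c))"
        then obtain k where k: "k < n" "x \<in> R (2 * k + c)" by auto
        have "1 / (real (2 * n + c) + 1 / 2) \<le> 1 / real (2 * k + c + 2)"
          using k by (intro divide_left_mono) (auto intro!: mult_pos_pos add_nonneg_pos)
        then show "1 / (real (2 * n + c) + 1 / 2) \<le> infdist x F" using R[OF k(2)] by simp
      next
        show "infdist x F \<le> 1 / (real (2 * n + c) + 1)" if "x \<in> R (2 * n + c)" for x
          using R[OF that] by (simp add: ac_simps)
      qed
      also have "(\<Union>k<n. R (2 * k + c)) \<union> R (2 * n + c) = (\<Union>k<Suc n. R (2 * k + c))"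
        by (auto simp: less_Suc_eq)
      finally show ?case .
    qed (simp add: outer_empty)
    also have "\<dots> \<le> ?h X" using R by (intro outer_mono) auto
    finally show ?thesis .
  qed
  have "(\<Sum>k<n. ?h (R k)) \<le> ?h X + ?h X" for n
  proof -
    have "(\<Sum>k<n. ?h (R k)) \<le> (\<Sum>k<2 * n. ?h (R k))" by (intro sum_mono2) auto
    also have "\<dots> = (\<Sum>k<n. ?h (R (2 * k + 0))) + (\<Sum>k<n. ?h (R (2 * k + 1)))"
      by (induction n) (auto simp: algebra_simps)
    also have "\<dots> \<le> ?h X + ?h X" by (intro add_mono part)
    finally show ?thesis .
  qed
  then have "(\<Sum>n. ?h (R n)) \<le> ?h X + ?h X" by (rule suminf_le_const[OF summableI])
  also have "\<dots> < \<infinity>" using fin by simp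
  finally show ?thesis .
qed

text \<open>The points of X at distance at least 1/(n+1) from F are separated from F, so the metric
  property applies to them. The remaining points of X - F lie in the rings from index n on, and
  these tails of a convergent series tend to 0.\<close>

lemma outer_caratheodory_closed:
  assumes cl: "closed F"
  shows "hausdorff2_outer (F \<inter> X) + hausdorff2_outer (X - F) \<le> hausdorff2_outer X"
proof (cases "F = {} \<or> hausdorff2_outer X = \<infinity>")
  case True
  then show ?thesis by (auto simp: outer_empty)
next
  case False
  let ?h = hausdorff2_outer
  from False have F: "F \<noteq> {}" and fin: "?h X < \<infinity>" by (auto simp: less_top)
  define E where "E n = {x \<in> X. 1 / real (n + 1) \<le> infdist x F}" for n :: nat
  define R where "R n = {x \<in> X. 1 / real (n + 2) \<le> infdist x F \<and> infdist x F < 1 / real (n + 1)}" for n :: nat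
  have "(\<Sum>n. ?h (R n)) < \<infinity>"
    by (rule outer_rings_summable[OF F fin]) (auto simp: R_def)
  then have sfin: "(\<Sum>n. ?h (R n)) \<noteq> top" by simp
  then have tfin: "?h (R n) \<noteq> top" for n
    using sum_le_suminf[of "\<lambda>n. ?h (R n)" "{n}"] by (auto simp: top_unique)
  define r where "r n = enn2real (?h (R n))" for n
  have r: "?h (R n) = ennreal (r n)" "0 \<le> r n" for n
    using tfin[of n] by (auto simp: r_def less_top)
  have sr: "summable r"
    using sfin r by (intro summable_suminf_not_top) auto
  have "X - F \<subseteq> E n \<union> (\<Union>k. R (k + n))" for n
  proof
    fix x assume x: "x \<in> X - F"
    then have pos: "0 < infdist x F"
      using cl F in_closed_iff_infdist_zero[OF cl F, of x] infdist_nonneg[of x F] by auto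
    show "x \<in> E n \<union> (\<Union>k. R (k + n))"
    proof (cases "x \<in> E n")
      case False
      \<comment> \<open>The first threshold that x reaches. As x is not in \<open>E n\<close>, it
        exceeds n, and minimality places x in ring m - 1.\<close>
      define m where "m = (LEAST m. 1 / real (m + 1) \<le> infdist x F)"
      obtain m0 where "inverse (real (Suc m0)) < infdist x F" using reals_Archimedean[OF pos] by blast
      then have "1 / real (m0 + 1) \<le> infdist x F" by (simp add: inverse_eq_divide)
      then have m: "1 / real (m + 1) \<le> infdist x F" unfolding m_def by (rule LeastI)
      have "n < m"
      proof (rule ccontr)
        assume "\<not> n < m"
        then have "1 / real (n + 1) \<le> 1 / real (m + 1)" by (intro divide_left_mono) auto
        then show False using m False x by (auto simp: E_def)
      qed
      then obtain k where k: "m = Suc (k + n)" by (metis add.commute less_imp_Suc_add)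
      have "\<not> 1 / real (k + n + 1) \<le> infdist x F"
        by (rule not_less_Least[where P = "\<lambda>m. 1 / real (m + 1) \<le> infdist x F", folded m_def])
          (simp add: k)
      then have "x \<in> R (k + n)" using m x k by (auto simp: R_def add.commute)
      then show ?thesis by blast
    qed simp
  qed
  then have le: "?h (F \<inter> X) + ?h (X - F) \<le> ?h X + ennreal (\<Sum>k. r (k + n))" for n
  proof -
    have "?h (X - F) \<le> ?h (E n) + ?h (\<Union>k. R (k + n))"
      using \<open>X - F \<subseteq> E n \<union> _\<close> by (meson outer_Un outer_mono order_trans)
    also have "?h (\<Union>k. R (k + n)) \<le> (\<Sum>k. ?h (R (k + n)))" by (rule outer_countably_subadditive)
    also have "(\<Sum>k. ?h (R (k + n))) = ennreal (\<Sum>k. r (k + n))"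
      using r sr by (simp add: suminf_ennreal2 summable_iff_shift)
    finally have 1: "?h (X - F) \<le> ?h (E n) + ennreal (\<Sum>k. r (k + n))" by simp
    have "?h (E n) + ?h (F \<inter> X) \<le> ?h (E n \<union> (F \<inter> X))"
      by (rule outer_metric_infdist[OF F, of 0 "1 / real (n + 1)"]) (auto simp: E_def)
    also have "\<dots> \<le> ?h X" by (intro outer_mono) (auto simp: E_def)
    finally have 2: "?h (E n) + ?h (F \<inter> X) \<le> ?h X" .
    have "?h (F \<inter> X) + ?h (X - F) \<le> ?h (F \<inter> X) + (?h (E n) + ennreal (\<Sum>k. r (k + n)))"
      using 1 by (rule add_left_mono)
    also have "\<dots> = (?h (E n) + ?h (F \<inter> X)) + ennreal (\<Sum>k. r (k + n))" by (simp add: ac_simps)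
    also have "\<dots> \<le> ?h X + ennreal (\<Sum>k. r (k + n))" using 2 by (rule add_right_mono)
    finally show ?thesis .
  qed
  show ?thesis
  proof (rule ennreal_le_epsilon)
    fix e :: real assume e: "0 < e"
    obtain N where "\<forall>n\<ge>N. norm (\<Sum>k. r (k + n)) < e" using suminf_exist_split[OF e sr] by blast
    then have "(\<Sum>k. r (k + N)) \<le> e" by force
    then show "?h (F \<inter> X) + ?h (X - F) \<le> ?h X + ennreal e"
      using le[of N] by (meson add_left_mono ennreal_leI order_trans)
  qed
qed

text \<open>\<open>measure_of\<close> yields the zero measure unless its function is countably
  additive on the generated algebra. This lemma therefore is what gives the surface measure its
  content: closed sets satisfy Caratheodory's criterion and generate the Borel sets.\<close>

lemma emeasure_hausdorff2:
  assumes "A \<in> sets borel"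
  shows "emeasure hausdorff2 A = hausdorff2_outer A"
proof -
  let ?L = "lambda_system UNIV UNIV hausdorff2_outer"
  interpret P: sigma_algebra UNIV "UNIV :: point set set"
    using sigma_algebra_Pow[of UNIV] by simp
  have "outer_measure_space UNIV hausdorff2_outer"
    unfolding outer_measure_space_def positive_def increasing_def countably_subadditive_def
    using outer_empty outer_mono outer_countably_subadditive by auto
  then have ms: "measure_space UNIV ?L hausdorff2_outer" by (rule P.caratheodory_lemma)
  then interpret L: sigma_algebra UNIV ?L by (simp add: measure_space_def)
  have "F \<in> ?L" if "closed F" for F
  proof -
    have "hausdorff2_outer (F \<inter> X) + hausdorff2_outer ((UNIV - F) \<inter> X) = hausdorff2_outer X" for X
    proof (rule antisym)
      have eq: "(UNIV - F) \<inter> X = X - F" by auto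
      show "hausdorff2_outer (F \<inter> X) + hausdorff2_outer ((UNIV - F) \<inter> X) \<le> hausdorff2_outer X"
        unfolding eq by (rule outer_caratheodory_closed[OF that])
      have "hausdorff2_outer ((F \<inter> X) \<union> ((UNIV - F) \<inter> X)) \<le> hausdorff2_outer (F \<inter> X) + hausdorff2_outer ((UNIV - F) \<inter> X)"
        by (rule outer_Un)
      moreover have "(F \<inter> X) \<union> ((UNIV - F) \<inter> X) = X" by auto
      ultimately show "hausdorff2_outer X \<le> hausdorff2_outer (F \<inter> X) + hausdorff2_outer ((UNIV - F) \<inter> X)"
        by simp
    qed
    then show ?thesis by (simp add: lambda_system_def)
  qed
  then have "sigma_sets UNIV (Collect closed) \<subseteq> ?L"
    by (intro L.sigma_sets_subset) auto
  then have sub: "sets borel \<subseteq> ?L"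
    by (simp add: borel_eq_closed)
  have "measure_space UNIV (sets borel) hausdorff2_outer"
    by (rule measure_down[OF ms _ sub]) (metis sets.sigma_algebra_axioms space_borel)
  then have "positive (sets hausdorff2) hausdorff2_outer" "countably_additive (sets hausdorff2) hausdorff2_outer"
    by (auto simp: measure_space_def hausdorff2_def sets.sigma_sets_eq[of borel, simplified])
  then show ?thesis
    using assms by (intro emeasure_measure_of[OF hausdorff2_def]) (auto simp: hausdorff2_def)
qed

lemma sets_hausdorff2 [simp, measurable_cong]: "sets hausdorff2 = sets borel"
  unfolding hausdorff2_def using sets.sigma_sets_eq[of "borel :: point measure"] by simp

lemma space_hausdorff2 [simp]: "space hausdorff2 = UNIV"
  by (simp add: hausdorff2_def)

text \<open>Cut the parameter square into cells of side s = 2R/N. Their images have diameter at most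
  2 s M, and at most 4 \<open>N\<^sup>2\<close> discs of area pi (s M)^2 give a total that depends
  neither on N nor on the scale.\<close>

lemma outer_lipschitz_square:
  fixes F :: "real \<times> real \<Rightarrow> point"
  assumes M: "M-lipschitz_on UNIV F" and R: "0 < R" and A: "A \<subseteq> F ` ({-R..R} \<times> {-R..R})"
  shows "hausdorff2_outer A < \<infinity>"
proof -
  have M0: "0 \<le> M" using M by (rule lipschitz_on_nonneg)
  have "hausdorff2_outer A \<le> ennreal (16 * pi * R\<^sup>2 * M\<^sup>2)"
  proof (rule outer_least)
    fix d :: real assume d: "0 < d"
    \<comment> \<open>This makes the diameter bound 2 s M = 4 R M / N at most d.\<close>
    obtain N :: nat where N: "4 * R * M / d < real N" using reals_Archimedean2 by blast
    have N0: "0 < real N" using N d R M0 by (smt (verit) divide_nonneg_pos mult_nonneg_nonneg)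
    define s where "s = 2 * R / real N"
    have s: "0 < s" "2 * s * M \<le> d" using R N0 N d by (auto simp: s_def field_simps)
    define Q where "Q i = {s * real i - R .. s * real (Suc i) - R}" for i
    \<comment> \<open>N + 1 cells per side, since the right end point of [-R, R] falls into the cell
      with index N. The cell (i, j) has the number i (N + 1) + j.\<close>
    define C where "C n = (if n < (N + 1)\<^sup>2 then F ` (Q (n div (N + 1)) \<times> Q (n mod (N + 1))) else {})" for n
    have diam: "bounded (C n) \<and> diameter (C n) \<le> 2 * s * M" for n
    proof -
      have "dist (F u) (F v) \<le> 2 * s * M" if "u \<in> Q i \<times> Q j" "v \<in> Q i \<times> Q j" for u v i j
      proof -
        have "\<bar>fst u - fst v\<bar> \<le> s" "\<bar>snd u - snd v\<bar> \<le> s"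
          using that by (auto simp: Q_def algebra_simps)
        then have "dist u v \<le> 2 * s"
          using norm_Pair_le[of "fst u - fst v" "snd u - snd v"] by (cases u; cases v) (auto simp: dist_norm)
        have "dist (F u) (F v) \<le> M * dist u v" using M by (rule lipschitz_onD) auto
        also have "\<dots> \<le> M * (2 * s)" using \<open>dist u v \<le> 2 * s\<close> M0 by (rule mult_left_mono)
        finally show ?thesis by (simp add: mult_ac)
      qed
      then have d: "dist x y \<le> 2 * s * M" if "x \<in> C n" "y \<in> C n" for x y
        using that by (auto simp: C_def split: if_splits)
      then have "diameter (C n) \<le> 2 * s * M"
        using s M0 by (intro diameter_le) (auto simp: dist_norm)
      moreover have "bounded (C n)"
        using d by (cases "C n = {}") (auto simp: bounded_def, metis)
      ultimately show ?thesis by simp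
    qed
    have "C \<in> covers2 d A"
      unfolding covers2_def
    proof (intro CollectI conjI allI)
      show "A \<subseteq> (\<Union>n. C n)"
      proof
        fix x assume "x \<in> A"
        then obtain a b where ab: "x = F (a, b)" "\<bar>a\<bar> \<le> R" "\<bar>b\<bar> \<le> R" using A by fastforce
        have idx: "\<exists>i<N + 1. c \<in> Q i" if "\<bar>c\<bar> \<le> R" for c
        proof (intro exI[of _ "nat \<lfloor>(c + R) / s\<rfloor>"] conjI)
          have nn: "0 \<le> (c + R) / s" using that s by simp
          have "(c + R) / s \<le> 2 * R / s" using that s by (intro divide_right_mono) auto
          also have "\<dots> = real N" using R N0 by (simp add: s_def)
          finally show "nat \<lfloor>(c + R) / s\<rfloor> < N + 1" using nn by linarith
          have "real (nat \<lfloor>(c + R) / s\<rfloor>) \<le> (c + R) / s" "(c + R) / s \<le> real (Suc (nat \<lfloor>(c + R) / s\<rfloor>))"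
            using nn by linarith+
          then show "c \<in> Q (nat \<lfloor>(c + R) / s\<rfloor>)"
            using s by (auto simp: Q_def field_simps)
        qed
        obtain i j where ij: "i < N + 1" "a \<in> Q i" "j < N + 1" "b \<in> Q j" using idx ab by blast
        define n where "n = i * (N + 1) + j"
        have dm: "(a * m + b) div m = a \<and> (a * m + b) mod m = b" if "b < m" for a b m :: nat
          using that by auto
        have "n div (N + 1) = i" "n mod (N + 1) = j"
          using dm[OF ij(3), of i] by (simp_all only: n_def)
        moreover have "n < (N + 1)\<^sup>2"
        proof -
          have "n < i * (N + 1) + (N + 1)" using ij by (simp add: n_def)
          also have "\<dots> = (i + 1) * (N + 1)" by simp
          also have "\<dots> \<le> (N + 1) * (N + 1)" using ij by (intro mult_right_mono) auto
          finally show ?thesis by (simp only: power2_eq_square)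
        qed
        ultimately have "x \<in> C n" using ab ij by (auto simp: C_def)
        then show "x \<in> (\<Union>n. C n)" by blast
      qed
    qed (use diam s in \<open>auto intro: order_trans\<close>)
    then have "hausdorff2_content d A \<le> (\<Sum>n. disc_area (C n))" by (rule content_le)
    also have "\<dots> = (\<Sum>n<(N + 1)\<^sup>2. disc_area (C n))"
      by (rule suminf_finite) (auto simp: C_def)
    also have "\<dots> \<le> (\<Sum>n<(N + 1)\<^sup>2. ennreal (pi * (s * M)\<^sup>2))"
    proof (rule sum_mono)
      fix n
      have "diameter (C n) / 2 \<le> s * M" "0 \<le> diameter (C n)"
        using diam[of n] diameter_ge_0 by auto
      then show "disc_area (C n) \<le> ennreal (pi * (s * M)\<^sup>2)"
        unfolding disc_area_def by (intro ennreal_leI mult_left_mono power_mono) auto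
    qed
    also have "\<dots> = ennreal (real ((N + 1)\<^sup>2) * (pi * (s * M)\<^sup>2))"
      by (simp add: ennreal_mult ennreal_of_nat_eq_real_of_nat)
    also have "\<dots> \<le> ennreal (16 * pi * R\<^sup>2 * M\<^sup>2)"
    proof (rule ennreal_leI)
      have "real ((N + 1)\<^sup>2) \<le> (2 * real N)\<^sup>2"
        using N0 by (simp only: of_nat_power) (intro power_mono, auto)
      then have "real ((N + 1)\<^sup>2) * (pi * (s * M)\<^sup>2) \<le> (2 * real N)\<^sup>2 * (pi * (s * M)\<^sup>2)"
        by (rule mult_right_mono) simp
      also have "\<dots> = 16 * pi * R\<^sup>2 * M\<^sup>2"
        using N0 by (simp add: s_def power2_eq_square)
      finally show "real ((N + 1)\<^sup>2) * (pi * (s * M)\<^sup>2) \<le> 16 * pi * R\<^sup>2 * M\<^sup>2" .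
    qed
    finally show "hausdorff2_content d A \<le> ennreal (16 * pi * R\<^sup>2 * M\<^sup>2)" .
  qed
  then show ?thesis by (simp add: order_le_less_trans)
qed

text \<open>The part of U strictly above the graph is open and misses D, hence misses its closure. A
  frontier point is in addition outside the open set D, hence not strictly below the graph.\<close>

lemma frontier_below_graph:
  fixes T :: "point \<Rightarrow> point"
  assumes D: "open D" and U: "open U" "x \<in> U" and T: "orthogonal_transformation T"
    and \<psi>: "continuous_on UNIV \<psi>"
    and DU: "D \<inter> U = {y \<in> U. T y $ 3 < \<psi> (T y $ 1, T y $ 2)}"
  shows "x \<in> closure D \<Longrightarrow> T x $ 3 \<le> \<psi> (T x $ 1, T x $ 2)"
    and "x \<in> frontier D \<Longrightarrow> T x $ 3 = \<psi> (T x $ 1, T x $ 2)"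
proof -
  have lin: "bounded_linear T"
    using orthogonal_transformation_linear[OF T] by (simp add: linear_conv_bounded_linear)
  have Tc: "continuous_on UNIV (\<lambda>y. T y)"
    using lin by (rule linear_continuous_on)
  have g: "continuous_on UNIV (\<lambda>y. \<psi> (T y $ 1, T y $ 2))"
    by (intro continuous_on_compose2[OF \<psi>] continuous_intros continuous_on_compose2[OF Tc]) auto
  have T3: "continuous_on UNIV (\<lambda>y. T y $ 3)"
    by (intro continuous_intros Tc)
  show le: "T x $ 3 \<le> \<psi> (T x $ 1, T x $ 2)" if x: "x \<in> closure D"
  proof (rule ccontr)
    assume "\<not> ?thesis"
    then have "x \<in> U \<inter> {y. \<psi> (T y $ 1, T y $ 2) < T y $ 3}" using U by auto
    moreover have "open (U \<inter> {y. \<psi> (T y $ 1, T y $ 2) < T y $ 3})"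
      by (intro open_Int U open_Collect_less g T3)
    ultimately obtain y where y: "y \<in> D \<inter> U" "\<psi> (T y $ 1, T y $ 2) < T y $ 3"
      using x unfolding closure_iff_nhds_not_empty by blast
    show False using y(1) y(2) unfolding DU by simp
  qed
  show "T x $ 3 = \<psi> (T x $ 1, T x $ 2)" if x: "x \<in> frontier D"
  proof (rule antisym)
    show "T x $ 3 \<le> \<psi> (T x $ 1, T x $ 2)" using x le by (auto simp: frontier_def)
    have "x \<notin> D" using x D by (auto simp: frontier_def interior_open)
    then have "x \<notin> D \<inter> U" by simp
    then show "\<psi> (T x $ 1, T x $ 2) \<le> T x $ 3" unfolding DU using U(2) by simp
  qed
qed

lemma outer_frontier_local:
  assumes D: "open D" and sl: "strongly_lipschitz D" and x: "x \<in> frontier D"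
  obtains r where "0 < r" "hausdorff2_outer (frontier D \<inter> ball x r) < \<infinity>"
proof -
  obtain U T \<psi> L where "open U \<and> x \<in> U \<and> orthogonal_transformation (T :: point \<Rightarrow> point) \<and>
      L-lipschitz_on UNIV (\<psi> :: real \<times> real \<Rightarrow> real) \<and>
      D \<inter> U = {y \<in> U. T y $ 3 < \<psi> (T y $ 1, T y $ 2)}"
    using bspec[OF sl[unfolded strongly_lipschitz_def] x] by (elim exE)
  then have U: "open U" "x \<in> U" and T: "orthogonal_transformation T"
    and \<psi>: "L-lipschitz_on UNIV \<psi>"
    and DU: "D \<inter> U = {y \<in> U. T y $ 3 < \<psi> (T y $ 1, T y $ 2)}"
    by simp_all
  obtain r where r: "0 < r" "ball x r \<subseteq> U" using U open_contains_ball by blast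
  define R where "R = norm x + r"
  have bij: "bij T" using T by (rule orthogonal_transformation_bij)
  have Ti: "orthogonal_transformation (inv T)" using T by (rule orthogonal_transformation_inv)
  \<comment> \<open>The graph in the original coordinates. It has Lipschitz constant 2 + L, one unit
    for each parameter and L for the height, because T is an isometry.\<close>
  define F where "F p = inv T (vector [fst p, snd p, \<psi> p])" for p
  have L0: "0 \<le> L" using \<psi> by (rule lipschitz_on_nonneg)
  have "(2 + L)-lipschitz_on UNIV F"
  proof (rule lipschitz_onI)
    fix p q :: "real \<times> real"
    let ?v = "vector [fst p, snd p, \<psi> p] - vector [fst q, snd q, \<psi> q] :: point"
    have "dist (F p) (F q) = norm (inv T ?v)"
      using orthogonal_transformation_linear[OF Ti] by (simp add: F_def dist_norm linear_diff)
    also have "\<dots> = norm ?v" using Ti by (rule orthogonal_transformation_norm)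
    also have "\<dots> \<le> (\<Sum>i\<in>UNIV. \<bar>?v $ i\<bar>)" by (rule norm_le_l1_cart)
    also have "\<dots> = \<bar>fst p - fst q\<bar> + \<bar>snd p - snd q\<bar> + \<bar>\<psi> p - \<psi> q\<bar>"
      by (simp add: sum_3)
    also have "\<dots> \<le> dist p q + dist p q + L * dist p q"
    proof (intro add_mono)
      show "\<bar>fst p - fst q\<bar> \<le> dist p q" using dist_fst_le[of p q] by (simp add: dist_real_def)
      show "\<bar>snd p - snd q\<bar> \<le> dist p q" using dist_snd_le[of p q] by (simp add: dist_real_def)
      show "\<bar>\<psi> p - \<psi> q\<bar> \<le> L * dist p q" using lipschitz_onD[OF \<psi>, of p q] by (simp add: dist_real_def)
    qed
    finally show "dist (F p) (F q) \<le> (2 + L) * dist p q" by (simp add: algebra_simps)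
  qed (use L0 in simp)
  moreover have "frontier D \<inter> ball x r \<subseteq> F ` ({-R..R} \<times> {-R..R})"
  proof
    fix y assume y: "y \<in> frontier D \<inter> ball x r"
    then have "y \<in> U" using r by auto
    have c: "continuous_on UNIV \<psi>" using \<psi> by (rule lipschitz_on_continuous_on)
    have "T y $ 3 = \<psi> (T y $ 1, T y $ 2)"
      using frontier_below_graph(2)[OF D U(1) \<open>y \<in> U\<close> T c DU] y by simp
    then have "vector [T y $ 1, T y $ 2, \<psi> (T y $ 1, T y $ 2)] = T y"
      by (simp add: vec_eq_iff forall_3)
    then have Fy: "y = F (T y $ 1, T y $ 2)" using bij by (simp add: F_def bij_is_inj)
    have "norm y \<le> R"
      using y norm_triangle_ineq2[of y x] by (auto simp: R_def dist_norm norm_minus_commute)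
    then have "\<bar>T y $ i\<bar> \<le> R" for i
      using component_le_norm_cart[of "T y" i] orthogonal_transformation_norm[OF T, of y] by simp
    then have "(T y $ 1, T y $ 2) \<in> {-R..R} \<times> {-R..R}" by (simp add: abs_le_iff minus_le_iff)
    with Fy show "y \<in> F ` ({-R..R} \<times> {-R..R})" by blast
  qed
  moreover have "0 < R" using r by (simp add: R_def add_nonneg_pos)
  ultimately have "hausdorff2_outer (frontier D \<inter> ball x r) < \<infinity>"
    by (intro outer_lipschitz_square)
  with r(1) show ?thesis by (rule that)
qed

lemma outer_UN_finite: "finite I \<Longrightarrow> (\<And>i. i \<in> I \<Longrightarrow> hausdorff2_outer (A i) < \<infinity>) \<Longrightarrow> hausdorff2_outer (\<Union>i\<in>I. A i) < \<infinity>"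
proof (induction I rule: finite_induct)
  case (insert i I)
  then have "hausdorff2_outer (A i) + hausdorff2_outer (\<Union>i\<in>I. A i) < \<infinity>" by simp
  then show ?case using outer_Un[of "A i" "\<Union>i\<in>I. A i"] by (auto intro: order_le_less_trans)
qed (simp add: outer_empty)

lemma outer_frontier_finite:
  assumes D: "open D" "bounded D" and sl: "strongly_lipschitz D"
  shows "hausdorff2_outer (frontier D) < \<infinity>"
proof -
  have "\<exists>r. 0 < r \<and> hausdorff2_outer (frontier D \<inter> ball x r) < \<infinity>" if "x \<in> frontier D" for x
    using outer_frontier_local[OF D(1) sl that] by blast
  then obtain r where r: "\<And>x. x \<in> frontier D \<Longrightarrow> 0 < r x \<and> hausdorff2_outer (frontier D \<inter> ball x (r x)) < \<infinity>"
    by metis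
  have "compact (frontier D)" using D(2) by (rule compact_frontier_bounded)
  then obtain I where I: "I \<subseteq> frontier D" "finite I" "frontier D \<subseteq> (\<Union>x\<in>I. ball x (r x))"
    using compactE_image[of "frontier D" "frontier D" "\<lambda>x. ball x (r x)"] r
    by (metis (no_types, lifting) UN_I centre_in_ball open_ball subsetI)
  have "hausdorff2_outer (\<Union>x\<in>I. frontier D \<inter> ball x (r x)) < \<infinity>"
    using I r by (intro outer_UN_finite) auto
  moreover have "frontier D = (\<Union>x\<in>I. frontier D \<inter> ball x (r x))" using I by auto
  ultimately show ?thesis by simp
qed

text \<open>A set of diameter \<open>d \<le> t\<close>, swept over length \<open>t\<close> along an axis, lies in a box of volume at
  most \<open>(2 * d)\<^sup>2 * (3 * t)\<close>: the diameter enters squared, as in the two-dimensional measure.\<close>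

lemma layer_cover:
  fixes K t :: real
  assumes K: "hausdorff2_outer A < ennreal K" and t: "0 < t"
  obtains B where "B \<in> sets borel" "\<And>x s. x \<in> A \<Longrightarrow> 0 \<le> s \<Longrightarrow> s \<le> t \<Longrightarrow> x + s *\<^sub>R axis i 1 \<in> B"
    "emeasure lborel B \<le> ennreal (16 * t * K)" "\<And>y. y \<in> B \<Longrightarrow> \<exists>x\<in>A. norm (y - x) \<le> 6 * t"
proof -
  have "hausdorff2_content t A < ennreal K" using outer_ge_content[OF t] K by (rule order_le_less_trans)
  then obtain C where C: "C \<in> covers2 t A" "(\<Sum>n. disc_area (C n)) < ennreal K" by (rule content_approx)
  have K0: "0 \<le> K" using K by (cases "0 \<le> K") (auto simp: ennreal_neg)
  \<comment> \<open>The centre is taken in A so that the box stays close to A; covering sets that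
    miss A get an empty box.\<close>
  define c where "c n = (SOME c. c \<in> C n \<inter> A)" for n
  have c: "c n \<in> C n" "c n \<in> A" if "C n \<inter> A \<noteq> {}" for n
    using someI_ex[of "\<lambda>c. c \<in> C n \<inter> A"] that unfolding c_def by blast+
  define \<rho> where "\<rho> n = diameter (C n)" for n
  have \<rho>: "0 \<le> \<rho> n" "\<rho> n \<le> t" for n
    using C(1) by (auto simp: \<rho>_def covers2_def intro: diameter_ge_0)
  \<comment> \<open>A cube of half side \<rho> around the centre, lengthened by t only in direction
    i, the direction of the sweep.\<close>
  define lo where "lo n = (\<chi> j. c n $ j - \<rho> n)" for n
  define hi where "hi n = (\<chi> j. c n $ j + \<rho> n + (if j = i then t else 0))" for n
  define B where "B n = (if C n \<inter> A = {} then {} else cbox (lo n) (hi n))" for n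
  have [measurable]: "B n \<in> sets borel" for n by (simp add: B_def)
  show ?thesis
  proof (rule that[of "\<Union>n. B n"])
    show "(\<Union>n. B n) \<in> sets borel" by measurable
  next
    fix x s assume x: "x \<in> A" and s: "0 \<le> s" "s \<le> t"
    then obtain n where n: "x \<in> C n" using C(1) by (auto simp: covers2_def)
    then have ne: "C n \<inter> A \<noteq> {}" using x by blast
    have "norm (x - c n) \<le> \<rho> n"
      using diameter_bounded_bound[of "C n" x "c n"] C(1) n c[OF ne] by (auto simp: covers2_def \<rho>_def dist_norm)
    then have comp: "\<bar>x $ j - c n $ j\<bar> \<le> \<rho> n" for j
      using component_le_norm_cart[of "x - c n" j] by simp
    have "x + s *\<^sub>R axis i 1 \<in> cbox (lo n) (hi n)"
      unfolding mem_box_cart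
    proof
      fix j
      show "lo n $ j \<le> (x + s *\<^sub>R axis i 1) $ j \<and> (x + s *\<^sub>R axis i 1) $ j \<le> hi n $ j"
        using comp[of j] s t by (auto simp: lo_def hi_def axis_def abs_le_iff)
    qed
    then show "x + s *\<^sub>R axis i 1 \<in> (\<Union>n. B n)" using ne by (auto simp: B_def)
  next
    have vol: "emeasure lborel (B n) \<le> ennreal (16 * t) * disc_area (C n)" for n
    proof (cases "C n \<inter> A = {}")
      case False
      have le: "lo n $ j \<le> hi n $ j" for j using \<rho>[of n] t by (auto simp: lo_def hi_def)
      have "measure lborel (cbox (lo n) (hi n)) = (\<Prod>j\<in>UNIV. hi n $ j - lo n $ j)"
        using le by (intro content_cbox_cart) (auto simp: interval_ne_empty_cart)
      also have "\<dots> = (\<Prod>j\<in>UNIV. 2 * \<rho> n + (if j = i then t else 0))"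
        by (simp add: lo_def hi_def algebra_simps)
      also have "\<dots> = (2 * \<rho> n + t) * (2 * \<rho> n)\<^sup>2"
        by (subst prod.remove[of UNIV i]) (simp_all add: card_Diff_singleton)
      also have "\<dots> \<le> (3 * t) * (2 * \<rho> n)\<^sup>2"
        using \<rho>[of n] by (intro mult_right_mono) auto
      \<comment> \<open>Here the constant arises: 12 t \<open>\<rho>\<^sup>2\<close> is 16 t times 3
        \<open>(\<rho>/2)\<^sup>2\<close>, and 3 < pi turns the last factor into the area of a disc
        of diameter \<rho>.\<close>
      also have "\<dots> = 16 * t * (3 * (\<rho> n / 2)\<^sup>2)" by (simp add: power2_eq_square)
      also have "\<dots> \<le> 16 * t * (pi * (\<rho> n / 2)\<^sup>2)"
        using t pi_gt3 by (intro mult_left_mono mult_right_mono) auto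
      finally have "ennreal (measure lborel (cbox (lo n) (hi n))) \<le> ennreal (16 * t) * disc_area (C n)"
        using t by (simp add: disc_area_def \<rho>_def ennreal_mult[symmetric] ennreal_leI)
      then show ?thesis
        using False emeasure_lborel_cbox_finite[of "lo n" "hi n"]
        by (simp add: B_def emeasure_eq_ennreal_measure less_top)
    qed (simp add: B_def)
    have "emeasure lborel (\<Union>n. B n) \<le> (\<Sum>n. emeasure lborel (B n))"
      by (rule emeasure_subadditive_countably) auto
    also have "\<dots> \<le> (\<Sum>n. ennreal (16 * t) * disc_area (C n))" by (intro suminf_le vol) auto
    also have "\<dots> = ennreal (16 * t) * (\<Sum>n. disc_area (C n))" by simp
    also have "\<dots> \<le> ennreal (16 * t) * ennreal K" using C(2) by (intro mult_left_mono) auto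
    also have "\<dots> = ennreal (16 * t * K)" using t K0 by (simp add: ennreal_mult)
    finally show "emeasure lborel (\<Union>n. B n) \<le> ennreal (16 * t * K)" .
  next
    fix y assume "y \<in> (\<Union>n. B n)"
    then obtain n where n: "C n \<inter> A \<noteq> {}" "y \<in> cbox (lo n) (hi n)"
      by (auto simp: B_def split: if_splits)
    have "\<bar>(y - c n) $ j\<bar> \<le> \<rho> n + t" for j
      using n(2) \<rho>[of n] t unfolding mem_box_cart
      by (auto simp: lo_def hi_def abs_le_iff algebra_simps split: if_splits dest!: spec[of _ j])
    then have "norm (y - c n) \<le> (\<Sum>j\<in>(UNIV::3 set). \<rho> n + t)"
      by (intro order_trans[OF norm_le_l1_cart] sum_mono) auto
    also have "\<dots> \<le> 6 * t" using \<rho>[of n] by simp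
    finally show "\<exists>x\<in>A. norm (y - x) \<le> 6 * t" using c[OF n(1)] by blast
  qed
qed

section \<open>Divergence theorem\<close>

lemma bounded_in_cball:
  fixes D :: "point set"
  assumes "bounded D"
  obtains r where "D \<subseteq> cball 0 r"
proof -
  obtain r where "\<forall>x\<in>D. norm x \<le> r" using assms by (auto simp: bounded_iff)
  then show ?thesis by (intro that[of r]) auto
qed

lemma integrable_cmult_indicator:
  fixes D :: "point set"
  assumes "D \<in> sets borel" "emeasure lborel D < \<infinity>"
  shows "integrable lborel (\<lambda>x. B * indicator D x :: real)"
  by (rule integrable_mult_right, rule integrable_real_indicator) (use assms in simp_all)

lemma borel_measurable_indicator_mult:
  fixes f :: scalar_field
  assumes "D \<in> sets borel" "f \<in> borel_measurable borel"
  shows "(\<lambda>x. indicator D x * f x) \<in> borel_measurable lborel"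
  by (rule borel_measurable_times, rule borel_measurable_indicator) (use assms in simp_all)

lemma smooth_bounded_on:
  assumes f: "smooth f" and D: "bounded D"
  obtains B where "0 \<le> B" "\<And>x. x \<in> D \<Longrightarrow> \<bar>f x\<bar> \<le> B"
proof -
  obtain r where r: "D \<subseteq> cball 0 r" by (rule bounded_in_cball[OF D])
  have "bounded (f ` cball 0 r)"
    by (intro compact_imp_bounded compact_continuous_image smooth_continuous f compact_cball)
  then obtain B where B: "\<forall>x\<in>cball 0 r. \<bar>f x\<bar> \<le> B" by (auto simp: bounded_iff)
  show ?thesis
  proof (rule that[of "\<bar>B\<bar>"])
    fix x assume "x \<in> D"
    then have "\<bar>f x\<bar> \<le> B" using B r by blast
    then show "\<bar>f x\<bar> \<le> \<bar>B\<bar>" by linarith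
  qed simp
qed

lemma integrable_bounded_on:
  fixes f :: scalar_field
  assumes D: "bounded D" "D \<in> sets borel" and f [measurable]: "f \<in> borel_measurable borel"
    and B: "\<And>x. x \<in> D \<Longrightarrow> \<bar>f x\<bar> \<le> B"
  shows "integrable lborel (\<lambda>x. indicator D x * f x)"
proof (rule Bochner_Integration.integrable_bound)
  have fin: "emeasure lborel D < \<infinity>" using emeasure_bounded_finite[OF D(1)] by (simp add: less_top)
  show "integrable lborel (\<lambda>x. B * indicator D x)"
    using D(2) fin by (rule integrable_cmult_indicator)
  show "(\<lambda>x. indicator D x * f x) \<in> borel_measurable lborel"
    using D(2) f by (rule borel_measurable_indicator_mult)
  show "AE x in lborel. norm (indicator D x * f x) \<le> norm (B * indicator D x)"
    using order_trans[OF B abs_ge_self] by (intro AE_I2) (auto simp: indicator_def)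
qed

lemma integrable_smooth_on:
  assumes D: "bounded D" "D \<in> sets borel" and f: "smooth f"
  shows "integrable lborel (\<lambda>x. indicator D x * f x)"
proof -
  obtain B where "\<And>x. x \<in> D \<Longrightarrow> \<bar>f x\<bar> \<le> B" using smooth_bounded_on[OF f D(1)] by blast
  then show ?thesis by (rule integrable_bounded_on[OF D smooth_borel[OF f]])
qed

text \<open>Discrete integration by parts: translation invariance moves the shift from the indicator
  to h. The left-hand integrand lives in a layer at the boundary, while the right-hand side is a
  difference quotient inside D.\<close>

lemma difference_quotient_eq:
  fixes D :: "point set"
  assumes D: "bounded D" "D \<in> sets borel" and h: "smooth h"
  shows "(LINT y|lborel. (indicator D (y - v) - indicator D y) * h y)
    = (LINT y|lborel. indicator D y * (h (y + v) - h y))"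
    and "integrable lborel (\<lambda>y. (indicator D (y - v) - indicator D y) * h y)"
proof -
  have [measurable]: "h \<in> borel_measurable borel" "D \<in> sets borel" using h D by auto
  let ?g = "\<lambda>y. indicator D y * h (y + v)"
  have hv: "smooth (\<lambda>y. h (y + v))" using smooth_translate[OF h, of v] by (simp add: add.commute)
  have ig: "integrable lborel ?g" using D hv by (rule integrable_smooth_on)
  have ih: "integrable lborel (\<lambda>y. indicator D y * h y)" using D h by (rule integrable_smooth_on)
  have gm: "?g \<in> borel_measurable borel" using ig by auto
  have "integrable (distr lborel borel ((+) (- v))) ?g" using ig by (simp add: lborel_distr_plus)
  then have i2: "integrable lborel (\<lambda>y. indicator D (y - v) * h y)"
    by (subst (asm) integrable_distr_eq) (use gm in simp_all)
  have eq: "(\<lambda>y. (indicator D (y - v) - indicator D y) * h y) = (\<lambda>y. indicator D (y - v) * h y - indicator D y * h y)"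
    by (simp add: left_diff_distrib)
  show "integrable lborel (\<lambda>y. (indicator D (y - v) - indicator D y) * h y)"
    unfolding eq by (rule Bochner_Integration.integrable_diff[OF i2 ih])
  have "(LINT y|lborel. indicator D (y - v) * h y) = (LINT y|lborel. ?g y)"
    using lborel_integral_shift[OF gm, of v] by simp
  then show "(LINT y|lborel. (indicator D (y - v) - indicator D y) * h y)
    = (LINT y|lborel. indicator D y * (h (y + v) - h y))"
    unfolding eq right_diff_distrib using i2 ih ig by simp
qed

lemma difference_quotient_tendsto:
  fixes D :: "point set"
  assumes D: "bounded D" "D \<in> sets borel" and h: "smooth h"
  defines "t \<equiv> \<lambda>n. 1 / real (Suc n)"
  shows "(\<lambda>n. (1 / t n) * (LINT y|lborel. (indicator D (y - t n *\<^sub>R axis i 1) - indicator D y) * h y))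
    \<longlonglongrightarrow> (LINT y|lborel. indicator D y * partial i h y)"
proof -
  have [measurable]: "h \<in> borel_measurable borel" "partial i h \<in> borel_measurable borel" "D \<in> sets borel"
    using h D smooth_partial by auto
  obtain r where r: "D \<subseteq> cball 0 r" by (rule bounded_in_cball[OF D(1)])
  \<comment> \<open>The radius r + 1 contains the segments on which the mean value theorem is used,
    since the step lengths are at most 1.\<close>
  obtain B where B: "0 \<le> B" "\<And>x. x \<in> cball 0 (r + 1) \<Longrightarrow> \<bar>partial i h x\<bar> \<le> B"
    using smooth_bounded_on[OF smooth_partial[OF h], of "cball 0 (r + 1)"] by auto
  let ?q = "\<lambda>n y. (h (y + t n *\<^sub>R axis i 1) - h y) / t n"
  have t: "0 < t n" "t n \<le> 1" for n by (auto simp: t_def)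
  have t0: "t \<longlonglongrightarrow> 0" unfolding t_def by (rule LIMSEQ_Suc[OF lim_1_over_n])
  have fin: "emeasure lborel D < \<infinity>" using emeasure_bounded_finite[OF D(1)] by (simp add: less_top)
  have lim: "(\<lambda>n. LINT y|lborel. indicator D y * ?q n y) \<longlonglongrightarrow> (LINT y|lborel. indicator D y * partial i h y)"
  proof (rule integral_dominated_convergence[where w = "\<lambda>y. B * indicator D y"])
    show "integrable lborel (\<lambda>y. B * indicator D y)"
      using D(2) fin by (rule integrable_cmult_indicator)
    show "(\<lambda>y. indicator D y * ?q n y) \<in> borel_measurable lborel" for n
      by (rule borel_measurable_indicator_mult) measurable
    show "(\<lambda>y. indicator D y * partial i h y) \<in> borel_measurable lborel"
      by (rule borel_measurable_indicator_mult) measurable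
    show "AE y in lborel. (\<lambda>n. indicator D y * ?q n y) \<longlonglongrightarrow> indicator D y * partial i h y"
    proof (intro AE_I2 tendsto_mult tendsto_const)
      fix y
      have "(\<lambda>s. (h (y + (0 + s) *\<^sub>R axis i 1) - h (y + 0 *\<^sub>R axis i 1)) / s) \<midarrow>0\<rightarrow> partial i h y"
        using smooth_directional_derivative[OF h, of y i 0] unfolding DERIV_def by simp
      moreover have "filterlim t (at 0) sequentially"
        using t(1) by (intro filterlim_atI t0) (simp add: less_imp_neq[symmetric])
      ultimately show "(\<lambda>n. ?q n y) \<longlonglongrightarrow> partial i h y"
        using filterlim_compose by force
    qed
    show "AE y in lborel. norm (indicator D y * ?q n y) \<le> B * indicator D y" for n
    proof (intro AE_I2)
      fix y
      have "\<bar>?q n y\<bar> \<le> B" if y: "y \<in> D"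
      proof -
        obtain s where s: "0 < s" "s < t n" "h (y + t n *\<^sub>R axis i 1) - h (y + 0 *\<^sub>R axis i 1) = (t n - 0) * partial i h (y + s *\<^sub>R axis i 1)"
          using MVT2[OF t(1)[of n], of "\<lambda>s. h (y + s *\<^sub>R axis i 1)" "\<lambda>s. partial i h (y + s *\<^sub>R axis i 1)"]
            smooth_directional_derivative[OF h] by blast
        have "norm (y + s *\<^sub>R axis i 1) \<le> norm y + norm (s *\<^sub>R axis i (1::real))"
          by (rule norm_triangle_ineq)
        also have "\<dots> \<le> r + 1" using s t(2)[of n] r y by (auto intro!: add_mono simp: norm_axis_1)
        finally have "\<bar>partial i h (y + s *\<^sub>R axis i 1)\<bar> \<le> B" by (intro B(2)) simp
        moreover have "?q n y = partial i h (y + s *\<^sub>R axis i 1)"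
          using s(3) t(1)[of n] by simp
        ultimately show ?thesis by simp
      qed
      then show "norm (indicator D y * ?q n y) \<le> B * indicator D y" by (auto simp: indicator_def)
    qed
  qed
  have eq: "(1 / t n) * (LINT y|lborel. (indicator D (y - t n *\<^sub>R axis i 1) - indicator D y) * h y)
     = (LINT y|lborel. indicator D y * ?q n y)" for n
    unfolding difference_quotient_eq(1)[OF D h]
    by (subst integral_mult_right_zero[symmetric]) (simp add: field_simps)
  show ?thesis unfolding eq by (rule lim)
qed

text \<open>Once the step is shorter than the distance from K to the complement of D, both
  indicators equal 1 on K, so the difference quotients are eventually 0.\<close>

lemma integral_partial_eq_0:
  assumes D: "open D" "bounded D" and h: "smooth h" and K: "compact K" "K \<subseteq> D" "\<And>x. x \<notin> K \<Longrightarrow> h x = 0"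
  shows "(LINT y|lborel. indicator D y * partial i h y) = 0"
proof -
  let ?t = "\<lambda>n. 1 / real (Suc n)"
  obtain e where e: "0 < e" "(\<Union>x\<in>K. ball x e) \<subseteq> D"
    using compact_subset_open_imp_ball_epsilon_subset[OF K(1) D(1) K(2)] by blast
  have t0: "?t \<longlonglongrightarrow> 0" by (rule LIMSEQ_Suc[OF lim_1_over_n])
  then have "\<forall>\<^sub>F n in sequentially. ?t n < e" using e(1) by (rule order_tendstoD)
  then have "\<forall>\<^sub>F n in sequentially.
    (1 / ?t n) * (LINT y|lborel. (indicator D (y - ?t n *\<^sub>R axis i 1) - indicator D y) * h y) = 0"
  proof eventually_elim
    case (elim n)
    have "(indicator D (y - ?t n *\<^sub>R axis i 1) - indicator D y) * h y = 0" for y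
    proof (cases "y \<in> K")
      case True
      have "y - ?t n *\<^sub>R axis i 1 \<in> ball y e" using elim by (simp add: dist_norm norm_axis_1)
      with True e(2) have "y - ?t n *\<^sub>R axis i 1 \<in> D" by blast
      moreover have "y \<in> D" using True K(2) by blast
      ultimately have "y - ?t n *\<^sub>R axis i 1 \<in> D" "y \<in> D" .
      then show ?thesis by simp
    qed (simp add: K)
    then show ?case by (simp only: integral_zero mult_zero_right)
  qed
  then have "(\<lambda>n. (1 / ?t n) * (LINT y|lborel. (indicator D (y - ?t n *\<^sub>R axis i 1) - indicator D y) * h y)) \<longlonglongrightarrow> 0"
    by (rule tendsto_eventually)
  moreover have "D \<in> sets borel" using D by simp
  ultimately show ?thesis
    using LIMSEQ_unique[OF difference_quotient_tendsto[OF D(2) _ h]] by blast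
qed


lemma crossing_frontier:
  assumes "(y - v \<in> D) \<noteq> (y \<in> D)"
  obtains s where "0 \<le> s" "s \<le> 1" "y - s *\<^sub>R v \<in> frontier (D :: point set)"
proof -
  let ?S = "closed_segment y (y - v)"
  have "?S \<inter> D \<noteq> {}" "?S - D \<noteq> {}" using assms by auto
  then have "?S \<inter> frontier D \<noteq> {}" by (intro connected_Int_frontier connected_segment)
  then obtain z where z: "z \<in> ?S" "z \<in> frontier D" by blast
  then obtain u where u: "0 \<le> u" "u \<le> 1" "z = (1 - u) *\<^sub>R y + u *\<^sub>R (y - v)"
    by (auto simp: in_segment)
  then have "z = y - u *\<^sub>R v" by (simp add: algebra_simps)
  with u z show ?thesis by (intro that[of u]) auto
qed

text \<open>A Riemann sum over the level sets j a \<le> \<bar>h\<bar> < (j + 1) a of the boundary.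
  The layer of each level set is covered separately, and uniform continuity bounds \<bar>h\<bar> on
  it by (j + 2) a. Additivity of the Hausdorff measure recombines the level sets into the integral
  of \<bar>h\<bar>, up to an error that is split into two halves of e.\<close>

lemma layer_integral_le:
  fixes D :: "point set"
  assumes D: "open D" "bounded D" and fin: "hausdorff2_outer (frontier D) < \<infinity>"
    and h: "smooth h" and e: "0 < e"
  obtains \<tau> where "0 < \<tau>" "\<And>t. 0 < t \<Longrightarrow> t \<le> \<tau> \<Longrightarrow>
    (\<integral>\<^sup>+y. ennreal \<bar>(indicator D (y - t *\<^sub>R axis i 1) - indicator D y) * h y\<bar> \<partial>lborel)
      \<le> ennreal (16 * t) * ((\<integral>\<^sup>+x. ennreal \<bar>h x\<bar> \<partial>surface_measure D) + ennreal e)"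
proof -
  let ?S = "frontier D" and ?H = hausdorff2_outer
  have hm [measurable]: "h \<in> borel_measurable borel" using h by (rule smooth_borel)
  have Sb: "?S \<in> sets borel" by (intro borel_closed) simp
  obtain HS where HS: "?H ?S = ennreal HS" "0 \<le> HS"
    using fin by (cases "?H ?S") auto
  \<comment> \<open>The two extra levels in (j + 2) a cost 2 a per unit of boundary measure, in
    total at most e/2.\<close>
  define a where "a = e / (4 * (HS + 1))"
  have a: "0 < a" "2 * a * HS \<le> e / 2" using e HS(2) by (auto simp: a_def field_simps)
  obtain M where M: "0 \<le> M" "\<And>x. x \<in> ?S \<Longrightarrow> \<bar>h x\<bar> \<le> M"
    using smooth_bounded_on[OF h compact_imp_bounded[OF compact_frontier_bounded[OF D(2)]]] by blast
  obtain N :: nat where N: "M / a < real N" using reals_Archimedean2 by blast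
  define A where "A j = {x \<in> ?S. real j * a \<le> \<bar>h x\<bar> \<and> \<bar>h x\<bar> < real (j + 1) * a}" for j :: nat
  have Ab: "A j \<in> sets borel" for j
  proof -
    have "A j = ?S \<inter> {x \<in> space borel. real j * a \<le> \<bar>h x\<bar> \<and> \<bar>h x\<bar> < real (j + 1) * a}"
      by (auto simp: A_def)
    also have "\<dots> \<in> sets borel" using Sb by (intro sets.Int) measurable
    finally show ?thesis .
  qed
  have cover: "\<exists>j<N. x \<in> A j" if x: "x \<in> ?S" for x
  proof (intro exI[of _ "nat \<lfloor>\<bar>h x\<bar> / a\<rfloor>"] conjI)
    have nn: "0 \<le> \<bar>h x\<bar> / a" using a by simp
    have "\<bar>h x\<bar> / a \<le> M / a" using M(2)[OF x] a by (intro divide_right_mono) auto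
    then show "nat \<lfloor>\<bar>h x\<bar> / a\<rfloor> < N" using nn N by linarith
    have "real (nat \<lfloor>\<bar>h x\<bar> / a\<rfloor>) \<le> \<bar>h x\<bar> / a" "\<bar>h x\<bar> / a < real (nat \<lfloor>\<bar>h x\<bar> / a\<rfloor> + 1)"
      using nn by linarith+
    then show "x \<in> A (nat \<lfloor>\<bar>h x\<bar> / a\<rfloor>)"
      unfolding A_def pos_le_divide_eq[OF a(1)] pos_divide_less_eq[OF a(1)] using x by simp
  qed
  have disj: "disjoint_family A"
    unfolding disjoint_family_on_def
  proof (intro ballI impI)
    fix j k :: nat assume jk: "j \<noteq> k"
    have "False" if "x \<in> A j" "x \<in> A k" "j < k" for x j k
    proof -
      have "real (j + 1) * a \<le> real k * a" using that a by (intro mult_right_mono) auto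
      then show False using that by (auto simp: A_def)
    qed
    then have "j < k \<Longrightarrow> A j \<inter> A k = {}" "k < j \<Longrightarrow> A j \<inter> A k = {}" by blast+
    with jk show "A j \<inter> A k = {}" by linarith
  qed
  have Sun: "(\<Union>j<N. A j) = ?S" using cover by (auto simp: A_def)
  have Hsum: "(\<Sum>j<N. ?H (A j)) = ?H ?S"
  proof -
    have "(\<Sum>j<N. emeasure hausdorff2 (A j)) = emeasure hausdorff2 (\<Union>j<N. A j)"
      using Ab disj by (intro sum_emeasure) (auto simp: disjoint_family_on_def)
    then show ?thesis using Ab Sb Sun by (simp add: emeasure_hausdorff2)
  qed
  define H where "H j = enn2real (?H (A j))" for j
  have H: "?H (A j) = ennreal (H j)" "0 \<le> H j" for j
  proof -
    have "?H (A j) \<le> ennreal HS" unfolding HS(1)[symmetric] by (intro outer_mono) (auto simp: A_def)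
    then have "?H (A j) < top" by (rule order_le_less_trans) simp
    then show "?H (A j) = ennreal (H j)" "0 \<le> H j" by (simp_all add: H_def)
  qed
  have HsumR: "(\<Sum>j<N. H j) = HS"
  proof -
    have "(\<Sum>j<N. ennreal (H j)) = ennreal HS" using Hsum unfolding H(1) HS(1) .
    then have "ennreal (\<Sum>j<N. H j) = ennreal HS" using H(2) by (simp add: sum_ennreal)
    then show ?thesis using H(2) HS(2) by (simp add: sum_nonneg)
  qed
  define W where "W = (\<Sum>j<N. real (j + 2) * a)"
  have W: "0 \<le> W" unfolding W_def using a by (intro sum_nonneg) auto
  \<comment> \<open>\<open>layer_cover\<close> needs a bound strictly above the measure of the level
    set. The slack b is weighted by the heights, whose sum is W, and costs at most e/2.\<close>
  define b where "b = e / (2 * (W + 1))"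
  have b: "0 < b" "W * b \<le> e / 2" using e W by (auto simp: b_def field_simps)
  have surf: "ennreal (\<Sum>j<N. real j * a * H j) \<le> (\<integral>\<^sup>+x. ennreal \<bar>h x\<bar> \<partial>surface_measure D)"
  proof -
    have Ar: "A j \<in> sets (surface_measure D)" for j
      using Ab[of j] by (auto simp: surface_measure_def sets_restrict_space A_def intro!: image_eqI[of _ _ "A j"])
    have em: "emeasure (surface_measure D) (A j) = ennreal (H j)" for j
      unfolding surface_measure_def using Ab[of j] Sb H(1)[of j]
      by (subst emeasure_restrict_space) (auto simp: A_def emeasure_hausdorff2)
    have "ennreal (\<Sum>j<N. real j * a * H j) = (\<Sum>j<N. ennreal (real j * a) * emeasure (surface_measure D) (A j))"
      using a H(2) by (simp add: em sum_ennreal ennreal_mult[symmetric])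
    also have "\<dots> = (\<Sum>j<N. \<integral>\<^sup>+x. ennreal (real j * a) * indicator (A j) x \<partial>surface_measure D)"
      using Ar by (simp add: nn_integral_cmult_indicator)
    also have "\<dots> = (\<integral>\<^sup>+x. (\<Sum>j<N. ennreal (real j * a) * indicator (A j) x) \<partial>surface_measure D)"
      by (rule nn_integral_sum[symmetric]) (intro borel_measurable_times_ennreal borel_measurable_const borel_measurable_indicator Ar)
    also have "\<dots> \<le> (\<integral>\<^sup>+x. ennreal \<bar>h x\<bar> \<partial>surface_measure D)"
    proof (rule nn_integral_mono)
      fix x assume "x \<in> space (surface_measure D)"
      then have "x \<in> ?S" by (simp add: surface_measure_def space_restrict_space)
      then obtain k where k: "k < N" "x \<in> A k" using cover by blast
      have "ennreal (real j * a) * indicator (A j) x = (if j = k then ennreal (real k * a) else 0)" for j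
        using k disj by (auto simp: disjoint_family_on_def indicator_def)
      then have "(\<Sum>j<N. ennreal (real j * a) * indicator (A j) x) = (\<Sum>j<N. if j = k then ennreal (real k * a) else 0)"
        by (simp only:)
      also have "\<dots> = ennreal (real k * a)" using k by simp
      also have "\<dots> \<le> ennreal \<bar>h x\<bar>" using k(2) by (intro ennreal_leI) (simp add: A_def)
      finally show "(\<Sum>j<N. ennreal (real j * a) * indicator (A j) x) \<le> ennreal \<bar>h x\<bar>" .
    qed
    finally show ?thesis .
  qed
  obtain R where R: "?S \<subseteq> cball 0 R" by (rule bounded_in_cball[OF compact_imp_bounded[OF compact_frontier_bounded[OF D(2)]]])
  have "uniformly_continuous_on (cball 0 (R + 1)) h"
    by (intro compact_uniformly_continuous smooth_continuous h compact_cball)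
  then obtain d where d: "0 < d" "\<And>x y. x \<in> cball 0 (R + 1) \<Longrightarrow> y \<in> cball 0 (R + 1) \<Longrightarrow> dist y x < d \<Longrightarrow> dist (h y) (h x) < a"
    using a(1) unfolding uniformly_continuous_on_def by metis
  \<comment> \<open>The layer stays within 6 t of the boundary: 6 t \<le> d/2 allows uniform
    continuity to be used, and 6 t \<le> 1 keeps the points in the ball of radius R + 1.\<close>
  define \<tau> where "\<tau> = min (d / 12) (1 / 6)"
  show ?thesis
  proof (rule that[of \<tau>])
    show "0 < \<tau>" using d by (simp add: \<tau>_def)
    fix t assume t: "0 < t" "t \<le> \<tau>"
    have "\<exists>B. B \<in> sets borel \<and> (\<forall>x s. x \<in> A j \<longrightarrow> 0 \<le> s \<longrightarrow> s \<le> t \<longrightarrow> x + s *\<^sub>R axis i 1 \<in> B) \<and>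
      emeasure lborel B \<le> ennreal (16 * t * (H j + b)) \<and> (\<forall>y\<in>B. \<exists>x\<in>A j. norm (y - x) \<le> 6 * t)" for j
    proof -
      have "?H (A j) < ennreal (H j + b)"
        unfolding H(1) using H(2)[of j] b(1) by (intro ennreal_lessI) auto
      from layer_cover[OF this t(1), of i] show ?thesis by metis
    qed
    then obtain B where B: "\<And>j. B j \<in> sets borel"
      "\<And>j x s. x \<in> A j \<Longrightarrow> 0 \<le> s \<Longrightarrow> s \<le> t \<Longrightarrow> x + s *\<^sub>R axis i 1 \<in> B j"
      "\<And>j. emeasure lborel (B j) \<le> ennreal (16 * t * (H j + b))"
      "\<And>j y. y \<in> B j \<Longrightarrow> \<exists>x\<in>A j. norm (y - x) \<le> 6 * t"
      by metis
    have hB: "\<bar>h y\<bar> \<le> real (j + 2) * a" if y: "y \<in> B j" for j y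
    proof -
      obtain x where x: "x \<in> A j" "norm (y - x) \<le> 6 * t" using B(4)[OF y] by blast
      have "norm x \<le> R" using x R by (auto simp: A_def)
      moreover have "norm y \<le> norm x + norm (y - x)" using norm_triangle_ineq[of x "y - x"] by simp
      ultimately have "dist (h y) (h x) < a"
        using x t d(1) by (intro d(2)) (auto simp: \<tau>_def dist_norm)
      moreover have "\<bar>h x\<bar> < real (j + 1) * a" using x by (simp add: A_def)
      ultimately show ?thesis by (simp add: dist_real_def algebra_simps)
    qed
    have "(\<integral>\<^sup>+y. ennreal \<bar>(indicator D (y - t *\<^sub>R axis i 1) - indicator D y) * h y\<bar> \<partial>lborel)
      \<le> (\<integral>\<^sup>+y. (\<Sum>j<N. ennreal (real (j + 2) * a) * indicator (B j) y) \<partial>lborel)"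
    proof (rule nn_integral_mono)
      fix y :: point
      show "ennreal \<bar>(indicator D (y - t *\<^sub>R axis i 1) - indicator D y) * h y\<bar>
        \<le> (\<Sum>j<N. ennreal (real (j + 2) * a) * indicator (B j) y)"
      proof (cases "(y - t *\<^sub>R axis i 1 \<in> D) \<noteq> (y \<in> D)")
        case True
        then obtain s where s: "0 \<le> s" "s \<le> 1" "y - s *\<^sub>R (t *\<^sub>R axis i 1) \<in> ?S"
          by (rule crossing_frontier)
        then obtain k where k: "k < N" "y - s *\<^sub>R (t *\<^sub>R axis i 1) \<in> A k" using cover by blast
        have "s * t \<le> 1 * t" using s t by (intro mult_right_mono) auto
        then have "(y - s *\<^sub>R (t *\<^sub>R axis i 1)) + (s * t) *\<^sub>R axis i 1 \<in> B k"
          using s t by (intro B(2)[OF k(2)]) auto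
        then have yB: "y \<in> B k" by simp
        have "\<bar>(indicator D (y - t *\<^sub>R axis i 1) - indicator D y) * h y\<bar> \<le> \<bar>h y\<bar>"
          by (auto simp: indicator_def)
        also have "\<dots> \<le> real (k + 2) * a" using hB[OF yB] .
        finally have "ennreal \<bar>(indicator D (y - t *\<^sub>R axis i 1) - indicator D y) * h y\<bar>
          \<le> ennreal (real (k + 2) * a) * indicator (B k) y"
          using yB by (simp add: ennreal_leI)
        also have "\<dots> \<le> (\<Sum>j<N. ennreal (real (j + 2) * a) * indicator (B j) y)"
          using k by (intro member_le_sum) auto
        finally show ?thesis .
      next
        case False
        then have "indicator D (y - t *\<^sub>R axis i 1) - indicator D y = (0::real)" by (auto simp: indicator_def)
        then show ?thesis by simp
      qed
    qed
    also have "\<dots> = (\<Sum>j<N. \<integral>\<^sup>+y. ennreal (real (j + 2) * a) * indicator (B j) y \<partial>lborel)"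
      by (rule nn_integral_sum) (intro borel_measurable_times_ennreal borel_measurable_const borel_measurable_indicator, simp add: B(1))
    also have "\<dots> = (\<Sum>j<N. ennreal (real (j + 2) * a) * emeasure lborel (B j))"
      using B(1) by (simp add: nn_integral_cmult_indicator)
    also have "\<dots> \<le> (\<Sum>j<N. ennreal (real (j + 2) * a) * ennreal (16 * t * (H j + b)))"
      by (intro sum_mono mult_left_mono B(3)) auto
    also have "\<dots> = ennreal (\<Sum>j<N. real (j + 2) * a * (16 * t * (H j + b)))"
      using a(1) t(1) H(2) b(1) by (simp add: ennreal_mult[symmetric] sum_ennreal less_imp_le)
    \<comment> \<open>(j + 2) a (H + b) splits into the lower sum j a H, the excess 2 a H and the
      slack (j + 2) a b.\<close>
    also have "(\<Sum>j<N. real (j + 2) * a * (16 * t * (H j + b))) = 16 * t * ((\<Sum>j<N. real j * a * H j) + 2 * a * (\<Sum>j<N. H j) + W * b)"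
      unfolding W_def sum_distrib_left sum_distrib_right sum.distrib[symmetric]
      by (intro sum.cong) (auto simp: algebra_simps)
    also have "ennreal \<dots> \<le> ennreal (16 * t * ((\<Sum>j<N. real j * a * H j) + e))"
      using t(1) a(2) b(2) by (intro ennreal_leI mult_left_mono) (auto simp: HsumR)
    also have "\<dots> = ennreal (16 * t) * (ennreal (\<Sum>j<N. real j * a * H j) + ennreal e)"
      using t(1) a(1) e H(2) by (simp add: ennreal_mult[symmetric] ennreal_plus[symmetric] sum_nonneg del: ennreal_plus)
    also have "\<dots> \<le> ennreal (16 * t) * ((\<integral>\<^sup>+x. ennreal \<bar>h x\<bar> \<partial>surface_measure D) + ennreal e)"
      using surf by (intro mult_left_mono add_right_mono) auto
    finally show "(\<integral>\<^sup>+y. ennreal \<bar>(indicator D (y - t *\<^sub>R axis i 1) - indicator D y) * h y\<bar> \<partial>lborel)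
      \<le> ennreal (16 * t) * ((\<integral>\<^sup>+x. ennreal \<bar>h x\<bar> \<partial>surface_measure D) + ennreal e)" .
  qed
qed

theorem divergence_inequality:
  fixes D :: "point set"
  assumes D: "open D" "bounded D" and fin: "hausdorff2_outer (frontier D) < \<infinity>" and h: "smooth h"
  shows "ennreal \<bar>LINT y|lborel. indicator D y * partial i h y\<bar>
    \<le> 16 * (\<integral>\<^sup>+x. ennreal \<bar>h x\<bar> \<partial>surface_measure D)"
proof (rule ennreal_le_epsilon)
  fix e :: real assume e: "0 < e"
  define S where "S = (\<integral>\<^sup>+x. ennreal \<bar>h x\<bar> \<partial>surface_measure D)"
  obtain \<tau> where \<tau>: "0 < \<tau>" "\<And>t. 0 < t \<Longrightarrow> t \<le> \<tau> \<Longrightarrow>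
    (\<integral>\<^sup>+y. ennreal \<bar>(indicator D (y - t *\<^sub>R axis i 1) - indicator D y) * h y\<bar> \<partial>lborel)
      \<le> ennreal (16 * t) * (S + ennreal (e / 16))"
    unfolding S_def by (rule layer_integral_le[OF D fin h, of "e / 16"]) (use e in auto)
  have Db: "D \<in> sets borel" using D by simp
  let ?t = "\<lambda>n. 1 / real (Suc n)"
  let ?I = "\<lambda>n. (LINT y|lborel. (indicator D (y - ?t n *\<^sub>R axis i 1) - indicator D y) * h y)"
  have t0: "?t \<longlonglongrightarrow> 0" by (rule LIMSEQ_Suc[OF lim_1_over_n])
  have "\<forall>\<^sub>F n in sequentially. ?t n < \<tau>" using t0 \<tau>(1) by (rule order_tendstoD)
  then have ev: "\<forall>\<^sub>F n in sequentially. ennreal \<bar>(1 / ?t n) * ?I n\<bar> \<le> 16 * S + ennreal e"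
  proof eventually_elim
    case (elim n)
    have t: "0 < ?t n" by simp
    have "ennreal \<bar>?I n\<bar> \<le> (\<integral>\<^sup>+y. ennreal \<bar>(indicator D (y - ?t n *\<^sub>R axis i 1) - indicator D y) * h y\<bar> \<partial>lborel)"
      using integral_norm_bound_ennreal[OF difference_quotient_eq(2)[OF D(2) Db h, of "?t n *\<^sub>R axis i 1"]]
      by (simp only: real_norm_def)
    also have "\<dots> \<le> ennreal (16 * ?t n) * (S + ennreal (e / 16))"
      using elim by (intro \<tau>(2)) auto
    finally have "ennreal \<bar>?I n\<bar> \<le> ennreal (16 * ?t n) * (S + ennreal (e / 16))" .
    then have "ennreal (1 / ?t n) * ennreal \<bar>?I n\<bar> \<le> ennreal (1 / ?t n) * (ennreal (16 * ?t n) * (S + ennreal (e / 16)))"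
      by (rule mult_left_mono) simp
    also have "\<dots> = ennreal ((1 / ?t n) * (16 * ?t n)) * (S + ennreal (e / 16))"
    proof -
      have "ennreal (1 / ?t n) * ennreal (16 * ?t n) = ennreal ((1 / ?t n) * (16 * ?t n))"
        by (rule ennreal_mult[symmetric]) (use t in auto)
      then show ?thesis by (simp only: mult.assoc[symmetric])
    qed
    also have "(1 / ?t n) * (16 * ?t n) = 16" by (simp add: field_simps)
    also have "ennreal 16 * (S + ennreal (e / 16)) = 16 * S + ennreal e"
      using e by (simp add: distrib_left ennreal_mult[symmetric] flip: ennreal_numeral)
    finally have "ennreal (1 / ?t n) * ennreal \<bar>?I n\<bar> \<le> 16 * S + ennreal e" .
    moreover have "ennreal \<bar>(1 / ?t n) * ?I n\<bar> = ennreal (1 / ?t n) * ennreal \<bar>?I n\<bar>"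
      by (subst ennreal_mult[symmetric]) (simp_all add: abs_mult)
    ultimately show ?case by (simp only:)
  qed
  have "(\<lambda>n. ennreal \<bar>(1 / ?t n) * ?I n\<bar>) \<longlonglongrightarrow> ennreal \<bar>LINT y|lborel. indicator D y * partial i h y\<bar>"
    by (intro tendsto_ennrealI tendsto_rabs difference_quotient_tendsto[OF D(2) Db h])
  then show "ennreal \<bar>LINT y|lborel. indicator D y * partial i h y\<bar>
      \<le> 16 * (\<integral>\<^sup>+x. ennreal \<bar>h x\<bar> \<partial>surface_measure D) + ennreal e"
    unfolding S_def[symmetric] using ev by (rule tendsto_upperbound) simp
qed

section \<open>Approximation by test functions\<close>

text \<open>Arbitrarily short shifts move K into D, each with a whole ball of freedom. That ball
  will carry a mollifier, so that convolution moves a function carried by K into D.\<close>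

definition inward :: "point set \<Rightarrow> point set \<Rightarrow> bool" where
  "inward D K \<longleftrightarrow> (\<forall>d>0. \<exists>z r. 0 < r \<and> cball z r \<subseteq> cball 0 d \<and> (\<forall>y\<in>K. \<forall>w\<in>cball z r. y + w \<in> D))"

text \<open>The translate of the compact set K is a compact subset of the open set D, so it has room
  for a ball of perturbations.\<close>

lemma inwardI:
  assumes D: "open D" and K: "compact K" and s: "0 < s"
    and e: "\<And>t y. 0 < t \<Longrightarrow> t \<le> s \<Longrightarrow> y \<in> K \<Longrightarrow> y + t *\<^sub>R e \<in> D"
  shows "inward D K"
  unfolding inward_def
proof (intro allI impI)
  fix d :: real assume d: "0 < d"
  \<comment> \<open>The shift uses at most half of d; the radius of the ball around it may use the
    other half.\<close>
  define t where "t = min s (d / (2 * (norm e + 1)))"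
  have t: "0 < t" "t \<le> s" using s d by (auto simp: t_def add_nonneg_pos)
  have "t * norm e \<le> d / (2 * (norm e + 1)) * (norm e + 1)"
    using d t by (intro mult_mono) (auto simp: t_def)
  also have "\<dots> = d / 2"
  proof -
    have c: "d / (2 * c) * c = d / 2" if "c \<noteq> 0" for c :: real using that by simp
    have "norm e + 1 \<noteq> 0" using norm_ge_zero[of e] by linarith
    then show ?thesis by (rule c)
  qed
  finally have te: "t * norm e \<le> d / 2" .
  have "compact ((\<lambda>y. t *\<^sub>R e + y) ` K)" using K by (rule compact_translation)
  moreover have "(\<lambda>y. t *\<^sub>R e + y) ` K \<subseteq> D" using e[OF t] by (auto simp: add.commute)
  ultimately obtain r where r: "0 < r" "(\<Union>x\<in>(\<lambda>y. t *\<^sub>R e + y) ` K. ball x r) \<subseteq> D"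
    using compact_subset_open_imp_ball_epsilon_subset[OF _ D] by blast
  define q where "q = min (d / 2) (r / 2)"
  show "\<exists>z r. 0 < r \<and> cball z r \<subseteq> cball 0 d \<and> (\<forall>y\<in>K. \<forall>w\<in>cball z r. y + w \<in> D)"
  proof (intro exI[of _ "t *\<^sub>R e"] exI[of _ q] conjI ballI subsetI)
    show "0 < q" using d r by (simp add: q_def)
    fix w assume w: "w \<in> cball (t *\<^sub>R e) q"
    then have n: "norm (w - t *\<^sub>R e) \<le> q" by (simp add: dist_norm norm_minus_commute)
    have "norm w \<le> norm (w - t *\<^sub>R e) + norm (t *\<^sub>R e)" using norm_triangle_ineq[of "w - t *\<^sub>R e" "t *\<^sub>R e"] by simp
    also have "\<dots> \<le> d / 2 + d / 2" using n te t by (intro add_mono) (auto simp: q_def)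
    finally show "w \<in> cball 0 d" by simp
    fix y assume y: "y \<in> K"
    have "y + w \<in> ball (t *\<^sub>R e + y) r"
      using n r(1) by (simp add: dist_norm norm_minus_commute q_def algebra_simps)
    then show "y + w \<in> D" using r(2) y by blast
  qed
qed

text \<open>At an interior point the direction 0 serves. At a boundary point the direction is the
  preimage under T of the downward unit vector: closure points of D lie on or below the graph, and
  any positive shift moves them strictly below it while they stay in U.\<close>

lemma inward_local:
  assumes D: "open D" and sl: "strongly_lipschitz D" and x: "x \<in> closure D"
  obtains r where "0 < r" "inward D (closure D \<inter> cball x r)"
proof (cases "x \<in> D")
  case True
  then obtain r where r: "0 < r" "cball x r \<subseteq> D" using D open_contains_cball by blast
  have "inward D (closure D \<inter> cball x r)"
  proof (rule inwardI[OF D _ zero_less_one])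
    show "compact (closure D \<inter> cball x r)" by (intro closed_Int_compact) auto
    show "y + t *\<^sub>R 0 \<in> D" if "y \<in> closure D \<inter> cball x r" for t y using that r by auto
  qed
  with r show ?thesis using that by blast
next
  case False
  with x D have xf: "x \<in> frontier D" by (simp add: frontier_def interior_open)
  obtain U T \<psi> L where "open U \<and> x \<in> U \<and> orthogonal_transformation (T :: point \<Rightarrow> point) \<and>
      L-lipschitz_on UNIV (\<psi> :: real \<times> real \<Rightarrow> real) \<and>
      D \<inter> U = {y \<in> U. T y $ 3 < \<psi> (T y $ 1, T y $ 2)}"
    using bspec[OF sl[unfolded strongly_lipschitz_def] xf] by (elim exE)
  then have U: "open U" "x \<in> U" and T: "orthogonal_transformation T"
    and \<psi>: "L-lipschitz_on UNIV \<psi>"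
    and DU: "D \<inter> U = {y \<in> U. T y $ 3 < \<psi> (T y $ 1, T y $ 2)}"
    by simp_all
  have c: "continuous_on UNIV \<psi>" using \<psi> by (rule lipschitz_on_continuous_on)
  obtain r where r: "0 < r" "cball x r \<subseteq> U" using U open_contains_cball by blast
  define e where "e = - inv T (axis 3 1)"
  have bij: "bij T" using T by (rule orthogonal_transformation_bij)
  have lin: "linear T" using T by (rule orthogonal_transformation_linear)
  have Te: "T e = - axis 3 1"
    using bij lin by (simp add: e_def linear_neg bij_is_surj surj_f_inv_f)
  have ne: "norm e = 1"
    using orthogonal_transformation_norm[OF T, of e] by (simp add: Te norm_axis_1)
  have "inward D (closure D \<inter> cball x (r / 2))"
  proof (rule inwardI[OF D])
    show "compact (closure D \<inter> cball x (r / 2))" by (intro closed_Int_compact) auto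
    show "0 < r / 2" using r by simp
    fix t y assume t: "0 < t" "t \<le> r / 2" and y: "y \<in> closure D \<inter> cball x (r / 2)"
    have yU: "y \<in> U" using y r by auto
    have "dist x (y + t *\<^sub>R e) \<le> dist x y + dist y (y + t *\<^sub>R e)" by (rule dist_triangle)
    also have "\<dots> \<le> r / 2 + r / 2" using y t ne by (intro add_mono) (auto simp: dist_norm)
    finally have zU: "y + t *\<^sub>R e \<in> U" using r by auto
    have "T (y + t *\<^sub>R e) = T y - t *\<^sub>R axis 3 1"
      using lin by (simp add: linear_add linear_scale Te)
    moreover have "T y $ 3 \<le> \<psi> (T y $ 1, T y $ 2)"
      using frontier_below_graph(1)[OF D U(1) yU T c DU] y by simp
    ultimately have "y + t *\<^sub>R e \<in> {y \<in> U. T y $ 3 < \<psi> (T y $ 1, T y $ 2)}"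
      using zU t by (simp add: axis_def)
    then show "y + t *\<^sub>R e \<in> D" unfolding DU[symmetric] by simp
  qed
  then show ?thesis using that r by (metis half_gt_zero)
qed

lemma conv_eq_0:
  assumes "\<And>y. f y = 0 \<or> k (x - y) = 0"
  shows "conv k f x = 0"
proof -
  have "k (x - y) * f y = 0" for y using assms[of y] by auto
  then show ?thesis unfolding conv_def by (simp only: integral_zero)
qed

lemma mollifier_integral_reflect: "mollifier k S \<Longrightarrow> (LINT y|lborel. k (x - y)) = 1"
  using lborel_integral_reflect[of k x] smooth_borel[of k] by (simp add: mollifier_def)

text \<open>Make the covering balls disjoint and mollify the indicators of the pieces. The
  indicators add up to 1 on a neighbourhood of the closure of D wider than the mollifier, so the
  mollified sum is 1 on D without any division.\<close>

lemma partition_of_unity: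
  assumes D: "open D" "bounded D" and sl: "strongly_lipschitz D"
  obtains m :: nat and \<theta> K where "\<And>j. smooth (\<theta> j)" "\<And>j. j < m \<Longrightarrow> compact (K j)"
    "\<And>j. j < m \<Longrightarrow> inward D (K j)" "\<And>j x. j < m \<Longrightarrow> x \<in> D \<Longrightarrow> \<theta> j x \<noteq> 0 \<Longrightarrow> x \<in> K j"
    "\<And>x. x \<in> D \<Longrightarrow> (\<Sum>j<m. \<theta> j x) = 1"
proof -
  have "\<exists>r. 0 < r \<and> inward D (closure D \<inter> cball x r)" if "x \<in> closure D" for x
    using inward_local[OF D(1) sl that] by blast
  then obtain r where r: "\<And>x. x \<in> closure D \<Longrightarrow> 0 < r x \<and> inward D (closure D \<inter> cball x (r x))"
    by metis
  have cD: "compact (closure D)" using D by (simp add: compact_closure)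
  obtain I where I: "I \<subseteq> closure D" "finite I" "closure D \<subseteq> (\<Union>x\<in>I. ball x (r x / 2))"
  proof (rule compactE_image[OF cD, of "closure D" "\<lambda>x. ball x (r x / 2)"])
    show "closure D \<subseteq> (\<Union>x\<in>closure D. ball x (r x / 2))" using r by force
  qed auto
  obtain p where p: "bij_betw p {0..<card I} I" using ex_bij_betw_nat_finite[OF I(2)] by blast
  define m where "m = card I"
  have pI: "p j \<in> I" if "j < m" for j using p that by (auto simp: bij_betw_def m_def)
  have Ip: "I = p ` {..<m}" using p by (auto simp: bij_betw_def m_def atLeast0LessThan)
  define W where "W j = ball (p j) (r (p j) / 2)" for j
  define U where "U = (\<Union>j<m. W j)"
  have oU: "open U" by (auto simp: U_def W_def)
  have DU: "closure D \<subseteq> U" using I(3) by (simp add: U_def W_def Ip)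
  obtain d0 where d0: "0 < d0" "(\<Union>x\<in>closure D. ball x d0) \<subseteq> U"
    using compact_subset_open_imp_ball_epsilon_subset[OF cD oU DU] by blast
  \<comment> \<open>d0/2 keeps the mollifier within the set where the indicators add up to 1; half
    of each radius keeps the piece, which starts from the ball of half radius, within the full
    ball.\<close>
  define d where "d = Min (insert (d0 / 2) ((\<lambda>j. r (p j) / 2) ` {..<m}))"
  have rp: "0 < r (p j)" if "j < m" for j using r pI[OF that] I(1) by blast
  have d: "0 < d" using d0(1) rp by (auto simp: d_def)
  have dle: "d \<le> d0 / 2" "j < m \<Longrightarrow> d \<le> r (p j) / 2" for j
    unfolding d_def by (rule Min_le; simp)+
  obtain k where k: "mollifier k (cball 0 d)" using mollifier_exists[OF d] by blast
  then have ks: "smooth k" "continuous_on UNIV k"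
    by (auto simp: mollifier_def smooth_continuous)
  have kb: "bdd_supp k" by (rule mollifier_bdd_supp[OF k bounded_cball])
  define A where "A j = (if j < m then W j - (\<Union>i<j. W i) else {})" for j
  have Ab: "A j \<in> sets borel" "bounded (A j)" for j
    by (auto simp: A_def W_def intro: bounded_subset[OF bounded_ball])
  have intA: "integrable lborel (indicator (A j) :: scalar_field)" for j
    using Ab emeasure_bounded_finite[of "A j"] by (intro integrable_real_indicator) (auto simp: less_top)
  define \<theta> where "\<theta> j = conv k (indicator (A j))" for j
  have sA: "(\<Sum>j<m. indicator (A j) x) = (indicator U x :: real)" for x
  proof (cases "x \<in> U")
    case True
    define l where "l = (LEAST j. x \<in> W j)"
    from True obtain j where j: "j < m" "x \<in> W j" by (auto simp: U_def)
    then have l: "x \<in> W l" "l \<le> j" unfolding l_def by (auto intro: LeastI Least_le)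
    have nl: "x \<notin> W i" if "i < l" for i using not_less_Least that unfolding l_def by blast
    have "x \<in> A i \<longleftrightarrow> i = l" if "i < m" for i
      using l nl that by (auto simp: A_def) (metis lessThan_iff linorder_neqE_nat)
    then have "(\<Sum>j<m. indicator (A j) x) = (\<Sum>j<m. if j = l then 1 else 0 :: real)"
      by (intro sum.cong) (auto simp: indicator_def)
    then show ?thesis using True l j by simp
  next
    case False
    then have "x \<notin> A j" for j by (auto simp: A_def U_def)
    then show ?thesis using False by simp
  qed
  show ?thesis
  proof (rule that[of \<theta> m "\<lambda>j. closure D \<inter> cball (p j) (r (p j))"])
    show "smooth (\<theta> j)" for j unfolding \<theta>_def by (rule smooth_conv[OF intA ks(1) kb])
    show "compact (closure D \<inter> cball (p j) (r (p j)))" for j by (intro closed_Int_compact) auto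
    show "inward D (closure D \<inter> cball (p j) (r (p j)))" if "j < m" for j
      using r pI[OF that] I(1) by blast
    show "x \<in> closure D \<inter> cball (p j) (r (p j))" if j: "j < m" and x: "x \<in> D" "\<theta> j x \<noteq> 0" for j x
    proof -
      obtain y where y: "y \<in> A j" "k (x - y) \<noteq> 0"
        using x(2) conv_eq_0[of "indicator (A j)" k x] unfolding \<theta>_def by (auto simp: indicator_def)
      have "x - y \<in> cball 0 d" using y(2) k by (auto simp: mollifier_def)
      then have "dist y x \<le> r (p j) / 2" using dle(2)[OF j] by (simp add: dist_norm norm_minus_commute)
      moreover have "dist (p j) y < r (p j) / 2" using y(1) by (auto simp: A_def W_def split: if_splits)
      ultimately have "dist (p j) x \<le> r (p j)" using dist_triangle[of "p j" x y] by linarith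
      then show ?thesis using x closure_subset by auto
    qed
    show "(\<Sum>j<m. \<theta> j x) = 1" if x: "x \<in> D" for x
    proof -
      have "(\<Sum>j<m. \<theta> j x) = (LINT y|lborel. (\<Sum>j<m. k (x - y) * indicator (A j) y))"
        unfolding \<theta>_def conv_def by (rule Bochner_Integration.integral_sum[symmetric]) (rule conv_integrable[OF intA ks(2) kb])
      also have "\<dots> = (LINT y|lborel. k (x - y))"
      proof (intro Bochner_Integration.integral_cong refl)
        fix y
        have "y \<in> U" if "k (x - y) \<noteq> 0"
        proof -
          have "x - y \<in> cball 0 d" using that k by (auto simp: mollifier_def)
          then have "y \<in> ball x d0" using dle(1) d0(1) norm_minus_commute[of x y] by (simp add: dist_norm)
          then show ?thesis using d0(2) x closure_subset by blast
        qed
        then show "(\<Sum>j<m. k (x - y) * indicator (A j) y) = k (x - y)"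
          unfolding sum_distrib_left[symmetric] sA by (auto simp: indicator_def)
      qed
      also have "\<dots> = 1" by (rule mollifier_integral_reflect[OF k])
      finally show ?thesis .
    qed
  qed
qed


text \<open>L^p(D) through Borel functions on the whole space that vanish outside D: extension by
  zero is built into the representation.\<close>

definition Lz :: "real \<Rightarrow> point set \<Rightarrow> scalar_field set" where
  "Lz p D = {u \<in> borel_measurable borel. (\<forall>x. x \<notin> D \<longrightarrow> u x = 0) \<and> Np p u < \<infinity>}"

section \<open>Functions vanishing outside D and limits of their p-th power integrals\<close>

lemma Lz_Lc: "bounded D \<Longrightarrow> u \<in> Lz p D \<Longrightarrow> u \<in> Lc p"
  by (auto simp: Lz_def Lc_def bdd_supp_def bounded_iff) (metis not_le)

lemma Lz_borel: "u \<in> Lz p D \<Longrightarrow> u \<in> borel_measurable borel"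
  by (simp add: Lz_def)

lemma Lz_add:
  assumes p: "0 \<le> p" and u: "u \<in> Lz p D" and v: "v \<in> Lz p D"
  shows "(\<lambda>x. u x + v x) \<in> Lz p D"
proof -
  have [measurable]: "u \<in> borel_measurable borel" "v \<in> borel_measurable borel"
    using u v by (auto simp: Lz_def)
  have "ennreal (2 powr p) * (Np p u + Np p v) < \<infinity>"
    using u v by (auto simp: Lz_def ennreal_mult_less_top)
  then have "Np p (\<lambda>x. u x + v x) < \<infinity>"
    using Np_add[OF p, of u v] by (auto intro: order_le_less_trans)
  then show ?thesis using u v by (auto simp: Lz_def)
qed

lemma Lz_0: "0 < p \<Longrightarrow> (\<lambda>_. 0) \<in> Lz p D"
  by (simp add: Lz_def Np_def)

lemma Lz_sum: "0 < p \<Longrightarrow> (\<And>i. i \<in> I \<Longrightarrow> u i \<in> Lz p D) \<Longrightarrow> (\<lambda>x. \<Sum>i\<in>I. u i x) \<in> Lz p D"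
  by (induction I rule: infinite_finite_induct) (auto intro!: Lz_add Lz_0)

lemma Lz_mult:
  assumes p: "0 < p" and D: "bounded D" and \<phi>: "smooth \<phi>" and u: "u \<in> Lz p D"
  shows "(\<lambda>x. \<phi> x * u x) \<in> Lz p D"
proof -
  have um [measurable]: "u \<in> borel_measurable borel" "\<phi> \<in> borel_measurable borel"
    using u \<phi> by (auto simp: Lz_def)
  obtain B where B: "0 \<le> B" "\<And>x. x \<in> D \<Longrightarrow> \<bar>\<phi> x\<bar> \<le> B" using smooth_bounded_on[OF \<phi> D] by blast
  have "Np p (\<lambda>x. \<phi> x * u x) \<le> (\<integral>\<^sup>+x. ennreal (B powr p) * ennreal (\<bar>u x\<bar> powr p) \<partial>lborel)"
    unfolding Np_def
  proof (rule nn_integral_mono)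
    fix x
    have "\<bar>\<phi> x * u x\<bar> powr p \<le> B powr p * \<bar>u x\<bar> powr p"
    proof (cases "x \<in> D")
      case True
      then have "\<bar>\<phi> x\<bar> powr p \<le> B powr p" using B p by (intro powr_mono2) auto
      then show ?thesis by (simp add: abs_mult powr_mult mult_right_mono)
    qed (use u in \<open>simp add: Lz_def\<close>)
    then show "ennreal (\<bar>\<phi> x * u x\<bar> powr p) \<le> ennreal (B powr p) * ennreal (\<bar>u x\<bar> powr p)"
      by (simp add: ennreal_mult[symmetric] ennreal_leI)
  qed
  also have "\<dots> = ennreal (B powr p) * Np p u"
    unfolding Np_def by (rule nn_integral_cmult) measurable
  also have "\<dots> < \<infinity>" using u by (auto simp: Lz_def ennreal_mult_less_top)
  finally show ?thesis using u by (auto simp: Lz_def)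
qed

lemma Np_tendsto_add:
  assumes p: "0 \<le> p" and [measurable]: "\<And>n. f n \<in> borel_measurable borel" "\<And>n. g n \<in> borel_measurable borel"
    and "(\<lambda>n. Np p (f n)) \<longlonglongrightarrow> 0" "(\<lambda>n. Np p (g n)) \<longlonglongrightarrow> 0"
  shows "(\<lambda>n. Np p (\<lambda>x. f n x + g n x)) \<longlonglongrightarrow> 0"
proof (rule tendsto_sandwich[of "\<lambda>_. 0" _ _ "\<lambda>n. ennreal (2 powr p) * (Np p (f n) + Np p (g n))"])
  have "(\<lambda>n. ennreal (2 powr p) * (Np p (f n) + Np p (g n))) \<longlonglongrightarrow> ennreal (2 powr p) * (0 + 0)"
    using assms by (intro ennreal_tendsto_cmult tendsto_add) auto
  then show "(\<lambda>n. ennreal (2 powr p) * (Np p (f n) + Np p (g n))) \<longlonglongrightarrow> 0" by simp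
  show "\<forall>\<^sub>F n in sequentially. Np p (\<lambda>x. f n x + g n x) \<le> ennreal (2 powr p) * (Np p (f n) + Np p (g n))"
    using Np_add[OF p] by simp
qed simp_all

lemma Np_tendsto_sum:
  assumes p: "0 < p" and I: "finite I" and "\<And>i n. i \<in> I \<Longrightarrow> f i n \<in> borel_measurable borel"
    and "\<And>i. i \<in> I \<Longrightarrow> (\<lambda>n. Np p (f i n)) \<longlonglongrightarrow> 0"
  shows "(\<lambda>n. Np p (\<lambda>x. \<Sum>i\<in>I. f i n x)) \<longlonglongrightarrow> 0"
  using I assms(3,4)
proof (induction I rule: finite_induct)
  case empty
  show ?case by (simp add: Np_def)
next
  case (insert i I)
  have "(\<lambda>n. Np p (\<lambda>x. f i n x + (\<Sum>i\<in>I. f i n x))) \<longlonglongrightarrow> 0"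
    using p insert by (intro Np_tendsto_add borel_measurable_sum) auto
  then show ?case using insert by simp
qed

lemma Np_conv_tendsto:
  assumes p: "1 \<le> p" and f: "f \<in> Lc p" and k: "\<And>n. mollifier (k n) (cball 0 (1 / real (Suc n)))"
  shows "(\<lambda>n. Np p (\<lambda>x. conv (k n) f x - f x)) \<longlonglongrightarrow> 0"
proof (rule order_tendstoI)
  fix a :: ennreal assume a: "0 < a"
  then obtain e where e: "0 < e" "ennreal e < a"
  proof (cases a)
    case (real r)
    then show ?thesis using a that[of "r / 2"] by (simp add: ennreal_less_iff)
  qed (use that[of 1] in simp)
  obtain d where d: "0 < d" "\<And>k. mollifier k (cball 0 d) \<Longrightarrow> Np p (\<lambda>x. conv k f x - f x) \<le> ennreal e"
    using Np_conv_approx[OF p f e(1)] by blast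
  have "(\<lambda>n. 1 / real (Suc n)) \<longlonglongrightarrow> 0" by (rule LIMSEQ_Suc[OF lim_1_over_n])
  then have "\<forall>\<^sub>F n in sequentially. 1 / real (Suc n) < d" using d(1) by (rule order_tendstoD)
  then show "\<forall>\<^sub>F n in sequentially. Np p (\<lambda>x. conv (k n) f x - f x) < a"
  proof eventually_elim
    case (elim n)
    have "k n x = 0" if "x \<notin> cball 0 d" for x
      using k[of n] that elim by (auto simp: mollifier_def)
    then have "mollifier (k n) (cball 0 d)" using k[of n] by (auto simp: mollifier_def)
    from d(2)[OF this] e(2) show ?case by (rule order_le_less_trans)
  qed
qed simp

text \<open>Tested with every smooth function, of compact support or not, since the fields
  considered vanish outside a bounded set. As the test functions need not vanish at the boundary of
  D, this encodes both the divergence inside D and a zero normal trace.\<close>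

definition weak_div_UNIV :: "(3 \<Rightarrow> scalar_field) \<Rightarrow> scalar_field \<Rightarrow> bool" where
  "weak_div_UNIV v g \<longleftrightarrow> (\<forall>\<phi>. smooth \<phi> \<longrightarrow>
     (LINT x|lborel. (\<Sum>i\<in>UNIV. v i x * partial i \<phi> x)) = - (LINT x|lborel. g x * \<phi> x))"

text \<open>A single operator for all exponents: fields are approximated in L^p, their test partners
  in L^q. It acts on scalars so that a vector field is treated componentwise. Oddness and the value
  at 0 make it commute with the passage to the rows of the curl, whose entries are 0 or plus or
  minus a component.\<close>

definition approximation_scheme :: "point set \<Rightarrow> (nat \<Rightarrow> scalar_field \<Rightarrow> scalar_field) \<Rightarrow> bool" where
  "approximation_scheme D \<Lambda> \<longleftrightarrow>
     (\<forall>n u p. 1 \<le> p \<longrightarrow> u \<in> Lz p D \<longrightarrow> \<Lambda> n u \<in> test_functions D) \<and>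
     (\<forall>u p. 1 \<le> p \<longrightarrow> u \<in> Lz p D \<longrightarrow> (\<lambda>n. Np p (\<lambda>x. \<Lambda> n u x - u x)) \<longlonglongrightarrow> 0) \<and>
     (\<forall>v g p. 1 \<le> p \<longrightarrow> (\<forall>i. v i \<in> Lz p D) \<longrightarrow> g \<in> Lz p D \<longrightarrow> weak_div_UNIV v g \<longrightarrow>
       (\<lambda>n. Np p (\<lambda>x. (\<Sum>i\<in>UNIV. partial i (\<Lambda> n (v i)) x) - g x)) \<longlonglongrightarrow> 0) \<and>
     (\<forall>n u. \<Lambda> n (\<lambda>x. - u x) = (\<lambda>x. - \<Lambda> n u x)) \<and> (\<forall>n. \<Lambda> n (\<lambda>x. 0) = (\<lambda>x. 0))"

text \<open>Localise by a partition of unity, then convolve each piece with a mollifier supported in a small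
  ball whose centre points into \<open>D\<close>, so that translation and mollification happen at once.\<close>

theorem approximation:
  assumes D: "open D" "bounded D" and sl: "strongly_lipschitz D"
  obtains \<Lambda> where "approximation_scheme D \<Lambda>"
proof -
  obtain m \<theta> K where \<theta>: "\<And>j::nat. smooth (\<theta> j)"
    and K: "\<And>j. j < m \<Longrightarrow> compact (K j)" "\<And>j. j < m \<Longrightarrow> inward D (K j)"
      "\<And>j x. j < m \<Longrightarrow> x \<in> D \<Longrightarrow> \<theta> j x \<noteq> 0 \<Longrightarrow> x \<in> K j"
    and one: "\<And>x. x \<in> D \<Longrightarrow> (\<Sum>j<m. \<theta> j x) = 1"
    by (rule partition_of_unity[OF D sl]) (rule that; assumption)
  have "\<exists>z r k. j < m \<longrightarrow> 0 < r \<and> cball z r \<subseteq> cball 0 (1 / real (Suc n)) \<and>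
      (\<forall>y\<in>K j. \<forall>w\<in>cball z r. y + w \<in> D) \<and> mollifier k (cball z r)" for j n
  proof (cases "j < m")
    case True
    have "0 < 1 / real (Suc n)" by simp
    then obtain z r where zr: "0 < r" "cball z r \<subseteq> cball 0 (1 / real (Suc n))" "\<forall>y\<in>K j. \<forall>w\<in>cball z r. y + w \<in> D"
      using K(2)[OF True] unfolding inward_def by blast
    obtain k where "mollifier k (cball z r)" using mollifier_exists[OF zr(1)] by blast
    with zr show ?thesis by blast
  qed simp
  then obtain z r k where zrk: "\<And>j n. j < m \<Longrightarrow> 0 < r j n \<and> cball (z j n) (r j n) \<subseteq> cball 0 (1 / real (Suc n)) \<and>
      (\<forall>y\<in>K j. \<forall>w\<in>cball (z j n) (r j n). y + w \<in> D) \<and> mollifier (k j n) (cball (z j n) (r j n))"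
    by metis
  have ker: "mollifier (k j n) (cball 0 (1 / real (Suc n)))" if "j < m" for j n
    using zrk[OF that, of n] unfolding mollifier_def by blast
  have ks: "smooth (k j n)" "bdd_supp (k j n)" "continuous_on UNIV (k j n)" if "j < m" for j n
    using ker[OF that, of n] mollifier_bdd_supp[OF ker[OF that, of n] bounded_cball]
    by (auto simp: mollifier_def intro: smooth_continuous)
  define \<Lambda> where "\<Lambda> n u x = (\<Sum>j<m. conv (k j n) (\<lambda>y. \<theta> j y * u y) x)" for n u x
  have Lc: "(\<lambda>y. \<theta> j y * u y) \<in> Lc p" if "1 \<le> p" "u \<in> Lz p D" for j u p
    by (rule Lz_Lc[OF D(2)], rule Lz_mult[OF _ D(2) \<theta>]) (use that in auto)
  have int: "integrable lborel (\<lambda>y. \<theta> j y * u y)" if "1 \<le> p" "u \<in> Lz p D" for j u p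
    using Lc_integrable[OF that(1) Lc[OF that]] .
  have sm: "smooth (conv (k j n) (\<lambda>y. \<theta> j y * u y))" if "1 \<le> p" "u \<in> Lz p D" "j < m" for j u p n
    using smooth_conv[OF int[OF that(1,2)] ks(1,2)[OF that(3)]] .
  have "approximation_scheme D \<Lambda>"
    unfolding approximation_scheme_def
  proof (intro conjI allI impI)
    fix n u p assume p: "1 \<le> p" and u: "u \<in> Lz p D"
    have "smooth (\<Lambda> n u)"
      unfolding \<Lambda>_def[abs_def] by (rule smooth_sum) (use sm[OF p u] in auto)
    \<comment> \<open>The support is the union of the sums of K j and the kernel's ball, compact and
      inside D by the choice of the balls.\<close>
    moreover have "compact (\<Union>j<m. {y + w |y w. y \<in> K j \<and> w \<in> cball (z j n) (r j n)})"
      by (intro compact_UN compact_sums K(1)) auto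
    moreover have "(\<Union>j<m. {y + w |y w. y \<in> K j \<and> w \<in> cball (z j n) (r j n)}) \<subseteq> D"
      using zrk by blast
    moreover have "\<Lambda> n u x = 0" if x: "x \<notin> (\<Union>j<m. {y + w |y w. y \<in> K j \<and> w \<in> cball (z j n) (r j n)})" for x
      unfolding \<Lambda>_def
    proof (intro sum.neutral ballI conv_eq_0)
      fix j y assume j: "j \<in> {..<m}"
      show "\<theta> j y * u y = 0 \<or> k j n (x - y) = 0"
      proof (rule ccontr)
        assume ne: "\<not> ?thesis"
        then have "y \<in> D" using u by (auto simp: Lz_def)
        then have "y \<in> K j" using K(3)[of j y] j ne by auto
        moreover have "x - y \<in> cball (z j n) (r j n)"
          using zrk[of j n] j ne unfolding mollifier_def by auto
        moreover have "x = y + (x - y)" by simp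
        ultimately show False using x j by blast
      qed
    qed
    ultimately show "\<Lambda> n u \<in> test_functions D" unfolding test_functions_def by blast
  next
    fix u p assume p: "1 \<le> p" and u: "u \<in> Lz p D"
    have eq: "\<Lambda> n u x - u x = (\<Sum>j<m. conv (k j n) (\<lambda>y. \<theta> j y * u y) x - \<theta> j x * u x)" for n x
    proof -
      have "(\<Sum>j<m. \<theta> j x * u x) = u x"
        using one[of x] u by (cases "x \<in> D") (auto simp: Lz_def sum_distrib_right[symmetric])
      then show ?thesis by (simp add: \<Lambda>_def sum_subtractf)
    qed
    show "(\<lambda>n. Np p (\<lambda>x. \<Lambda> n u x - u x)) \<longlonglongrightarrow> 0"
      unfolding eq
    proof (rule Np_tendsto_sum)
      fix j n assume j: "j \<in> {..<m}"
      have "(\<lambda>y. \<theta> j y * u y) \<in> borel_measurable borel" using Lc[OF p u] by (simp add: Lc_def)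
      moreover have "conv (k j n) (\<lambda>y. \<theta> j y * u y) \<in> borel_measurable borel"
        using j by (intro smooth_borel sm[OF p u]) simp
      ultimately show "(\<lambda>x. conv (k j n) (\<lambda>y. \<theta> j y * u y) x - \<theta> j x * u x) \<in> borel_measurable borel"
        by (intro borel_measurable_diff)
      show "(\<lambda>n. Np p (\<lambda>x. conv (k j n) (\<lambda>y. \<theta> j y * u y) x - \<theta> j x * u x)) \<longlonglongrightarrow> 0"
        using j by (intro Np_conv_tendsto[OF p Lc[OF p u]] ker) simp
    qed (use p in auto)
  next
    fix v :: "3 \<Rightarrow> scalar_field" and g p
    assume p: "1 \<le> p" and v': "\<forall>i. v i \<in> Lz p D" and g: "g \<in> Lz p D" and w: "weak_div_UNIV v g"
    have v: "v i \<in> Lz p D" for i using v' by blast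
    \<comment> \<open>The divergence of \<theta> times v by the product rule.\<close>
    define G where "G j y = \<theta> j y * g y + (\<Sum>i\<in>UNIV. partial i (\<theta> j) y * v i y)" for j y
    have GLz: "G j \<in> Lz p D" for j
      unfolding G_def[abs_def] using p
      by (intro Lz_add Lz_sum Lz_mult[OF _ D(2)] smooth_partial \<theta> v g) auto
    have GLc: "G j \<in> Lc p" for j using Lz_Lc[OF D(2) GLz] .
    have intG: "integrable lborel (G j)" for j using Lc_integrable[OF p GLc] .
    have part: "(\<Sum>i\<in>UNIV. partial i (conv (k j n) (\<lambda>y. \<theta> j y * v i y)) x) = conv (k j n) (G j) x" if j: "j < m" for j n x
    proof -
      let ?k = "k j n"
      \<comment> \<open>This function of y is the test function in the weak divergence. The
        derivative of the reflected kernel has a minus sign, so the identity turns the divergence of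
        the convolutions into the convolution of G.\<close>
      define \<phi> where "\<phi> y = ?k (x - y) * \<theta> j y" for y
      have kx: "smooth (\<lambda>y. ?k (x - y))" by (rule smooth_reflect[OF ks(1)[OF j]])
      have \<phi>: "smooth \<phi>" unfolding \<phi>_def[abs_def] by (rule smooth_mult[OF kx \<theta>])
      have d\<phi>: "partial i \<phi> y = ?k (x - y) * partial i (\<theta> j) y - partial i ?k (x - y) * \<theta> j y" for i y
        unfolding \<phi>_def[abs_def]
        using partial_mult[OF smooth_differentiable[OF kx] smooth_differentiable[OF \<theta>[of j]], of i y]
        by (simp add: partial_reflect[OF ks(1)[OF j]])
      have i1: "integrable lborel (\<lambda>y. partial i ?k (x - y) * (\<theta> j y * v i y))" for i
        by (rule conv_integrable[OF int[OF p v] smooth_continuous[OF smooth_partial[OF ks(1)[OF j]]] bdd_supp_partial[OF ks(2)[OF j]]])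
      have i2: "integrable lborel (\<lambda>y. ?k (x - y) * G j y)"
        by (rule conv_integrable[OF intG ks(3,2)[OF j]])
      have i3: "integrable lborel (\<lambda>y. g y * \<phi> y)"
      proof -
        have "integrable lborel (\<lambda>y. ?k (x - y) * (\<theta> j y * g y))"
          by (rule conv_integrable[OF int[OF p g] ks(3,2)[OF j]])
        then show ?thesis by (simp add: \<phi>_def mult_ac)
      qed
      have i4: "integrable lborel (\<lambda>y. \<Sum>i\<in>UNIV. partial i ?k (x - y) * (\<theta> j y * v i y))"
        by (rule Bochner_Integration.integrable_sum) (rule i1)
      have eq: "(\<Sum>i\<in>UNIV. v i y * partial i \<phi> y) = ?k (x - y) * G j y - g y * \<phi> y
          - (\<Sum>i\<in>UNIV. partial i ?k (x - y) * (\<theta> j y * v i y))" for y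
        unfolding d\<phi> G_def \<phi>_def
        by (simp add: sum_subtractf right_diff_distrib distrib_left sum_distrib_left mult_ac)
      have "(\<Sum>i\<in>UNIV. partial i (conv ?k (\<lambda>y. \<theta> j y * v i y)) x) = (\<Sum>i\<in>UNIV. conv (partial i ?k) (\<lambda>y. \<theta> j y * v i y) x)"
        by (simp only: partial_conv[OF int[OF p v] ks(1,2)[OF j]])
      also have "\<dots> = (LINT y|lborel. (\<Sum>i\<in>UNIV. partial i ?k (x - y) * (\<theta> j y * v i y)))"
        unfolding conv_def by (rule Bochner_Integration.integral_sum[symmetric]) (rule i1)
      also have "\<dots> = (LINT y|lborel. ?k (x - y) * G j y)"
      proof -
        have "(LINT y|lborel. (\<Sum>i\<in>UNIV. v i y * partial i \<phi> y)) = - (LINT y|lborel. g y * \<phi> y)"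
          using w \<phi> by (simp add: weak_div_UNIV_def)
        then show ?thesis
          unfolding eq Bochner_Integration.integral_diff[OF Bochner_Integration.integrable_diff[OF i2 i3] i4]
            Bochner_Integration.integral_diff[OF i2 i3] by simp
      qed
      finally show ?thesis by (simp add: conv_def)
    qed
    have Gsum: "(\<Sum>j<m. G j x) = g x" for x
    proof (cases "x \<in> D")
      case True
      \<comment> \<open>The sum of the \<theta> is constant on the open set D. Hence the terms with
        derivatives of the cutoffs cancel, and the pieces G j add up to g.\<close>
      have "(\<Sum>j<m. partial i (\<theta> j) x) = 0" for i
      proof -
        have "((\<lambda>x. \<Sum>j<m. \<theta> j x) has_derivative (\<lambda>_. 0)) (at x)"
          by (rule has_derivative_transform_within_open[OF has_derivative_const[of 1] D(1) True]) (simp add: one)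
        then have "partial i (\<lambda>x. \<Sum>j<m. \<theta> j x) x = 0" by (rule partialI)
        then show ?thesis using partial_sum[of "{..<m}" \<theta> i x] \<theta> by simp
      qed
      then show ?thesis
        using one[OF True]
        by (simp add: G_def sum.distrib sum_distrib_right[symmetric] sum.swap[of _ UNIV "{..<m}"])
    next
      case False
      then show ?thesis using v g by (simp add: G_def Lz_def)
    qed
    have eq: "(\<Sum>i\<in>UNIV. partial i (\<Lambda> n (v i)) x) - g x = (\<Sum>j<m. conv (k j n) (G j) x - G j x)" for n x
    proof -
      have "partial i (\<Lambda> n (v i)) x = (\<Sum>j<m. partial i (conv (k j n) (\<lambda>y. \<theta> j y * v i y)) x)" for i
        unfolding \<Lambda>_def[abs_def] by (rule partial_sum) (use sm[OF p v] in auto)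
      then have "(\<Sum>i\<in>UNIV. partial i (\<Lambda> n (v i)) x) = (\<Sum>j<m. \<Sum>i\<in>UNIV. partial i (conv (k j n) (\<lambda>y. \<theta> j y * v i y)) x)"
        by (simp add: sum.swap[of _ "{..<m}"])
      also have "\<dots> = (\<Sum>j<m. conv (k j n) (G j) x)" by (intro sum.cong refl part) simp
      finally show ?thesis by (simp add: sum_subtractf Gsum)
    qed
    show "(\<lambda>n. Np p (\<lambda>x. (\<Sum>i\<in>UNIV. partial i (\<Lambda> n (v i)) x) - g x)) \<longlonglongrightarrow> 0"
      unfolding eq
    proof (rule Np_tendsto_sum)
      fix j n assume j: "j \<in> {..<m}"
      show "(\<lambda>x. conv (k j n) (G j) x - G j x) \<in> borel_measurable borel"
        using j by (intro borel_measurable_diff Lz_borel[OF GLz] smooth_borel smooth_conv[OF intG] ks) auto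
      show "(\<lambda>n. Np p (\<lambda>x. conv (k j n) (G j) x - G j x)) \<longlonglongrightarrow> 0"
        using j by (intro Np_conv_tendsto[OF p GLc] ker) simp
    qed (use p in auto)
  next
    show "\<Lambda> n (\<lambda>x. - u x) = (\<lambda>x. - \<Lambda> n u x)" for n u
      by (simp add: \<Lambda>_def conv_def sum_negf fun_eq_iff)
    show "\<Lambda> n (\<lambda>x. 0) = (\<lambda>x. 0)" for n by (simp add: \<Lambda>_def conv_def fun_eq_iff)
  qed
  then show ?thesis by (rule that)
qed

section \<open>Duality pairings\<close>

lemma conj_exponent_gt_1: "1 < p \<Longrightarrow> 1 < conj_exponent p"
  by (simp add: conj_exponent_def)

lemma conj_exponent_involution: "1 < p \<Longrightarrow> conj_exponent (conj_exponent p) = p"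
  by (simp add: conj_exponent_def field_simps)

lemma Lz_powr_integrable:
  assumes u: "u \<in> Lz p D"
  shows "integrable lborel (\<lambda>x. \<bar>u x\<bar> powr p)"
proof (rule integrableI_nonneg)
  have [measurable]: "u \<in> borel_measurable borel" using u by (rule Lz_borel)
  show "(\<lambda>x. \<bar>u x\<bar> powr p) \<in> borel_measurable lborel" by measurable
  show "(\<integral>\<^sup>+x. ennreal (\<bar>u x\<bar> powr p) \<partial>lborel) < \<infinity>" using u by (simp add: Lz_def Np_def)
qed simp

lemma Np_eq_integral: "u \<in> Lz p D \<Longrightarrow> Np p u = ennreal (LINT x|lborel. \<bar>u x\<bar> powr p)"
  unfolding Np_def by (rule nn_integral_eq_integral[OF Lz_powr_integrable]) simp_all

lemma Lz_minus: "u \<in> Lz p D \<Longrightarrow> (\<lambda>x. - u x) \<in> Lz p D"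
  by (simp add: Lz_def Np_minus)

lemma Lz_diff: "0 \<le> p \<Longrightarrow> u \<in> Lz p D \<Longrightarrow> v \<in> Lz p D \<Longrightarrow> (\<lambda>x. u x - v x) \<in> Lz p D"
  using Lz_add[OF _ _ Lz_minus, of p u D v] by simp

lemma Lz_holder_integrable:
  assumes "1 < p" "f \<in> Lz p D" "g \<in> Lz (conj_exponent p) D"
  shows "integrable lborel (\<lambda>x. f x * g x)"
  by (rule holder_integrable[OF assms(1)])
    (use assms in \<open>auto intro: Lz_powr_integrable Lz_borel\<close>)

lemma Lz_holder_tendsto:
  assumes p: "1 < p" and f: "f \<in> Lz p D"
    and g: "\<And>n. g n \<in> Lz (conj_exponent p) D" "g0 \<in> Lz (conj_exponent p) D"
    and lim: "(\<lambda>n. Np (conj_exponent p) (\<lambda>x. g n x - g0 x)) \<longlonglongrightarrow> 0"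
  shows "(\<lambda>n. LINT x|lborel. f x * g n x) \<longlonglongrightarrow> (LINT x|lborel. f x * g0 x)"
proof -
  let ?q = "conj_exponent p"
  have q: "1 < ?q" using p by (rule conj_exponent_gt_1)
  have d: "(\<lambda>x. g n x - g0 x) \<in> Lz ?q D" for n using q g by (intro Lz_diff) auto
  have "(\<lambda>n. ennreal (LINT x|lborel. \<bar>g n x - g0 x\<bar> powr ?q)) \<longlonglongrightarrow> ennreal 0"
    using lim by (simp add: Np_eq_integral[OF d])
  then have l: "(\<lambda>n. LINT x|lborel. \<bar>g n x - g0 x\<bar> powr ?q) \<longlonglongrightarrow> 0"
    by (subst (asm) tendsto_ennreal_iff) (auto intro!: always_eventually integral_nonneg_AE)
  have 0: "(\<lambda>n. LINT x|lborel. \<bar>f x * (g n x - g0 x)\<bar>) \<longlonglongrightarrow> 0"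
    by (rule holder_tendsto_0[OF p _ _ _ _ l])
      (use f in \<open>auto intro: Lz_powr_integrable[OF d] Lz_powr_integrable Lz_borel simp: borel_measurable_diff Lz_borel[OF g(1)] Lz_borel[OF g(2)]\<close>)
  have eq: "(LINT x|lborel. f x * g n x) - (LINT x|lborel. f x * g0 x) = (LINT x|lborel. f x * (g n x - g0 x))" for n
    unfolding right_diff_distrib
    by (rule Bochner_Integration.integral_diff[symmetric]) (rule Lz_holder_integrable[OF p f g(1)] Lz_holder_integrable[OF p f g(2)])+
  have "(\<lambda>n. (LINT x|lborel. f x * g n x) - (LINT x|lborel. f x * g0 x)) \<longlonglongrightarrow> 0"
    unfolding eq by (rule Lim_null_comparison[OF _ 0]) (auto intro!: always_eventually integral_abs_bound)
  then show ?thesis by (rule LIM_zero_cancel)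
qed

text \<open>For \<open>b\<close> the divergence of \<open>a\<close> and \<open>G\<close> the gradient of \<open>w\<close>, this is the boundary term of Green's
  formula; the roles of \<open>(a, b)\<close> and \<open>(G, w)\<close> are symmetric.\<close>

definition pairing :: "(3 \<Rightarrow> scalar_field) \<Rightarrow> scalar_field \<Rightarrow> scalar_field \<Rightarrow> (3 \<Rightarrow> scalar_field) \<Rightarrow> real" where
  "pairing a b w G = (LINT x|lborel. (\<Sum>i\<in>UNIV. a i x * G i x) + b x * w x)"

lemma pairing_integrable:
  assumes p: "1 < p" and a: "\<And>i. a i \<in> Lz p D" and b: "b \<in> Lz p D"
    and w: "w \<in> Lz (conj_exponent p) D" and G: "\<And>i. G i \<in> Lz (conj_exponent p) D"
  shows "integrable lborel (\<lambda>x. (\<Sum>i\<in>UNIV. a i x * G i x) + b x * w x)"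
  by (intro Bochner_Integration.integrable_add Bochner_Integration.integrable_sum
      Lz_holder_integrable[OF p a G] Lz_holder_integrable[OF p b w])

lemma pairing_eq_sum:
  assumes p: "1 < p" and a: "\<And>i. a i \<in> Lz p D" and b: "b \<in> Lz p D"
    and w: "w \<in> Lz (conj_exponent p) D" and G: "\<And>i. G i \<in> Lz (conj_exponent p) D"
  shows "pairing a b w G = (\<Sum>i\<in>UNIV. (LINT x|lborel. a i x * G i x)) + (LINT x|lborel. b x * w x)"
proof -
  have "pairing a b w G = (LINT x|lborel. (\<Sum>i\<in>UNIV. a i x * G i x)) + (LINT x|lborel. b x * w x)"
    unfolding pairing_def
    by (rule Bochner_Integration.integral_add)
      (intro Bochner_Integration.integrable_sum Lz_holder_integrable[OF p a G], rule Lz_holder_integrable[OF p b w])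
  also have "(LINT x|lborel. (\<Sum>i\<in>UNIV. a i x * G i x)) = (\<Sum>i\<in>UNIV. (LINT x|lborel. a i x * G i x))"
    by (rule Bochner_Integration.integral_sum) (rule Lz_holder_integrable[OF p a G])
  finally show ?thesis .
qed

lemma pairing_commute: "pairing a b w G = pairing G w b a"
  by (simp add: pairing_def mult.commute)

lemma pairing_tendsto:
  assumes p: "1 < p" and a: "\<And>i. a i \<in> Lz p D" and b: "b \<in> Lz p D"
    and w: "\<And>n. w n \<in> Lz (conj_exponent p) D" "w0 \<in> Lz (conj_exponent p) D"
    and G: "\<And>n i. G n i \<in> Lz (conj_exponent p) D" "\<And>i. G0 i \<in> Lz (conj_exponent p) D"
    and lw: "(\<lambda>n. Np (conj_exponent p) (\<lambda>x. w n x - w0 x)) \<longlonglongrightarrow> 0"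
    and lG: "\<And>i. (\<lambda>n. Np (conj_exponent p) (\<lambda>x. G n i x - G0 i x)) \<longlonglongrightarrow> 0"
  shows "(\<lambda>n. pairing a b (w n) (G n)) \<longlonglongrightarrow> pairing a b w0 G0"
  unfolding pairing_eq_sum[OF p a b w(1) G(1)] pairing_eq_sum[OF p a b w(2) G(2)]
  by (intro tendsto_add tendsto_sum Lz_holder_tendsto[OF p a G(1) G(2) lG] Lz_holder_tendsto[OF p b w lw])

lemma Lz_smooth:
  assumes p: "0 < p" and D: "bounded D" "D \<in> sets borel" and \<phi>: "smooth \<phi>"
  shows "(\<lambda>x. indicator D x * \<phi> x) \<in> Lz p D"
proof -
  have m: "(\<lambda>x. indicator D x * \<phi> x) \<in> borel_measurable borel"
    using borel_measurable_indicator_mult[OF D(2) smooth_borel[OF \<phi>]] by simp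
  obtain B where B: "0 \<le> B" "\<And>x. x \<in> D \<Longrightarrow> \<bar>\<phi> x\<bar> \<le> B" using smooth_bounded_on[OF \<phi> D(1)] by blast
  have "Np p (\<lambda>x. indicator D x * \<phi> x) \<le> (\<integral>\<^sup>+x. ennreal (B powr p) * indicator D x \<partial>lborel)"
    unfolding Np_def
  proof (rule nn_integral_mono)
    fix x
    have "\<bar>\<phi> x\<bar> powr p \<le> B powr p" if "x \<in> D" using B(2)[OF that] p by (intro powr_mono2) auto
    then show "ennreal (\<bar>indicator D x * \<phi> x\<bar> powr p) \<le> ennreal (B powr p) * indicator D x"
      by (auto simp: indicator_def intro: ennreal_leI)
  qed
  also have "\<dots> = ennreal (B powr p) * emeasure lborel D"
    using D(2) by (simp add: nn_integral_cmult_indicator)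
  also have "\<dots> < \<infinity>"
    using emeasure_bounded_finite[OF D(1)] by (auto simp: ennreal_mult_less_top less_top)
  finally show ?thesis using m by (simp add: Lz_def)
qed

lemma test_functions_smooth: "f \<in> test_functions D \<Longrightarrow> smooth f"
  by (simp add: test_functions_def)

lemma test_functions_zero: "f \<in> test_functions D \<Longrightarrow> x \<notin> D \<Longrightarrow> f x = 0"
  by (auto simp: test_functions_def)

lemma test_functions_partial:
  assumes "f \<in> test_functions D"
  shows "partial i f \<in> test_functions D"
proof -
  obtain K where K: "compact K" "K \<subseteq> D" "\<And>x. x \<notin> K \<Longrightarrow> f x = 0" using assms by (auto simp: test_functions_def)
  have "partial i f x = 0" if "x \<notin> K" for x
  proof -
    have "open (- K)" using K(1) by (simp add: compact_imp_closed open_Compl)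
    then have "(f has_derivative (\<lambda>_. 0)) (at x)"
      by (rule has_derivative_transform_within_open[OF has_derivative_const[of 0]]) (use that K in auto)
    then show ?thesis by (rule partialI)
  qed
  then show ?thesis
    using K smooth_partial[OF test_functions_smooth[OF assms]] unfolding test_functions_def by blast
qed

lemma test_functions_Lz:
  assumes "0 < p" "bounded D" "D \<in> sets borel" and f: "f \<in> test_functions D"
  shows "f \<in> Lz p D"
proof -
  have "(\<lambda>x. indicator D x * f x) = f"
    using test_functions_zero[OF f] by (auto simp: indicator_def fun_eq_iff)
  with Lz_smooth[OF assms(1-3) test_functions_smooth[OF f]] show ?thesis by simp
qed

text \<open>The distributional divergence inside D, in contrast to \<open>weak_div_UNIV\<close>:
  test functions that vanish near the boundary see no trace.\<close>

definition weak_div_on :: "point set \<Rightarrow> (3 \<Rightarrow> scalar_field) \<Rightarrow> scalar_field \<Rightarrow> bool" where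
  "weak_div_on D a b \<longleftrightarrow> (\<forall>\<phi>\<in>test_functions D. pairing a b \<phi> (\<lambda>i. partial i \<phi>) = 0)"

lemma Lz_smooth_mult_integrable:
  assumes p: "1 \<le> p" and D: "bounded D" and u: "u \<in> Lz p D" and \<phi>: "smooth \<phi>"
  shows "integrable lborel (\<lambda>x. u x * \<phi> x)"
  using Lc_integrable[OF p Lz_Lc[OF D Lz_mult[OF _ D \<phi> u]]] p by (simp add: mult.commute)

lemma weak_div_UNIV_iff:
  assumes p: "1 \<le> p" and D: "bounded D" and a: "\<And>i. a i \<in> Lz p D" and b: "b \<in> Lz p D"
  shows "weak_div_UNIV a b \<longleftrightarrow> (\<forall>\<phi>. smooth \<phi> \<longrightarrow> pairing a b \<phi> (\<lambda>i. partial i \<phi>) = 0)"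
proof -
  have "pairing a b \<phi> (\<lambda>i. partial i \<phi>) =
      (LINT x|lborel. (\<Sum>i\<in>UNIV. a i x * partial i \<phi> x)) + (LINT x|lborel. b x * \<phi> x)" if "smooth \<phi>" for \<phi>
    unfolding pairing_def
    by (rule Bochner_Integration.integral_add)
      (intro Bochner_Integration.integrable_sum Lz_smooth_mult_integrable[OF p D a] smooth_partial that,
        rule Lz_smooth_mult_integrable[OF p D b that])
  then show ?thesis unfolding weak_div_UNIV_def by (auto simp: eq_neg_iff_add_eq_0)
qed

text \<open>The integral of the i-th derivative of f n times \<phi> is bounded by a multiple of the
  boundary integral of \<bar>f n\<bar> and so tends to 0. By the product rule it also tends to the
  integral of w times the derivative of \<phi> plus G \<phi>. The result is phrased for the field w
  e_i so that the approximation of divergences applies to partial derivatives.\<close>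

lemma zero_trace_weak_div_UNIV:
  assumes D: "open D" "bounded D" and fin: "hausdorff2_outer (frontier D) < \<infinity>" and q: "1 < q"
    and f: "\<And>n::nat. smooth (f n)" and w: "w \<in> Lz q D" and G: "G \<in> Lz q D"
    and lw: "(\<lambda>n. Np q (\<lambda>x. indicator D x * f n x - w x)) \<longlonglongrightarrow> 0"
    and lG: "(\<lambda>n. Np q (\<lambda>x. indicator D x * partial i (f n) x - G x)) \<longlonglongrightarrow> 0"
    and lb: "(\<lambda>n. \<integral>\<^sup>+x. ennreal \<bar>f n x\<bar> \<partial>surface_measure D) \<longlonglongrightarrow> 0"
  shows "weak_div_UNIV (\<lambda>j. if j = i then w else (\<lambda>_. 0)) G"
  unfolding weak_div_UNIV_def
proof (intro allI impI)
  fix \<phi> assume \<phi>: "smooth \<phi>"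
  define p where "p = conj_exponent q"
  have p: "1 < p" "conj_exponent p = q"
    using q by (simp_all add: p_def conj_exponent_gt_1 conj_exponent_involution)
  have Db: "D \<in> sets borel" using D by simp
  have Lq: "(\<lambda>x. indicator D x * h x) \<in> Lz (conj_exponent p) D" "(\<lambda>x. indicator D x * h x) \<in> Lz p D" if "smooth h" for h
    using p q by (auto intro!: Lz_smooth D(2) Db that)
  let ?I = "\<lambda>n. LINT y|lborel. indicator D y * partial i (\<lambda>x. f n x * \<phi> x) y"
  obtain B where B: "0 \<le> B" "\<And>x. x \<in> frontier D \<Longrightarrow> \<bar>\<phi> x\<bar> \<le> B"
    using smooth_bounded_on[OF \<phi> compact_imp_bounded[OF compact_frontier_bounded[OF D(2)]]] by blast
  have bd: "ennreal \<bar>?I n\<bar> \<le> ennreal (16 * B) * (\<integral>\<^sup>+x. ennreal \<bar>f n x\<bar> \<partial>surface_measure D)" for n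
  proof -
    have fm: "f n \<in> borel_measurable (surface_measure D)"
      unfolding surface_measure_def using smooth_borel[OF f] by (intro measurable_restrict_space1) simp
    have "ennreal \<bar>?I n\<bar> \<le> 16 * (\<integral>\<^sup>+x. ennreal \<bar>f n x * \<phi> x\<bar> \<partial>surface_measure D)"
      by (rule divergence_inequality[OF D fin smooth_mult[OF f \<phi>]])
    also have "\<dots> \<le> 16 * (\<integral>\<^sup>+x. ennreal B * ennreal \<bar>f n x\<bar> \<partial>surface_measure D)"
    proof (intro mult_left_mono nn_integral_mono)
      fix x assume "x \<in> space (surface_measure D)"
      then have "\<bar>\<phi> x\<bar> \<le> B" by (intro B(2)) (simp add: surface_measure_def space_restrict_space)
      then have "\<bar>f n x * \<phi> x\<bar> \<le> B * \<bar>f n x\<bar>" by (simp add: abs_mult mult.commute mult_right_mono)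
      then show "ennreal \<bar>f n x * \<phi> x\<bar> \<le> ennreal B * ennreal \<bar>f n x\<bar>"
        using B(1) by (simp add: ennreal_mult[symmetric] ennreal_leI)
    qed simp
    also have "\<dots> = 16 * (ennreal B * (\<integral>\<^sup>+x. ennreal \<bar>f n x\<bar> \<partial>surface_measure D))"
      using fm by (subst nn_integral_cmult) auto
    also have "\<dots> = ennreal (16 * B) * (\<integral>\<^sup>+x. ennreal \<bar>f n x\<bar> \<partial>surface_measure D)"
      using B(1) by (simp add: ennreal_mult mult.assoc)
    finally show ?thesis .
  qed
  have "(\<lambda>n. ennreal (16 * B) * (\<integral>\<^sup>+x. ennreal \<bar>f n x\<bar> \<partial>surface_measure D)) \<longlonglongrightarrow> ennreal (16 * B) * 0"
    by (intro ennreal_tendsto_cmult lb) simp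
  then have ub: "(\<lambda>n. ennreal (16 * B) * (\<integral>\<^sup>+x. ennreal \<bar>f n x\<bar> \<partial>surface_measure D)) \<longlonglongrightarrow> 0"
    by (simp only: mult_zero_right)
  have "(\<lambda>n. ennreal \<bar>?I n\<bar>) \<longlonglongrightarrow> 0"
  proof (rule tendsto_sandwich[OF _ _ tendsto_const ub])
    show "\<forall>\<^sub>F n in sequentially. 0 \<le> ennreal \<bar>?I n\<bar>" by (rule always_eventually) simp
    show "\<forall>\<^sub>F n in sequentially. ennreal \<bar>?I n\<bar> \<le> ennreal (16 * B) * (\<integral>\<^sup>+x. ennreal \<bar>f n x\<bar> \<partial>surface_measure D)"
      by (rule always_eventually) (rule allI, rule bd)
  qed
  then have "(\<lambda>n. ennreal \<bar>?I n\<bar>) \<longlonglongrightarrow> ennreal 0" by (simp only: ennreal_0)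
  then have "(\<lambda>n. \<bar>?I n\<bar>) \<longlonglongrightarrow> 0"
    by (rule tendsto_ennrealD) (rule always_eventually, simp, simp)
  then have 1: "?I \<longlonglongrightarrow> 0" by (rule tendsto_rabs_zero_cancel)
  let ?J = "\<lambda>n. (LINT y|lborel. (indicator D y * partial i \<phi> y) * (indicator D y * f n y))
      + (LINT y|lborel. (indicator D y * \<phi> y) * (indicator D y * partial i (f n) y))"
  have IJ: "?I n = ?J n" for n
  proof -
    have "indicator D y * partial i (\<lambda>x. f n x * \<phi> x) y = (indicator D y * partial i \<phi> y) * (indicator D y * f n y)
      + (indicator D y * \<phi> y) * (indicator D y * partial i (f n) y)" for y
      using partial_mult[OF smooth_differentiable[OF f[of n]] smooth_differentiable[OF \<phi>], of i y]
      by (auto simp: indicator_def)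
    then show ?thesis
      using Lz_holder_integrable[OF p(1) Lq(2)[OF smooth_partial[OF \<phi>]] Lq(1)[OF f]]
        Lz_holder_integrable[OF p(1) Lq(2)[OF \<phi>] Lq(1)[OF smooth_partial[OF f]]]
      by (simp only: Bochner_Integration.integral_add)
  qed
  have "?J \<longlonglongrightarrow> (LINT y|lborel. (indicator D y * partial i \<phi> y) * w y) + (LINT y|lborel. (indicator D y * \<phi> y) * G y)"
  proof (rule tendsto_add)
    note [simp] = p(2)
    show "(\<lambda>n. LINT y|lborel. (indicator D y * partial i \<phi> y) * (indicator D y * f n y)) \<longlonglongrightarrow>
        (LINT y|lborel. (indicator D y * partial i \<phi> y) * w y)"
      by (rule Lz_holder_tendsto[OF p(1) Lq(2)[OF smooth_partial[OF \<phi>]] Lq(1)[OF f]]) (simp_all add: w lw)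
    show "(\<lambda>n. LINT y|lborel. (indicator D y * \<phi> y) * (indicator D y * partial i (f n) y)) \<longlonglongrightarrow>
        (LINT y|lborel. (indicator D y * \<phi> y) * G y)"
      by (rule Lz_holder_tendsto[OF p(1) Lq(2)[OF \<phi>] Lq(1)[OF smooth_partial[OF f]]]) (simp_all add: G lG)
  qed
  with 1 have "(LINT y|lborel. (indicator D y * partial i \<phi> y) * w y) + (LINT y|lborel. (indicator D y * \<phi> y) * G y) = 0"
    unfolding IJ by (intro LIMSEQ_unique[of ?J])
  moreover have "(indicator D y * partial i \<phi> y) * w y = (\<Sum>j\<in>UNIV. (if j = i then w else (\<lambda>_. 0)) y * partial j \<phi> y)" for y
  proof -
    have "(if j = i then w else (\<lambda>_. 0)) y * partial j \<phi> y = (if j = i then w y * partial i \<phi> y else 0)" for j by simp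
    then have "(\<Sum>j\<in>UNIV. (if j = i then w else (\<lambda>_. 0)) y * partial j \<phi> y) = w y * partial i \<phi> y"
      by (simp only: sum.delta[OF finite] UNIV_I if_True)
    then show ?thesis using w by (auto simp: Lz_def indicator_def)
  qed
  moreover have "(indicator D y * \<phi> y) * G y = G y * \<phi> y" for y
    using G by (auto simp: Lz_def indicator_def)
  ultimately show "(LINT x|lborel. (\<Sum>j\<in>UNIV. (if j = i then w else (\<lambda>_. 0)) x * partial j \<phi> x)) = - (LINT x|lborel. G x * \<phi> x)"
    by simp
qed

text \<open>The approximations of w are test functions, whose pairing vanishes by
  \<open>weak_div_on\<close>. Their i-th derivative converges to \<open>G i\<close>, being the
  divergence of the approximation of w e_i, and the pairing is continuous.\<close>

lemma zero_extension_pairing_eq_0: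
  assumes D: "open D" "bounded D" and sl: "strongly_lipschitz D" and p: "1 < p"
    and a: "\<And>i. a i \<in> Lz p D" and b: "b \<in> Lz p D" and ab: "weak_div_on D a b"
    and w: "w \<in> Lz (conj_exponent p) D" and G: "\<And>i. G i \<in> Lz (conj_exponent p) D"
    and wG: "\<And>i. weak_div_UNIV (\<lambda>j. if j = i then w else (\<lambda>_. 0)) (G i)"
  shows "pairing a b w G = 0"
proof -
  let ?q = "conj_exponent p"
  have q: "1 \<le> ?q" using conj_exponent_gt_1[OF p] by simp
  have Db: "D \<in> sets borel" using D by simp
  obtain \<Lambda> where "approximation_scheme D \<Lambda>" by (rule approximation[OF D sl])
  then have t: "\<And>n u p. 1 \<le> p \<Longrightarrow> u \<in> Lz p D \<Longrightarrow> \<Lambda> n u \<in> test_functions D"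
    and l: "\<And>u p. 1 \<le> p \<Longrightarrow> u \<in> Lz p D \<Longrightarrow> (\<lambda>n. Np p (\<lambda>x. \<Lambda> n u x - u x)) \<longlonglongrightarrow> 0"
    and ld: "\<And>v g p. 1 \<le> p \<Longrightarrow> \<forall>i. v i \<in> Lz p D \<Longrightarrow> g \<in> Lz p D \<Longrightarrow> weak_div_UNIV v g \<Longrightarrow>
      (\<lambda>n. Np p (\<lambda>x. (\<Sum>i\<in>UNIV. partial i (\<Lambda> n (v i)) x) - g x)) \<longlonglongrightarrow> 0"
    and z: "\<And>n. \<Lambda> n (\<lambda>x. 0) = (\<lambda>x. 0)"
    unfolding approximation_scheme_def by simp_all
  have tw: "\<Lambda> n w \<in> test_functions D" for n using t[OF q w] .
  have "(\<lambda>n. pairing a b (\<Lambda> n w) (\<lambda>i. partial i (\<Lambda> n w))) \<longlonglongrightarrow> pairing a b w G"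
  proof (rule pairing_tendsto[OF p a b _ w _ G l[OF q w]])
    show "\<Lambda> n w \<in> Lz ?q D" "partial i (\<Lambda> n w) \<in> Lz ?q D" for n i
      using q by (auto intro!: test_functions_Lz D Db tw test_functions_partial)
    have "(\<lambda>n. Np ?q (\<lambda>x. (\<Sum>j\<in>UNIV. partial j (\<Lambda> n (if j = i then w else (\<lambda>_. 0))) x) - G i x)) \<longlonglongrightarrow> 0" for i
      by (rule ld[OF q _ G wG]) (use w q in \<open>auto intro: Lz_0\<close>)
    moreover have "(\<Sum>j\<in>UNIV. partial j (\<Lambda> n (if j = i then w else (\<lambda>_. 0))) x) = partial i (\<Lambda> n w) x" for i n x
    proof -
      have "partial j (\<Lambda> n (if j = i then w else (\<lambda>_. 0))) x = (if j = i then partial i (\<Lambda> n w) x else 0)" for j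
        by (simp add: z)
      then show ?thesis by (simp only: sum.delta[OF finite] UNIV_I if_True)
    qed
    ultimately show "(\<lambda>n. Np ?q (\<lambda>x. partial i (\<Lambda> n w) x - G i x)) \<longlonglongrightarrow> 0" for i by simp
  qed
  moreover have "pairing a b (\<Lambda> n w) (\<lambda>i. partial i (\<Lambda> n w)) = 0" for n
    using ab tw unfolding weak_div_on_def by blast
  ultimately have "(\<lambda>n::nat. 0) \<longlonglongrightarrow> pairing a b w G" by simp
  then show ?thesis by (rule LIMSEQ_unique[OF _ tendsto_const])
qed

text \<open>On V the mollified function is 0, so the integral of \<bar>G\<bar> over V is at most the
  L^1 error of mollification, which is arbitrarily small.\<close>

lemma fundamental_lemma_AE:
  assumes G: "G \<in> Lc 1" and d: "0 < d" and V: "V \<in> sets borel"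
    and z: "\<And>x k. x \<in> V \<Longrightarrow> mollifier k (cball 0 d) \<Longrightarrow> conv k G x = 0"
  shows "AE x in lborel. x \<in> V \<longrightarrow> G x = 0"
proof -
  have Gm: "G \<in> borel_measurable borel" using G by (simp add: Lc_def)
  have m: "(\<lambda>x. indicator V x * G x) \<in> borel_measurable lborel"
    by (rule borel_measurable_indicator_mult[OF V Gm])
  have "(\<integral>\<^sup>+x. ennreal \<bar>indicator V x * G x\<bar> \<partial>lborel) \<le> 0"
  proof (rule ennreal_le_epsilon)
    fix e :: real assume e: "0 < e"
    obtain d' where d': "0 < d'" "\<And>k. mollifier k (cball 0 d') \<Longrightarrow> Np 1 (\<lambda>x. conv k G x - G x) \<le> ennreal e"
      using Np_conv_approx[OF order_refl G e] by blast
    obtain k where k: "mollifier k (cball 0 (min d d'))" using mollifier_exists[of "min d d'" 0] d d' by auto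
    then have k1: "mollifier k (cball 0 d)" and k2: "mollifier k (cball 0 d')" by (auto simp: mollifier_def)
    have "(\<integral>\<^sup>+x. ennreal \<bar>indicator V x * G x\<bar> \<partial>lborel) \<le> Np 1 (\<lambda>x. conv k G x - G x)"
      unfolding Np_def
    proof (rule nn_integral_mono)
      fix x
      show "ennreal \<bar>indicator V x * G x\<bar> \<le> ennreal (\<bar>conv k G x - G x\<bar> powr 1)"
        using z[OF _ k1, of x] by (cases "x \<in> V") auto
    qed
    also have "\<dots> \<le> ennreal e" by (rule d'(2)[OF k2])
    finally show "(\<integral>\<^sup>+x. ennreal \<bar>indicator V x * G x\<bar> \<partial>lborel) \<le> 0 + ennreal e" by simp
  qed
  then have 0: "(\<integral>\<^sup>+x. ennreal \<bar>indicator V x * G x\<bar> \<partial>lborel) = 0" by simp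
  have m': "(\<lambda>x. ennreal \<bar>indicator V x * G x\<bar>) \<in> borel_measurable lborel"
    by (rule measurable_compose[OF m, where g = "\<lambda>y. ennreal \<bar>y\<bar>"]) measurable
  have ae: "AE x in lborel. ennreal \<bar>indicator V x * G x\<bar> = 0"
    by (rule iffD1[OF nn_integral_0_iff_AE[OF m'] 0])
  have "AE x in lborel. ennreal \<bar>indicator V x * G x\<bar> = 0 \<longrightarrow> x \<in> V \<longrightarrow> G x = 0"
    by (rule AE_I2) (simp add: indicator_eq_0_iff)
  with ae show ?thesis by (rule AE_mp)
qed

section \<open>Borel representatives\<close>

text \<open>The value of \<open>rep\<close> is meaningful only for \<open>u\<close> measurable on \<open>D\<close>.\<close>

definition rep :: "point set \<Rightarrow> scalar_field \<Rightarrow> scalar_field" where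
  "rep D u = (SOME u'. u' \<in> borel_measurable borel \<and> (\<forall>x. x \<notin> D \<longrightarrow> u' x = 0) \<and>
     (AE x in lebesgue_on D. u' x = u x))"

lemma AE_lebesgue_on:
  fixes D :: "point set"
  assumes "D \<in> sets borel"
  shows "(AE x in lebesgue_on D. P x) \<longleftrightarrow> (AE x in lborel. x \<in> D \<longrightarrow> P x)"
proof -
  have "(AE x in lebesgue_on D. P x) \<longleftrightarrow> (AE x in lebesgue. x \<in> D \<longrightarrow> P x)"
    by (rule AE_restrict_space_iff) (use assms in simp)
  then show ?thesis by (simp add: AE_completion_iff)
qed

lemma rep:
  assumes D: "D \<in> sets borel" and u: "u \<in> borel_measurable (lebesgue_on D)"
  shows rep_borel: "rep D u \<in> borel_measurable borel"
    and rep_zero: "x \<notin> D \<Longrightarrow> rep D u x = 0"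
    and rep_AE: "AE x in lebesgue_on D. rep D u x = u x"
proof -
  have "(\<lambda>x. if x \<in> D then u x else 0) \<in> borel_measurable lebesgue"
    using u D by (intro borel_measurable_if_I) auto
  then obtain g where g: "g \<in> borel_measurable lborel" "AE x in lborel. (if x \<in> D then u x else 0) = g x"
    using completion_ex_borel_measurable_real by blast
  have "(\<lambda>x. indicator D x * g x) \<in> borel_measurable borel"
    using borel_measurable_indicator_mult[OF D] g(1) by simp
  moreover have "AE x in lebesgue_on D. indicator D x * g x = u x"
    unfolding AE_lebesgue_on[OF D] using g(2) by eventually_elim auto
  ultimately have "\<exists>u'. u' \<in> borel_measurable borel \<and> (\<forall>x. x \<notin> D \<longrightarrow> u' x = 0) \<and>
     (AE x in lebesgue_on D. u' x = u x)"
    by (intro exI[of _ "\<lambda>x. indicator D x * g x"]) auto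
  from someI_ex[OF this] show "rep D u \<in> borel_measurable borel" "x \<notin> D \<Longrightarrow> rep D u x = 0"
    "AE x in lebesgue_on D. rep D u x = u x"
    unfolding rep_def by blast+
qed

lemma nn_integral_lebesgue_on_eq:
  fixes F :: "point \<Rightarrow> ennreal"
  assumes D: "D \<in> sets borel" and z: "\<And>x. x \<notin> D \<Longrightarrow> F' x = 0" and eq: "AE x in lebesgue_on D. F x = F' x"
  shows "(\<integral>\<^sup>+x. F x \<partial>lebesgue_on D) = (\<integral>\<^sup>+x. F' x \<partial>lborel)"
proof -
  have "(\<integral>\<^sup>+x. F x \<partial>lebesgue_on D) = (\<integral>\<^sup>+x. F' x \<partial>lebesgue_on D)"
    using eq by (rule nn_integral_cong_AE)
  also have "\<dots> = (\<integral>\<^sup>+x. F' x * indicator D x \<partial>lebesgue)"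
    using D by (intro nn_integral_restrict_space) simp
  also have "\<dots> = (\<integral>\<^sup>+x. F' x \<partial>lebesgue)"
    using z by (intro nn_integral_cong) (auto simp: indicator_def)
  finally show ?thesis by (simp add: nn_integral_completion)
qed

lemma integral_lebesgue_on_eq:
  fixes f f' :: scalar_field
  assumes D: "D \<in> sets borel" and f: "f \<in> borel_measurable (lebesgue_on D)"
    and f': "f' \<in> borel_measurable borel" "\<And>x. x \<notin> D \<Longrightarrow> f' x = 0"
    and eq: "AE x in lebesgue_on D. f x = f' x"
  shows "(LINT x|lebesgue_on D. f x) = (LINT x|lborel. f' x)"
    and "integrable (lebesgue_on D) f \<longleftrightarrow> integrable lborel f'"
proof -
  have l: "f' \<in> borel_measurable lebesgue" using f'(1) by (simp add: measurable_completion)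
  then have m: "f' \<in> borel_measurable (lebesgue_on D)" by (rule measurable_restrict_space1)
  have DL: "D \<inter> space lebesgue \<in> sets lebesgue" using D by simp
  have i: "(\<lambda>x. indicator D x *\<^sub>R f' x) = f'" using f'(2) by (auto simp: indicator_def fun_eq_iff)
  have "(LINT x|lebesgue_on D. f x) = (LINT x|lebesgue_on D. f' x)"
    using f m eq by (rule integral_cong_AE)
  also have "\<dots> = (LINT x|lebesgue. f' x)" by (simp only: integral_restrict_space[OF DL] i)
  also have "\<dots> = (LINT x|lborel. f' x)" using f'(1) by (simp add: integral_completion)
  finally show "(LINT x|lebesgue_on D. f x) = (LINT x|lborel. f' x)" .
  have "integrable (lebesgue_on D) f \<longleftrightarrow> integrable (lebesgue_on D) f'"
    using f m eq by (rule integrable_cong_AE)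
  also have "\<dots> \<longleftrightarrow> integrable lebesgue f'" by (simp only: integrable_restrict_space[OF DL] i)
  also have "\<dots> \<longleftrightarrow> integrable lborel f'" using f'(1) by (simp add: integrable_completion)
  finally show "integrable (lebesgue_on D) f \<longleftrightarrow> integrable lborel f'" .
qed

section \<open>Lebesgue spaces on D expressed through Borel representatives\<close>

lemma Lp_borel: "u \<in> Lp p M \<Longrightarrow> u \<in> borel_measurable M"
  by (simp add: Lp_def)

lemma nn_integral_Lp:
  "u \<in> Lp p M \<Longrightarrow> (\<integral>\<^sup>+x. ennreal (norm (u x) powr p) \<partial>M) = ennreal (LINT x|M. norm (u x) powr p)"
  by (intro nn_integral_eq_integral) (auto simp: Lp_def)

lemma Np_eq_Lp:
  fixes u :: scalar_field
  assumes D: "D \<in> sets borel" and z: "\<And>x. x \<notin> D \<Longrightarrow> u' x = 0"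
    and eq: "AE x in lebesgue_on D. u' x = u x"
  shows "Np p u' = (\<integral>\<^sup>+x. ennreal (norm (u x) powr p) \<partial>lebesgue_on D)"
proof -
  have "AE x in lebesgue_on D. ennreal (norm (u x) powr p) = ennreal (\<bar>u' x\<bar> powr p)"
    using eq by eventually_elim simp
  then have "(\<integral>\<^sup>+x. ennreal (norm (u x) powr p) \<partial>lebesgue_on D) = (\<integral>\<^sup>+x. ennreal (\<bar>u' x\<bar> powr p) \<partial>lborel)"
    using z by (intro nn_integral_lebesgue_on_eq[OF D]) auto
  then show ?thesis by (simp add: Np_def)
qed

lemma rep_Lz:
  assumes D: "D \<in> sets borel" and u: "u \<in> Lp p (lebesgue_on D)"
  shows "rep D u \<in> Lz p D"
proof -
  note r = rep[OF D Lp_borel[OF u]]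
  have "Np p (rep D u) = (\<integral>\<^sup>+x. ennreal (norm (u x) powr p) \<partial>lebesgue_on D)"
    by (rule Np_eq_Lp[OF D]) (use r in auto)
  then have "Np p (rep D u) < \<infinity>" unfolding nn_integral_Lp[OF u] by simp
  then show ?thesis using r by (simp add: Lz_def)
qed

lemma Lz_imp_Lp:
  fixes u :: scalar_field
  assumes D: "D \<in> sets borel" and u: "u \<in> borel_measurable (lebesgue_on D)"
    and u': "u' \<in> Lz p D" and eq: "AE x in lebesgue_on D. u' x = u x"
  shows "u \<in> Lp p (lebesgue_on D)"
proof -
  have "(\<integral>\<^sup>+x. ennreal (norm (u x) powr p) \<partial>lebesgue_on D) < \<infinity>"
    using Np_eq_Lp[OF D _ eq, of p] u' by (simp add: Lz_def)
  moreover have "(\<lambda>x. norm (u x) powr p) \<in> borel_measurable (lebesgue_on D)" using u by measurable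
  ultimately have "integrable (lebesgue_on D) (\<lambda>x. norm (u x) powr p)"
    by (intro integrableI_nonneg) auto
  then show ?thesis using u by (simp add: Lp_def)
qed

lemma borel_measurable_vec_iff:
  fixes v :: "'a \<Rightarrow> point"
  shows "v \<in> borel_measurable M \<longleftrightarrow> (\<forall>i. (\<lambda>x. v x $ i) \<in> borel_measurable M)"
  unfolding borel_measurable_euclidean_space[of v]
  by (auto simp: Basis_vec_def inner_axis)

lemma norm_powr_le_sum_components:
  fixes v :: point
  assumes "0 \<le> p"
  shows "norm v powr p \<le> 3 powr p * (\<Sum>i\<in>UNIV. \<bar>v $ i\<bar> powr p)"
proof -
  obtain i where i: "\<And>j. \<bar>v $ j\<bar> \<le> \<bar>v $ i\<bar>"
  proof -
    have "Max (range (\<lambda>i. \<bar>v $ i\<bar>)) \<in> range (\<lambda>i. \<bar>v $ i\<bar>)" by (intro Max_in) auto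
    then obtain i where "\<bar>v $ i\<bar> = Max (range (\<lambda>i. \<bar>v $ i\<bar>))" by force
    then show ?thesis by (intro that[of i]) simp
  qed
  have "norm v \<le> (\<Sum>j\<in>UNIV. \<bar>v $ j\<bar>)" by (rule norm_le_l1_cart)
  also have "\<dots> \<le> (\<Sum>j\<in>(UNIV::3 set). \<bar>v $ i\<bar>)" by (intro sum_mono i)
  finally have "norm v powr p \<le> (3 * \<bar>v $ i\<bar>) powr p" using assms by (intro powr_mono2) auto
  also have "\<dots> = 3 powr p * \<bar>v $ i\<bar> powr p" by (simp add: powr_mult)
  also have "\<dots> \<le> 3 powr p * (\<Sum>i\<in>UNIV. \<bar>v $ i\<bar> powr p)"
    by (intro mult_left_mono member_le_sum) auto
  finally show ?thesis .
qed

lemma Lp_components_iff: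
  fixes v :: "'a \<Rightarrow> point"
  assumes p: "0 \<le> p"
  shows "v \<in> Lp p M \<longleftrightarrow> (\<forall>i. (\<lambda>x. v x $ i) \<in> Lp p M)"
proof
  assume v: "v \<in> Lp p M"
  show "\<forall>i. (\<lambda>x. v x $ i) \<in> Lp p M"
  proof
    fix i
    have m: "(\<lambda>x. v x $ i) \<in> borel_measurable M" using v borel_measurable_vec_iff[of v M] by (simp add: Lp_def)
    have "integrable M (\<lambda>x. norm (v x $ i) powr p)"
    proof (rule Bochner_Integration.integrable_bound)
      show "integrable M (\<lambda>x. norm (v x) powr p)" using v by (simp add: Lp_def)
      show "(\<lambda>x. norm (v x $ i) powr p) \<in> borel_measurable M" using m by measurable
      show "AE x in M. norm (norm (v x $ i) powr p) \<le> norm (norm (v x) powr p)"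
        using p component_le_norm_cart by (intro AE_I2) (auto intro!: powr_mono2)
    qed
    with m show "(\<lambda>x. v x $ i) \<in> Lp p M" by (simp add: Lp_def)
  qed
next
  assume v: "\<forall>i. (\<lambda>x. v x $ i) \<in> Lp p M"
  have m: "v \<in> borel_measurable M" using v borel_measurable_vec_iff[of v M] by (simp add: Lp_def)
  have "integrable M (\<lambda>x. norm (v x) powr p)"
  proof (rule Bochner_Integration.integrable_bound)
    show "integrable M (\<lambda>x. 3 powr p * (\<Sum>i\<in>UNIV. norm (v x $ i) powr p))"
      using v by (intro integrable_mult_right Bochner_Integration.integrable_sum) (simp add: Lp_def)
    show "(\<lambda>x. norm (v x) powr p) \<in> borel_measurable M" using m by measurable
    show "AE x in M. norm (norm (v x) powr p) \<le> norm (3 powr p * (\<Sum>i\<in>UNIV. norm (v x $ i) powr p))"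
      using norm_powr_le_sum_components[OF p] by (intro AE_I2) (simp add: sum_nonneg)
  qed
  with m show "v \<in> Lp p M" by (simp add: Lp_def)
qed

lemma Lp_norm_powr: "0 < p \<Longrightarrow> Lp_norm p M f powr p = (LINT x|M. norm (f x) powr p)"
  unfolding Lp_norm_def by (simp add: powr_powr integral_nonneg_AE)

lemma Lp_norm_nonneg: "0 \<le> Lp_norm p M f"
  by (simp add: Lp_norm_def)

lemma Lp_norm_cong_AE:
  fixes f g :: "'a \<Rightarrow> 'b::euclidean_space"
  assumes "f \<in> borel_measurable M" "g \<in> borel_measurable M" "AE x in M. f x = g x"
  shows "Lp_norm p M f = Lp_norm p M g"
proof -
  have "(\<lambda>x. norm (f x) powr p) \<in> borel_measurable M" "(\<lambda>x. norm (g x) powr p) \<in> borel_measurable M"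
    using assms by measurable
  then have "(LINT x|M. norm (f x) powr p) = (LINT x|M. norm (g x) powr p)"
    by (rule integral_cong_AE) (use assms(3) in eventually_elim, simp)
  then show ?thesis by (simp add: Lp_norm_def)
qed

text \<open>From the seminorm on D to \<open>Np\<close> of a function dominated by it, typically one
  component. Membership in \<open>Lp\<close> is essential, since \<open>Lp_norm\<close> is 0 on
  functions that are not integrable.\<close>

lemma Lp_norm_tendsto_0_imp:
  fixes u :: "nat \<Rightarrow> point \<Rightarrow> 'b::euclidean_space"
  assumes p: "0 < p" and D: "D \<in> sets borel" and u: "\<And>n. u n \<in> Lp p (lebesgue_on D)"
    and lim: "(\<lambda>n. Lp_norm p (lebesgue_on D) (u n)) \<longlonglongrightarrow> 0"
    and z: "\<And>n x. x \<notin> D \<Longrightarrow> u' n x = 0" and le: "\<And>n. AE x in lebesgue_on D. \<bar>u' n x\<bar> \<le> norm (u n x)"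
  shows "(\<lambda>n. Np p (u' n)) \<longlonglongrightarrow> 0"
proof -
  have bd: "Np p (u' n) \<le> ennreal (Lp_norm p (lebesgue_on D) (u n) powr p)" for n
  proof -
    have "Np p (u' n) = (\<integral>\<^sup>+x. ennreal (norm (u' n x) powr p) \<partial>lebesgue_on D)"
      by (rule Np_eq_Lp[OF D z]) simp_all
    also have "\<dots> \<le> (\<integral>\<^sup>+x. ennreal (norm (u n x) powr p) \<partial>lebesgue_on D)"
    proof (rule nn_integral_mono_AE)
      show "AE x in lebesgue_on D. ennreal (norm (u' n x) powr p) \<le> ennreal (norm (u n x) powr p)"
        using le[of n]
      proof eventually_elim
        case (elim x)
        then show ?case using p by (intro ennreal_leI powr_mono2) auto
      qed
    qed
    finally show ?thesis unfolding nn_integral_Lp[OF u] Lp_norm_powr[OF p] .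
  qed
  have "(\<lambda>n. Lp_norm p (lebesgue_on D) (u n) powr p) \<longlonglongrightarrow> 0"
    by (rule tendsto_zero_powrI[OF lim tendsto_const[of p]]) (simp_all add: p Lp_norm_nonneg)
  from tendsto_ennrealI[OF this]
  have ub: "(\<lambda>n. ennreal (Lp_norm p (lebesgue_on D) (u n) powr p)) \<longlonglongrightarrow> 0" by simp
  show ?thesis
  proof (rule tendsto_sandwich[OF _ _ tendsto_const ub])
    show "\<forall>\<^sub>F n in sequentially. 0 \<le> Np p (u' n)" by (rule always_eventually) simp
    show "\<forall>\<^sub>F n in sequentially. Np p (u' n) \<le> ennreal (Lp_norm p (lebesgue_on D) (u n) powr p)"
      by (rule always_eventually) (rule allI, rule bd)
  qed
qed

text \<open>The way back: a vector-valued error is controlled by finitely many scalar ones through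
  an estimate of p-th powers.\<close>

lemma Np_tendsto_0_imp:
  assumes p: "0 < p" and D: "D \<in> sets borel"
    and u: "\<And>n. u n \<in> Lp p (lebesgue_on D)"
    and I: "finite I" and z: "\<And>i n x. i \<in> I \<Longrightarrow> x \<notin> D \<Longrightarrow> u' i n x = 0"
    and m: "\<And>i n. i \<in> I \<Longrightarrow> u' i n \<in> borel_measurable borel"
    and le: "\<And>n. AE x in lebesgue_on D. norm (u n x) powr p \<le> C * (\<Sum>i\<in>I. \<bar>u' i n x\<bar> powr p)"
    and lim: "\<And>i. i \<in> I \<Longrightarrow> (\<lambda>n. Np p (u' i n)) \<longlonglongrightarrow> 0" and C: "0 \<le> C"
  shows "(\<lambda>n. Lp_norm p (lebesgue_on D) (u n)) \<longlonglongrightarrow> 0"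
proof -
  have bd: "ennreal (LINT x|lebesgue_on D. norm (u n x) powr p) \<le> ennreal C * (\<Sum>i\<in>I. Np p (u' i n))" for n
  proof -
    have meas: "(\<lambda>x. ennreal (\<bar>u' i n x\<bar> powr p)) \<in> borel_measurable (lebesgue_on D)" if "i \<in> I" for i
    proof -
      have "(\<lambda>x. ennreal (\<bar>u' i n x\<bar> powr p)) \<in> borel_measurable borel" using m[OF that] by measurable
      then show ?thesis by (intro measurable_restrict_space1) (simp add: measurable_completion)
    qed
    have "ennreal (LINT x|lebesgue_on D. norm (u n x) powr p) = (\<integral>\<^sup>+x. ennreal (norm (u n x) powr p) \<partial>lebesgue_on D)"
      by (rule nn_integral_Lp[OF u, symmetric])
    also have "\<dots> \<le> (\<integral>\<^sup>+x. ennreal C * (\<Sum>i\<in>I. ennreal (\<bar>u' i n x\<bar> powr p)) \<partial>lebesgue_on D)"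
    proof (rule nn_integral_mono_AE)
      show "AE x in lebesgue_on D. ennreal (norm (u n x) powr p) \<le> ennreal C * (\<Sum>i\<in>I. ennreal (\<bar>u' i n x\<bar> powr p))"
        using le[of n]
      proof eventually_elim
        case (elim x)
        then have "ennreal (norm (u n x) powr p) \<le> ennreal (C * (\<Sum>i\<in>I. \<bar>u' i n x\<bar> powr p))" by (rule ennreal_leI)
        also have "\<dots> = ennreal C * (\<Sum>i\<in>I. ennreal (\<bar>u' i n x\<bar> powr p))"
          using C by (simp add: ennreal_mult sum_nonneg)
        finally show ?case .
      qed
    qed
    also have "\<dots> = ennreal C * (\<integral>\<^sup>+x. (\<Sum>i\<in>I. ennreal (\<bar>u' i n x\<bar> powr p)) \<partial>lebesgue_on D)"
      by (rule nn_integral_cmult) (rule borel_measurable_sum, rule meas)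
    also have "(\<integral>\<^sup>+x. (\<Sum>i\<in>I. ennreal (\<bar>u' i n x\<bar> powr p)) \<partial>lebesgue_on D)
        = (\<Sum>i\<in>I. \<integral>\<^sup>+x. ennreal (\<bar>u' i n x\<bar> powr p) \<partial>lebesgue_on D)"
      by (rule nn_integral_sum) (rule meas)
    also have "\<dots> = (\<Sum>i\<in>I. Np p (u' i n))"
    proof (rule sum.cong)
      fix i assume i: "i \<in> I"
      show "(\<integral>\<^sup>+x. ennreal (\<bar>u' i n x\<bar> powr p) \<partial>lebesgue_on D) = Np p (u' i n)"
      proof -
        have "Np p (u' i n) = (\<integral>\<^sup>+x. ennreal (norm (u' i n x) powr p) \<partial>lebesgue_on D)"
          by (rule Np_eq_Lp[OF D]) (use z[OF i] in auto)
        then show ?thesis by simp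
      qed
    qed simp
    finally show ?thesis .
  qed
  have "(\<lambda>n. ennreal C * (\<Sum>i\<in>I. Np p (u' i n))) \<longlonglongrightarrow> ennreal C * (\<Sum>i\<in>I. 0)"
    by (intro ennreal_tendsto_cmult tendsto_sum lim) simp_all
  then have ub: "(\<lambda>n. ennreal C * (\<Sum>i\<in>I. Np p (u' i n))) \<longlonglongrightarrow> 0" by simp
  have "(\<lambda>n. ennreal (LINT x|lebesgue_on D. norm (u n x) powr p)) \<longlonglongrightarrow> 0"
  proof (rule tendsto_sandwich[OF _ _ tendsto_const ub])
    show "\<forall>\<^sub>F n in sequentially. 0 \<le> ennreal (LINT x|lebesgue_on D. norm (u n x) powr p)" by (rule always_eventually) simp
    show "\<forall>\<^sub>F n in sequentially. ennreal (LINT x|lebesgue_on D. norm (u n x) powr p) \<le> ennreal C * (\<Sum>i\<in>I. Np p (u' i n))"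
      by (rule always_eventually) (rule allI, rule bd)
  qed
  then have "(\<lambda>n. ennreal (LINT x|lebesgue_on D. norm (u n x) powr p)) \<longlonglongrightarrow> ennreal 0" by (simp only: ennreal_0)
  then have "(\<lambda>n. LINT x|lebesgue_on D. norm (u n x) powr p) \<longlonglongrightarrow> 0"
    by (rule tendsto_ennrealD) (auto intro!: always_eventually integral_nonneg_AE)
  then show ?thesis
    unfolding Lp_norm_def
    by (rule tendsto_zero_powrI[OF _ tendsto_const[of "1 / p"]]) (auto intro!: always_eventually integral_nonneg_AE simp: p)
qed

section \<open>Uniqueness of weak derivatives\<close>

lemma locally_integrable_test_integrable:
  fixes g :: scalar_field
  assumes D: "D \<in> sets borel" and g: "locally_integrable D g" and f: "f \<in> test_functions D"
  shows "integrable (lebesgue_on D) (\<lambda>x. g x * f x)"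
proof -
  obtain K where K: "compact K" "K \<subseteq> D" "\<And>x. x \<notin> K \<Longrightarrow> f x = 0" using f by (auto simp: test_functions_def)
  have Kb: "K \<in> sets borel" using K(1) by (intro borel_closed compact_imp_closed)
  have gi: "integrable (lebesgue_on K) g" using g K by (simp add: locally_integrable_def)
  obtain B where B: "0 \<le> B" "\<And>x. x \<in> K \<Longrightarrow> \<bar>f x\<bar> \<le> B"
    using smooth_bounded_on[OF test_functions_smooth[OF f] compact_imp_bounded[OF K(1)]] by blast
  have fm: "f \<in> borel_measurable (lebesgue_on K)"
    using smooth_borel[OF test_functions_smooth[OF f]]
    by (intro measurable_restrict_space1) (simp add: measurable_completion)
  have "integrable (lebesgue_on K) (\<lambda>x. g x * f x)"
  proof (rule Bochner_Integration.integrable_bound)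
    show "integrable (lebesgue_on K) (\<lambda>x. B * g x)" using gi by simp
    show "(\<lambda>x. g x * f x) \<in> borel_measurable (lebesgue_on K)"
      using gi fm by (intro borel_measurable_times) auto
    show "AE x in lebesgue_on K. norm (g x * f x) \<le> norm (B * g x)"
    proof (rule AE_I2)
      fix x assume "x \<in> space (lebesgue_on K)"
      then have "\<bar>f x\<bar> \<le> \<bar>B\<bar>" using B by fastforce
      then show "norm (g x * f x) \<le> norm (B * g x)"
        by (simp add: abs_mult mult.commute mult_right_mono)
    qed
  qed
  then have "integrable lebesgue (\<lambda>x. indicator K x *\<^sub>R (g x * f x))"
    using Kb by (subst (asm) integrable_restrict_space) auto
  moreover have "(\<lambda>x. indicator K x *\<^sub>R (g x * f x)) = (\<lambda>x. indicator D x *\<^sub>R (g x * f x))"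
    using K by (auto simp: indicator_def fun_eq_iff)
  ultimately show ?thesis using D by (subst integrable_restrict_space) auto
qed

text \<open>Near a point of D the reflected mollifiers y \<mapsto> k(x - y) are test functions, so
  the mollified difference vanishes and the fundamental lemma applies. Since the functions are only
  locally integrable, this is done on a closed ball inside D.\<close>

lemma weak_unique:
  fixes g1 g2 :: scalar_field
  assumes D: "open D" and g: "locally_integrable D g1" "locally_integrable D g2"
    and eq: "\<And>f. f \<in> test_functions D \<Longrightarrow> (LINT x|lebesgue_on D. g1 x * f x) = (LINT x|lebesgue_on D. g2 x * f x)"
  shows "AE x in lebesgue_on D. g1 x = g2 x"
proof -
  have Db: "D \<in> sets borel" using D by simp
  have loc: "\<exists>V. open V \<and> a \<in> V \<and> (AE x in lborel. x \<in> V \<longrightarrow> g1 x = g2 x)" if a: "a \<in> D" for a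
  proof -
    obtain r0 where r0: "0 < r0" "cball a r0 \<subseteq> D" using D a open_contains_cball by blast
    \<comment> \<open>Kernels of radius r centred in the ball of radius r stay inside the ball of
      radius 2 r on which the functions are integrable.\<close>
    define r where "r = r0 / 2"
    have r: "0 < r" "cball a (2 * r) \<subseteq> D" using r0 by (auto simp: r_def)
    define B where "B = cball a (2 * r)"
    have Bb: "B \<in> sets borel" "compact B" "B \<subseteq> D" using r by (auto simp: B_def)
    define g where "g x = g1 x - g2 x" for x
    have gi: "integrable (lebesgue_on B) g"
      unfolding g_def[abs_def] using g Bb by (intro Bochner_Integration.integrable_diff) (auto simp: locally_integrable_def)
    then have gm: "g \<in> borel_measurable (lebesgue_on B)" by auto
    note G = rep[OF Bb(1) gm]
    have "integrable lborel (rep B g)"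
      using integral_lebesgue_on_eq(2)[OF Bb(1) gm G(1,2)] G(3) gi by (auto simp: eq_commute)
    then have "Np 1 (rep B g) < \<infinity>"
      unfolding Np_def integrable_iff_bounded by simp
    moreover have "bdd_supp (rep B g)"
      unfolding bdd_supp_def
    proof (intro exI[of _ "norm a + 2 * r"] allI impI G(2))
      fix x :: point assume "norm a + 2 * r < norm x"
      then show "x \<notin> B" using norm_triangle_ineq2[of x a] by (auto simp: B_def dist_norm norm_minus_commute)
    qed
    ultimately have GL: "rep B g \<in> Lc 1" using G(1) by (simp add: Lc_def)
    have "AE x in lborel. x \<in> ball a r \<longrightarrow> rep B g x = 0"
    proof (rule fundamental_lemma_AE[OF GL r(1)])
      fix x k assume x: "x \<in> ball a r" and k: "mollifier k (cball 0 r)"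
      define f where "f y = k (x - y)" for y
      have fs: "smooth f" unfolding f_def[abs_def] using k by (intro smooth_reflect) (simp add: mollifier_def)
      have sub: "cball x r \<subseteq> B"
      proof
        fix y assume "y \<in> cball x r"
        then show "y \<in> B" using x dist_triangle[of a y x] by (simp add: B_def)
      qed
      have f0: "f y = 0" if "y \<notin> cball x r" for y
        using that k by (auto simp: f_def mollifier_def dist_norm)
      have ft: "f \<in> test_functions D"
        unfolding test_functions_def using fs f0 sub Bb(3) by (auto intro!: exI[of _ "cball x r"])
      have fm: "f \<in> borel_measurable (lebesgue_on B)"
        using smooth_borel[OF fs] by (intro measurable_restrict_space1) (simp add: measurable_completion)
      have "conv k (rep B g) x = (LINT y|lborel. rep B g y * f y)" by (simp add: conv_def f_def mult.commute)
      also have "\<dots> = (LINT y|lebesgue_on B. g y * f y)"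
      proof (rule integral_lebesgue_on_eq(1)[OF Bb(1), symmetric])
        show "(\<lambda>y. g y * f y) \<in> borel_measurable (lebesgue_on B)" using gm fm by (rule borel_measurable_times)
        show "(\<lambda>y. rep B g y * f y) \<in> borel_measurable borel" using G(1) smooth_borel[OF fs] by (rule borel_measurable_times)
        show "AE y in lebesgue_on B. g y * f y = rep B g y * f y" using G(3) by eventually_elim simp
      qed (simp add: G(2))
      also have "\<dots> = (LINT y|lebesgue. indicator B y *\<^sub>R (g y * f y))" using Bb(1) by (intro integral_restrict_space) simp
      also have "(\<lambda>y. indicator B y *\<^sub>R (g y * f y)) = (\<lambda>y. indicator D y *\<^sub>R (g y * f y))"
      proof
        fix y
        show "indicator B y *\<^sub>R (g y * f y) = indicator D y *\<^sub>R (g y * f y)"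
          using f0[of y] sub Bb(3) by (cases "y \<in> cball x r") (auto simp: indicator_def)
      qed
      also have "(LINT y|lebesgue. indicator D y *\<^sub>R (g y * f y)) = (LINT y|lebesgue_on D. g y * f y)"
        using Db by (intro integral_restrict_space[symmetric]) simp
      also have "\<dots> = (LINT y|lebesgue_on D. g1 y * f y) - (LINT y|lebesgue_on D. g2 y * f y)"
        unfolding g_def left_diff_distrib
        by (rule Bochner_Integration.integral_diff) (rule locally_integrable_test_integrable[OF Db _ ft], rule g)+
      also have "\<dots> = 0" using eq[OF ft] by simp
      finally show "conv k (rep B g) x = 0" .
    qed simp
    moreover have "AE x in lborel. x \<in> B \<longrightarrow> rep B g x = g x" using G(3) unfolding AE_lebesgue_on[OF Bb(1)] .
    ultimately have "AE x in lborel. x \<in> ball a r \<longrightarrow> g1 x = g2 x"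
    proof eventually_elim
      case (elim x)
      then show ?case using r(1) by (auto simp: B_def g_def)
    qed
    then show ?thesis using r(1) by (intro exI[of _ "ball a r"]) simp
  qed
  \<comment> \<open>Lindelof selects countably many of the local neighbourhoods, whose exceptional
    sets unite to one null set.\<close>
  define F where "F = {V. open V \<and> (AE x in lborel. x \<in> V \<longrightarrow> g1 x = g2 x)}"
  obtain F' where F': "F' \<subseteq> F" "countable F'" "\<Union>F' = \<Union>F"
    using Lindelof[of F] by (auto simp: F_def)
  have "AE x in lborel. \<forall>V\<in>F'. x \<in> V \<longrightarrow> g1 x = g2 x"
    unfolding AE_ball_countable[OF F'(2)] using F'(1) by (auto simp: F_def)
  moreover have "D \<subseteq> \<Union>F'" unfolding F'(3) using loc by (auto simp: F_def)
  ultimately show ?thesis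
    unfolding AE_lebesgue_on[OF Db] by (auto elim!: eventually_mono)
qed

section \<open>Weak derivatives and pairings\<close>

text \<open>Completeness of Lebesgue measure. It makes derivatives picked by choice measurable on D
  as soon as one representative is.\<close>

lemma borel_measurable_lebesgue_on_AE:
  fixes f g :: "point \<Rightarrow> 'b::euclidean_space"
  assumes D: "D \<in> sets borel" and g: "g \<in> borel_measurable (lebesgue_on D)"
    and eq: "AE x in lebesgue_on D. g x = f x"
  shows "f \<in> borel_measurable (lebesgue_on D)"
proof -
  have DL: "D \<in> sets lebesgue" using D by simp
  have "(\<lambda>x. if x \<in> D then g x else 0) \<in> borel_measurable lebesgue"
    using g DL by (rule borel_measurable_if_I)
  moreover have "AE x in lebesgue. (if x \<in> D then g x else 0) = (if x \<in> D then f x else 0)"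
    using eq DL by (subst (asm) AE_restrict_space_iff) (auto elim!: eventually_mono)
  ultimately have "(\<lambda>x. if x \<in> D then f x else 0) \<in> borel_measurable lebesgue"
    by (rule borel_measurable_AE)
  then show ?thesis by (rule borel_measurable_if_D)
qed

lemma borel_imp_lebesgue_on: "f \<in> borel_measurable borel \<Longrightarrow> f \<in> borel_measurable (lebesgue_on D)"
  by (rule measurable_restrict_space1) (simp add: measurable_completion)

lemma pairing_eqI:
  assumes D: "D \<in> sets borel"
    and m: "\<And>i. a i \<in> borel_measurable borel" "b \<in> borel_measurable borel"
      "w \<in> borel_measurable borel" "\<And>i. G i \<in> borel_measurable borel"
    and z: "\<And>i x. x \<notin> D \<Longrightarrow> a i x = 0" "\<And>x. x \<notin> D \<Longrightarrow> b x = 0"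
    and eq: "AE x in lebesgue_on D. F x = (\<Sum>i\<in>UNIV. a i x * G i x) + b x * w x"
  shows "(LINT x|lebesgue_on D. F x) = pairing a b w G"
proof -
  have m': "(\<lambda>x. (\<Sum>i\<in>UNIV. a i x * G i x) + b x * w x) \<in> borel_measurable borel"
    by (intro borel_measurable_add borel_measurable_sum borel_measurable_times m)
  have "AE x in lebesgue_on D. (\<Sum>i\<in>UNIV. a i x * G i x) + b x * w x = F x"
    using eq by eventually_elim simp
  then have "F \<in> borel_measurable (lebesgue_on D)"
    by (rule borel_measurable_lebesgue_on_AE[OF D borel_imp_lebesgue_on[OF m']])
  then show ?thesis
    unfolding pairing_def by (rule integral_lebesgue_on_eq(1)[OF D _ m' _ eq]) (simp add: z)
qed

section \<open>Local integrability and operations on test functions\<close>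

lemma locally_integrable_component:
  "locally_integrable D v \<Longrightarrow> locally_integrable D (\<lambda>x. v x $ i :: real)"
  unfolding locally_integrable_def
  by (auto intro: integrable_bounded_linear[OF bounded_linear_vec_nth])

lemma locally_integrable_vec:
  fixes v :: vector_field
  assumes "\<And>i. locally_integrable D (\<lambda>x. v x $ i)"
  shows "locally_integrable D v"
  unfolding locally_integrable_def
proof (intro allI impI)
  fix K assume K: "compact K \<and> K \<subseteq> D"
  have "integrable (lebesgue_on K) (\<lambda>x. \<Sum>i\<in>UNIV. (v x $ i) *\<^sub>R axis i (1::real))"
    using assms K by (intro Bochner_Integration.integrable_sum integrable_scaleR_left) (auto simp: locally_integrable_def)
  moreover have "(\<Sum>i\<in>UNIV. (v x $ i) *\<^sub>R axis i (1::real)) = v x" for x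
    using basis_expansion[of "v x"] by (simp add: scalar_mult_eq_scaleR)
  ultimately show "integrable (lebesgue_on K) v" by simp
qed

lemma locally_integrable_diff:
  "locally_integrable D u \<Longrightarrow> locally_integrable D v \<Longrightarrow> locally_integrable D (\<lambda>x. u x - v x)"
  unfolding locally_integrable_def by auto

lemma locally_integrable_smooth:
  assumes f: "smooth f"
  shows "locally_integrable D f"
  unfolding locally_integrable_def
proof (intro allI impI)
  fix K :: "point set" assume "compact K \<and> K \<subseteq> D"
  then have K: "bounded K" "K \<in> sets borel" by (auto intro: compact_imp_bounded borel_closed compact_imp_closed)
  have "integrable lborel (\<lambda>x. indicator K x * f x)" using K f by (rule integrable_smooth_on)
  then have "integrable lebesgue (\<lambda>x. indicator K x * f x)"
    using borel_measurable_indicator_mult[OF K(2) smooth_borel[OF f]] by (subst integrable_completion) auto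
  then show "integrable (lebesgue_on K) f" using K(2) by (subst integrable_restrict_space) auto
qed

lemma test_functionsE:
  assumes "f \<in> test_functions D"
  obtains K where "smooth f" "compact K" "K \<subseteq> D" "\<And>x. x \<notin> K \<Longrightarrow> f x = 0"
  using assms by (auto simp: test_functions_def)

lemma test_functionsI:
  "smooth f \<Longrightarrow> compact K \<Longrightarrow> K \<subseteq> D \<Longrightarrow> (\<And>x. x \<notin> K \<Longrightarrow> f x = 0) \<Longrightarrow> f \<in> test_functions D"
  by (auto simp: test_functions_def)

lemma test_functions_diff:
  assumes f: "f \<in> test_functions D" and g: "g \<in> test_functions D"
  shows "(\<lambda>x. f x - g x) \<in> test_functions D"
proof -
  obtain K where K: "smooth f" "compact K" "K \<subseteq> D" "\<And>x. x \<notin> K \<Longrightarrow> f x = 0"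
    using test_functionsE[OF f] by blast
  obtain L where L: "smooth g" "compact L" "L \<subseteq> D" "\<And>x. x \<notin> L \<Longrightarrow> g x = 0"
    using test_functionsE[OF g] by blast
  show ?thesis
    by (rule test_functionsI[OF smooth_diff[OF K(1) L(1)] compact_Un[OF K(2) L(2)]]) (use K L in auto)
qed

lemma test_functions_0: "(\<lambda>_. 0) \<in> test_functions D"
  by (rule test_functionsI[of _ "{}"]) auto

lemma test_functions_mult:
  assumes f: "smooth f" and g: "g \<in> test_functions D"
  shows "(\<lambda>x. f x * g x) \<in> test_functions D"
proof -
  obtain K where K: "smooth g" "compact K" "K \<subseteq> D" "\<And>x. x \<notin> K \<Longrightarrow> g x = 0"
    using test_functionsE[OF g] by blast
  show ?thesis
    by (rule test_functionsI[OF smooth_mult[OF f K(1)] K(2,3)]) (use K in auto)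
qed

lemma locally_integrable_inner:
  assumes D: "D \<in> sets borel" and v: "locally_integrable D v" and F: "\<And>i. (\<lambda>x. F x $ i) \<in> test_functions D"
  shows "integrable (lebesgue_on D) (\<lambda>x. v x \<bullet> F x)"
  unfolding inner_vec_def inner_real_def
  by (intro Bochner_Integration.integrable_sum locally_integrable_test_integrable[OF D locally_integrable_component[OF v] F])

lemma curl_component:
  "curl f x $ 1 = partial 2 (\<lambda>y. f y $ 3) x - partial 3 (\<lambda>y. f y $ 2) x"
  "curl f x $ 2 = partial 3 (\<lambda>y. f y $ 1) x - partial 1 (\<lambda>y. f y $ 3) x"
  "curl f x $ 3 = partial 1 (\<lambda>y. f y $ 2) x - partial 2 (\<lambda>y. f y $ 1) x"
  by (simp_all add: curl_def)

lemma curl_test: "f \<in> test_fields D \<Longrightarrow> (\<lambda>x. curl f x $ i) \<in> test_functions D"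
proof -
  assume f: "f \<in> test_fields D"
  have t: "(\<lambda>x. partial j (\<lambda>y. f y $ k) x - partial l (\<lambda>y. f y $ m) x) \<in> test_functions D" for j k l m
    using f by (intro test_functions_diff test_functions_partial) (auto simp: test_fields_def)
  show ?thesis using exhaust_3[of i] t by (auto simp: curl_component)
qed

lemma grad_test: "f \<in> test_functions D \<Longrightarrow> (\<lambda>x. grad f x $ i) \<in> test_functions D"
  using test_functions_partial[of f D i] by (simp add: grad_def)

definition single :: "3 \<Rightarrow> scalar_field \<Rightarrow> vector_field" where
  "single i f x = (\<chi> j. if j = i then f x else 0)"

lemma single_test: "f \<in> test_functions D \<Longrightarrow> single i f \<in> test_fields D"
proof -
  assume f: "f \<in> test_functions D"
  have "(\<lambda>x. single i f x $ j) \<in> test_functions D" for j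
    using f test_functions_0 by (cases "j = i") (simp_all add: single_def)
  then show ?thesis by (simp add: test_fields_def)
qed

lemma inner_single: "v \<bullet> single i f x = v $ i * f x"
  by (simp add: inner_vec_def single_def if_distrib cong: if_cong)

lemma has_weak_gradD:
  "has_weak_grad D u g \<Longrightarrow> f \<in> test_functions D \<Longrightarrow>
    (LINT x|lebesgue_on D. u x * partial i f x) = - (LINT x|lebesgue_on D. g x $ i * f x)"
  by (simp add: has_weak_grad_def)

lemma has_weak_divD:
  "has_weak_div D v g \<Longrightarrow> f \<in> test_functions D \<Longrightarrow>
    (LINT x|lebesgue_on D. v x \<bullet> grad f x) = - (LINT x|lebesgue_on D. g x * f x)"
  by (simp add: has_weak_div_def)

lemma has_weak_curlD:
  "has_weak_curl D v g \<Longrightarrow> f \<in> test_fields D \<Longrightarrow>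
    (LINT x|lebesgue_on D. v x \<bullet> curl f x) = (LINT x|lebesgue_on D. g x \<bullet> f x)"
  by (simp add: has_weak_curl_def)

section \<open>The chosen weak derivatives: uniqueness and integrability\<close>

lemma weak_grad_unique:
  assumes D: "open D" and "has_weak_grad D u g" "has_weak_grad D u h"
  shows "AE x in lebesgue_on D. g x = h x"
proof -
  have "AE x in lebesgue_on D. g x $ i = h x $ i" for i
  proof (rule weak_unique[OF D])
    show "locally_integrable D (\<lambda>x. g x $ i)" "locally_integrable D (\<lambda>x. h x $ i)"
      using assms(2,3) by (auto simp: has_weak_grad_def intro: locally_integrable_component)
    fix f assume f: "f \<in> test_functions D"
    have "- (LINT x|lebesgue_on D. g x $ i * f x) = - (LINT x|lebesgue_on D. h x $ i * f x)"
      by (rule trans[OF has_weak_gradD[OF assms(2) f, symmetric] has_weak_gradD[OF assms(3) f]])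
    then show "(LINT x|lebesgue_on D. g x $ i * f x) = (LINT x|lebesgue_on D. h x $ i * f x)" by simp
  qed
  then have "AE x in lebesgue_on D. \<forall>i. g x $ i = h x $ i" by (simp add: AE_all_countable)
  then show ?thesis by (simp add: vec_eq_iff)
qed

lemma weak_div_unique:
  assumes D: "open D" and "has_weak_div D v g" "has_weak_div D v h"
  shows "AE x in lebesgue_on D. g x = h x"
proof (rule weak_unique[OF D])
  show "locally_integrable D g" "locally_integrable D h" using assms(2,3) by (auto simp: has_weak_div_def)
  fix f assume f: "f \<in> test_functions D"
  have "- (LINT x|lebesgue_on D. g x * f x) = - (LINT x|lebesgue_on D. h x * f x)"
    by (rule trans[OF has_weak_divD[OF assms(2) f, symmetric] has_weak_divD[OF assms(3) f]])
  then show "(LINT x|lebesgue_on D. g x * f x) = (LINT x|lebesgue_on D. h x * f x)" by simp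
qed

lemma weak_curl_unique:
  assumes D: "open D" and g: "has_weak_curl D v g" and h: "has_weak_curl D v h"
  shows "AE x in lebesgue_on D. g x = h x"
proof -
  have "AE x in lebesgue_on D. g x $ i = h x $ i" for i
  proof (rule weak_unique[OF D])
    show "locally_integrable D (\<lambda>x. g x $ i)" "locally_integrable D (\<lambda>x. h x $ i)"
      using g h by (auto simp: has_weak_curl_def intro: locally_integrable_component)
    fix f assume "f \<in> test_functions D"
    then have s: "single i f \<in> test_fields D" by (rule single_test)
    have "(LINT x|lebesgue_on D. g x \<bullet> single i f x) = (LINT x|lebesgue_on D. h x \<bullet> single i f x)"
      by (rule trans[OF has_weak_curlD[OF g s, symmetric] has_weak_curlD[OF h s]])
    then show "(LINT x|lebesgue_on D. g x $ i * f x) = (LINT x|lebesgue_on D. h x $ i * f x)"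
      by (simp only: inner_single)
  qed
  then have "AE x in lebesgue_on D. \<forall>i. g x $ i = h x $ i" by (simp add: AE_all_countable)
  then show ?thesis by (simp add: vec_eq_iff)
qed

lemma weak_grad_works: "has_weak_grad D u g \<Longrightarrow> has_weak_grad D u (weak_grad D u)"
  unfolding weak_grad_def by (rule someI[where P = "has_weak_grad D u"])

lemma weak_div_works: "has_weak_div D v g \<Longrightarrow> has_weak_div D v (weak_div D v)"
  unfolding weak_div_def by (rule someI[where P = "has_weak_div D v"])

lemma weak_curl_works: "has_weak_curl D v g \<Longrightarrow> has_weak_curl D v (weak_curl D v)"
  unfolding weak_curl_def by (rule someI[where P = "has_weak_curl D v"])

lemma Lp_AE:
  fixes f g :: "point \<Rightarrow> 'b::euclidean_space"
  assumes D: "D \<in> sets borel" and g: "g \<in> Lp p (lebesgue_on D)" and eq: "AE x in lebesgue_on D. g x = f x"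
  shows "f \<in> Lp p (lebesgue_on D)"
proof -
  have f: "f \<in> borel_measurable (lebesgue_on D)"
    by (rule borel_measurable_lebesgue_on_AE[OF D Lp_borel[OF g] eq])
  have "integrable (lebesgue_on D) (\<lambda>x. norm (g x) powr p) \<longleftrightarrow> integrable (lebesgue_on D) (\<lambda>x. norm (f x) powr p)"
  proof (rule integrable_cong_AE)
    show "(\<lambda>x. norm (g x) powr p) \<in> borel_measurable (lebesgue_on D)" using Lp_borel[OF g] by measurable
    show "(\<lambda>x. norm (f x) powr p) \<in> borel_measurable (lebesgue_on D)" using f by measurable
    show "AE x in lebesgue_on D. norm (g x) powr p = norm (f x) powr p" using eq by eventually_elim simp
  qed
  with f g show ?thesis by (simp add: Lp_def)
qed

text \<open>By its definition the chosen gradient is only locally integrable; almost everywhere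
  uniqueness transfers the L^q bound from the witness in \<open>W1\<close>. The lemmas for
  \<open>Zd\<close> and \<open>Zc\<close> follow the same pattern.\<close>

lemma W1_weak_grad:
  assumes D: "open D" and u: "u \<in> W1 q D"
  shows "has_weak_grad D u (weak_grad D u)" "weak_grad D u \<in> Lp q (lebesgue_on D)" "u \<in> Lp q (lebesgue_on D)"
proof -
  obtain g where g: "g \<in> Lp q (lebesgue_on D)" "has_weak_grad D u g" and u': "u \<in> Lp q (lebesgue_on D)"
    using u by (auto simp: W1_def)
  show "has_weak_grad D u (weak_grad D u)" by (rule weak_grad_works[OF g(2)])
  then show "weak_grad D u \<in> Lp q (lebesgue_on D)"
    using D by (intro Lp_AE[OF _ g(1) weak_grad_unique[OF D g(2)]]) auto
  show "u \<in> Lp q (lebesgue_on D)" by (rule u')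
qed

lemma Zd_weak_div:
  assumes D: "open D" and v: "v \<in> Zd p D"
  shows "has_weak_div D v (weak_div D v)" "weak_div D v \<in> Lp p (lebesgue_on D)" "v \<in> Lp p (lebesgue_on D)"
proof -
  obtain g where g: "g \<in> Lp p (lebesgue_on D)" "has_weak_div D v g" and v': "v \<in> Lp p (lebesgue_on D)"
    using v by (auto simp: Zd_def)
  show "has_weak_div D v (weak_div D v)" by (rule weak_div_works[OF g(2)])
  then show "weak_div D v \<in> Lp p (lebesgue_on D)"
    using D by (intro Lp_AE[OF _ g(1) weak_div_unique[OF D g(2)]]) auto
  show "v \<in> Lp p (lebesgue_on D)" by (rule v')
qed

lemma Zc_weak_curl:
  assumes D: "open D" and v: "v \<in> Zc p D"
  shows "has_weak_curl D v (weak_curl D v)" "weak_curl D v \<in> Lp p (lebesgue_on D)" "v \<in> Lp p (lebesgue_on D)"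
proof -
  obtain g where g: "g \<in> Lp p (lebesgue_on D)" "has_weak_curl D v g" and v': "v \<in> Lp p (lebesgue_on D)"
    using v by (auto simp: Zc_def)
  show "has_weak_curl D v (weak_curl D v)" by (rule weak_curl_works[OF g(2)])
  then show "weak_curl D v \<in> Lp p (lebesgue_on D)"
    using D by (intro Lp_AE[OF _ g(1) weak_curl_unique[OF D g(2)]]) auto
  show "v \<in> Lp p (lebesgue_on D)" by (rule v')
qed

lemma integral_by_parts_smooth:
  assumes D: "open D" "bounded D" and f: "smooth f" and \<phi>: "\<phi> \<in> test_functions D"
  shows "(LINT x|lebesgue_on D. f x * partial i \<phi> x) = - (LINT x|lebesgue_on D. partial i f x * \<phi> x)"
proof -
  have Db: "D \<in> sets borel" using D by simp
  have t: "(\<lambda>x. f x * \<phi> x) \<in> test_functions D" using f \<phi> by (rule test_functions_mult)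
  then obtain K where K: "compact K" "K \<subseteq> D" "\<And>x. x \<notin> K \<Longrightarrow> f x * \<phi> x = 0"
    by (auto simp: test_functions_def)
  have i: "integrable (lebesgue_on D) (\<lambda>x. f x * partial i \<phi> x)" "integrable (lebesgue_on D) (\<lambda>x. partial i f x * \<phi> x)"
    by (intro locally_integrable_test_integrable[OF Db] locally_integrable_smooth f smooth_partial \<phi> test_functions_partial)+
  have eq: "partial i (\<lambda>x. f x * \<phi> x) x = f x * partial i \<phi> x + partial i f x * \<phi> x" for x
    using f test_functions_smooth[OF \<phi>] by (intro partial_mult smooth_differentiable)
  have "(LINT x|lebesgue_on D. f x * partial i \<phi> x) + (LINT x|lebesgue_on D. partial i f x * \<phi> x)
      = (LINT x|lebesgue_on D. partial i (\<lambda>x. f x * \<phi> x) x)"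
    unfolding eq using i by simp
  also have "\<dots> = (LINT y|lborel. indicator D y * partial i (\<lambda>x. f x * \<phi> x) y)"
  proof (rule integral_lebesgue_on_eq(1)[OF Db])
    have m: "partial i (\<lambda>x. f x * \<phi> x) \<in> borel_measurable borel"
      by (intro smooth_borel smooth_partial test_functions_smooth[OF t])
    then show "partial i (\<lambda>x. f x * \<phi> x) \<in> borel_measurable (lebesgue_on D)" by (rule borel_imp_lebesgue_on)
    show "(\<lambda>y. indicator D y * partial i (\<lambda>x. f x * \<phi> x) y) \<in> borel_measurable borel"
      using borel_measurable_indicator_mult[OF Db m] by simp
  qed auto
  also have "\<dots> = 0"
    by (rule integral_partial_eq_0[OF D test_functions_smooth[OF t] K])
  finally show ?thesis by simp
qed

lemma has_weak_grad_smooth: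
  assumes D: "open D" "bounded D" and f: "smooth f"
  shows "has_weak_grad D f (grad f)"
  unfolding has_weak_grad_def
  using integral_by_parts_smooth[OF D f] f
  by (auto simp: grad_def intro!: locally_integrable_smooth locally_integrable_vec smooth_partial)

section \<open>Weak derivatives of differences, and divergence and curl from gradients\<close>

lemma has_weak_grad_diff:
  assumes D: "D \<in> sets borel" and u: "has_weak_grad D u g" and v: "has_weak_grad D v h"
  shows "has_weak_grad D (\<lambda>x. u x - v x) (\<lambda>x. g x - h x)"
  unfolding has_weak_grad_def
proof (intro conjI allI ballI)
  show "locally_integrable D (\<lambda>x. u x - v x)" "locally_integrable D (\<lambda>x. g x - h x)"
    using u v by (auto simp: has_weak_grad_def intro: locally_integrable_diff)
  fix i f assume f: "f \<in> test_functions D"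
  have l: "locally_integrable D u" "locally_integrable D v" "locally_integrable D (\<lambda>x. g x $ i)" "locally_integrable D (\<lambda>x. h x $ i)"
    using u v by (auto simp: has_weak_grad_def intro: locally_integrable_component)
  note i = locally_integrable_test_integrable[OF D]
  have "(LINT x|lebesgue_on D. (u x - v x) * partial i f x) = (LINT x|lebesgue_on D. u x * partial i f x) - (LINT x|lebesgue_on D. v x * partial i f x)"
    unfolding left_diff_distrib by (rule Bochner_Integration.integral_diff) (intro i l test_functions_partial f)+
  also have "\<dots> = - ((LINT x|lebesgue_on D. g x $ i * f x) - (LINT x|lebesgue_on D. h x $ i * f x))"
    by (simp only: has_weak_gradD[OF u f] has_weak_gradD[OF v f])
  also have "(LINT x|lebesgue_on D. g x $ i * f x) - (LINT x|lebesgue_on D. h x $ i * f x) = (LINT x|lebesgue_on D. (g x - h x) $ i * f x)"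
    unfolding vector_minus_component left_diff_distrib by (rule Bochner_Integration.integral_diff[symmetric]) (intro i l f)+
  finally show "(LINT x|lebesgue_on D. (u x - v x) * partial i f x) = - (LINT x|lebesgue_on D. (g x - h x) $ i * f x)" .
qed

lemma has_weak_div_diff:
  assumes D: "D \<in> sets borel" and u: "has_weak_div D u g" and v: "has_weak_div D v h"
  shows "has_weak_div D (\<lambda>x. u x - v x) (\<lambda>x. g x - h x)"
  unfolding has_weak_div_def
proof (intro conjI ballI)
  show "locally_integrable D (\<lambda>x. u x - v x)" "locally_integrable D (\<lambda>x. g x - h x)"
    using u v by (auto simp: has_weak_div_def intro: locally_integrable_diff)
  fix f assume f: "f \<in> test_functions D"
  have l: "locally_integrable D u" "locally_integrable D v" "locally_integrable D g" "locally_integrable D h"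
    using u v by (auto simp: has_weak_div_def)
  have "(LINT x|lebesgue_on D. (u x - v x) \<bullet> grad f x) = (LINT x|lebesgue_on D. u x \<bullet> grad f x) - (LINT x|lebesgue_on D. v x \<bullet> grad f x)"
    unfolding inner_diff_left by (rule Bochner_Integration.integral_diff) (intro locally_integrable_inner[OF D] l grad_test f)+
  also have "\<dots> = - ((LINT x|lebesgue_on D. g x * f x) - (LINT x|lebesgue_on D. h x * f x))"
    by (simp only: has_weak_divD[OF u f] has_weak_divD[OF v f])
  also have "(LINT x|lebesgue_on D. g x * f x) - (LINT x|lebesgue_on D. h x * f x) = (LINT x|lebesgue_on D. (g x - h x) * f x)"
    unfolding left_diff_distrib by (rule Bochner_Integration.integral_diff[symmetric]) (intro locally_integrable_test_integrable[OF D] l f)+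
  finally show "(LINT x|lebesgue_on D. (u x - v x) \<bullet> grad f x) = - (LINT x|lebesgue_on D. (g x - h x) * f x)" .
qed

lemma has_weak_curl_diff:
  assumes D: "D \<in> sets borel" and u: "has_weak_curl D u g" and v: "has_weak_curl D v h"
  shows "has_weak_curl D (\<lambda>x. u x - v x) (\<lambda>x. g x - h x)"
  unfolding has_weak_curl_def
proof (intro conjI ballI)
  show "locally_integrable D (\<lambda>x. u x - v x)" "locally_integrable D (\<lambda>x. g x - h x)"
    using u v by (auto simp: has_weak_curl_def intro: locally_integrable_diff)
  fix f assume f: "f \<in> test_fields D"
  have l: "locally_integrable D u" "locally_integrable D v" "locally_integrable D g" "locally_integrable D h"
    using u v by (auto simp: has_weak_curl_def)
  have fc: "(\<lambda>x. f x $ i) \<in> test_functions D" for i using f by (simp add: test_fields_def)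
  have "(LINT x|lebesgue_on D. (u x - v x) \<bullet> curl f x) = (LINT x|lebesgue_on D. u x \<bullet> curl f x) - (LINT x|lebesgue_on D. v x \<bullet> curl f x)"
    unfolding inner_diff_left by (rule Bochner_Integration.integral_diff) (intro locally_integrable_inner[OF D] l curl_test f)+
  also have "\<dots> = (LINT x|lebesgue_on D. g x \<bullet> f x) - (LINT x|lebesgue_on D. h x \<bullet> f x)"
    by (simp only: has_weak_curlD[OF u f] has_weak_curlD[OF v f])
  also have "\<dots> = (LINT x|lebesgue_on D. (g x - h x) \<bullet> f x)"
    unfolding inner_diff_left by (rule Bochner_Integration.integral_diff[symmetric]) (intro locally_integrable_inner[OF D] l fc)+
  finally show "(LINT x|lebesgue_on D. (u x - v x) \<bullet> curl f x) = (LINT x|lebesgue_on D. (g x - h x) \<bullet> f x)" .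
qed

lemma has_weak_div_from_grads:
  assumes D: "D \<in> sets borel" and w: "\<And>i. has_weak_grad D (\<lambda>x. w x $ i) (G i)"
  shows "has_weak_div D w (\<lambda>x. \<Sum>i\<in>UNIV. G i x $ i)"
  unfolding has_weak_div_def
proof (intro conjI ballI)
  have l: "locally_integrable D (\<lambda>x. w x $ i)" "locally_integrable D (\<lambda>x. G i x $ j)" for i j
    using w[of i] by (auto simp: has_weak_grad_def intro: locally_integrable_component)
  show "locally_integrable D w" by (rule locally_integrable_vec) (rule l)
  show "locally_integrable D (\<lambda>x. \<Sum>i\<in>UNIV. G i x $ i)"
    using l(2) unfolding locally_integrable_def by (auto intro!: Bochner_Integration.integrable_sum)
  fix f assume f: "f \<in> test_functions D"
  note i = locally_integrable_test_integrable[OF D]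
  have "(LINT x|lebesgue_on D. w x \<bullet> grad f x) = (\<Sum>i\<in>UNIV. (LINT x|lebesgue_on D. w x $ i * partial i f x))"
    unfolding inner_vec_def inner_real_def grad_def vec_lambda_beta
    by (rule Bochner_Integration.integral_sum) (intro i l test_functions_partial f)
  also have "\<dots> = - (\<Sum>i\<in>UNIV. (LINT x|lebesgue_on D. G i x $ i * f x))"
    by (simp only: has_weak_gradD[OF w f] sum_negf)
  also have "(\<Sum>i\<in>UNIV. (LINT x|lebesgue_on D. G i x $ i * f x)) = (LINT x|lebesgue_on D. (\<Sum>i\<in>UNIV. G i x $ i) * f x)"
    unfolding sum_distrib_right by (rule Bochner_Integration.integral_sum[symmetric]) (intro i l f)
  finally show "(LINT x|lebesgue_on D. w x \<bullet> grad f x) = - (LINT x|lebesgue_on D. (\<Sum>i\<in>UNIV. G i x $ i) * f x)" .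
qed

text \<open>\<open>G i\<close> stands for the gradient of the i-th component, so
  \<open>G i x $ j\<close> is the j-th derivative of component i.\<close>

definition curl_of_grads :: "(3 \<Rightarrow> vector_field) \<Rightarrow> vector_field" where
  "curl_of_grads G x = vector [G 3 x $ 2 - G 2 x $ 3, G 1 x $ 3 - G 3 x $ 1, G 2 x $ 1 - G 1 x $ 2]"

lemma has_weak_curl_from_grads:
  assumes D: "D \<in> sets borel" and w: "\<And>i. has_weak_grad D (\<lambda>x. w x $ i) (G i)"
  shows "has_weak_curl D w (curl_of_grads G)"
  unfolding has_weak_curl_def
proof (intro conjI ballI)
  have l: "locally_integrable D (\<lambda>x. w x $ i)" "locally_integrable D (\<lambda>x. G i x $ j)" for i j
    using w[of i] by (auto simp: has_weak_grad_def intro: locally_integrable_component)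
  show "locally_integrable D w" by (rule locally_integrable_vec) (rule l)
  have "locally_integrable D (\<lambda>x. curl_of_grads G x $ i)" for i
    using exhaust_3[of i] by (auto simp: curl_of_grads_def intro!: locally_integrable_diff l)
  then show "locally_integrable D (curl_of_grads G)" by (rule locally_integrable_vec)
  fix f assume f: "f \<in> test_fields D"
  have fc: "(\<lambda>x. f x $ i) \<in> test_functions D" for i using f by (simp add: test_fields_def)
  let ?A = "\<lambda>i j k. (LINT x|lebesgue_on D. w x $ i * partial j (\<lambda>y. f y $ k) x)"
  let ?B = "\<lambda>i j k. (LINT x|lebesgue_on D. G i x $ j * f x $ k)"
  have AB: "?A i j k = - ?B i j k" for i j k
    by (rule has_weak_gradD[OF w fc])
  have iA: "integrable (lebesgue_on D) (\<lambda>x. w x $ i * partial j (\<lambda>y. f y $ k) x)" for i j k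
    by (intro locally_integrable_test_integrable[OF D] l test_functions_partial fc)
  have iB: "integrable (lebesgue_on D) (\<lambda>x. G i x $ j * f x $ k)" for i j k
    by (intro locally_integrable_test_integrable[OF D] l fc)
  have "(LINT x|lebesgue_on D. w x \<bullet> curl f x) = (?A 1 2 3 - ?A 1 3 2) + (?A 2 3 1 - ?A 2 1 3) + (?A 3 1 2 - ?A 3 2 1)"
    unfolding inner_vec_def inner_real_def sum_3 curl_component right_diff_distrib
    by (simp only: Bochner_Integration.integral_add Bochner_Integration.integral_diff
        Bochner_Integration.integrable_add Bochner_Integration.integrable_diff iA)
  also have "\<dots> = (?B 3 2 1 - ?B 2 3 1) + (?B 1 3 2 - ?B 3 1 2) + (?B 2 1 3 - ?B 1 2 3)"
    unfolding AB by simp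
  also have "\<dots> = (LINT x|lebesgue_on D. curl_of_grads G x \<bullet> f x)"
    unfolding inner_vec_def inner_real_def sum_3 curl_of_grads_def vector_3 left_diff_distrib
    by (simp only: Bochner_Integration.integral_add Bochner_Integration.integral_diff
        Bochner_Integration.integrable_add Bochner_Integration.integrable_diff iB)
  finally show "(LINT x|lebesgue_on D. w x \<bullet> curl f x) = (LINT x|lebesgue_on D. curl_of_grads G x \<bullet> f x)" .
qed

lemma Lp_diff:
  fixes u v :: "'a \<Rightarrow> 'b::euclidean_space"
  assumes p: "0 \<le> p" and u: "u \<in> Lp p M" and v: "v \<in> Lp p M"
  shows "(\<lambda>x. u x - v x) \<in> Lp p M"
proof -
  have m: "(\<lambda>x. u x - v x) \<in> borel_measurable M" using Lp_borel[OF u] Lp_borel[OF v] by (rule borel_measurable_diff)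
  have "integrable M (\<lambda>x. norm (u x - v x) powr p)"
  proof (rule Bochner_Integration.integrable_bound)
    show "integrable M (\<lambda>x. 2 powr p * (norm (u x) powr p + norm (v x) powr p))"
      using u v by (intro integrable_mult_right Bochner_Integration.integrable_add) (auto simp: Lp_def)
    show "(\<lambda>x. norm (u x - v x) powr p) \<in> borel_measurable M" using m by measurable
    show "AE x in M. norm (norm (u x - v x) powr p) \<le> norm (2 powr p * (norm (u x) powr p + norm (v x) powr p))"
      using norm_add_powr_le[OF p, of "u _" "- v _"] by (intro AE_I2) simp
  qed
  with m show ?thesis by (simp add: Lp_def)
qed

lemma smooth_Lp:
  assumes p: "0 < p" and D: "bounded D" "D \<in> sets borel" and f: "smooth f"
  shows "f \<in> Lp p (lebesgue_on D)"
  by (rule Lz_imp_Lp[OF D(2) borel_imp_lebesgue_on[OF smooth_borel[OF f]] Lz_smooth[OF p D f]])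
    (rule AE_I2, simp)

lemma Lp_component:
  fixes v :: "'a \<Rightarrow> point"
  shows "0 \<le> p \<Longrightarrow> v \<in> Lp p M \<Longrightarrow> (\<lambda>x. v x $ i) \<in> Lp p M"
  by (simp add: Lp_components_iff)

lemma component_rep_AE:
  assumes D: "D \<in> sets borel" and v: "\<And>i. (\<lambda>x. v x $ i) \<in> borel_measurable (lebesgue_on D)"
  shows "AE x in lebesgue_on D. \<forall>i. rep D (\<lambda>x. v x $ i) x = v x $ i"
  using rep_AE[OF D v] by (simp add: AE_all_countable)

lemma rep_component_Lz:
  fixes v :: vector_field
  assumes p: "0 \<le> p" and D: "D \<in> sets borel" and v: "v \<in> Lp p (lebesgue_on D)"
  shows "rep D (\<lambda>x. v x $ i) \<in> Lz p D"
  using v by (intro rep_Lz[OF D]) (simp add: Lp_components_iff[OF p])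

lemma Lz_zero: "u \<in> Lz p D \<Longrightarrow> x \<notin> D \<Longrightarrow> u x = 0"
  by (simp add: Lz_def)

subsection \<open>The curl as three divergences\<close>

text \<open>The \<open>i\<close>-th component of the curl of \<open>a\<close> is the divergence of the \<open>i\<close>-th row \<open>rot a i\<close>; the
  rows are \<open>(0, a 3, - a 2)\<close>, \<open>(- a 3, 0, a 1)\<close> and \<open>(a 2, - a 1, 0)\<close>.\<close>

definition rot_sign :: "3 \<Rightarrow> 3 \<Rightarrow> real" where
  "rot_sign i j = (if i = j then 0 else if (i = 1 \<and> j = 2) \<or> (i = 2 \<and> j = 3) \<or> (i = 3 \<and> j = 1) then 1 else - 1)"

text \<open>The third index when i and j differ, so that \<open>rot_sign\<close> together with it is
  the Levi-Civita symbol; on the diagonal the sign 0 multiplies whatever component is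
  picked.\<close>

definition rot_index :: "3 \<Rightarrow> 3 \<Rightarrow> 3" where
  "rot_index i j = (if i \<noteq> 1 \<and> j \<noteq> 1 then 1 else if i \<noteq> 2 \<and> j \<noteq> 2 then 2 else 3)"

definition rot :: "(3 \<Rightarrow> scalar_field) \<Rightarrow> 3 \<Rightarrow> 3 \<Rightarrow> scalar_field" where
  "rot a i j x = rot_sign i j * a (rot_index i j) x"

lemma rot_values:
  "rot_sign 1 1 = 0" "rot_sign 1 2 = 1" "rot_sign 1 3 = - 1"
  "rot_sign 2 1 = - 1" "rot_sign 2 2 = 0" "rot_sign 2 3 = 1"
  "rot_sign 3 1 = 1" "rot_sign 3 2 = - 1" "rot_sign 3 3 = 0"
  "rot_index 1 2 = 3" "rot_index 1 3 = 2" "rot_index 2 1 = 3"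
  "rot_index 2 3 = 1" "rot_index 3 1 = 2" "rot_index 3 2 = 1"
  by (simp_all add: rot_sign_def rot_index_def)

lemma rot_sign_cases: "rot_sign i j = 0 \<or> rot_sign i j = 1 \<or> rot_sign i j = - 1"
  by (simp add: rot_sign_def)

lemma rot_Lz: "0 < p \<Longrightarrow> bounded D \<Longrightarrow> (\<And>k. a k \<in> Lz p D) \<Longrightarrow> rot a i j \<in> Lz p D"
  unfolding rot_def[abs_def] by (rule Lz_mult) simp_all

lemma rot_test: "(\<And>k. a k \<in> test_functions D) \<Longrightarrow> rot a i j \<in> test_functions D"
  unfolding rot_def[abs_def] by (rule test_functions_mult) simp_all

lemma rot_Np_tendsto:
  assumes "\<And>k. (\<lambda>n. Np p (\<lambda>x. a n k x - b k x)) \<longlonglongrightarrow> 0"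
  shows "(\<lambda>n. Np p (\<lambda>x. rot (a n) i j x - rot b i j x)) \<longlonglongrightarrow> 0"
proof -
  have le: "Np p (\<lambda>x. rot (a n) i j x - rot b i j x) \<le> Np p (\<lambda>x. a n (rot_index i j) x - b (rot_index i j) x)" for n
    unfolding Np_def
  proof (rule nn_integral_mono)
    fix x
    show "ennreal (\<bar>rot (a n) i j x - rot b i j x\<bar> powr p) \<le> ennreal (\<bar>a n (rot_index i j) x - b (rot_index i j) x\<bar> powr p)"
      using rot_sign_cases[of i j] by (auto simp: rot_def abs_minus_commute)
  qed
  show ?thesis
    by (rule tendsto_sandwich[OF _ _ tendsto_const assms[of "rot_index i j"]])
      (auto intro!: always_eventually le)
qed

lemma sum_partial_rot:
  assumes a: "\<And>k. smooth (a k)"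
  shows "(\<Sum>j\<in>UNIV. partial j (rot a i j) x) = curl (\<lambda>x. \<chi> k. a k x) x $ i"
proof -
  have "partial j (rot a i j) x = rot_sign i j * partial j (a (rot_index i j)) x" for j
    unfolding rot_def[abs_def]
    using partial_mult[of "\<lambda>_. rot_sign i j" x "a (rot_index i j)" j] smooth_differentiable[OF a] by simp
  then show ?thesis
    using exhaust_3[of i] by (auto simp: sum_3 rot_values curl_component)
qed

lemma weak_div_onI:
  assumes D: "D \<in> sets borel"
    and m: "\<And>i. a i \<in> borel_measurable borel" "b \<in> borel_measurable borel"
    and z: "\<And>i x. x \<notin> D \<Longrightarrow> a i x = 0" "\<And>x. x \<notin> D \<Longrightarrow> b x = 0"
    and eq: "\<And>f. f \<in> test_functions D \<Longrightarrow>
      AE x in lebesgue_on D. F f x = (\<Sum>i\<in>UNIV. a i x * partial i f x) + b x * f x"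
    and int: "\<And>f. f \<in> test_functions D \<Longrightarrow> (LINT x|lebesgue_on D. F f x) = 0"
  shows "weak_div_on D a b"
  unfolding weak_div_on_def
proof
  fix f assume f: "f \<in> test_functions D"
  have "(LINT x|lebesgue_on D. F f x) = pairing a b f (\<lambda>i. partial i f)"
    using test_functions_smooth[OF f] by (intro pairing_eqI[OF D m _ _ z eq[OF f]] smooth_borel smooth_partial)
  then show "pairing a b f (\<lambda>i. partial i f) = 0" using int[OF f] by simp
qed

lemma sum_delta_mult:
  fixes c :: "3 \<Rightarrow> real"
  shows "(\<Sum>j\<in>UNIV. (if j = i then u else (\<lambda>_. 0)) x * c j) = u x * c i"
proof -
  have "(if j = i then u else (\<lambda>_. 0)) x * c j = (if j = i then u x * c i else 0)" for j by simp
  then show ?thesis by (simp only: sum.delta[OF finite] UNIV_I if_True)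
qed

text \<open>A gradient as three divergences: the i-th partial derivative of u is the divergence of u
  times the i-th unit vector.\<close>

lemma weak_grad_rows:
  assumes D: "D \<in> sets borel" and u: "u \<in> Lp q (lebesgue_on D)" and G: "G \<in> Lp q (lebesgue_on D)"
    and q: "0 < q" and uG: "has_weak_grad D u G"
  shows "weak_div_on D (\<lambda>j. if j = i then rep D u else (\<lambda>_. 0)) (rep D (\<lambda>x. G x $ i))"
proof (rule weak_div_onI[OF D, where F = "\<lambda>f x. u x * partial i f x + G x $ i * f x"])
  have Gi: "(\<lambda>x. G x $ i) \<in> Lp q (lebesgue_on D)" using G Lp_components_iff[of q G] q by simp
  note ru = rep[OF D Lp_borel[OF u]] and rG = rep[OF D Lp_borel[OF Gi]]
  show "(if j = i then rep D u else (\<lambda>_. 0)) \<in> borel_measurable borel" for j using ru(1) by simp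
  show "rep D (\<lambda>x. G x $ i) \<in> borel_measurable borel" by (rule rG(1))
  show "(if j = i then rep D u else (\<lambda>_. 0)) x = 0" if "x \<notin> D" for j x using ru(2)[OF that] by simp
  show "rep D (\<lambda>x. G x $ i) x = 0" if "x \<notin> D" for x using rG(2)[OF that] .
  fix f assume f: "f \<in> test_functions D"
  show "AE x in lebesgue_on D. u x * partial i f x + G x $ i * f x =
      (\<Sum>j\<in>UNIV. (if j = i then rep D u else (\<lambda>_. 0)) x * partial j f x) + rep D (\<lambda>x. G x $ i) x * f x"
    using ru(3) rG(3)
  proof eventually_elim
    case (elim x)
    then show ?case by (simp only: sum_delta_mult)
  qed
  have "locally_integrable D u" "locally_integrable D (\<lambda>x. G x $ i)"
    using uG by (auto simp: has_weak_grad_def intro: locally_integrable_component)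
  then have "integrable (lebesgue_on D) (\<lambda>x. u x * partial i f x)" "integrable (lebesgue_on D) (\<lambda>x. G x $ i * f x)"
    using f by (auto intro!: locally_integrable_test_integrable[OF D] test_functions_partial)
  then show "(LINT x|lebesgue_on D. u x * partial i f x + G x $ i * f x) = 0"
    by (simp add: has_weak_gradD[OF uG f])
qed

lemma weak_div_row:
  assumes D: "D \<in> sets borel" and v: "v \<in> Lp p (lebesgue_on D)" and g: "g \<in> Lp p (lebesgue_on D)"
    and p: "0 < p" and vg: "has_weak_div D v g"
  shows "weak_div_on D (\<lambda>j. rep D (\<lambda>x. v x $ j)) (rep D g)"
proof (rule weak_div_onI[OF D, where F = "\<lambda>f x. v x \<bullet> grad f x + g x * f x"])
  have vi: "(\<lambda>x. v x $ i) \<in> borel_measurable (lebesgue_on D)" for i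
    by (rule Lp_borel[OF Lp_component[OF less_imp_le[OF p] v]])
  note rv = rep[OF D vi] and rg = rep[OF D Lp_borel[OF g]]
  show "rep D (\<lambda>x. v x $ j) \<in> borel_measurable borel" for j by (rule rv(1))
  show "rep D g \<in> borel_measurable borel" by (rule rg(1))
  show "rep D (\<lambda>x. v x $ j) x = 0" if "x \<notin> D" for j x using rv(2)[OF that] .
  show "rep D g x = 0" if "x \<notin> D" for x using rg(2)[OF that] .
  fix f assume f: "f \<in> test_functions D"
  show "AE x in lebesgue_on D. v x \<bullet> grad f x + g x * f x =
      (\<Sum>j\<in>UNIV. rep D (\<lambda>x. v x $ j) x * partial j f x) + rep D g x * f x"
    using component_rep_AE[OF D vi] rg(3)
  proof eventually_elim
    case (elim x)
    then show ?case by (simp add: inner_vec_def grad_def)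
  qed
  have l: "locally_integrable D v" "locally_integrable D g" using vg by (auto simp: has_weak_div_def)
  have "integrable (lebesgue_on D) (\<lambda>x. v x \<bullet> grad f x)" by (intro locally_integrable_inner[OF D l(1)] grad_test f)
  moreover have "integrable (lebesgue_on D) (\<lambda>x. g x * f x)" by (rule locally_integrable_test_integrable[OF D l(2) f])
  ultimately show "(LINT x|lebesgue_on D. v x \<bullet> grad f x + g x * f x) = 0"
    by (simp add: has_weak_divD[OF vg f])
qed

text \<open>The rows of \<open>rot\<close> form an antisymmetric matrix, which produces the minus
  sign. It reconciles the weak curl, defined with a plus sign, with the weak divergence, defined
  with a minus sign.\<close>

lemma inner_curl_single:
  assumes f: "smooth f"
  shows "v \<bullet> curl (single i f) x = - (\<Sum>j\<in>UNIV. rot (\<lambda>k _. v $ k) i j x * partial j f x)"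
proof -
  have "partial j (\<lambda>y. single i f y $ k) x = (if k = i then partial j f x else 0)" for j k
    by (simp add: single_def)
  then show ?thesis
    using exhaust_3[of i] by (auto simp: inner_vec_def sum_3 curl_component rot_def rot_values)
qed

lemma weak_curl_rows:
  assumes D: "D \<in> sets borel" and v: "v \<in> Lp p (lebesgue_on D)" and g: "g \<in> Lp p (lebesgue_on D)"
    and p: "0 < p" and bD: "bounded D" and vg: "has_weak_curl D v g"
  shows "weak_div_on D (rot (\<lambda>j. rep D (\<lambda>x. v x $ j)) i) (rep D (\<lambda>x. g x $ i))"
proof (rule weak_div_onI[OF D, where F = "\<lambda>f x. g x \<bullet> single i f x - v x \<bullet> curl (single i f) x"])
  have vi: "(\<lambda>x. v x $ i) \<in> borel_measurable (lebesgue_on D)" for i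
    by (rule Lp_borel[OF Lp_component[OF less_imp_le[OF p] v]])
  have gi: "(\<lambda>x. g x $ i) \<in> borel_measurable (lebesgue_on D)"
    by (rule Lp_borel[OF Lp_component[OF less_imp_le[OF p] g]])
  note rg = rep[OF D gi]
  have rL: "rot (\<lambda>j. rep D (\<lambda>x. v x $ j)) i j \<in> Lz p D" for j
    using p by (intro rot_Lz[OF p bD] rep_component_Lz[OF _ D v]) simp
  show "rot (\<lambda>j. rep D (\<lambda>x. v x $ j)) i j \<in> borel_measurable borel" for j by (rule Lz_borel[OF rL])
  show "rep D (\<lambda>x. g x $ i) \<in> borel_measurable borel" by (rule rg(1))
  show "rot (\<lambda>j. rep D (\<lambda>x. v x $ j)) i j x = 0" if "x \<notin> D" for j x by (rule Lz_zero[OF rL that])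
  show "rep D (\<lambda>x. g x $ i) x = 0" if "x \<notin> D" for x using rg(2)[OF that] .
  fix f assume f: "f \<in> test_functions D"
  note s = single_test[OF f, of i]
  show "AE x in lebesgue_on D. g x \<bullet> single i f x - v x \<bullet> curl (single i f) x =
      (\<Sum>j\<in>UNIV. rot (\<lambda>j. rep D (\<lambda>x. v x $ j)) i j x * partial j f x) + rep D (\<lambda>x. g x $ i) x * f x"
    using component_rep_AE[OF D vi] rg(3)
  proof eventually_elim
    case (elim x)
    then have "rot (\<lambda>j. rep D (\<lambda>x. v x $ j)) i j x = rot (\<lambda>k _. v x $ k) i j x" for j by (simp add: rot_def)
    then show ?case
      using elim(2) by (simp add: inner_curl_single[OF test_functions_smooth[OF f]] inner_single)
  qed
  have l: "locally_integrable D v" "locally_integrable D g" using vg by (auto simp: has_weak_curl_def)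
  have sc: "(\<lambda>x. single i f x $ k) \<in> test_functions D" for k using s by (simp add: test_fields_def)
  have "integrable (lebesgue_on D) (\<lambda>x. v x \<bullet> curl (single i f) x)" by (intro locally_integrable_inner[OF D l(1)] curl_test s)
  moreover have "integrable (lebesgue_on D) (\<lambda>x. g x \<bullet> single i f x)" by (intro locally_integrable_inner[OF D l(2)] sc)
  ultimately show "(LINT x|lebesgue_on D. g x \<bullet> single i f x - v x \<bullet> curl (single i f) x) = 0"
    by (simp add: has_weak_curlD[OF vg s])
qed

subsection \<open>Limits of test fields\<close>

text \<open>Here the approximated field supplies the test functions: each component
  \<open>a n i\<close> is inserted into the weak gradient of w, and the sum over i is the pairing of
  (G, w) with the field and its divergence. Hence the limit is taken in the pairing with exchanged
  roles, and exchanged back at the end.\<close>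

lemma pairing_limit_eq_0:
  assumes D: "D \<in> sets borel" "bounded D" and p: "1 < p"
    and t: "\<And>n j. a n j \<in> test_functions D"
    and a0: "\<And>j. a0 j \<in> Lz p D" and b0: "b0 \<in> Lz p D"
    and la: "\<And>j. (\<lambda>n::nat. Np p (\<lambda>x. a n j x - a0 j x)) \<longlonglongrightarrow> 0"
    and lb: "(\<lambda>n. Np p (\<lambda>x. (\<Sum>j\<in>UNIV. partial j (a n j) x) - b0 x)) \<longlonglongrightarrow> 0"
    and w: "w \<in> Lz (conj_exponent p) D" and G: "\<And>j. G j \<in> Lz (conj_exponent p) D"
    and wG: "\<And>i. weak_div_on D (\<lambda>j. if j = i then w else (\<lambda>_. 0)) (G i)"
  shows "pairing a0 b0 w G = 0"
proof -
  let ?q = "conj_exponent p"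
  have q: "1 < ?q" using conj_exponent_gt_1[OF p] .
  have qp: "conj_exponent ?q = p" using p by (rule conj_exponent_involution)
  let ?b = "\<lambda>n x. (\<Sum>j\<in>UNIV. partial j (a n j) x)"
  have tL: "a n j \<in> Lz p D" "partial k (a n j) \<in> Lz p D" for n j k
    using p by (auto intro!: test_functions_Lz D t test_functions_partial)
  have bL: "?b n \<in> Lz p D" for n using p by (intro Lz_sum tL) simp
  note h = Lz_holder_integrable[OF q w, unfolded qp] and hG = Lz_holder_integrable[OF q G, unfolded qp]
  have z: "(LINT x|lborel. w x * partial i (a n i) x) + (LINT x|lborel. G i x * a n i x) = 0" for n i
  proof -
    have "pairing (\<lambda>j. if j = i then w else (\<lambda>_. 0)) (G i) (a n i) (\<lambda>j. partial j (a n i)) = 0"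
      using wG[of i] t[of n i] unfolding weak_div_on_def by blast
    then show ?thesis
      unfolding pairing_def sum_delta_mult Bochner_Integration.integral_add[OF h[OF tL(2)] hG[OF tL(1)]] .
  qed
  have "pairing G w (?b n) (a n) = 0" for n
  proof -
    have "pairing G w (?b n) (a n) = (\<Sum>i\<in>UNIV. (LINT x|lborel. G i x * a n i x)) + (LINT x|lborel. w x * ?b n x)"
      by (rule pairing_eq_sum[OF q G w, unfolded qp, OF bL tL(1)])
    also have "(LINT x|lborel. w x * ?b n x) = (\<Sum>i\<in>UNIV. (LINT x|lborel. w x * partial i (a n i) x))"
      unfolding sum_distrib_left by (rule Bochner_Integration.integral_sum) (rule h[OF tL(2)])
    also have "(\<Sum>i\<in>UNIV. (LINT x|lborel. G i x * a n i x)) + (\<Sum>i\<in>UNIV. (LINT x|lborel. w x * partial i (a n i) x))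
        = (\<Sum>i\<in>UNIV. (LINT x|lborel. w x * partial i (a n i) x) + (LINT x|lborel. G i x * a n i x))"
      unfolding sum.distrib by (rule add.commute)
    also have "\<dots> = 0" by (simp only: z) simp
    finally show ?thesis .
  qed
  moreover have "(\<lambda>n. pairing G w (?b n) (a n)) \<longlonglongrightarrow> pairing G w b0 a0"
    by (rule pairing_tendsto[OF q G w, unfolded qp, OF bL b0 tL(1) a0 lb la])
  ultimately have "(\<lambda>n::nat. 0) \<longlonglongrightarrow> pairing G w b0 a0" by simp
  then have "pairing G w b0 a0 = 0" by (rule LIMSEQ_unique[OF _ tendsto_const])
  then show ?thesis by (simp add: pairing_commute[of a0])
qed

subsection \<open>Traces\<close>

text \<open>Since \<open>Lp_norm\<close> is 0 on functions that are not integrable, the convergence on the boundary in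
  \<open>has_trace\<close> would say nothing if the boundary had infinite measure.\<close>

lemma surface_measure_finite:
  assumes "open D" "bounded D" "strongly_lipschitz D"
  shows "finite_measure (surface_measure D)"
proof
  have "emeasure (surface_measure D) (space (surface_measure D)) = emeasure hausdorff2 (frontier D)"
    unfolding surface_measure_def by (subst emeasure_restrict_space) (simp_all add: space_restrict_space)
  also have "\<dots> < \<infinity>" using outer_frontier_finite[OF assms] by (simp add: emeasure_hausdorff2)
  finally show "emeasure (surface_measure D) (space (surface_measure D)) \<noteq> \<infinity>" by simp
qed

lemma smooth_surface_measurable: "smooth f \<Longrightarrow> f \<in> borel_measurable (surface_measure D)"
  unfolding surface_measure_def by (intro measurable_restrict_space1) (simp add: smooth_borel)

lemma smooth_surface_Lp:
  assumes D: "open D" "bounded D" "strongly_lipschitz D" and q: "0 < q" and f: "smooth f"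
  shows "f \<in> Lp q (surface_measure D)"
proof -
  interpret finite_measure "surface_measure D" by (rule surface_measure_finite[OF D])
  obtain B where B: "0 \<le> B" "\<And>x. x \<in> frontier D \<Longrightarrow> \<bar>f x\<bar> \<le> B"
    using smooth_bounded_on[OF f compact_imp_bounded[OF compact_frontier_bounded[OF D(2)]]] by blast
  have m: "f \<in> borel_measurable (surface_measure D)" using f by (rule smooth_surface_measurable)
  have "integrable (surface_measure D) (\<lambda>x. norm (f x) powr q)"
  proof (rule integrable_const_bound[of _ "B powr q"])
    show "AE x in surface_measure D. norm (norm (f x) powr q) \<le> B powr q"
    proof (rule AE_I2)
      fix x assume "x \<in> space (surface_measure D)"
      then have "\<bar>f x\<bar> \<le> B" by (intro B(2)) (simp add: surface_measure_def space_restrict_space)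
      then show "norm (norm (f x) powr q) \<le> B powr q" using q by (auto intro: powr_mono2)
    qed
    show "(\<lambda>x. norm (f x) powr q) \<in> borel_measurable (surface_measure D)" using m by measurable
  qed
  with m show ?thesis by (simp add: Lp_def)
qed

lemma smooth_W1:
  assumes D: "open D" "bounded D" and q: "0 < q" and f: "smooth f"
  shows "f \<in> W1 q D"
proof -
  have Db: "D \<in> sets borel" using D by simp
  have "grad f \<in> Lp q (lebesgue_on D)"
    using q f by (simp add: Lp_components_iff grad_def smooth_Lp[OF _ D(2) Db] smooth_partial)
  then show ?thesis
    unfolding W1_def using smooth_Lp[OF q D(2) Db f] has_weak_grad_smooth[OF D f] by blast
qed

text \<open>The constant sequence f is a witness. Its \<open>W1_norm\<close> distance needs an
  argument: the gradient picked for the zero function is 0 only almost everywhere.\<close>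

lemma smooth_has_trace:
  assumes D: "open D" "bounded D" "strongly_lipschitz D" and q: "0 < q" and f: "smooth f"
  shows "has_trace q D f f"
proof -
  have Db: "D \<in> sets borel" using D by simp
  have "grad (\<lambda>_. 0) = (\<lambda>_. 0)" by (simp add: grad_def fun_eq_iff vec_eq_iff)
  then have h: "has_weak_grad D (\<lambda>_. 0) (\<lambda>_. 0)" using has_weak_grad_smooth[OF D(1,2) smooth_const[of 0]] by simp
  have "AE x in lebesgue_on D. weak_grad D (\<lambda>_. 0) x = 0"
    by (rule weak_grad_unique[OF D(1) weak_grad_works[OF h] h])
  then have ae: "AE x in lebesgue_on D. 0 = weak_grad D (\<lambda>_. 0) x" by eventually_elim simp
  have "Lp_norm q (lebesgue_on D) (\<lambda>_. 0 :: point) = Lp_norm q (lebesgue_on D) (weak_grad D (\<lambda>_. 0))"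
    by (rule Lp_norm_cong_AE[OF _ borel_measurable_lebesgue_on_AE[OF Db _ ae] ae]) simp_all
  then have "W1_norm q D (\<lambda>_. 0) = 0" by (simp add: W1_norm_def Lp_norm_def)
  moreover have "Lp_norm q (surface_measure D) (\<lambda>_. 0 :: real) = 0" by (simp add: Lp_norm_def)
  ultimately show ?thesis
    unfolding has_trace_def using smooth_W1[OF D(1,2) q f] smooth_surface_Lp[OF D q f] f
    by (auto intro!: exI[of _ "\<lambda>_. f"])
qed

lemma pairing_diff:
  assumes p: "1 < p" and a: "\<And>i. a i \<in> Lz p D" and b: "b \<in> Lz p D"
    and w: "w \<in> Lz (conj_exponent p) D" "w' \<in> Lz (conj_exponent p) D"
    and G: "\<And>i. G i \<in> Lz (conj_exponent p) D" "\<And>i. G' i \<in> Lz (conj_exponent p) D"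
  shows "pairing a b (\<lambda>x. w x - w' x) (\<lambda>i x. G i x - G' i x) = pairing a b w G - pairing a b w' G'"
proof -
  have "(\<Sum>i\<in>UNIV. a i x * (G i x - G' i x)) + b x * (w x - w' x)
      = ((\<Sum>i\<in>UNIV. a i x * G i x) + b x * w x) - ((\<Sum>i\<in>UNIV. a i x * G' i x) + b x * w' x)" for x
    by (simp add: right_diff_distrib sum_subtractf)
  then show ?thesis
    unfolding pairing_def
    by (simp only: Bochner_Integration.integral_diff[OF pairing_integrable[OF p a b w(1) G(1)] pairing_integrable[OF p a b w(2) G(2)]])
qed

text \<open>Independence of the lifting for smooth boundary values: u and \<phi> have the same
  trace, so u - \<phi> is approximated by the smooth functions f n - \<phi> with boundary values
  tending to 0. Its extension by zero then has the zero-extended gradient, and its pairing with (a,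
  b) vanishes.\<close>

lemma trace_pairing:
  assumes D: "open D" "bounded D" and sl: "strongly_lipschitz D" and p: "1 < p"
    and a: "\<And>i. a i \<in> Lz p D" and b: "b \<in> Lz p D" and ab: "weak_div_on D a b"
    and tr: "has_trace (conj_exponent p) D u \<phi>" and \<phi>: "smooth \<phi>"
  shows "pairing a b (rep D u) (\<lambda>i. rep D (\<lambda>x. weak_grad D u x $ i)) = pairing a b \<phi> (\<lambda>i. partial i \<phi>)"
proof -
  let ?q = "conj_exponent p" and ?S = "surface_measure D"
  have q: "1 < ?q" using conj_exponent_gt_1[OF p] .
  then have q0: "0 < ?q" "0 \<le> ?q" by auto
  have Db: "D \<in> sets borel" using D by simp
  define G where "G = weak_grad D u"
  obtain f :: "nat \<Rightarrow> scalar_field" where f: "\<And>n. smooth (f n)"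
    and l1: "(\<lambda>n. W1_norm ?q D (\<lambda>x. f n x - u x)) \<longlonglongrightarrow> 0"
    and l2: "(\<lambda>n. Lp_norm ?q ?S (\<lambda>x. f n x - \<phi> x)) \<longlonglongrightarrow> 0"
    and uW: "u \<in> W1 ?q D"
    using tr unfolding has_trace_def by blast
  have uG: "has_weak_grad D u G" "G \<in> Lp ?q (lebesgue_on D)" "u \<in> Lp ?q (lebesgue_on D)"
    using W1_weak_grad[OF D(1) uW] by (simp_all add: G_def)
  define u' where "u' = rep D u"
  define G' where "G' i = rep D (\<lambda>x. G x $ i)" for i
  have u': "u' \<in> Lz ?q D" unfolding u'_def by (rule rep_Lz[OF Db uG(3)])
  have G': "G' i \<in> Lz ?q D" for i unfolding G'_def by (rule rep_component_Lz[OF q0(2) Db uG(2)])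
  have sm: "(\<lambda>x. indicator D x * h x) \<in> Lz ?q D" if "smooth h" for h by (rule Lz_smooth[OF q0(1) D(2) Db that])
  have squeeze: "X \<longlonglongrightarrow> 0" if "\<And>n. 0 \<le> X n" "\<And>n. X n \<le> W1_norm ?q D (\<lambda>x. f n x - u x)" for X :: "nat \<Rightarrow> real"
    by (rule tendsto_sandwich[OF _ _ tendsto_const l1]) (auto intro!: always_eventually that)
  have lu: "(\<lambda>n. Lp_norm ?q (lebesgue_on D) (\<lambda>x. f n x - u x)) \<longlonglongrightarrow> 0"
    by (rule squeeze) (simp_all add: W1_norm_def Lp_norm_nonneg)
  have lg: "(\<lambda>n. Lp_norm ?q (lebesgue_on D) (weak_grad D (\<lambda>x. f n x - u x))) \<longlonglongrightarrow> 0"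
    by (rule squeeze) (simp_all add: W1_norm_def Lp_norm_nonneg)
  have wd: "(\<lambda>n. Np ?q (\<lambda>x. indicator D x * f n x - u' x)) \<longlonglongrightarrow> 0"
  proof (rule Lp_norm_tendsto_0_imp[OF q0(1) Db _ lu])
    show "(\<lambda>x. f n x - u x) \<in> Lp ?q (lebesgue_on D)" for n
      by (intro Lp_diff[OF q0(2)] smooth_Lp[OF q0(1) D(2) Db] f uG)
    show "indicator D x * f n x - u' x = 0" if "x \<notin> D" for n x using that Lz_zero[OF u' that] by simp
    show "AE x in lebesgue_on D. \<bar>indicator D x * f n x - u' x\<bar> \<le> norm (f n x - u x)" for n
      using rep_AE[OF Db Lp_borel[OF uG(3)]] AE_space
      by eventually_elim (simp add: u'_def)
  qed
  have gd: "(\<lambda>n. Np ?q (\<lambda>x. indicator D x * partial i (f n) x - G' i x)) \<longlonglongrightarrow> 0" for i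
  proof (rule Lp_norm_tendsto_0_imp[OF q0(1) Db _ lg])
    have hw: "has_weak_grad D (\<lambda>x. f n x - u x) (\<lambda>x. grad (f n) x - G x)" for n
      by (rule has_weak_grad_diff[OF Db has_weak_grad_smooth[OF D f] uG(1)])
    have ae: "AE x in lebesgue_on D. grad (f n) x - G x = weak_grad D (\<lambda>x. f n x - u x) x" for n
      by (rule weak_grad_unique[OF D(1) hw weak_grad_works[OF hw]])
    have "grad (f n) \<in> Lp ?q (lebesgue_on D)" for n
      using q0 f by (simp add: Lp_components_iff grad_def smooth_Lp[OF _ D(2) Db] smooth_partial)
    then show "weak_grad D (\<lambda>x. f n x - u x) \<in> Lp ?q (lebesgue_on D)" for n
      by (intro Lp_AE[OF Db _ ae] Lp_diff[OF q0(2)] uG)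
    show "indicator D x * partial i (f n) x - G' i x = 0" if "x \<notin> D" for n x
      using that Lz_zero[OF G' that] by simp
    have Gi: "(\<lambda>x. G x $ i) \<in> borel_measurable (lebesgue_on D)"
      by (rule Lp_borel[OF Lp_component[OF q0(2) uG(2)]])
    show "AE x in lebesgue_on D. \<bar>indicator D x * partial i (f n) x - G' i x\<bar> \<le> norm (weak_grad D (\<lambda>x. f n x - u x) x)" for n
      using rep_AE[OF Db Gi] AE_space ae[of n]
    proof eventually_elim
      case (elim x)
      have "indicator D x * partial i (f n) x - G' i x = weak_grad D (\<lambda>x. f n x - u x) x $ i"
        using elim by (simp add: G'_def grad_def flip: elim(3))
      then show ?case using component_le_norm_cart by simp
    qed
  qed
  \<comment> \<open>The definition of the trace gives convergence in L^q on the boundary, whereas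
    the divergence inequality needs L^1. The constant function 1 is p-integrable there because the
    surface measure is finite.\<close>
  have sb: "(\<lambda>n. \<integral>\<^sup>+x. ennreal \<bar>f n x - \<phi> x\<bar> \<partial>?S) \<longlonglongrightarrow> 0"
  proof -
    interpret finite_measure ?S by (rule surface_measure_finite[OF D sl])
    have d: "(\<lambda>x. f n x - \<phi> x) \<in> Lp r ?S" if "0 < r" for n r
      using D sl that smooth_diff[OF f \<phi>] by (intro smooth_surface_Lp)
    have "(\<lambda>n. Lp_norm ?q ?S (\<lambda>x. f n x - \<phi> x) powr ?q) \<longlonglongrightarrow> 0"
      by (rule tendsto_zero_powrI[OF l2 tendsto_const[of ?q]]) (simp_all add: q0 Lp_norm_nonneg)
    then have l: "(\<lambda>n. LINT x|?S. \<bar>f n x - \<phi> x\<bar> powr ?q) \<longlonglongrightarrow> 0"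
      by (simp add: Lp_norm_powr[OF q0(1)])
    have "(\<lambda>n. LINT x|?S. \<bar>1 * (f n x - \<phi> x)\<bar>) \<longlonglongrightarrow> 0"
    proof (rule holder_tendsto_0[OF p _ _ _ _ l])
      show "(\<lambda>x. f n x - \<phi> x) \<in> borel_measurable ?S" for n by (rule Lp_borel[OF d[OF zero_less_one]])
      show "integrable ?S (\<lambda>x. \<bar>f n x - \<phi> x\<bar> powr ?q)" for n using d[OF q0(1), of n] by (simp add: Lp_def)
    qed simp_all
    then have "(\<lambda>n. ennreal (LINT x|?S. \<bar>f n x - \<phi> x\<bar>)) \<longlonglongrightarrow> ennreal 0"
      by (intro tendsto_ennrealI) simp
    moreover have "(\<integral>\<^sup>+x. ennreal \<bar>f n x - \<phi> x\<bar> \<partial>?S) = ennreal (LINT x|?S. \<bar>f n x - \<phi> x\<bar>)" for n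
      using nn_integral_Lp[OF d[OF zero_less_one], of n] by simp
    ultimately show ?thesis by simp
  qed
  have "weak_div_UNIV (\<lambda>j. if j = i then (\<lambda>x. u' x - indicator D x * \<phi> x) else (\<lambda>_. 0))
      (\<lambda>x. G' i x - indicator D x * partial i \<phi> x)" for i
  proof (rule zero_trace_weak_div_UNIV[OF D outer_frontier_finite[OF D sl] q])
    show "smooth (\<lambda>x. f n x - \<phi> x)" for n by (rule smooth_diff[OF f \<phi>])
    show "(\<lambda>x. u' x - indicator D x * \<phi> x) \<in> Lz ?q D" by (intro Lz_diff[OF q0(2) u'] sm \<phi>)
    show "(\<lambda>x. G' i x - indicator D x * partial i \<phi> x) \<in> Lz ?q D" by (intro Lz_diff[OF q0(2) G'] sm smooth_partial \<phi>)
    have "indicator D x * (f n x - \<phi> x) - (u' x - indicator D x * \<phi> x) = indicator D x * f n x - u' x" for n x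
      by (simp add: right_diff_distrib)
    then show "(\<lambda>n. Np ?q (\<lambda>x. indicator D x * (f n x - \<phi> x) - (u' x - indicator D x * \<phi> x))) \<longlonglongrightarrow> 0"
      using wd by (simp only:)
    have "indicator D x * partial i (\<lambda>x. f n x - \<phi> x) x - (G' i x - indicator D x * partial i \<phi> x) = indicator D x * partial i (f n) x - G' i x" for n x
      by (simp add: right_diff_distrib partial_diff[OF f \<phi>])
    then show "(\<lambda>n. Np ?q (\<lambda>x. indicator D x * partial i (\<lambda>x. f n x - \<phi> x) x - (G' i x - indicator D x * partial i \<phi> x))) \<longlonglongrightarrow> 0"
      using gd by (simp only:)
  qed (rule sb)
  then have "pairing a b (\<lambda>x. u' x - indicator D x * \<phi> x) (\<lambda>i x. G' i x - indicator D x * partial i \<phi> x) = 0"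
    by (intro zero_extension_pairing_eq_0[OF D sl p a b ab] Lz_diff[OF q0(2)] u' G' sm smooth_partial \<phi>)
  then have "pairing a b u' G' = pairing a b (\<lambda>x. indicator D x * \<phi> x) (\<lambda>i x. indicator D x * partial i \<phi> x)"
    by (simp add: pairing_diff[OF p a b u' sm[OF \<phi>] G' sm[OF smooth_partial[OF \<phi>]]])
  also have "\<dots> = pairing a b \<phi> (\<lambda>i. partial i \<phi>)"
  proof -
    have "(\<Sum>i\<in>UNIV. a i x * (indicator D x * partial i \<phi> x)) + b x * (indicator D x * \<phi> x)
        = (\<Sum>i\<in>UNIV. a i x * partial i \<phi> x) + b x * \<phi> x" for x
      using Lz_zero[OF a] Lz_zero[OF b] by (cases "x \<in> D") simp_all
    then show ?thesis by (simp only: pairing_def)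
  qed
  finally show ?thesis by (simp add: u'_def G'_def[abs_def] G_def)
qed

section \<open>The graph spaces and the kernels of the traces\<close>

lemma tendsto_0_inverse_bound:
  fixes X Y :: "nat \<Rightarrow> real"
  assumes "\<And>n. 0 \<le> X n" "\<And>n. X n \<le> Y n" "\<And>n. Y n < 1 / real (Suc n)"
  shows "X \<longlonglongrightarrow> 0"
proof (rule tendsto_sandwich[OF _ _ tendsto_const])
  show "(\<lambda>n. 1 / real (Suc n)) \<longlonglongrightarrow> 0" by (rule LIMSEQ_Suc[OF lim_1_over_n])
  show "\<forall>\<^sub>F n in sequentially. 0 \<le> X n" by (rule always_eventually) (rule allI, rule assms(1))
  show "\<forall>\<^sub>F n in sequentially. X n \<le> 1 / real (Suc n)"
    by (rule always_eventually) (rule allI, rule order_trans[OF assms(2) less_imp_le[OF assms(3)]])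
qed

lemma tendsto_0_ex_less:
  fixes X :: "nat \<Rightarrow> real"
  assumes "X \<longlonglongrightarrow> 0" "0 < e"
  obtains n where "X n < e"
  using order_tendstoD(2)[OF assms] by (auto simp: eventually_sequentially)

section \<open>Graph norms of differences with test fields\<close>

lemma test_field_component: "f \<in> test_fields D \<Longrightarrow> (\<lambda>x. f x $ i) \<in> test_functions D"
  by (simp add: test_fields_def)

definition div_field :: "vector_field \<Rightarrow> scalar_field" where
  "div_field f x = (\<Sum>i\<in>UNIV. partial i (\<lambda>y. f y $ i) x)"

lemma test_field_weak_derivs:
  assumes D: "open D" "bounded D" and f: "f \<in> test_fields D"
  shows "has_weak_div D f (div_field f)" "has_weak_curl D f (curl f)"
proof -
  have Db: "D \<in> sets borel" using D by simp
  have g: "has_weak_grad D (\<lambda>x. f x $ i) (grad (\<lambda>x. f x $ i))" for i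
    by (rule has_weak_grad_smooth[OF D test_functions_smooth[OF test_field_component[OF f]]])
  have "(\<lambda>x. \<Sum>i\<in>UNIV. grad (\<lambda>x. f x $ i) x $ i) = div_field f"
    by (simp add: grad_def div_field_def fun_eq_iff)
  with has_weak_div_from_grads[OF Db g] show "has_weak_div D f (div_field f)" by simp
  have "curl_of_grads (\<lambda>i. grad (\<lambda>x. f x $ i)) = curl f"
    by (simp add: curl_of_grads_def curl_def grad_def fun_eq_iff)
  with has_weak_curl_from_grads[OF Db g] show "has_weak_curl D f (curl f)" by simp
qed

lemma test_field_Lp:
  assumes D: "bounded D" "D \<in> sets borel" and p: "0 < p" and f: "f \<in> test_fields D"
  shows "f \<in> Lp p (lebesgue_on D)" "div_field f \<in> Lp p (lebesgue_on D)" "curl f \<in> Lp p (lebesgue_on D)"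
proof -
  note fs = test_functions_smooth[OF test_field_component[OF f]]
  show "f \<in> Lp p (lebesgue_on D)"
    using p by (simp add: Lp_components_iff smooth_Lp[OF p D fs])
  show "div_field f \<in> Lp p (lebesgue_on D)"
    unfolding div_field_def[abs_def] by (intro smooth_Lp[OF p D] smooth_sum smooth_partial fs)
  show "curl f \<in> Lp p (lebesgue_on D)"
    using p by (simp add: Lp_components_iff smooth_Lp[OF p D test_functions_smooth[OF curl_test[OF f]]])
qed

text \<open>The graph norm of the difference refers to a newly chosen divergence of v - f;
  uniqueness replaces it by the difference of the two divergences.\<close>

lemma Zd_norm_diff_test:
  assumes D: "open D" "bounded D" and p: "0 < p" and v: "v \<in> Zd p D" and f: "f \<in> test_fields D"
  shows "(\<lambda>x. v x - f x) \<in> Lp p (lebesgue_on D)"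
    and "(\<lambda>x. weak_div D v x - div_field f x) \<in> Lp p (lebesgue_on D)"
    and "Zd_norm p D (\<lambda>x. v x - f x) = Lp_norm p (lebesgue_on D) (\<lambda>x. v x - f x)
      + Lp_norm p (lebesgue_on D) (\<lambda>x. weak_div D v x - div_field f x)"
proof -
  have Db: "D \<in> sets borel" using D by simp
  note V = Zd_weak_div[OF D(1) v] and F = test_field_Lp[OF D(2) Db p f]
  show "(\<lambda>x. v x - f x) \<in> Lp p (lebesgue_on D)"
    using p by (intro Lp_diff V F) simp
  show L: "(\<lambda>x. weak_div D v x - div_field f x) \<in> Lp p (lebesgue_on D)"
    using p by (intro Lp_diff V F) simp
  have w: "has_weak_div D (\<lambda>x. v x - f x) (\<lambda>x. weak_div D v x - div_field f x)"
    by (rule has_weak_div_diff[OF Db V(1) test_field_weak_derivs(1)[OF D f]])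
  have ae: "AE x in lebesgue_on D. weak_div D v x - div_field f x = weak_div D (\<lambda>x. v x - f x) x"
    by (rule weak_div_unique[OF D(1) w weak_div_works[OF w]])
  have "Lp_norm p (lebesgue_on D) (\<lambda>x. weak_div D v x - div_field f x)
      = Lp_norm p (lebesgue_on D) (weak_div D (\<lambda>x. v x - f x))"
    by (rule Lp_norm_cong_AE[OF Lp_borel[OF L] borel_measurable_lebesgue_on_AE[OF Db Lp_borel[OF L] ae] ae])
  then show "Zd_norm p D (\<lambda>x. v x - f x) = Lp_norm p (lebesgue_on D) (\<lambda>x. v x - f x)
      + Lp_norm p (lebesgue_on D) (\<lambda>x. weak_div D v x - div_field f x)"
    by (simp add: Zd_norm_def)
qed

lemma Zc_norm_diff_test:
  assumes D: "open D" "bounded D" and p: "0 < p" and v: "v \<in> Zc p D" and f: "f \<in> test_fields D"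
  shows "(\<lambda>x. v x - f x) \<in> Lp p (lebesgue_on D)"
    and "(\<lambda>x. weak_curl D v x - curl f x) \<in> Lp p (lebesgue_on D)"
    and "Zc_norm p D (\<lambda>x. v x - f x) = Lp_norm p (lebesgue_on D) (\<lambda>x. v x - f x)
      + Lp_norm p (lebesgue_on D) (\<lambda>x. weak_curl D v x - curl f x)"
proof -
  have Db: "D \<in> sets borel" using D by simp
  note V = Zc_weak_curl[OF D(1) v] and F = test_field_Lp[OF D(2) Db p f]
  show "(\<lambda>x. v x - f x) \<in> Lp p (lebesgue_on D)"
    using p by (intro Lp_diff V F) simp
  show L: "(\<lambda>x. weak_curl D v x - curl f x) \<in> Lp p (lebesgue_on D)"
    using p by (intro Lp_diff V F) simp
  have w: "has_weak_curl D (\<lambda>x. v x - f x) (\<lambda>x. weak_curl D v x - curl f x)"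
    by (rule has_weak_curl_diff[OF Db V(1) test_field_weak_derivs(2)[OF D f]])
  have ae: "AE x in lebesgue_on D. weak_curl D v x - curl f x = weak_curl D (\<lambda>x. v x - f x) x"
    by (rule weak_curl_unique[OF D(1) w weak_curl_works[OF w]])
  have "Lp_norm p (lebesgue_on D) (\<lambda>x. weak_curl D v x - curl f x)
      = Lp_norm p (lebesgue_on D) (weak_curl D (\<lambda>x. v x - f x))"
    by (rule Lp_norm_cong_AE[OF Lp_borel[OF L] borel_measurable_lebesgue_on_AE[OF Db Lp_borel[OF L] ae] ae])
  then show "Zc_norm p D (\<lambda>x. v x - f x) = Lp_norm p (lebesgue_on D) (\<lambda>x. v x - f x)
      + Lp_norm p (lebesgue_on D) (\<lambda>x. weak_curl D v x - curl f x)"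
    by (simp add: Zc_norm_def)
qed

lemma components_rep_tendsto:
  fixes v :: vector_field and f :: "nat \<Rightarrow> vector_field"
  assumes D: "D \<in> sets borel" and p: "0 < p" and v: "v \<in> Lp p (lebesgue_on D)"
    and fz: "\<And>n x. x \<notin> D \<Longrightarrow> f n x = 0" and vf: "\<And>n. (\<lambda>x. v x - f n x) \<in> Lp p (lebesgue_on D)"
    and lim: "(\<lambda>n. Lp_norm p (lebesgue_on D) (\<lambda>x. v x - f n x)) \<longlonglongrightarrow> 0"
  shows "(\<lambda>n. Np p (\<lambda>x. f n x $ i - rep D (\<lambda>x. v x $ i) x)) \<longlonglongrightarrow> 0"
proof (rule Lp_norm_tendsto_0_imp[OF p D vf lim])
  have vi: "(\<lambda>x. v x $ i) \<in> borel_measurable (lebesgue_on D)" by (rule Lp_borel[OF Lp_component[OF less_imp_le[OF p] v]])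
  note r = rep[OF D vi]
  show "f n x $ i - rep D (\<lambda>x. v x $ i) x = 0" if "x \<notin> D" for n x using fz[OF that] r(2)[OF that] by simp
  show "AE x in lebesgue_on D. \<bar>f n x $ i - rep D (\<lambda>x. v x $ i) x\<bar> \<le> norm (v x - f n x)" for n
    using r(3)
  proof eventually_elim
    case (elim x)
    then show ?case using component_le_norm_cart[of "v x - f n x" i] by (simp add: abs_minus_commute)
  qed
qed

lemma Lp_norm_components_tendsto:
  fixes v :: vector_field and f :: "nat \<Rightarrow> vector_field"
  assumes D: "D \<in> sets borel" and p: "0 < p" and v: "v \<in> Lp p (lebesgue_on D)"
    and fz: "\<And>n x. x \<notin> D \<Longrightarrow> f n x = 0" and vf: "\<And>n. (\<lambda>x. v x - f n x) \<in> Lp p (lebesgue_on D)"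
    and fm: "\<And>n i. (\<lambda>x. f n x $ i) \<in> borel_measurable borel"
    and lim: "\<And>i. (\<lambda>n. Np p (\<lambda>x. f n x $ i - rep D (\<lambda>x. v x $ i) x)) \<longlonglongrightarrow> 0"
  shows "(\<lambda>n. Lp_norm p (lebesgue_on D) (\<lambda>x. v x - f n x)) \<longlonglongrightarrow> 0"
proof (rule Np_tendsto_0_imp[OF p D vf, where I = "UNIV :: 3 set" and C = "3 powr p"])
  have vi: "(\<lambda>x. v x $ i) \<in> borel_measurable (lebesgue_on D)" for i by (rule Lp_borel[OF Lp_component[OF less_imp_le[OF p] v]])
  note r = rep[OF D vi]
  show "f n x $ i - rep D (\<lambda>x. v x $ i) x = 0" if "x \<notin> D" for n x i using fz[OF that] r(2)[OF that] by simp
  show "(\<lambda>x. f n x $ i - rep D (\<lambda>x. v x $ i) x) \<in> borel_measurable borel" for n i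
    using fm r(1) by (intro borel_measurable_diff)
  show "AE x in lebesgue_on D. norm (v x - f n x) powr p \<le> 3 powr p * (\<Sum>i\<in>UNIV. \<bar>f n x $ i - rep D (\<lambda>x. v x $ i) x\<bar> powr p)" for n
    using component_rep_AE[OF D vi]
  proof eventually_elim
    case (elim x)
    then show ?case
      using norm_powr_le_sum_components[of p "v x - f n x"] p by (simp add: abs_minus_commute)
  qed
qed (simp_all add: lim)

lemma Zd0_pairing:
  assumes D: "open D" "bounded D" and p: "1 < p" and v: "v \<in> Zd0 p D" and u: "u \<in> W1 (conj_exponent p) D"
  shows "pairing (\<lambda>j. rep D (\<lambda>x. v x $ j)) (rep D (weak_div D v)) (rep D u) (\<lambda>j. rep D (\<lambda>x. weak_grad D u x $ j)) = 0"
proof -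
  let ?q = "conj_exponent p" and ?M = "lebesgue_on D"
  have q: "0 < ?q" using conj_exponent_gt_1[OF p] by simp
  have p0: "0 < p" using p by simp
  have Db: "D \<in> sets borel" using D by simp
  have vZ: "v \<in> Zd p D" using v by (simp add: Zd0_def)
  note V = Zd_weak_div[OF D(1) vZ] and U = W1_weak_grad[OF D(1) u]
  have "\<exists>f\<in>test_fields D. Zd_norm p D (\<lambda>x. v x - f x) < 1 / real (Suc n)" for n
    using v by (simp add: Zd0_def)
  then obtain f where f: "\<And>n. f n \<in> test_fields D" "\<And>n. Zd_norm p D (\<lambda>x. v x - f n x) < 1 / real (Suc n)"
    by metis
  note N = Zd_norm_diff_test[OF D p0 vZ f(1)]
  have l1: "(\<lambda>n. Lp_norm p ?M (\<lambda>x. v x - f n x)) \<longlonglongrightarrow> 0"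
    by (rule tendsto_0_inverse_bound[OF _ _ f(2)]) (simp_all add: N(3) Lp_norm_nonneg)
  have l2: "(\<lambda>n. Lp_norm p ?M (\<lambda>x. weak_div D v x - div_field (f n) x)) \<longlonglongrightarrow> 0"
    by (rule tendsto_0_inverse_bound[OF _ _ f(2)]) (simp_all add: N(3) Lp_norm_nonneg)
  have fz: "f n x $ j = 0" if "x \<notin> D" for n x j
    using test_functions_zero[OF test_field_component[OF f(1)] that] .
  note rh = rep[OF Db Lp_borel[OF V(2)]]
  show ?thesis
  proof (rule pairing_limit_eq_0[OF Db D(2) p, where a = "\<lambda>n j x. f n x $ j"])
    show "(\<lambda>x. f n x $ j) \<in> test_functions D" for n j by (rule test_field_component[OF f(1)])
    show "rep D (\<lambda>x. v x $ j) \<in> Lz p D" for j by (rule rep_component_Lz[OF less_imp_le[OF p0] Db V(3)])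
    show "rep D (weak_div D v) \<in> Lz p D" by (rule rep_Lz[OF Db V(2)])
    show "(\<lambda>n. Np p (\<lambda>x. f n x $ j - rep D (\<lambda>x. v x $ j) x)) \<longlonglongrightarrow> 0" for j
      by (rule components_rep_tendsto[OF Db p0 V(3) _ N(1) l1]) (simp add: vec_eq_iff fz)
    show "(\<lambda>n. Np p (\<lambda>x. (\<Sum>j\<in>UNIV. partial j (\<lambda>x. f n x $ j) x) - rep D (weak_div D v) x)) \<longlonglongrightarrow> 0"
    proof (rule Lp_norm_tendsto_0_imp[OF p0 Db N(2) l2])
      show "(\<Sum>j\<in>UNIV. partial j (\<lambda>x. f n x $ j) x) - rep D (weak_div D v) x = 0" if "x \<notin> D" for n x
        using test_functions_zero[OF test_functions_partial[OF test_field_component[OF f(1)]] that] rh(2)[OF that] by simp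
      show "AE x in ?M. \<bar>(\<Sum>j\<in>UNIV. partial j (\<lambda>x. f n x $ j) x) - rep D (weak_div D v) x\<bar> \<le> norm (weak_div D v x - div_field (f n) x)" for n
        using rh(3) by eventually_elim (simp add: div_field_def abs_minus_commute)
    qed
    show "rep D u \<in> Lz ?q D" by (rule rep_Lz[OF Db U(3)])
    show "rep D (\<lambda>x. weak_grad D u x $ j) \<in> Lz ?q D" for j by (rule rep_component_Lz[OF less_imp_le[OF q] Db U(2)])
    show "weak_div_on D (\<lambda>j. if j = i then rep D u else (\<lambda>_. 0)) (rep D (\<lambda>x. weak_grad D u x $ i))" for i
      by (rule weak_grad_rows[OF Db U(3,2) q U(1)])
  qed
qed

text \<open>One row at a time: the rows of approximating test fields consist of test functions, and
  their divergences are the components of curls that converge in L^p.\<close>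

lemma Zc0_pairing:
  assumes D: "open D" "bounded D" and p: "1 < p" and v: "v \<in> Zc0 p D" and u: "u \<in> W1 (conj_exponent p) D"
  shows "pairing (rot (\<lambda>j. rep D (\<lambda>x. v x $ j)) i) (rep D (\<lambda>x. weak_curl D v x $ i)) (rep D u) (\<lambda>j. rep D (\<lambda>x. weak_grad D u x $ j)) = 0"
proof -
  let ?q = "conj_exponent p" and ?M = "lebesgue_on D"
  have q: "0 < ?q" using conj_exponent_gt_1[OF p] by simp
  have p0: "0 < p" using p by simp
  have Db: "D \<in> sets borel" using D by simp
  have vZ: "v \<in> Zc p D" using v by (simp add: Zc0_def)
  note V = Zc_weak_curl[OF D(1) vZ] and U = W1_weak_grad[OF D(1) u]
  have "\<exists>f\<in>test_fields D. Zc_norm p D (\<lambda>x. v x - f x) < 1 / real (Suc n)" for n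
    using v by (simp add: Zc0_def)
  then obtain f where f: "\<And>n. f n \<in> test_fields D" "\<And>n. Zc_norm p D (\<lambda>x. v x - f n x) < 1 / real (Suc n)"
    by metis
  note N = Zc_norm_diff_test[OF D p0 vZ f(1)]
  have l1: "(\<lambda>n. Lp_norm p ?M (\<lambda>x. v x - f n x)) \<longlonglongrightarrow> 0"
    by (rule tendsto_0_inverse_bound[OF _ _ f(2)]) (simp_all add: N(3) Lp_norm_nonneg)
  have l2: "(\<lambda>n. Lp_norm p ?M (\<lambda>x. weak_curl D v x - curl (f n) x)) \<longlonglongrightarrow> 0"
    by (rule tendsto_0_inverse_bound[OF _ _ f(2)]) (simp_all add: N(3) Lp_norm_nonneg)
  have fz: "f n x $ j = 0" "curl (f n) x $ j = 0" if "x \<notin> D" for n x j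
    using test_functions_zero[OF test_field_component[OF f(1)] that]
      test_functions_zero[OF curl_test[OF f(1)] that] by simp_all
  show ?thesis
  proof (rule pairing_limit_eq_0[OF Db D(2) p, where a = "\<lambda>n. rot (\<lambda>j x. f n x $ j) i"])
    show "rot (\<lambda>j x. f n x $ j) i j \<in> test_functions D" for n j
      by (rule rot_test) (rule test_field_component[OF f(1)])
    show "rot (\<lambda>j. rep D (\<lambda>x. v x $ j)) i j \<in> Lz p D" for j
      by (intro rot_Lz[OF p0 D(2)] rep_component_Lz[OF less_imp_le[OF p0] Db V(3)])
    show "rep D (\<lambda>x. weak_curl D v x $ i) \<in> Lz p D" by (rule rep_component_Lz[OF less_imp_le[OF p0] Db V(2)])
    show "(\<lambda>n. Np p (\<lambda>x. rot (\<lambda>j x. f n x $ j) i j x - rot (\<lambda>j. rep D (\<lambda>x. v x $ j)) i j x)) \<longlonglongrightarrow> 0" for j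
      by (rule rot_Np_tendsto, rule components_rep_tendsto[OF Db p0 V(3) _ N(1) l1]) (simp add: vec_eq_iff fz)
    have "(\<Sum>j\<in>UNIV. partial j (rot (\<lambda>j x. f n x $ j) i j) x) = curl (f n) x $ i" for n x
      using sum_partial_rot[of "\<lambda>k x. f n x $ k" i x] test_functions_smooth[OF test_field_component[OF f(1)]]
      by (simp add: vec_lambda_eta)
    then show "(\<lambda>n. Np p (\<lambda>x. (\<Sum>j\<in>UNIV. partial j (rot (\<lambda>j x. f n x $ j) i j) x) - rep D (\<lambda>x. weak_curl D v x $ i) x)) \<longlonglongrightarrow> 0"
      using components_rep_tendsto[OF Db p0 V(2) _ N(2) l2, of i] by (simp add: vec_eq_iff fz)
    show "rep D u \<in> Lz ?q D" by (rule rep_Lz[OF Db U(3)])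
    show "rep D (\<lambda>x. weak_grad D u x $ j) \<in> Lz ?q D" for j by (rule rep_component_Lz[OF less_imp_le[OF q] Db U(2)])
    show "weak_div_on D (\<lambda>j. if j = k then rep D u else (\<lambda>_. 0)) (rep D (\<lambda>x. weak_grad D u x $ k))" for k
      by (rule weak_grad_rows[OF Db U(3,2) q U(1)])
  qed
qed

text \<open>The hypothesis says that the extension of v by zero has the zero-extended divergence on
  the whole space, which is what the approximation scheme requires.\<close>

lemma Zd0I:
  assumes D: "open D" "bounded D" and sl: "strongly_lipschitz D" and p: "1 < p" and v: "v \<in> Zd p D"
    and z: "\<And>\<phi>. smooth \<phi> \<Longrightarrow> pairing (\<lambda>j. rep D (\<lambda>x. v x $ j)) (rep D (weak_div D v)) \<phi> (\<lambda>j. partial j \<phi>) = 0"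
  shows "v \<in> Zd0 p D"
proof -
  let ?M = "lebesgue_on D"
  have p0: "0 < p" "0 \<le> p" "1 \<le> p" using p by auto
  have Db: "D \<in> sets borel" using D by simp
  note V = Zd_weak_div[OF D(1) v]
  obtain \<Lambda> where "approximation_scheme D \<Lambda>" by (rule approximation[OF D sl])
  then have t: "\<And>n u p. 1 \<le> p \<Longrightarrow> u \<in> Lz p D \<Longrightarrow> \<Lambda> n u \<in> test_functions D"
    and l: "\<And>u p. 1 \<le> p \<Longrightarrow> u \<in> Lz p D \<Longrightarrow> (\<lambda>n. Np p (\<lambda>x. \<Lambda> n u x - u x)) \<longlonglongrightarrow> 0"
    and ld: "\<And>v g p. 1 \<le> p \<Longrightarrow> \<forall>i. v i \<in> Lz p D \<Longrightarrow> g \<in> Lz p D \<Longrightarrow> weak_div_UNIV v g \<Longrightarrow>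
      (\<lambda>n. Np p (\<lambda>x. (\<Sum>i\<in>UNIV. partial i (\<Lambda> n (v i)) x) - g x)) \<longlonglongrightarrow> 0"
    unfolding approximation_scheme_def by simp_all
  define v' where "v' j = rep D (\<lambda>x. v x $ j)" for j
  define h' where "h' = rep D (weak_div D v)"
  have v': "v' j \<in> Lz p D" for j unfolding v'_def by (rule rep_component_Lz[OF p0(2) Db V(3)])
  have h': "h' \<in> Lz p D" unfolding h'_def by (rule rep_Lz[OF Db V(2)])
  have "weak_div_UNIV v' h'"
    unfolding weak_div_UNIV_iff[OF p0(3) D(2) v' h'] using z by (simp add: v'_def[abs_def] h'_def)
  then have lh: "(\<lambda>n. Np p (\<lambda>x. (\<Sum>i\<in>UNIV. partial i (\<Lambda> n (v' i)) x) - h' x)) \<longlonglongrightarrow> 0"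
    using ld[OF p0(3) _ h'] v' by blast
  define f where "f n x = (\<chi> j. \<Lambda> n (v' j) x)" for n x
  have fj: "(\<lambda>x. f n x $ j) = \<Lambda> n (v' j)" for n j by (simp add: f_def)
  have f: "f n \<in> test_fields D" for n
    unfolding test_fields_def using t[OF p0(3) v'] by (simp add: fj)
  note fc = test_field_component[OF f]
  note N = Zd_norm_diff_test[OF D p0(1) v f]
  have l1: "(\<lambda>n. Lp_norm p ?M (\<lambda>x. v x - f n x)) \<longlonglongrightarrow> 0"
  proof (rule Lp_norm_components_tendsto[OF Db p0(1) V(3) _ N(1)])
    show "f n x = 0" if "x \<notin> D" for n x using test_functions_zero[OF fc that] by (simp add: vec_eq_iff)
    show "(\<lambda>x. f n x $ i) \<in> borel_measurable borel" for n i by (rule smooth_borel[OF test_functions_smooth[OF fc]])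
    show "(\<lambda>n. Np p (\<lambda>x. f n x $ i - rep D (\<lambda>x. v x $ i) x)) \<longlonglongrightarrow> 0" for i
      using l[OF p0(3) v', of i] by (simp add: f_def v'_def)
  qed
  have l2: "(\<lambda>n. Lp_norm p ?M (\<lambda>x. weak_div D v x - div_field (f n) x)) \<longlonglongrightarrow> 0"
  \<comment> \<open>The divergence is scalar, so a single index stands in for the
    components.\<close>
  proof (rule Np_tendsto_0_imp[OF p0(1) Db N(2), where I = "{()}" and C = 1 and u' = "\<lambda>_ n x. div_field (f n) x - h' x"])
    have ft: "partial i (\<lambda>x. f n x $ i) \<in> test_functions D" for n i by (rule test_functions_partial[OF fc])
    show "div_field (f n) x - h' x = 0" if "x \<notin> D" for n x
      using test_functions_zero[OF ft that] Lz_zero[OF h' that] by (simp add: div_field_def)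
    show "(\<lambda>x. div_field (f n) x - h' x) \<in> borel_measurable borel" for n
      unfolding div_field_def
      by (intro borel_measurable_diff borel_measurable_sum Lz_borel[OF h'] smooth_borel test_functions_smooth[OF ft])
    show "(\<lambda>n. Np p (\<lambda>x. div_field (f n) x - h' x)) \<longlonglongrightarrow> 0"
      using lh by (simp add: div_field_def fj)
    show "AE x in ?M. norm (weak_div D v x - div_field (f n) x) powr p \<le> 1 * (\<Sum>i\<in>{()}. \<bar>div_field (f n) x - h' x\<bar> powr p)" for n
      using rep_AE[OF Db Lp_borel[OF V(2)]] by eventually_elim (simp add: h'_def abs_minus_commute)
  qed simp_all
  have lim: "(\<lambda>n. Zd_norm p D (\<lambda>x. v x - f n x)) \<longlonglongrightarrow> 0"
    unfolding N(3) using tendsto_add[OF l1 l2] by simp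
  have "\<exists>g\<in>test_fields D. Zd_norm p D (\<lambda>x. v x - g x) < e" if e: "0 < e" for e
  proof -
    obtain n where "Zd_norm p D (\<lambda>x. v x - f n x) < e" by (rule tendsto_0_ex_less[OF lim e])
    then show ?thesis using f by blast
  qed
  with v show ?thesis by (simp add: Zd0_def)
qed

lemma Zc0I:
  assumes D: "open D" "bounded D" and sl: "strongly_lipschitz D" and p: "1 < p" and v: "v \<in> Zc p D"
    and z: "\<And>i \<phi>. smooth \<phi> \<Longrightarrow> pairing (rot (\<lambda>j. rep D (\<lambda>x. v x $ j)) i) (rep D (\<lambda>x. weak_curl D v x $ i)) \<phi> (\<lambda>j. partial j \<phi>) = 0"
  shows "v \<in> Zc0 p D"
proof -
  let ?M = "lebesgue_on D"
  have p0: "0 < p" "0 \<le> p" "1 \<le> p" using p by auto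
  have Db: "D \<in> sets borel" using D by simp
  note V = Zc_weak_curl[OF D(1) v]
  obtain \<Lambda> where "approximation_scheme D \<Lambda>" by (rule approximation[OF D sl])
  then have t: "\<And>n u p. 1 \<le> p \<Longrightarrow> u \<in> Lz p D \<Longrightarrow> \<Lambda> n u \<in> test_functions D"
    and l: "\<And>u p. 1 \<le> p \<Longrightarrow> u \<in> Lz p D \<Longrightarrow> (\<lambda>n. Np p (\<lambda>x. \<Lambda> n u x - u x)) \<longlonglongrightarrow> 0"
    and ld: "\<And>v g p. 1 \<le> p \<Longrightarrow> \<forall>i. v i \<in> Lz p D \<Longrightarrow> g \<in> Lz p D \<Longrightarrow> weak_div_UNIV v g \<Longrightarrow>
      (\<lambda>n. Np p (\<lambda>x. (\<Sum>i\<in>UNIV. partial i (\<Lambda> n (v i)) x) - g x)) \<longlonglongrightarrow> 0"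
    and \<Lambda>m: "\<And>n u. \<Lambda> n (\<lambda>x. - u x) = (\<lambda>x. - \<Lambda> n u x)" and \<Lambda>0: "\<And>n. \<Lambda> n (\<lambda>x. 0) = (\<lambda>x. 0)"
    unfolding approximation_scheme_def by simp_all
  define v' where "v' j = rep D (\<lambda>x. v x $ j)" for j
  define g' where "g' i = rep D (\<lambda>x. weak_curl D v x $ i)" for i
  have v': "v' j \<in> Lz p D" for j unfolding v'_def by (rule rep_component_Lz[OF p0(2) Db V(3)])
  have g': "g' j \<in> Lz p D" for j unfolding g'_def by (rule rep_component_Lz[OF p0(2) Db V(2)])
  have r': "rot v' i j \<in> Lz p D" for i j by (rule rot_Lz[OF p0(1) D(2) v'])
  \<comment> \<open>This ties the three divergences together: the rows are approximated by the rows
    of one and the same field, so the approximated divergences are the components of its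
    curl.\<close>
  have \<Lambda>rot: "\<Lambda> n (rot v' i j) = rot (\<lambda>k. \<Lambda> n (v' k)) i j" for n i j
    using rot_sign_cases[of i j] by (auto simp: rot_def[abs_def] \<Lambda>0 \<Lambda>m)
  have "weak_div_UNIV (rot v' i) (g' i)" for i
    unfolding weak_div_UNIV_iff[OF p0(3) D(2) r' g'] using z by (simp add: v'_def[abs_def] g'_def)
  then have lg: "(\<lambda>n. Np p (\<lambda>x. (\<Sum>j\<in>UNIV. partial j (\<Lambda> n (rot v' i j)) x) - g' i x)) \<longlonglongrightarrow> 0" for i
    using ld[OF p0(3) _ g'] r' by blast
  define f where "f n x = (\<chi> j. \<Lambda> n (v' j) x)" for n x
  have fj: "(\<lambda>x. f n x $ j) = \<Lambda> n (v' j)" for n j by (simp add: f_def)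
  have f: "f n \<in> test_fields D" for n
    unfolding test_fields_def using t[OF p0(3) v'] by (simp add: fj)
  note fc = test_field_component[OF f]
  note N = Zc_norm_diff_test[OF D p0(1) v f]
  have fz: "f n x = 0" "curl (f n) x = 0" if "x \<notin> D" for n x
    using test_functions_zero[OF fc that] test_functions_zero[OF curl_test[OF f] that] by (simp_all add: vec_eq_iff)
  have l1: "(\<lambda>n. Lp_norm p ?M (\<lambda>x. v x - f n x)) \<longlonglongrightarrow> 0"
  proof (rule Lp_norm_components_tendsto[OF Db p0(1) V(3) fz(1) N(1)])
    show "(\<lambda>x. f n x $ i) \<in> borel_measurable borel" for n i by (rule smooth_borel[OF test_functions_smooth[OF fc]])
    show "(\<lambda>n. Np p (\<lambda>x. f n x $ i - rep D (\<lambda>x. v x $ i) x)) \<longlonglongrightarrow> 0" for i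
      using l[OF p0(3) v', of i] by (simp add: f_def v'_def)
  qed
  have l2: "(\<lambda>n. Lp_norm p ?M (\<lambda>x. weak_curl D v x - curl (f n) x)) \<longlonglongrightarrow> 0"
  proof (rule Lp_norm_components_tendsto[OF Db p0(1) V(2) fz(2) N(2)])
    show "(\<lambda>x. curl (f n) x $ i) \<in> borel_measurable borel" for n i
      by (rule smooth_borel[OF test_functions_smooth[OF curl_test[OF f]]])
    have sm: "smooth (\<Lambda> n (v' k))" for n k by (rule test_functions_smooth[OF t[OF p0(3) v']])
    have "(\<Sum>j\<in>UNIV. partial j (\<Lambda> n (rot v' i j)) x) = curl (f n) x $ i" for n i x
      unfolding \<Lambda>rot sum_partial_rot[OF sm] f_def[abs_def] ..
    then show "(\<lambda>n. Np p (\<lambda>x. curl (f n) x $ i - rep D (\<lambda>x. weak_curl D v x $ i) x)) \<longlonglongrightarrow> 0" for i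
      using lg[of i] by (simp add: g'_def)
  qed
  have lim: "(\<lambda>n. Zc_norm p D (\<lambda>x. v x - f n x)) \<longlonglongrightarrow> 0"
    unfolding N(3) using tendsto_add[OF l1 l2] by simp
  have "\<exists>g\<in>test_fields D. Zc_norm p D (\<lambda>x. v x - g x) < e" if e: "0 < e" for e
  proof -
    obtain n where "Zc_norm p D (\<lambda>x. v x - f n x) < e" by (rule tendsto_0_ex_less[OF lim e])
    then show ?thesis using f by blast
  qed
  with v show ?thesis by (simp add: Zc0_def)
qed

lemma gamma_dot_n_pairing:
  assumes D: "open D" "bounded D" and p: "1 < p" and v: "v \<in> Zd p D" and u: "u \<in> W1 (conj_exponent p) D"
  shows "(LINT x|lebesgue_on D. v x \<bullet> weak_grad D u x) + (LINT x|lebesgue_on D. u x * weak_div D v x)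
    = pairing (\<lambda>j. rep D (\<lambda>x. v x $ j)) (rep D (weak_div D v)) (rep D u) (\<lambda>j. rep D (\<lambda>x. weak_grad D u x $ j))"
proof -
  let ?q = "conj_exponent p"
  have q: "0 < ?q" "0 \<le> ?q" using conj_exponent_gt_1[OF p] by auto
  have p0: "0 < p" "0 \<le> p" using p by auto
  have Db: "D \<in> sets borel" using D by simp
  note V = Zd_weak_div[OF D(1) v] and U = W1_weak_grad[OF D(1) u]
  define v' where "v' j = rep D (\<lambda>x. v x $ j)" for j
  define h' where "h' = rep D (weak_div D v)"
  define u' where "u' = rep D u"
  define G' where "G' j = rep D (\<lambda>x. weak_grad D u x $ j)" for j
  have v': "v' j \<in> Lz p D" for j unfolding v'_def by (rule rep_component_Lz[OF p0(2) Db V(3)])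
  have h': "h' \<in> Lz p D" unfolding h'_def by (rule rep_Lz[OF Db V(2)])
  have u': "u' \<in> Lz ?q D" unfolding u'_def by (rule rep_Lz[OF Db U(3)])
  have G': "G' j \<in> Lz ?q D" for j unfolding G'_def by (rule rep_component_Lz[OF q(2) Db U(2)])
  have vA: "AE x in lebesgue_on D. \<forall>i. v' i x = v x $ i"
    unfolding v'_def by (rule component_rep_AE[OF Db Lp_borel[OF Lp_component[OF p0(2) V(3)]]])
  have GA: "AE x in lebesgue_on D. \<forall>i. G' i x = weak_grad D u x $ i"
    unfolding G'_def by (rule component_rep_AE[OF Db Lp_borel[OF Lp_component[OF q(2) U(2)]]])
  have uA: "AE x in lebesgue_on D. u' x = u x" unfolding u'_def by (rule rep_AE[OF Db Lp_borel[OF U(3)]])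
  have hA: "AE x in lebesgue_on D. h' x = weak_div D v x" unfolding h'_def by (rule rep_AE[OF Db Lp_borel[OF V(2)]])
  have 1: "(LINT x|lebesgue_on D. v x \<bullet> weak_grad D u x) = pairing v' (\<lambda>_. 0) u' G'"
  proof (rule pairing_eqI[OF Db Lz_borel[OF v'] _ Lz_borel[OF u'] Lz_borel[OF G'] Lz_zero[OF v']])
    show "AE x in lebesgue_on D. v x \<bullet> weak_grad D u x = (\<Sum>i\<in>UNIV. v' i x * G' i x) + 0 * u' x"
      using vA GA by eventually_elim (simp add: inner_vec_def)
  qed simp_all
  have 2: "(LINT x|lebesgue_on D. u x * weak_div D v x) = pairing (\<lambda>_ _. 0) h' u' G'"
  proof (rule pairing_eqI[OF Db _ Lz_borel[OF h'] Lz_borel[OF u'] Lz_borel[OF G'] _ Lz_zero[OF h']])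
    show "AE x in lebesgue_on D. u x * weak_div D v x = (\<Sum>i\<in>UNIV. 0 * G' i x) + h' x * u' x"
      using uA hA by eventually_elim simp
  qed simp_all
  have "pairing v' (\<lambda>_. 0) u' G' + pairing (\<lambda>_ _. 0) h' u' G' = pairing v' h' u' G'"
    unfolding pairing_eq_sum[OF p v' Lz_0[OF p0(1)] u' G'] pairing_eq_sum[OF p Lz_0[OF p0(1)] h' u' G']
      pairing_eq_sum[OF p v' h' u' G'] by simp
  with 1 2 show ?thesis by (simp add: v'_def[abs_def] h'_def u'_def G'_def[abs_def])
qed

text \<open>By antisymmetry v \<bullet> curl w is minus the sum over i of the i-th row of v times
  the gradient of the i-th component of w. The tangential pairing is thus minus the sum of three
  pairings of normal type.\<close>

lemma gamma_cross_n_pairing: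
  assumes D: "open D" "bounded D" and p: "1 < p" and v: "v \<in> Zc p D" and w: "w \<in> W1_fields (conj_exponent p) D"
  shows "(LINT x|lebesgue_on D. v x \<bullet> weak_curl D w x) - (LINT x|lebesgue_on D. w x \<bullet> weak_curl D v x)
    = - (\<Sum>i\<in>UNIV. pairing (rot (\<lambda>j. rep D (\<lambda>x. v x $ j)) i) (rep D (\<lambda>x. weak_curl D v x $ i))
          (rep D (\<lambda>x. w x $ i)) (\<lambda>j. rep D (\<lambda>x. weak_grad D (\<lambda>x. w x $ i) x $ j)))"
proof -
  let ?q = "conj_exponent p"
  have q: "0 < ?q" "0 \<le> ?q" using conj_exponent_gt_1[OF p] by auto
  have p0: "0 < p" "0 \<le> p" using p by auto
  have Db: "D \<in> sets borel" using D by simp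
  have wi: "(\<lambda>x. w x $ i) \<in> W1 ?q D" for i using w by (simp add: W1_fields_def)
  note V = Zc_weak_curl[OF D(1) v] and W = W1_weak_grad[OF D(1) wi]
  define G where "G i = weak_grad D (\<lambda>x. w x $ i)" for i
  define v' where "v' j = rep D (\<lambda>x. v x $ j)" for j
  define g' where "g' j = rep D (\<lambda>x. weak_curl D v x $ j)" for j
  define w' where "w' i = rep D (\<lambda>x. w x $ i)" for i
  define G' where "G' i j = rep D (\<lambda>x. G i x $ j)" for i j
  have v': "v' j \<in> Lz p D" for j unfolding v'_def by (rule rep_component_Lz[OF p0(2) Db V(3)])
  have g': "g' j \<in> Lz p D" for j unfolding g'_def by (rule rep_component_Lz[OF p0(2) Db V(2)])
  have w': "w' i \<in> Lz ?q D" for i unfolding w'_def by (rule rep_Lz[OF Db W(3)])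
  have G': "G' i j \<in> Lz ?q D" for i j unfolding G'_def G_def by (rule rep_component_Lz[OF q(2) Db W(2)])
  have r': "rot v' i j \<in> Lz p D" for i j by (rule rot_Lz[OF p0(1) D(2) v'])
  have vA: "AE x in lebesgue_on D. \<forall>i. v' i x = v x $ i"
    unfolding v'_def by (rule component_rep_AE[OF Db Lp_borel[OF Lp_component[OF p0(2) V(3)]]])
  have gA: "AE x in lebesgue_on D. \<forall>i. g' i x = weak_curl D v x $ i"
    unfolding g'_def by (rule component_rep_AE[OF Db Lp_borel[OF Lp_component[OF p0(2) V(2)]]])
  have wA: "AE x in lebesgue_on D. \<forall>i. w' i x = w x $ i"
    unfolding w'_def by (rule component_rep_AE[OF Db Lp_borel[OF W(3)]])
  have "AE x in lebesgue_on D. \<forall>j. G' i j x = G i x $ j" for i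
    unfolding G'_def G_def by (rule component_rep_AE[OF Db Lp_borel[OF Lp_component[OF q(2) W(2)]]])
  then have GA: "AE x in lebesgue_on D. \<forall>i j. G' i j x = G i x $ j" by (simp add: AE_all_countable)
  have wc: "has_weak_curl D w (curl_of_grads G)"
    unfolding G_def by (rule has_weak_curl_from_grads[OF Db W(1)])
  have cA: "AE x in lebesgue_on D. curl_of_grads G x = weak_curl D w x"
    by (rule weak_curl_unique[OF D(1) wc weak_curl_works[OF wc]])
  \<comment> \<open>The curl of w through the Borel representatives of the gradients; the chosen
    weak curl agrees with it almost everywhere on D.\<close>
  define c' where "c' = (\<lambda>(k::3) x. if k = 1 then G' 3 2 x - G' 2 3 x else if k = 2 then G' 1 3 x - G' 3 1 x else G' 2 1 x - G' 1 2 x)"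
  have c': "c' k \<in> Lz ?q D" for k
    unfolding c'_def using exhaust_3[of k] by (auto intro!: Lz_diff[OF q(2)] G')
  have z: "(\<lambda>_. 0) \<in> Lz ?q D" by (rule Lz_0[OF q(1)])
  have 1: "(LINT x|lebesgue_on D. v x \<bullet> weak_curl D w x) = pairing v' (\<lambda>_. 0) (\<lambda>_. 0) c'"
  proof (rule pairing_eqI[OF Db Lz_borel[OF v'] _ _ Lz_borel[OF c'] Lz_zero[OF v']])
    show "AE x in lebesgue_on D. v x \<bullet> weak_curl D w x = (\<Sum>i\<in>UNIV. v' i x * c' i x) + 0 * 0"
      using vA GA cA
    proof eventually_elim
      case (elim x)
      have "v x \<bullet> weak_curl D w x = (\<Sum>i\<in>UNIV. v x $ i * curl_of_grads G x $ i)"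
        unfolding elim(3) inner_vec_def inner_real_def ..
      then show ?case using elim(1,2) by (simp add: sum_3 curl_of_grads_def c'_def)
    qed
  qed simp_all
  have 2: "(LINT x|lebesgue_on D. w x \<bullet> weak_curl D v x) = pairing g' (\<lambda>_. 0) (\<lambda>_. 0) w'"
  proof (rule pairing_eqI[OF Db Lz_borel[OF g'] _ _ Lz_borel[OF w'] Lz_zero[OF g']])
    show "AE x in lebesgue_on D. w x \<bullet> weak_curl D v x = (\<Sum>i\<in>UNIV. g' i x * w' i x) + 0 * 0"
      using gA wA by eventually_elim (simp add: inner_vec_def mult.commute)
  qed simp_all
  have pt: "((\<Sum>i\<in>UNIV. v' i x * c' i x) + 0 * 0) - ((\<Sum>i\<in>UNIV. g' i x * w' i x) + 0 * 0)
      = - (\<Sum>i\<in>UNIV. (\<Sum>j\<in>UNIV. rot v' i j x * G' i j x) + g' i x * w' i x)" for x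
    by (simp add: sum_3 c'_def rot_def rot_values algebra_simps)
  have "pairing v' (\<lambda>_. 0) (\<lambda>_. 0) c' - pairing g' (\<lambda>_. 0) (\<lambda>_. 0) w'
      = (LINT x|lborel. - (\<Sum>i\<in>UNIV. (\<Sum>j\<in>UNIV. rot v' i j x * G' i j x) + g' i x * w' i x))"
    unfolding pairing_def pt[symmetric]
    by (rule Bochner_Integration.integral_diff[symmetric])
      (rule pairing_integrable[OF p v' Lz_0[OF p0(1)] z c'] pairing_integrable[OF p g' Lz_0[OF p0(1)] z w'])+
  also have "\<dots> = - (LINT x|lborel. (\<Sum>i\<in>UNIV. (\<Sum>j\<in>UNIV. rot v' i j x * G' i j x) + g' i x * w' i x))"
    by (rule Bochner_Integration.integral_minus)
  also have "(LINT x|lborel. (\<Sum>i\<in>UNIV. (\<Sum>j\<in>UNIV. rot v' i j x * G' i j x) + g' i x * w' i x))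
      = (\<Sum>i\<in>UNIV. pairing (rot v' i) (g' i) (w' i) (G' i))"
    unfolding pairing_def
    by (rule Bochner_Integration.integral_sum) (rule pairing_integrable[OF p r' g' w' G'])
  finally show ?thesis
    unfolding 1 2 by (simp add: v'_def[abs_def] g'_def[abs_def] w'_def[abs_def] G'_def[abs_def] G_def)
qed

lemma trace_space_lifting:
  assumes "l \<in> trace_space q D"
  defines "u \<equiv> (SOME u. u \<in> W1 q D \<and> has_trace q D u l)"
  shows "u \<in> W1 q D" "has_trace q D u l"
  using assms(1) someI_ex[of "\<lambda>u. u \<in> W1 q D \<and> has_trace q D u l"]
  unfolding trace_space_def u_def by blast+

text \<open>Membership gives a lifting of each component separately; assembling them into one field
  provides the witness for the choice.\<close>

lemma trace_space_fields_lifting: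
  assumes "l \<in> trace_space_fields q D"
  defines "w \<equiv> (SOME w. w \<in> W1_fields q D \<and> has_trace_field q D w l)"
  shows "w \<in> W1_fields q D" "has_trace_field q D w l"
proof -
  have "\<exists>u. u \<in> W1 q D \<and> has_trace q D u (\<lambda>x. l x $ i)" for i
    using assms(1) unfolding trace_space_fields_def trace_space_def by blast
  then obtain u where u: "\<And>i. u i \<in> W1 q D \<and> has_trace q D (u i) (\<lambda>x. l x $ i)" by metis
  have "(\<lambda>x. \<chi> i. u i x) \<in> W1_fields q D \<and> has_trace_field q D (\<lambda>x. \<chi> i. u i x) l"
    using u by (simp add: W1_fields_def has_trace_field_def)
  from someI[of "\<lambda>w. w \<in> W1_fields q D \<and> has_trace_field q D w l", OF this]
  show "w \<in> W1_fields q D" "has_trace_field q D w l" by (simp_all add: w_def)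
qed

lemma pairing_0: "pairing a b (\<lambda>_. 0) (\<lambda>_ _. 0) = 0"
  by (simp add: pairing_def)

theorem theorem4p7:
  fixes D :: "(real ^ 3) set" and p :: real
  assumes "open D" and "bounded D" and "connected D" and "strongly_lipschitz D"
    and "1 < p"
  shows "Zc0 p D = ker_gamma_cross_n p D \<and> Zd0 p D = ker_gamma_dot_n p D"
proof (intro conjI set_eqI iffI)
  note D = assms(1,2) and sl = assms(4) and p = assms(5)
  let ?q = "conj_exponent p"
  have q: "0 < ?q" using conj_exponent_gt_1[OF p] by simp
  have p0: "0 < p" "0 \<le> p" using p by auto
  have Db: "D \<in> sets borel" using D by simp
  show "v \<in> ker_gamma_cross_n p D" if v: "v \<in> Zc0 p D" for v
  proof -
    have vZ: "v \<in> Zc p D" using v by (simp add: Zc0_def)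
    have "gamma_cross_n p D v l = 0" if l: "l \<in> trace_space_fields ?q D" for l
    proof -
      note w = trace_space_fields_lifting[OF l]
      have "(\<lambda>x. (SOME w. w \<in> W1_fields ?q D \<and> has_trace_field ?q D w l) x $ i) \<in> W1 ?q D" for i
        using w(1) by (simp add: W1_fields_def)
      from Zc0_pairing[OF D p v this] show ?thesis
        unfolding gamma_cross_n_def Let_def gamma_cross_n_pairing[OF D p vZ w(1)] by simp
    qed
    with vZ show ?thesis by (simp add: ker_gamma_cross_n_def)
  qed
  show "v \<in> ker_gamma_dot_n p D" if v: "v \<in> Zd0 p D" for v
  proof -
    have vZ: "v \<in> Zd p D" using v by (simp add: Zd0_def)
    have "gamma_dot_n p D v l = 0" if l: "l \<in> trace_space ?q D" for l
    proof -
      note u = trace_space_lifting[OF l]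
      show ?thesis
        unfolding gamma_dot_n_def Let_def gamma_dot_n_pairing[OF D p vZ u(1)]
        by (rule Zd0_pairing[OF D p v u(1)])
    qed
    with vZ show ?thesis by (simp add: ker_gamma_dot_n_def)
  qed
  show "v \<in> Zd0 p D" if v: "v \<in> ker_gamma_dot_n p D" for v
  proof (rule Zd0I[OF D sl p])
    show vZ: "v \<in> Zd p D" using v by (simp add: ker_gamma_dot_n_def)
    note V = Zd_weak_div[OF D(1) vZ]
    fix \<phi> assume \<phi>: "smooth \<phi>"
    \<comment> \<open>A smooth \<phi> lifts itself, but the choice inside \<open>gamma_dot_n\<close>
      may return another lifting u; \<open>trace_pairing\<close> exchanges u for \<phi>.\<close>
    have l: "\<phi> \<in> trace_space ?q D"
      unfolding trace_space_def using smooth_has_trace[OF D sl q \<phi>] smooth_W1[OF D q \<phi>] by blast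
    note u = trace_space_lifting[OF l]
    have "pairing (\<lambda>j. rep D (\<lambda>x. v x $ j)) (rep D (weak_div D v)) \<phi> (\<lambda>j. partial j \<phi>) = gamma_dot_n p D v \<phi>"
      unfolding gamma_dot_n_def Let_def gamma_dot_n_pairing[OF D p vZ u(1)]
      by (rule trace_pairing[OF D sl p rep_component_Lz[OF p0(2) Db V(3)] rep_Lz[OF Db V(2)]
            weak_div_row[OF Db V(3,2) p0(1) V(1)] u(2) \<phi>, symmetric])
    also have "\<dots> = 0" using v l by (simp add: ker_gamma_dot_n_def)
    finally show "pairing (\<lambda>j. rep D (\<lambda>x. v x $ j)) (rep D (weak_div D v)) \<phi> (\<lambda>j. partial j \<phi>) = 0" .
  qed
  show "v \<in> Zc0 p D" if v: "v \<in> ker_gamma_cross_n p D" for v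
  proof (rule Zc0I[OF D sl p])
    show vZ: "v \<in> Zc p D" using v by (simp add: ker_gamma_cross_n_def)
    note V = Zc_weak_curl[OF D(1) vZ]
    fix i \<phi> assume \<phi>: "smooth \<phi>"
    let ?P = "\<lambda>k. pairing (rot (\<lambda>j. rep D (\<lambda>x. v x $ j)) k) (rep D (\<lambda>x. weak_curl D v x $ k))"
    \<comment> \<open>Boundary values \<phi> in component i and 0 elsewhere isolate row i: the other
      liftings have zero trace, so their pairings vanish although the liftings themselves may
      not.\<close>
    define l where "l = single i \<phi>"
    have lj: "smooth (\<lambda>x. l x $ j)" for j using \<phi> by (cases "j = i") (simp_all add: l_def single_def)
    have l: "l \<in> trace_space_fields ?q D"
      unfolding trace_space_fields_def trace_space_def
      using smooth_has_trace[OF D sl q lj] smooth_W1[OF D q lj] by blast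
    define w where "w = (SOME w. w \<in> W1_fields ?q D \<and> has_trace_field ?q D w l)"
    have w: "w \<in> W1_fields ?q D" "has_trace_field ?q D w l"
      unfolding w_def by (rule trace_space_fields_lifting[OF l])+
    have wt: "has_trace ?q D (\<lambda>x. w x $ k) (\<lambda>x. l x $ k)" for k
      using w(2) by (simp add: has_trace_field_def)
    have row: "?P k (rep D (\<lambda>x. w x $ k)) (\<lambda>j. rep D (\<lambda>x. weak_grad D (\<lambda>x. w x $ k) x $ j))
        = (if k = i then ?P i \<phi> (\<lambda>j. partial j \<phi>) else 0)" for k
    proof -
      have "?P k (rep D (\<lambda>x. w x $ k)) (\<lambda>j. rep D (\<lambda>x. weak_grad D (\<lambda>x. w x $ k) x $ j))
          = ?P k (\<lambda>x. l x $ k) (\<lambda>j. partial j (\<lambda>x. l x $ k))"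
        by (rule trace_pairing[OF D sl p rot_Lz[OF p0(1) D(2) rep_component_Lz[OF p0(2) Db V(3)]]
              rep_component_Lz[OF p0(2) Db V(2)] weak_curl_rows[OF Db V(3,2) p0(1) D(2) V(1)] wt lj])
      also have "\<dots> = (if k = i then ?P i \<phi> (\<lambda>j. partial j \<phi>) else 0)"
        by (simp add: l_def single_def pairing_0)
      finally show ?thesis .
    qed
    have "0 = gamma_cross_n p D v l" using v l by (simp add: ker_gamma_cross_n_def)
    also have "\<dots> = - (\<Sum>k\<in>UNIV. ?P k (rep D (\<lambda>x. w x $ k)) (\<lambda>j. rep D (\<lambda>x. weak_grad D (\<lambda>x. w x $ k) x $ j)))"
      unfolding gamma_cross_n_def Let_def w_def[symmetric] by (rule gamma_cross_n_pairing[OF D p vZ w(1)])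
    also have "\<dots> = - ?P i \<phi> (\<lambda>j. partial j \<phi>)"
      unfolding row by simp
    finally show "?P i \<phi> (\<lambda>j. partial j \<phi>) = 0" by simp
  qed
qed

end
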